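(* Let $\Bbbk$ be a field of characteristic zero, $R=\Bbbk[x_1,\ldots,x_n]$ a polynomial ring, $r\ge 0$ and $m\ge 0$ integers, and $\mathfrak p\in\mathrm{Spec}(R)$ a prime ideal of codimension $c$ with residue field $\mathbb F=R_{\mathfrak p}/\mathfrak pR_{\mathfrak p}$; after possibly permuting the variables, assume that $\{x_{c+1},\ldots,x_n\}$ is a basis modulo $\mathfrak p$. The following four sets of objects are in bijective correspondence: (a) $\mathfrak p$-primary $R$-submodules $U\subseteq R^r$ of multiplicity $m$ over $\mathfrak p$; (b) $\mathbb F$-points in the punctual Quot scheme $\mathrm{Quot}^m(\mathbb F[[y_1,\ldots,y_c]]^r)$; (c) $m$-dimensional $\mathbb F$-subspaces of $\mathbb F[z_1,\ldots,z_c]^r$ that are closed under differentiation; (d) $m$-dimensional $\mathbb F$-subspaces of the Weyl-Noether module $\mathbb F\otimes_R(D_{n,c})^r$ that are $R$-bimodules. Moreover, any basis of the $\mathbb F$-subspace in part (d) can be lifted to Noetherian operators $\delta_1,\ldots,\delta_m\in(D_{n,c})^r$ for the $R$-submodule $U$ in part (a) to which it corresponds.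
   Context: Basis modulo $\mathfrak p$: a set of variables $\{x_{i_1},\ldots,x_{i_\ell}\}$ is independent modulo $\mathfrak p$ if $\Bbbk[x_{i_1},\ldots,x_{i_\ell}]\cap\mathfrak p=\{0\}$; a basis modulo $\mathfrak p$ is a maximal such set. Primary submodules: $U\subseteq R^r$ is $\mathfrak p$-primary if $\mathrm{Ass}_R(R^r/U)=\{\mathfrak p\}$; its multiplicity over $\mathfrak p$ is $\mathrm{length}_{R_{\mathfrak p}}(R_{\mathfrak p}^r/U_{\mathfrak p})$. Quot scheme: let $\mathbb B=\mathbb F[[y_1,\ldots,y_c]]$ with maximal ideal $\mathfrak n=(y_1,\ldots,y_c)$. The $\mathbb F$-points of $\mathrm{Quot}^m(\mathbb B^r)$ are the $\mathbb B$-submodules $\mathbb V\subseteq\mathbb B^r$ with $\dim_{\mathbb F}(\mathbb B^r/\mathbb V)=m$. Closed under differentiation: an $\mathbb F$-subspace of $\mathbb E^r$, where $\mathbb E=\mathbb F[z_1,\ldots,z_c]$, is closed under differentiation if it is stable under all $\partial/\partial z_i$, acting coordinatewise. Differential operators: $D_n=R\langle\partial_{x_1},\ldots,\partial_{x_n}\rangle$ is the Weyl algebra and $D_{n,c}=R\langle\partial_{x_1},\ldots,\partial_{x_c}\rangle\subseteq D_n$ the relative Weyl algebra. An element $\delta=(\delta^{(1)},\ldots,\delta^{(r)})\in(D_n)^r$ acts as a differential operator $R^r\to R$ by $\delta(w)=\sum_j\delta^{(j)}(w_j)$. Operators $\delta_1,\ldots,\delta_m\in(D_n)^r$ are a set of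 Noetherian operators for a $\mathfrak p$-primary submodule $U\subseteq R^r$ if $U=\{w\in R^r\mid\delta_i(w)\in\mathfrak p\text{ for all }1\le i\le m\}$. The module $\mathbb F\otimes_RD_{n,c}=\bigoplus_{\alpha\in\mathbb N^c}\mathbb F\,\overline{\partial_{\mathbf x}^\alpha}$ (with $\overline{\partial_{\mathbf x}^\alpha}=1\otimes\partial_{x_1}^{\alpha_1}\cdots\partial_{x_c}^{\alpha_c}$) is a left $\mathbb F$-vector space and carries a right $R$-action from right multiplication on $D_{n,c}$; a subspace of $\mathbb F\otimes_R(D_{n,c})^r$ is an $R$-bimodule if it is stable under both $R$-actions. The correspondence meant in the last sentence of the claim: let $\gamma:R^r\hookrightarrow\mathbb B^r$ apply in each coordinate the $\Bbbk$-algebra map $R\hookrightarrow\mathbb B$ with $x_i\mapsto y_i+\overline{x_i}$ for $1\le i\le c$ and $x_j\mapsto\overline{x_j}$ for $c+1\le j\le n$, bars denoting classes in $\mathbb F$. Regard $\mathbb E$ as a $\mathbb B$-module with $y_i$ acting as $\partial/\partial z_i$, and for $\mathbb V\subseteq\mathbb B^r$ put $\mathbb V^\perp=\{w\in\mathbb E^r\mid\sum_{i=1}^rv_i\cdot w_i=0\ \forall v\in\mathbb V\}$. Let $\Omega:\mathbb E^r\to\mathbb F\otimes_R(D_{n,c})^r$ be the $\mathbb F$-linear isomorphism given on each coordinate by $\mathbf z^\alpha\mapsto\overline{\partial_{\mathbf x}^\alpha}$. To $U$ in (a) correspond $\mathbb V=\mathbb B\cdot\gamma(U)+\mathfrak n^m\mathbb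 B^r$ in (b), $\mathbb W=\mathbb V^\perp$ in (c) and $\mathcal E=\Omega(\mathbb W)$ in (d). Lifting: an element of $\mathbb F\otimes_R(D_{n,c})^r$ is lifted by multiplying it by a nonzero element of $R/\mathfrak p$ so that all its coefficients with respect to the $\overline{\partial_{\mathbf x}^\alpha}$ lie in $R/\mathfrak p$, and then replacing these coefficients by representatives in $R$, which gives an element of $(D_{n,c})^r$.
   Formalization: For m = 0 no submodule with Ass = {p} has multiplicity 0, while (b), (c), (d) each have one element; the formal statement therefore counts U = R^r in (a) as the p-primary submodule of multiplicity 0. For m > 0 nothing changes. *)

theory Defs
  imports
    "HOL-Library.Poly_Mapping"
    "HOL-Library.Function_Algebras"
    "HOL-Library.Extended_Nat"
    "HOL-Computational_Algebra.Fraction_Field"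
    "HOL-Algebra.Module"
    "HOL-Algebra.QuotRing"
    "HOL-Algebra.Ideal_Product"
begin

text \<open>
  Variables and coordinates are indexed from 0: the index \<open>i\<close> stands for
  \<open>x\<^sub>i\<^sub>+\<^sub>1\<close> (respectively \<open>y\<^sub>i\<^sub>+\<^sub>1\<close>, \<open>z\<^sub>i\<^sub>+\<^sub>1\<close>). A multi-index is a finitely
  supported function on these indices. A type of polynomials or power series has countably many
  variables; the rings in finitely many variables are subsets of such a type.
\<close>

type_synonym mindex = "nat \<Rightarrow>\<^sub>0 nat"
type_synonym 'a mpoly = "mindex \<Rightarrow>\<^sub>0 'a"

abbreviation "lookup \<equiv> Poly_Mapping.lookup"
abbreviation "keys \<equiv> Poly_Mapping.keys"
abbreviation "single \<equiv> Poly_Mapping.single"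


section \<open>Rings and free modules on subsets of a type\<close>

definition ring_on :: "'a::comm_ring_1 set \<Rightarrow> 'a ring" where
  "ring_on A = \<lparr>carrier = A, monoid.mult = (*), one = 1, zero = 0, add = (+)\<rparr>"

definition vecs :: "'a::zero set \<Rightarrow> nat \<Rightarrow> (nat \<Rightarrow> 'a) set" where
  "vecs A r = {v. (\<forall>j<r. v j \<in> A) \<and> (\<forall>j\<ge>r. v j = 0)}"

definition free_module :: "'a::comm_ring_1 set \<Rightarrow> nat \<Rightarrow> ('a, nat \<Rightarrow> 'a) module" where
  "free_module A r =
    \<lparr>carrier = vecs A r, monoid.mult = undefined, one = undefined, zero = 0, add = (+),
     smult = (\<lambda>a v j. a * v j)\<rparr>"

definition submodules :: "'a::comm_ring_1 set \<Rightarrow> nat \<Rightarrow> (nat \<Rightarrow> 'a) set set" where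
  "submodules A r = {U. submodule U (ring_on A) (free_module A r)}"

definition submodule_hull :: "'a::comm_ring_1 set \<Rightarrow> nat \<Rightarrow> (nat \<Rightarrow> 'a) set \<Rightarrow> (nat \<Rightarrow> 'a) set" where
  "submodule_hull A r S = \<Inter>{U \<in> submodules A r. S \<subseteq> U}"

text \<open>The length of the quotient \<open>A\<^sup>r / N\<close>; its submodules are those of \<open>A\<^sup>r\<close> that contain \<open>N\<close>.\<close>

definition quotient_length :: "'a::comm_ring_1 set \<Rightarrow> nat \<Rightarrow> (nat \<Rightarrow> 'a) set \<Rightarrow> enat" where
  "quotient_length A r N =
    Sup {enat l | l. \<exists>L. (\<forall>i\<le>l. L i \<in> submodules A r \<and> N \<subseteq> L i) \<and> (\<forall>i<l. L i \<subset> L (Suc i))}"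

text \<open>Associated primes of \<open>A\<^sup>r / U\<close>: the prime ideals that annihilate the class of some \<open>w\<close>.\<close>

definition assoc_primes :: "'a::comm_ring_1 set \<Rightarrow> nat \<Rightarrow> (nat \<Rightarrow> 'a) set \<Rightarrow> 'a set set" where
  "assoc_primes A r U =
    {q. primeideal q (ring_on A) \<and> (\<exists>w\<in>vecs A r. q = {a \<in> A. (\<lambda>j. a * w j) \<in> U})}"

definition height :: "'a::comm_ring_1 set \<Rightarrow> 'a set \<Rightarrow> enat" where
  "height A p =
    Sup {enat l | l. \<exists>q. (\<forall>i\<le>l. primeideal (q i) (ring_on A)) \<and> (\<forall>i<l. q i \<subset> q (Suc i)) \<and> q l = p}"


section \<open>Polynomial rings and differentiation\<close>

definition polys :: "nat set \<Rightarrow> 'a::comm_ring_1 mpoly set" where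
  "polys I = {f. \<forall>\<alpha>\<in>keys f. keys \<alpha> \<subseteq> I}"

abbreviation pring :: "nat \<Rightarrow> 'a::comm_ring_1 mpoly set" where
  "pring n \<equiv> polys {..<n}"

definition indep_modulo :: "'a::comm_ring_1 mpoly set \<Rightarrow> nat set \<Rightarrow> bool" where
  "indep_modulo p I \<longleftrightarrow> polys I \<inter> p = {0}"

definition basis_modulo :: "nat \<Rightarrow> 'a::comm_ring_1 mpoly set \<Rightarrow> nat set \<Rightarrow> bool" where
  "basis_modulo n p I \<longleftrightarrow>
    I \<subseteq> {..<n} \<and> indep_modulo p I \<and> (\<forall>J. I \<subset> J \<and> J \<subseteq> {..<n} \<longrightarrow> \<not> indep_modulo p J)"

definition pd :: "nat \<Rightarrow> 'a::comm_ring_1 mpoly \<Rightarrow> 'a mpoly" where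
  "pd i w = (\<Sum>\<beta>\<in>keys w.
     single (\<beta> - single i 1) (of_nat (lookup \<beta> i) * lookup w \<beta>))"

definition mpd :: "mindex \<Rightarrow> 'a::comm_ring_1 mpoly \<Rightarrow> 'a mpoly" where
  "mpd \<alpha> = fold (\<lambda>i. pd i ^^ lookup \<alpha> i) (sorted_list_of_set (keys \<alpha>))"

lemma lookup_pd: "lookup (pd i w) \<beta>
    = of_nat (lookup \<beta> i + 1) * lookup w (\<beta> + single i 1)"
proof -
  let ?e = "single i (1::nat)"
  have eq: "(of_nat (lookup \<gamma> i) * lookup w \<gamma> when \<gamma> - ?e = \<beta>)
      = (of_nat (lookup \<beta> i + 1) * lookup w (\<beta> + ?e) when \<gamma> = \<beta> + ?e)" for \<gamma>
  proof (cases "lookup \<gamma> i = 0")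
    case True
    then have "\<gamma> \<noteq> \<beta> + ?e" by (auto simp: lookup_add)
    then show ?thesis using True by (simp add: when_def)
  next
    case False
    then have "\<gamma> = (\<gamma> - ?e) + ?e"
      by (intro poly_mapping_eqI) (auto simp: lookup_add lookup_minus lookup_single when_def)
    then have "\<gamma> - ?e = \<beta> \<longleftrightarrow> \<gamma> = \<beta> + ?e" by auto
    then show ?thesis by (auto simp: when_def lookup_add)
  qed
  have "lookup (pd i w) \<beta> = (\<Sum>\<gamma>\<in>keys w. of_nat (lookup \<gamma> i) * lookup w \<gamma> when \<gamma> - ?e = \<beta>)"
    unfolding pd_def by (simp add: lookup_sum lookup_single)
  also have "\<dots> = (\<Sum>\<gamma>\<in>keys w. of_nat (lookup \<beta> i + 1) * lookup w (\<beta> + ?e) when \<gamma> = \<beta> + ?e)"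
    by (simp only: eq)
  also have "\<dots> = of_nat (lookup \<beta> i + 1) * lookup w (\<beta> + ?e)"
    by (auto simp: when_def in_keys_iff)
  finally show ?thesis .
qed

lemma pd_add: "pd i (v + w) = pd i v + pd i w"
  by (intro poly_mapping_eqI) (simp add: lookup_pd lookup_add algebra_simps)

lemma pd_0 [simp]: "pd i 0 = 0"
  by (simp add: pd_def)

lemma pd_sum: "pd i (sum f A) = (\<Sum>a\<in>A. pd i (f a))"
  by (induction A rule: infinite_finite_induct) (auto simp: pd_add)

lemma pd_commute: "pd i (pd j w) = pd j (pd i w)"
  by (intro poly_mapping_eqI)
    (auto simp: lookup_pd lookup_add lookup_single when_def algebra_simps)

lemma pd_single: "pd i (single \<beta> b)
    = single (\<beta> - single i 1) (of_nat (lookup \<beta> i) * b)"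
  by (cases "b = 0") (simp_all add: pd_def)

lemma poly_mapping_sum_single: "(\<Sum>\<alpha>\<in>keys f. single \<alpha> (lookup f \<alpha>)) = f"
  by (intro poly_mapping_eqI) (auto simp: lookup_sum lookup_single when_def in_keys_iff)

lemma pd_mult: "pd i (v * w) = pd i v * w + v * pd i (w :: 'a::comm_ring_1 mpoly)"
proof -
  let ?e = "single i (1::nat)"
  have single: "pd i (single \<alpha> a * single \<beta> b)
      = pd i (single \<alpha> a) * single \<beta> b
        + single \<alpha> a * pd i (single \<beta> b)" for \<alpha> \<beta> and a b :: 'a
  proof -
    have 1: "(\<alpha> - ?e) + \<beta> = (\<alpha> + \<beta>) - ?e" if "lookup \<alpha> i \<noteq> 0"
      using that by (intro poly_mapping_eqI) (auto simp: lookup_add lookup_minus lookup_single when_def)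
    have 2: "\<alpha> + (\<beta> - ?e) = (\<alpha> + \<beta>) - ?e" if "lookup \<beta> i \<noteq> 0"
      using that by (intro poly_mapping_eqI) (auto simp: lookup_add lookup_minus lookup_single when_def)
    have "pd i (single \<alpha> a) * single \<beta> b
        = single ((\<alpha> + \<beta>) - ?e) (of_nat (lookup \<alpha> i) * a * b)"
      using 1 by (cases "lookup \<alpha> i = 0") (simp_all add: pd_single mult_single)
    moreover have "single \<alpha> a * pd i (single \<beta> b)
        = single ((\<alpha> + \<beta>) - ?e) (of_nat (lookup \<beta> i) * a * b)"
      using 2 by (cases "lookup \<beta> i = 0") (simp_all add: pd_single mult_single mult_ac)
    ultimately show ?thesis
      by (simp add: pd_single mult_single lookup_add single_add[symmetric] algebra_simps)
  qed
  have "pd i ((\<Sum>\<alpha>\<in>keys v. single \<alpha> (lookup v \<alpha>)) * (\<Sum>\<beta>\<in>keys w. single \<beta> (lookup w \<beta>)))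
     = pd i (\<Sum>\<alpha>\<in>keys v. single \<alpha> (lookup v \<alpha>)) * (\<Sum>\<beta>\<in>keys w. single \<beta> (lookup w \<beta>))
      + (\<Sum>\<alpha>\<in>keys v. single \<alpha> (lookup v \<alpha>)) * pd i (\<Sum>\<beta>\<in>keys w. single \<beta> (lookup w \<beta>))"
    by (simp add: sum_product pd_sum single sum.distrib)
  then show ?thesis by (simp add: poly_mapping_sum_single)
qed

lemma pd_funpow_commute: "(pd i ^^ a) (pd j w) = pd j ((pd i ^^ a) w)"
  by (induction a) (simp_all add: pd_commute)

lemma fold_pd_commute: "fold (\<lambda>i. pd i ^^ f i) xs (pd j w) = pd j (fold (\<lambda>i. pd i ^^ f i) xs w)"
  by (induction xs arbitrary: w) (simp_all add: pd_funpow_commute)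

lemma fold_pd_Suc:
  fixes w :: "'a::comm_ring_1 mpoly"
  assumes "distinct xs" "j \<in> set xs"
  shows "fold (\<lambda>i. pd i ^^ (f(j := Suc (f j))) i) xs w = pd j (fold (\<lambda>i. pd i ^^ f i) xs w)"
  using assms
proof (induction xs arbitrary: w)
  case (Cons x xs)
  show ?case
  proof (cases "x = j")
    case True
    then have "fold (\<lambda>i. pd i ^^ (if i = j then Suc (f j) else f i)) xs v = fold (\<lambda>i. pd i ^^ f i) xs v"
      for v :: "'a mpoly"
      using Cons.prems by (intro List.fold_cong refl) auto
    then show ?thesis using True by (simp only: fun_upd_apply) (simp add: fold_pd_commute)
  qed (use Cons in simp)
qed simp

lemma fold_pd_filter:
  "fold (\<lambda>i. pd i ^^ f i) (filter (\<lambda>i. f i \<noteq> 0) xs) w = fold (\<lambda>i. pd i ^^ f i) xs w"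
  by (induction xs arbitrary: w) simp_all

lemma mpd_conv_fold:
  assumes "finite A" "keys \<alpha> \<subseteq> A"
  shows "mpd \<alpha> w = fold (\<lambda>i. pd i ^^ lookup \<alpha> i) (sorted_list_of_set A) w"
proof -
  have "filter (\<lambda>i. lookup \<alpha> i \<noteq> 0) (sorted_list_of_set A) = sorted_list_of_set (keys \<alpha>)"
  proof (intro sorted_distinct_set_unique)
    show "set (filter (\<lambda>i. lookup \<alpha> i \<noteq> 0) (sorted_list_of_set A)) = set (sorted_list_of_set (keys \<alpha>))"
      using assms by (auto simp: in_keys_iff)
  qed (auto simp: sorted_wrt_filter)
  then show ?thesis
    unfolding mpd_def using fold_pd_filter[of "lookup \<alpha>" "sorted_list_of_set A" w] by (simp only:)
qed

lemma mpd_0 [simp]: "mpd 0 w = w"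
  by (simp add: mpd_def)

lemma mpd_plus_single: "mpd (\<alpha> + single j 1) w = pd j (mpd \<alpha> w)"
proof -
  let ?A = "insert j (keys \<alpha>)"
  have keys: "keys (\<alpha> + single j 1) \<subseteq> ?A"
    using keys_add[of \<alpha> "single j 1"] by auto
  let ?f = "(lookup \<alpha>)(j := Suc (lookup \<alpha> j))"
  have eq: "lookup (\<alpha> + single j 1) = ?f"
    by (auto simp: lookup_add lookup_single when_def fun_eq_iff)
  have "mpd (\<alpha> + single j 1) w
      = fold (\<lambda>i. pd i ^^ lookup (\<alpha> + single j 1) i) (sorted_list_of_set ?A) w"
    by (rule mpd_conv_fold) (use keys in auto)
  also have "\<dots> = fold (\<lambda>i. pd i ^^ ?f i) (sorted_list_of_set ?A) w"
    by (simp only: eq)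
  also have "\<dots> = pd j (fold (\<lambda>i. pd i ^^ lookup \<alpha> i) (sorted_list_of_set ?A) w)"
    by (rule fold_pd_Suc)
      (simp_all only: distinct_sorted_list_of_set set_sorted_list_of_set finite_insert finite_keys insertI1)
  also have "fold (\<lambda>i. pd i ^^ lookup \<alpha> i) (sorted_list_of_set ?A) w = mpd \<alpha> w"
    by (rule mpd_conv_fold[symmetric]) auto
  finally show ?thesis .
qed

lemma mindex_induct [case_names 0 plus]:
  assumes "P 0" "\<And>\<alpha> i. P \<alpha> \<Longrightarrow> P (\<alpha> + single i 1)"
  shows "P (\<alpha> :: mindex)"
proof (induction "\<Sum>i\<in>keys \<alpha>. lookup \<alpha> i" arbitrary: \<alpha> rule: less_induct)
  case less
  show ?case
  proof (cases "\<alpha> = 0")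
    case False
    then obtain i where i: "i \<in> keys \<alpha>" by (metis keys_eq_empty all_not_in_conv)
    let ?\<beta> = "\<alpha> - single i 1"
    have eq: "?\<beta> + single i 1 = \<alpha>"
      using i by (intro poly_mapping_eqI)
        (auto simp: lookup_add lookup_minus lookup_single when_def in_keys_iff)
    have "keys ?\<beta> \<subseteq> keys \<alpha>" by (auto simp: in_keys_iff lookup_minus)
    then have "(\<Sum>j\<in>keys ?\<beta>. lookup ?\<beta> j) = (\<Sum>j\<in>keys \<alpha>. lookup ?\<beta> j)"
      by (intro sum.mono_neutral_left) (auto simp: in_keys_iff)
    also have "\<dots> < (\<Sum>j\<in>keys \<alpha>. lookup \<alpha> j)"
      using i by (intro sum_strict_mono_ex1)
        (auto simp: lookup_minus lookup_single when_def in_keys_iff intro!: bexI[of _ i])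
    finally have "P (?\<beta> + single i 1)" by (intro assms(2) less)
    then show ?thesis by (simp only: eq)
  qed (use assms in simp)
qed

lemma mpd_add: "mpd \<alpha> (v + w) = mpd \<alpha> v + mpd \<alpha> w"
  by (induction \<alpha> rule: mindex_induct) (simp_all only: mpd_0 mpd_plus_single pd_add)

lemma mpd_zero [simp]: "mpd \<alpha> 0 = 0"
  by (induction \<alpha> rule: mindex_induct) (simp_all only: mpd_0 mpd_plus_single pd_0)

lemma mpd_sum: "mpd \<alpha> (sum f A) = (\<Sum>a\<in>A. mpd \<alpha> (f a))"
  by (induction A rule: infinite_finite_induct) (auto simp: mpd_add)

lemma mpd_mpd: "mpd (\<alpha> + \<beta>) w = mpd \<alpha> (mpd \<beta> w)"
proof (induction \<alpha> rule: mindex_induct)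
  case (plus \<alpha> i)
  then show ?case by (metis (no_types) add.assoc add.commute mpd_plus_single)
qed simp

lemma mpd_single_eq_0: "mpd \<alpha> (single \<beta> b) = 0" if "\<not> lookup \<alpha> i \<le> lookup \<beta> i"
proof -
  have "mpd \<alpha> (single \<beta> b) = 0 \<or>
    (\<exists>b'. mpd \<alpha> (single \<beta> b) = single (\<beta> - \<alpha>) b' \<and> (\<forall>i. lookup \<alpha> i \<le> lookup \<beta> i))"
  proof (induction \<alpha> rule: mindex_induct)
    case (plus \<alpha> j)
    let ?\<alpha> = "\<alpha> + single j 1"
    have step: "mpd ?\<alpha> (single \<beta> b) = pd j (mpd \<alpha> (single \<beta> b))"
      by (rule mpd_plus_single)
    show ?case
    proof (cases "mpd \<alpha> (single \<beta> b) = 0")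
      case False
      then obtain b' where b': "mpd \<alpha> (single \<beta> b) = single (\<beta> - \<alpha>) b'"
        and le: "\<forall>i. lookup \<alpha> i \<le> lookup \<beta> i" using plus by blast
      show ?thesis
      proof (cases "lookup (\<beta> - \<alpha>) j = 0")
        case True
        then have "mpd ?\<alpha> (single \<beta> b) = 0"
          unfolding step b' pd_single by simp
        then show ?thesis ..
      next
        case False
        then have "\<forall>i. lookup ?\<alpha> i \<le> lookup \<beta> i"
          using le by (auto simp: lookup_add lookup_minus lookup_single when_def)
        moreover have "\<beta> - \<alpha> - single j 1 = \<beta> - ?\<alpha>"
          by (intro poly_mapping_eqI) (simp add: lookup_minus lookup_add)
        ultimately show ?thesis unfolding step b' pd_single by metis
      qed
    qed (simp only: step pd_0, simp)
  qed auto
  then show ?thesis using that by auto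
qed


section \<open>Multi-indices\<close>

definition splits :: "mindex \<Rightarrow> (mindex \<times> mindex) set" where
  "splits \<alpha> = {(\<beta>, \<gamma>). \<beta> + \<gamma> = \<alpha>}"

definition mbinom :: "mindex \<Rightarrow> mindex \<Rightarrow> nat" where
  "mbinom \<alpha> \<beta> = (\<Prod>i\<in>keys \<alpha>. lookup \<alpha> i choose lookup \<beta> i)"

lemma finite_mindex_le: "finite {\<beta> :: mindex. \<forall>i. lookup \<beta> i \<le> lookup \<alpha> i}"
proof (rule finite_imageD[where f = lookup])
  let ?B = "\<Union>i\<in>keys \<alpha>. {..lookup \<alpha> i}"
  have B: "finite ?B" by simp
  have "lookup \<beta> \<in> {f. \<forall>x. (x \<in> keys \<alpha> \<longrightarrow> f x \<in> ?B) \<and> (x \<notin> keys \<alpha> \<longrightarrow> f x = 0)}"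
    if "\<beta> \<in> {\<beta>. \<forall>i. lookup \<beta> i \<le> lookup \<alpha> i}" for \<beta> :: mindex
  proof (intro CollectI allI conjI impI)
    fix x
    assume "x \<notin> keys \<alpha>"
    then show "lookup \<beta> x = 0" using CollectD[OF that, THEN spec, of x] by (simp add: in_keys_iff)
  next
    fix x assume "x \<in> keys \<alpha>"
    then show "lookup \<beta> x \<in> ?B" using CollectD[OF that, THEN spec, of x] by (intro UN_I[of x] iffD2[OF atMost_iff])
  qed
  then have "lookup ` {\<beta> :: mindex. \<forall>i. lookup \<beta> i \<le> lookup \<alpha> i}
      \<subseteq> {f. \<forall>x. (x \<in> keys \<alpha> \<longrightarrow> f x \<in> ?B) \<and> (x \<notin> keys \<alpha> \<longrightarrow> f x = 0)}"
    by (rule image_subsetI)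
  then show "finite (lookup ` {\<beta> :: mindex. \<forall>i. lookup \<beta> i \<le> lookup \<alpha> i})"
    by (rule finite_subset) (rule finite_set_of_finite_funs[OF finite_keys B])
  show "inj_on lookup {\<beta> :: mindex. \<forall>i. lookup \<beta> i \<le> lookup \<alpha> i}"
    by (rule inj_onI) (simp only: poly_mapping_eq_iff)
qed

lemma finite_splits [simp]: "finite (splits \<alpha>)"
proof (rule finite_subset)
  show "splits \<alpha> \<subseteq> {\<beta>. \<forall>i. lookup \<beta> i \<le> lookup \<alpha> i} \<times> {\<beta>. \<forall>i. lookup \<beta> i \<le> lookup \<alpha> i}"
  proof
    fix x assume "x \<in> splits \<alpha>"
    then obtain \<beta> \<gamma> where "x = (\<beta>, \<gamma>)" "\<alpha> = \<beta> + \<gamma>" by (auto simp: splits_def)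
    then show "x \<in> {\<beta>. \<forall>i. lookup \<beta> i \<le> lookup \<alpha> i} \<times> {\<beta>. \<forall>i. lookup \<beta> i \<le> lookup \<alpha> i}"
      by (simp add: lookup_add)
  qed
qed (rule finite_cartesian_product[OF finite_mindex_le finite_mindex_le])

lemma mpd_nonzero_finite: "finite {\<alpha>. mpd \<alpha> (w :: 'a::comm_ring_1 mpoly) \<noteq> 0}"
proof (rule finite_subset)
  show "{\<alpha>. mpd \<alpha> w \<noteq> 0} \<subseteq> (\<Union>\<beta>\<in>keys w. {\<alpha>. \<forall>i. lookup \<alpha> i \<le> lookup \<beta> i})"
  proof
    fix \<alpha> assume "\<alpha> \<in> {\<alpha>. mpd \<alpha> w \<noteq> 0}"
    then have "mpd \<alpha> (\<Sum>\<beta>\<in>keys w. single \<beta> (lookup w \<beta>)) \<noteq> 0"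
      by (simp add: poly_mapping_sum_single)
    then obtain \<beta> where \<beta>: "\<beta> \<in> keys w" "mpd \<alpha> (single \<beta> (lookup w \<beta>)) \<noteq> 0"
      unfolding mpd_sum by (meson sum.neutral)
    have "lookup \<alpha> i \<le> lookup \<beta> i" for i
      using \<beta>(2) mpd_single_eq_0[of \<alpha> i \<beta> "lookup w \<beta>"] by linarith
    then show "\<alpha> \<in> (\<Union>\<beta>\<in>keys w. {\<alpha>. \<forall>i. lookup \<alpha> i \<le> lookup \<beta> i})"
      by (intro UN_I[OF \<beta>(1)] CollectI allI)
  qed
qed (rule finite_UN_I[OF finite_keys finite_mindex_le])

lemma mpd_mult:
  "mpd \<alpha> (v * w) = (\<Sum>(\<beta>, \<gamma>)\<in>splits \<alpha>. of_nat (mbinom \<alpha> \<beta>) * mpd \<beta> v * mpd \<gamma> (w :: 'a::comm_ring_1 mpoly))"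
proof (induction \<alpha> rule: mindex_induct)
  case 0
  have "splits 0 = {(0, 0)}"
    unfolding splits_def
  proof (intro subset_antisym subsetI)
    fix x assume "x \<in> {(\<beta>, \<gamma>). \<beta> + \<gamma> = (0 :: mindex)}"
    then obtain \<beta> \<gamma> :: mindex where x: "x = (\<beta>, \<gamma>)" and eq: "\<beta> + \<gamma> = 0" by auto
    have "lookup \<beta> i = 0 \<and> lookup \<gamma> i = 0" for i
      using arg_cong[OF eq, of "\<lambda>x. lookup x i"] by (simp add: lookup_add)
    then have "\<beta> = 0" "\<gamma> = 0" by (auto intro: poly_mapping_eqI)
    then show "x \<in> {(0, 0)}" by (simp add: x)
  qed simp
  then show ?case by (simp add: mbinom_def)
next
  case (plus \<alpha> i)
  let ?e = "single i (1::nat)"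
  define T where "T \<beta> \<gamma> = mpd \<beta> v * mpd \<gamma> w" for \<beta> \<gamma>
  define f where "f = (\<lambda>(\<beta>, \<gamma>). of_nat (mbinom \<alpha> (\<beta> - ?e)) * T \<beta> \<gamma>)"
  define g where "g = (\<lambda>(\<beta>, \<gamma>). of_nat (mbinom \<alpha> \<beta>) * T \<beta> \<gamma>)"
  define S where "S = splits (\<alpha> + ?e)"
  have cancel: "\<beta> - ?e + ?e = \<beta>" if "lookup \<beta> i \<noteq> 0" for \<beta>
    using that by (intro poly_mapping_eqI) (auto simp: lookup_add lookup_minus lookup_single when_def)
  have pascal: "(of_nat (mbinom (\<alpha> + ?e) \<beta>) :: 'a mpoly)
      = (if lookup \<beta> i \<noteq> 0 then of_nat (mbinom \<alpha> (\<beta> - ?e)) else 0)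
        + (if lookup \<gamma> i \<noteq> 0 then of_nat (mbinom \<alpha> \<beta>) else 0)"
    if "(\<beta>, \<gamma>) \<in> S" for \<beta> \<gamma>
  proof -
    have sum: "lookup \<beta> j + lookup \<gamma> j = lookup \<alpha> j + (if j = i then 1 else 0)" for j
      using arg_cong[OF that[unfolded S_def splits_def, simplified], of "\<lambda>x. lookup x j"]
      by (auto simp: lookup_add lookup_single when_def)
    define P where "P = (\<Prod>j\<in>keys \<alpha> - {i}. lookup \<alpha> j choose lookup \<beta> j)"
    have insert_i: "mbinom \<alpha> \<beta>' = (lookup \<alpha> i choose lookup \<beta>' i) * P"
      if "lookup \<beta>' i \<le> lookup \<alpha> i" "\<forall>j. j \<noteq> i \<longrightarrow> lookup \<beta>' j = lookup \<beta> j" for \<beta>'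
    proof -
      have P: "P = (\<Prod>j\<in>keys \<alpha> - {i}. lookup \<alpha> j choose lookup \<beta>' j)"
        unfolding P_def using that by (intro prod.cong) auto
      show ?thesis
      proof (cases "i \<in> keys \<alpha>")
        case True
        then show ?thesis unfolding mbinom_def P by (simp add: prod.remove)
      next
        case False
        then show ?thesis using that(1) unfolding mbinom_def P by (simp add: in_keys_iff)
      qed
    qed
    have "keys (\<alpha> + ?e) = insert i (keys \<alpha> - {i})"
      by (auto simp: in_keys_iff lookup_add lookup_single when_def split: if_splits)
    then have "mbinom (\<alpha> + ?e) \<beta>
        = (\<Prod>j\<in>insert i (keys \<alpha> - {i}). lookup (\<alpha> + ?e) j choose lookup \<beta> j)"
      by (simp only: mbinom_def)
    also have "\<dots> = (lookup (\<alpha> + ?e) i choose lookup \<beta> i)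
        * (\<Prod>j\<in>keys \<alpha> - {i}. lookup (\<alpha> + ?e) j choose lookup \<beta> j)"
      by (rule prod.insert) simp_all
    also have "(\<Prod>j\<in>keys \<alpha> - {i}. lookup (\<alpha> + ?e) j choose lookup \<beta> j) = P"
      unfolding P_def by (intro prod.cong) (auto simp: lookup_add lookup_single when_def)
    also have "lookup (\<alpha> + ?e) i = Suc (lookup \<alpha> i)"
      by (simp add: lookup_add)
    finally have 1: "mbinom (\<alpha> + ?e) \<beta> = (Suc (lookup \<alpha> i) choose lookup \<beta> i) * P" .
    have 2: "mbinom \<alpha> (\<beta> - ?e) = (lookup \<alpha> i choose (lookup \<beta> i - 1)) * P"
      using insert_i[of "\<beta> - ?e"] sum[of i] by (simp add: lookup_minus lookup_single when_def)
    have 3: "mbinom \<alpha> \<beta> = (lookup \<alpha> i choose lookup \<beta> i) * P" if "lookup \<gamma> i \<noteq> 0"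
      using insert_i[of \<beta>] sum[of i] that by simp
    have "mbinom (\<alpha> + ?e) \<beta> = (if lookup \<beta> i \<noteq> 0 then mbinom \<alpha> (\<beta> - ?e) else 0)
        + (if lookup \<gamma> i \<noteq> 0 then mbinom \<alpha> \<beta> else 0)"
    proof (cases "lookup \<beta> i")
      case 0
      then show ?thesis using 1 3 sum[of i] by simp
    next
      case (Suc k)
      then show ?thesis using 1 2 3 sum[of i]
        by (cases "lookup \<gamma> i = 0") (simp_all add: algebra_simps binomial_eq_0)
    qed
    then show ?thesis by (simp split: if_splits)
  qed
  have "mpd (\<alpha> + ?e) (v * w) = pd i (\<Sum>(\<beta>, \<gamma>)\<in>splits \<alpha>. of_nat (mbinom \<alpha> \<beta>) * T \<beta> \<gamma>)"
    unfolding mpd_plus_single plus T_def by (simp add: mult.assoc)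
  also have "\<dots> = (\<Sum>(\<beta>, \<gamma>)\<in>splits \<alpha>. of_nat (mbinom \<alpha> \<beta>) * T (\<beta> + ?e) \<gamma>)
      + (\<Sum>(\<beta>, \<gamma>)\<in>splits \<alpha>. of_nat (mbinom \<alpha> \<beta>) * T \<beta> (\<gamma> + ?e))"
  proof -
    have nat: "pd i (of_nat k * u) = of_nat k * pd i u" for k and u :: "'a mpoly"
      by (induction k) (simp_all add: algebra_simps pd_add)
    have "pd i (of_nat k * T \<beta> \<gamma>) = of_nat k * T (\<beta> + ?e) \<gamma> + of_nat k * T \<beta> (\<gamma> + ?e)" for k \<beta> \<gamma>
      unfolding nat unfolding T_def pd_mult mpd_plus_single by (simp add: algebra_simps)
    then show ?thesis by (simp add: pd_sum sum.distrib case_prod_unfold)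
  qed
  also have "(\<Sum>(\<beta>, \<gamma>)\<in>splits \<alpha>. of_nat (mbinom \<alpha> \<beta>) * T (\<beta> + ?e) \<gamma>)
      = (\<Sum>x\<in>S. if lookup (fst x) i \<noteq> 0 then f x else 0)"
  proof -
    have "(\<Sum>(\<beta>, \<gamma>)\<in>splits \<alpha>. of_nat (mbinom \<alpha> \<beta>) * T (\<beta> + ?e) \<gamma>)
        = (\<Sum>x | x \<in> S \<and> lookup (fst x) i \<noteq> 0. f x)"
    proof (rule sum.reindex_bij_witness[where i = "\<lambda>(\<beta>, \<gamma>). (\<beta> - ?e, \<gamma>)" and j = "\<lambda>(\<beta>, \<gamma>). (\<beta> + ?e, \<gamma>)"])
      fix x assume "x \<in> {x. x \<in> S \<and> lookup (fst x) i \<noteq> 0}"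
      then obtain \<beta> \<gamma> where x: "x = (\<beta>, \<gamma>)" "\<beta> + \<gamma> = \<alpha> + ?e" "lookup \<beta> i \<noteq> 0"
        by (auto simp: S_def splits_def)
      have "\<beta> - ?e + \<gamma> + ?e = \<alpha> + ?e"
        using cancel[OF x(3)] x(2) by (metis add.assoc add.commute)
      then show "(case x of (\<beta>, \<gamma>) \<Rightarrow> (\<beta> - ?e, \<gamma>)) \<in> splits \<alpha>"
        using x by (simp add: splits_def)
      show "(case case x of (\<beta>, \<gamma>) \<Rightarrow> (\<beta> - ?e, \<gamma>) of (\<beta>, \<gamma>) \<Rightarrow> (\<beta> + ?e, \<gamma>)) = x"
        using x cancel[OF x(3)] by simp
    qed (auto simp: S_def splits_def f_def lookup_add add_ac)
    also have "\<dots> = (\<Sum>x\<in>S. if lookup (fst x) i \<noteq> 0 then f x else 0)"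
      by (subst sum.inter_filter[symmetric]) (simp_all add: S_def)
    finally show ?thesis .
  qed
  also have "(\<Sum>(\<beta>, \<gamma>)\<in>splits \<alpha>. of_nat (mbinom \<alpha> \<beta>) * T \<beta> (\<gamma> + ?e))
      = (\<Sum>x\<in>S. if lookup (snd x) i \<noteq> 0 then g x else 0)"
  proof -
    have "(\<Sum>(\<beta>, \<gamma>)\<in>splits \<alpha>. of_nat (mbinom \<alpha> \<beta>) * T \<beta> (\<gamma> + ?e))
        = (\<Sum>x | x \<in> S \<and> lookup (snd x) i \<noteq> 0. g x)"
    proof (rule sum.reindex_bij_witness[where i = "\<lambda>(\<beta>, \<gamma>). (\<beta>, \<gamma> - ?e)" and j = "\<lambda>(\<beta>, \<gamma>). (\<beta>, \<gamma> + ?e)"])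
      fix x assume "x \<in> {x. x \<in> S \<and> lookup (snd x) i \<noteq> 0}"
      then obtain \<beta> \<gamma> where x: "x = (\<beta>, \<gamma>)" "\<beta> + \<gamma> = \<alpha> + ?e" "lookup \<gamma> i \<noteq> 0"
        by (auto simp: S_def splits_def)
      have "\<beta> + (\<gamma> - ?e) + ?e = \<alpha> + ?e"
        using cancel[OF x(3)] x(2) by (metis add.assoc)
      then show "(case x of (\<beta>, \<gamma>) \<Rightarrow> (\<beta>, \<gamma> - ?e)) \<in> splits \<alpha>"
        using x by (simp add: splits_def)
      show "(case case x of (\<beta>, \<gamma>) \<Rightarrow> (\<beta>, \<gamma> - ?e) of (\<beta>, \<gamma>) \<Rightarrow> (\<beta>, \<gamma> + ?e)) = x"
        using x cancel[OF x(3)] by simp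
    qed (auto simp: S_def splits_def g_def lookup_add add_ac)
    also have "\<dots> = (\<Sum>x\<in>S. if lookup (snd x) i \<noteq> 0 then g x else 0)"
      by (subst sum.inter_filter[symmetric]) (simp_all add: S_def)
    finally show ?thesis .
  qed
  also have "(\<Sum>x\<in>S. if lookup (fst x) i \<noteq> 0 then f x else 0)
        + (\<Sum>x\<in>S. if lookup (snd x) i \<noteq> 0 then g x else 0)
      = (\<Sum>(\<beta>, \<gamma>)\<in>S. of_nat (mbinom (\<alpha> + ?e) \<beta>) * mpd \<beta> v * mpd \<gamma> w)"
    unfolding sum.distrib[symmetric]
  proof (intro sum.cong refl)
    fix x assume "x \<in> S"
    then obtain \<beta> \<gamma> where x: "x = (\<beta>, \<gamma>)" "(\<beta>, \<gamma>) \<in> S" by (cases x) auto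
    have "(case x of (\<beta>, \<gamma>) \<Rightarrow> of_nat (mbinom (\<alpha> + ?e) \<beta>) * mpd \<beta> v * mpd \<gamma> w)
        = of_nat (mbinom (\<alpha> + ?e) \<beta>) * T \<beta> \<gamma>"
      by (simp add: x T_def mult.assoc)
    then show "(if lookup (fst x) i \<noteq> 0 then f x else 0) + (if lookup (snd x) i \<noteq> 0 then g x else 0)
      = (case x of (\<beta>, \<gamma>) \<Rightarrow> of_nat (mbinom (\<alpha> + ?e) \<beta>) * mpd \<beta> v * mpd \<gamma> w)"
      unfolding pascal[OF x(2)] by (simp add: x f_def g_def distrib_right)
  qed
  finally show ?case unfolding S_def .
qed


section \<open>The Weyl algebra\<close>

text \<open>
  An element \<open>\<Sum>\<^sub>\<alpha> P\<^sub>\<alpha> \<partial>\<^sup>\<alpha>\<close> of the Weyl algebra is encoded by its normal form, the finitely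
  supported family of its coefficients \<open>P\<^sub>\<alpha>\<close>. Its product is \<open>weyl_mult\<close> (Leibniz rule), not the
  commutative product of the type.
\<close>

type_synonym 'k weyl = "mindex \<Rightarrow>\<^sub>0 'k mpoly"

definition weyl :: "nat \<Rightarrow> nat \<Rightarrow> 'k::comm_ring_1 weyl set" where
  "weyl n c = {P. \<forall>\<alpha>\<in>keys P. keys \<alpha> \<subseteq> {..<c} \<and> lookup P \<alpha> \<in> pring n}"

definition weyl_mult :: "'k::comm_ring_1 weyl \<Rightarrow> 'k weyl \<Rightarrow> 'k weyl" where
  "weyl_mult P Q = (\<Sum>\<alpha>\<in>keys P. \<Sum>\<beta>\<in>keys Q. \<Sum>(\<gamma>, \<delta>)\<in>splits \<alpha>.
     single (\<delta> + \<beta>) (of_nat (mbinom \<alpha> \<gamma>) * lookup P \<alpha> * mpd \<gamma> (lookup Q \<beta>)))"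

definition weyl_apply :: "'k::comm_ring_1 weyl \<Rightarrow> 'k mpoly \<Rightarrow> 'k mpoly" where
  "weyl_apply P w = (\<Sum>\<alpha>\<in>keys P. lookup P \<alpha> * mpd \<alpha> w)"

lemma weyl_apply_single: "weyl_apply (single \<alpha> a) w = a * mpd \<alpha> w"
  by (cases "a = 0") (simp_all add: weyl_apply_def)

lemma weyl_apply_add: "weyl_apply (P + Q) w = weyl_apply P w + weyl_apply Q w"
proof -
  have *: "weyl_apply R w = (\<Sum>\<alpha>\<in>keys P \<union> keys Q. lookup R \<alpha> * mpd \<alpha> w)"
    if "keys R \<subseteq> keys P \<union> keys Q" for R
    unfolding weyl_apply_def using that
    by (intro sum.mono_neutral_left) (auto simp: in_keys_iff)
  show ?thesis
    by (subst (1 2 3) *) (auto simp: lookup_add algebra_simps sum.distrib dest: subsetD[OF keys_add])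
qed

lemma weyl_apply_sum: "weyl_apply (sum f A) w = (\<Sum>a\<in>A. weyl_apply (f a) w)"
proof (induction A rule: infinite_finite_induct)
qed (auto simp: weyl_apply_add, simp_all add: weyl_apply_def)

text \<open>The product is composition of operators.\<close>

lemma weyl_apply_mult: "weyl_apply (weyl_mult P Q) w = weyl_apply P (weyl_apply Q w)"
proof -
  have "weyl_apply P (weyl_apply Q w)
      = (\<Sum>\<alpha>\<in>keys P. \<Sum>\<beta>\<in>keys Q. lookup P \<alpha> * mpd \<alpha> (lookup Q \<beta> * mpd \<beta> w))"
    by (simp add: weyl_apply_def mpd_sum sum_distrib_left)
  also have "\<dots> = weyl_apply (weyl_mult P Q) w"
    unfolding weyl_mult_def weyl_apply_sum mpd_mult
    by (intro sum.cong refl)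
      (simp add: sum_distrib_left weyl_apply_single case_prod_unfold weyl_apply_sum mpd_mpd mult_ac)
  finally show ?thesis ..
qed

text \<open>An element of \<open>(D\<^sub>n)\<^sup>r\<close> as an operator \<open>R\<^sup>r \<rightarrow> R\<close>.\<close>

definition weyl_op :: "nat \<Rightarrow> (nat \<Rightarrow> 'k::comm_ring_1 weyl) \<Rightarrow> (nat \<Rightarrow> 'k mpoly) \<Rightarrow> 'k mpoly" where
  "weyl_op r \<delta> w = (\<Sum>j<r. weyl_apply (\<delta> j) (w j))"


section \<open>Formal power series in several variables\<close>

typedef 'a mfps = "UNIV :: (mindex \<Rightarrow> 'a) set"
  morphisms mfps_nth Abs_mfps ..

lemmas mfps_nth_Abs [simp] = Abs_mfps_inverse[OF UNIV_I]

lemma mfps_eqI: "(\<And>\<alpha>. mfps_nth f \<alpha> = mfps_nth g \<alpha>) \<Longrightarrow> f = g"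
  by (metis ext mfps_nth_inject)

instantiation mfps :: (comm_ring_1) comm_ring_1
begin

definition "0 = Abs_mfps (\<lambda>\<alpha>. 0)"
definition "1 = Abs_mfps (\<lambda>\<alpha>. if \<alpha> = 0 then 1 else 0)"
definition "f + g = Abs_mfps (\<lambda>\<alpha>. mfps_nth f \<alpha> + mfps_nth g \<alpha>)"
definition "- f = Abs_mfps (\<lambda>\<alpha>. - mfps_nth f \<alpha>)"
definition "f - g = Abs_mfps (\<lambda>\<alpha>. mfps_nth f \<alpha> - mfps_nth g \<alpha>)"
definition "f * g = Abs_mfps (\<lambda>\<alpha>. \<Sum>(\<beta>, \<gamma>)\<in>splits \<alpha>. mfps_nth f \<beta> * mfps_nth g \<gamma>)"

lemmas mfps_defs = zero_mfps_def one_mfps_def plus_mfps_def uminus_mfps_def minus_mfps_def times_mfps_def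

instance
proof
  fix a b c :: "'a mfps"
  show "a + b + c = a + (b + c)" "a + b = b + a" "0 + a = a" "- a + a = 0" "a - b = a + - b"
    by (auto intro!: mfps_eqI simp: mfps_defs algebra_simps)
  show "(a + b) * c = a * c + b * c"
    by (intro mfps_eqI) (simp add: mfps_defs algebra_simps sum.distrib case_prod_unfold)
  show "a * b = b * a"
  proof (intro mfps_eqI)
    fix \<alpha>
    have "(\<Sum>(\<beta>, \<gamma>)\<in>splits \<alpha>. mfps_nth a \<beta> * mfps_nth b \<gamma>)
        = (\<Sum>(\<beta>, \<gamma>)\<in>splits \<alpha>. mfps_nth b \<beta> * mfps_nth a \<gamma>)"
      by (rule sum.reindex_bij_witness[where i = prod.swap and j = prod.swap])
        (auto simp: splits_def add.commute mult.commute)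
    then show "mfps_nth (a * b) \<alpha> = mfps_nth (b * a) \<alpha>" by (simp add: mfps_defs)
  qed
  show "1 * a = a"
  proof (intro mfps_eqI)
    fix \<alpha>
    have "(\<Sum>x\<in>splits \<alpha>. (if fst x = 0 then 1 else 0) * mfps_nth a (snd x))
        = (\<Sum>x\<in>splits \<alpha>. if x = (0, \<alpha>) then mfps_nth a \<alpha> else 0)"
      by (intro sum.cong) (auto simp: splits_def)
    also have "\<dots> = mfps_nth a \<alpha>"
      by (subst sum.delta) (simp_all add: splits_def[of \<alpha>] finite_splits[unfolded splits_def])
    finally show "mfps_nth (1 * a) \<alpha> = mfps_nth a \<alpha>"
      by (simp add: mfps_defs case_prod_unfold)
  qed
  show "a * b * c = a * (b * c)"
  proof (intro mfps_eqI)
    fix \<alpha>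
    let ?t = "\<lambda>\<beta> \<gamma> \<delta>. mfps_nth a \<beta> * mfps_nth b \<gamma> * mfps_nth c \<delta>"
    have "mfps_nth (a * b * c) \<alpha> = (\<Sum>x\<in>splits \<alpha>. \<Sum>y\<in>splits (fst x). ?t (fst y) (snd y) (snd x))"
      by (simp add: mfps_defs case_prod_unfold sum_distrib_right)
    also have "\<dots> = (\<Sum>(x, y)\<in>(SIGMA x:splits \<alpha>. splits (fst x)). ?t (fst y) (snd y) (snd x))"
      by (rule sum.Sigma) auto
    also have "\<dots> = (\<Sum>(x, y)\<in>(SIGMA x:splits \<alpha>. splits (snd x)). ?t (fst x) (fst y) (snd y))"
      by (rule sum.reindex_bij_witness
          [where i = "\<lambda>((\<beta>, \<gamma>\<delta>), (\<gamma>, \<delta>)). ((\<beta> + \<gamma>, \<delta>), (\<beta>, \<gamma>))"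
            and j = "\<lambda>((\<beta>\<gamma>, \<delta>), (\<beta>, \<gamma>)). ((\<beta>, \<gamma> + \<delta>), (\<gamma>, \<delta>))"])
        (auto simp: splits_def add.assoc)
    also have "\<dots> = (\<Sum>x\<in>splits \<alpha>. \<Sum>y\<in>splits (snd x). ?t (fst x) (fst y) (snd y))"
      by (rule sum.Sigma[symmetric]) auto
    also have "\<dots> = mfps_nth (a * (b * c)) \<alpha>"
      by (simp add: mfps_defs case_prod_unfold sum_distrib_left mult.assoc)
    finally show "mfps_nth (a * b * c) \<alpha> = mfps_nth (a * (b * c)) \<alpha>" .
  qed
  have "mfps_nth (0 :: 'a mfps) 0 \<noteq> mfps_nth 1 0"
    by (simp add: mfps_defs)
  then show "(0 :: 'a mfps) \<noteq> 1" by metis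
qed

end

definition mfps_const :: "'a::comm_ring_1 \<Rightarrow> 'a mfps" where
  "mfps_const a = Abs_mfps (\<lambda>\<alpha>. if \<alpha> = 0 then a else 0)"

definition mfps_var :: "nat \<Rightarrow> 'a::comm_ring_1 mfps" where
  "mfps_var i = Abs_mfps (\<lambda>\<alpha>. if \<alpha> = single i 1 then 1 else 0)"

text \<open>The ring \<open>B\<close> of power series in the first \<open>c\<close> variables and its maximal ideal \<open>\<nn>\<close>.\<close>

definition psers :: "nat \<Rightarrow> 'a::comm_ring_1 mfps set" where
  "psers c = {f. \<forall>\<alpha>. mfps_nth f \<alpha> \<noteq> 0 \<longrightarrow> keys \<alpha> \<subseteq> {..<c}}"

definition max_ideal :: "nat \<Rightarrow> 'a::comm_ring_1 mfps set" where
  "max_ideal c = genideal (ring_on (psers c)) (mfps_var ` {..<c})"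

definition max_ideal_pow :: "nat \<Rightarrow> nat \<Rightarrow> 'a::comm_ring_1 mfps set" where
  "max_ideal_pow c m = max_ideal c [^]\<^bsub>ideals_set (ring_on (psers c))\<^esub> m"

text \<open>The action of a power series on a polynomial, \<open>y\<^sub>i\<close> acting as \<open>\<partial>/\<partial>z\<^sub>i\<close>; the sum is
  finite by \<open>mpd_nonzero_finite\<close>.\<close>

definition ps_act :: "'a::comm_ring_1 mfps \<Rightarrow> 'a mpoly \<Rightarrow> 'a mpoly" where
  "ps_act v w = (\<Sum>\<alpha> | mpd \<alpha> w \<noteq> 0. Poly_Mapping.map ((*) (mfps_nth v \<alpha>)) (mpd \<alpha> w))"

definition perp :: "nat \<Rightarrow> nat \<Rightarrow> (nat \<Rightarrow> 'a::comm_ring_1 mfps) set \<Rightarrow> (nat \<Rightarrow> 'a mpoly) set" where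
  "perp c r V = {w \<in> vecs (pring c) r. \<forall>v\<in>V. (\<Sum>j<r. ps_act (v j) (w j)) = 0}"


section \<open>Localization and residue field\<close>

definition local_ring :: "nat \<Rightarrow> 'k::idom mpoly set \<Rightarrow> 'k mpoly fract set" where
  "local_ring n p = {Fract a s | a s. a \<in> pring n \<and> s \<in> pring n - p}"

definition local_ideal :: "nat \<Rightarrow> 'k::idom mpoly set \<Rightarrow> 'k mpoly fract set" where
  "local_ideal n p = {Fract a s | a s. a \<in> p \<and> s \<in> pring n - p}"

definition local_submodule :: "nat \<Rightarrow> 'k::idom mpoly set \<Rightarrow> (nat \<Rightarrow> 'k mpoly) set \<Rightarrow> (nat \<Rightarrow> 'k mpoly fract) set" where
  "local_submodule n p U = {\<lambda>j. Fract (u j) s | u s. u \<in> U \<and> s \<in> pring n - p}"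

definition multiplicity :: "nat \<Rightarrow> nat \<Rightarrow> 'k::idom mpoly set \<Rightarrow> (nat \<Rightarrow> 'k mpoly) set \<Rightarrow> enat" where
  "multiplicity n r p U = quotient_length (local_ring n p) r (local_submodule n p U)"

text \<open>
  The residue field \<open>R\<^sub>\<pp> / \<pp>R\<^sub>\<pp>\<close> is represented by a field type \<open>'f\<close> together with a ring
  isomorphism from the quotient ring onto \<open>'f\<close>.
\<close>

definition is_residue_field ::
    "nat \<Rightarrow> 'k::idom mpoly set \<Rightarrow> ('k mpoly fract set \<Rightarrow> 'f::field) \<Rightarrow> bool" where
  "is_residue_field n p \<phi> \<longleftrightarrow>
    \<phi> \<in> ring_iso (ring_on (local_ring n p) Quot local_ideal n p) (ring_on UNIV)"

definition residue :: "nat \<Rightarrow> 'k::idom mpoly set \<Rightarrow> ('k mpoly fract set \<Rightarrow> 'f::field) \<Rightarrow> 'k mpoly \<Rightarrow> 'f" where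
  "residue n p \<phi> f = \<phi> (local_ideal n p +>\<^bsub>ring_on (local_ring n p)\<^esub> Fract f 1)"


section \<open>Primary submodules and points of the punctual Quot scheme\<close>

definition primary :: "nat \<Rightarrow> nat \<Rightarrow> 'k::idom mpoly set \<Rightarrow> (nat \<Rightarrow> 'k mpoly) set \<Rightarrow> bool" where
  "primary n r p U \<longleftrightarrow> U \<in> submodules (pring n) r \<and> assoc_primes (pring n) r U = {p}"

text \<open>
  By convention \<open>R\<^sup>r\<close> is the \<open>\<pp>\<close>-primary submodule of multiplicity 0: it has no associated
  primes, while every submodule with associated primes \<open>{\<pp>}\<close> has positive multiplicity. For
  \<open>m > 0\<close> the second alternative is void.
\<close>

definition primary_submodules ::
    "nat \<Rightarrow> nat \<Rightarrow> 'k::idom mpoly set \<Rightarrow> nat \<Rightarrow> (nat \<Rightarrow> 'k mpoly) set set" where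
  "primary_submodules n r p m =
    {U. (primary n r p U \<or> U = vecs (pring n) r) \<and> multiplicity n r p U = enat m}"

text \<open>The classes of \<open>b 0, \<dots>, b (m - 1)\<close> form an \<open>F\<close>-basis of \<open>B\<^sup>r / V\<close>.\<close>

definition quotient_basis ::
    "nat \<Rightarrow> nat \<Rightarrow> (nat \<Rightarrow> 'f::field mfps) set \<Rightarrow> nat \<Rightarrow> (nat \<Rightarrow> nat \<Rightarrow> 'f mfps) \<Rightarrow> bool" where
  "quotient_basis c r V m b \<longleftrightarrow>
    (\<forall>i<m. b i \<in> vecs (psers c) r) \<and>
    (\<forall>v\<in>vecs (psers c) r. \<exists>!a. (\<forall>i\<ge>m. a i = 0) \<and>
       (\<lambda>j. v j - (\<Sum>i<m. mfps_const (a i) * b i j)) \<in> V)"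

definition quot_points :: "nat \<Rightarrow> nat \<Rightarrow> nat \<Rightarrow> (nat \<Rightarrow> 'f::field mfps) set set" where
  "quot_points c r m = {V \<in> submodules (psers c) r. \<exists>b. quotient_basis c r V m b}"

text \<open>The embedding \<open>\<gamma>\<close>, where \<open>bar\<close> is the residue map \<open>R \<rightarrow> F\<close>.\<close>

definition gamma_map :: "('k::comm_ring_1 mpoly \<Rightarrow> 'f::field) \<Rightarrow> nat \<Rightarrow> 'k mpoly \<Rightarrow> 'f mfps" where
  "gamma_map bar c f = (\<Sum>\<alpha>\<in>keys f. mfps_const (bar (single 0 (lookup f \<alpha>))) *
     (\<Prod>i\<in>keys \<alpha>. ((if i < c then mfps_var i else 0) + mfps_const (bar (single (single i 1) 1)))
        ^ lookup \<alpha> i))"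

definition quot_point_of ::
    "('k::comm_ring_1 mpoly \<Rightarrow> 'f::field) \<Rightarrow> nat \<Rightarrow> nat \<Rightarrow> nat \<Rightarrow> (nat \<Rightarrow> 'k mpoly) set \<Rightarrow> (nat \<Rightarrow> 'f mfps) set" where
  "quot_point_of bar c r m U =
    submodule_hull (psers c) r
      ((\<lambda>u j. gamma_map bar c (u j)) ` U \<union>
       {\<lambda>j. a * v j | a v. a \<in> max_ideal_pow c m \<and> v \<in> vecs (psers c) r})"


section \<open>Finite-dimensional subspaces\<close>

definition vscale :: "'f::field \<Rightarrow> (nat \<Rightarrow> mindex \<Rightarrow>\<^sub>0 'f) \<Rightarrow> nat \<Rightarrow> mindex \<Rightarrow>\<^sub>0 'f" where
  "vscale a w = (\<lambda>j. Poly_Mapping.map ((*) a) (w j))"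

lemma lookup_map_times: "lookup (Poly_Mapping.map ((*) a) w) \<alpha> = (a::'a::comm_ring_1) * lookup w \<alpha>"
  by (simp add: Poly_Mapping.map.rep_eq when_def)

global_interpretation vec: vector_space vscale
  by standard
    (auto simp: vscale_def fun_eq_iff lookup_map_times lookup_add algebra_simps intro!: poly_mapping_eqI)

definition is_basis :: "nat \<Rightarrow> (nat \<Rightarrow> nat \<Rightarrow> mindex \<Rightarrow>\<^sub>0 'f::field) \<Rightarrow> (nat \<Rightarrow> mindex \<Rightarrow>\<^sub>0 'f) set \<Rightarrow> bool" where
  "is_basis m e W \<longleftrightarrow>
    inj_on e {..<m} \<and> vec.independent (e ` {..<m}) \<and> vec.span (e ` {..<m}) = W"

definition subspaces_of_dim :: "(nat \<Rightarrow> mindex \<Rightarrow>\<^sub>0 'f::field) set \<Rightarrow> nat \<Rightarrow> (nat \<Rightarrow> mindex \<Rightarrow>\<^sub>0 'f) set set" where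
  "subspaces_of_dim M m = {W. vec.subspace W \<and> W \<subseteq> M \<and> (\<exists>e. is_basis m e W)}"

definition diff_closed_subspaces :: "nat \<Rightarrow> nat \<Rightarrow> nat \<Rightarrow> (nat \<Rightarrow> 'f::field mpoly) set set" where
  "diff_closed_subspaces c r m =
    {W \<in> subspaces_of_dim (vecs (pring c) r) m. \<forall>w\<in>W. \<forall>i<c. (\<lambda>j. pd i (w j)) \<in> W}"


section \<open>The Weyl-Noether module and Noetherian operators\<close>

text \<open>
  An element of \<open>F \<otimes>\<^sub>R D\<^sub>n\<^sub>,\<^sub>c\<close> is encoded by its coefficients with respect to the basis
  \<open>1 \<otimes> \<partial>\<^sup>\<alpha>\<close>.
\<close>

type_synonym 'f wnoether = "mindex \<Rightarrow>\<^sub>0 'f"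

definition wnoether :: "nat \<Rightarrow> 'f::zero wnoether set" where
  "wnoether c = {e. \<forall>\<alpha>\<in>keys e. keys \<alpha> \<subseteq> {..<c}}"

text \<open>The element \<open>1 \<otimes> P\<close>.\<close>

definition one_tensor :: "('k::comm_ring_1 mpoly \<Rightarrow> 'f::field) \<Rightarrow> 'k weyl \<Rightarrow> 'f wnoether" where
  "one_tensor bar P = Poly_Mapping.map bar P"

definition left_act :: "('k::comm_ring_1 mpoly \<Rightarrow> 'f::field) \<Rightarrow> 'k mpoly \<Rightarrow> 'f wnoether \<Rightarrow> 'f wnoether" where
  "left_act bar g e = Poly_Mapping.map ((*) (bar g)) e"

text \<open>\<open>(\<Sum>\<^sub>\<alpha> e\<^sub>\<alpha> \<otimes> \<partial>\<^sup>\<alpha>) \<cdot> g = \<Sum>\<^sub>\<alpha> e\<^sub>\<alpha> \<otimes> (\<partial>\<^sup>\<alpha> g)\<close>, the product \<open>\<partial>\<^sup>\<alpha> g\<close> being that of the Weyl algebra.\<close>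

definition right_act :: "('k::comm_ring_1 mpoly \<Rightarrow> 'f::field) \<Rightarrow> 'f wnoether \<Rightarrow> 'k mpoly \<Rightarrow> 'f wnoether" where
  "right_act bar e g = (\<Sum>\<alpha>\<in>keys e. Poly_Mapping.map ((*) (lookup e \<alpha>))
     (one_tensor bar (weyl_mult (single \<alpha> 1) (single 0 g))))"

definition bimodule_subspaces ::
    "('k::comm_ring_1 mpoly \<Rightarrow> 'f::field) \<Rightarrow> nat \<Rightarrow> nat \<Rightarrow> nat \<Rightarrow> nat \<Rightarrow> (nat \<Rightarrow> 'f wnoether) set set" where
  "bimodule_subspaces bar n c r m =
    {W \<in> subspaces_of_dim (vecs (wnoether c) r) m. \<forall>e\<in>W. \<forall>g\<in>pring n.
       (\<lambda>j. left_act bar g (e j)) \<in> W \<and> (\<lambda>j. right_act bar (e j) g) \<in> W}"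

text \<open>The linear isomorphism \<open>z\<^sup>\<alpha> \<mapsto> 1 \<otimes> \<partial>\<^sup>\<alpha>\<close>.\<close>

definition Omega :: "(nat \<Rightarrow> 'f::field mpoly) \<Rightarrow> nat \<Rightarrow> 'f wnoether" where
  "Omega w = (\<lambda>j. \<Sum>\<alpha>\<in>keys (w j). Poly_Mapping.map ((*) (lookup (w j) \<alpha>)) (single \<alpha> 1))"

text \<open>
  \<open>\<delta>\<close> lifts \<open>e\<close>: after scaling by the class of some \<open>s \<notin> \<pp>\<close>, the coefficients of \<open>e\<close> are the
  classes of those of \<open>\<delta>\<close>.
\<close>

definition is_lift ::
    "('k::comm_ring_1 mpoly \<Rightarrow> 'f::field) \<Rightarrow> nat \<Rightarrow> nat \<Rightarrow> nat \<Rightarrow> 'k mpoly set \<Rightarrow>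
      (nat \<Rightarrow> 'f wnoether) \<Rightarrow> (nat \<Rightarrow> 'k weyl) \<Rightarrow> bool" where
  "is_lift bar n c r p e \<delta> \<longleftrightarrow> \<delta> \<in> vecs (weyl n c) r \<and>
    (\<exists>s\<in>pring n - p. \<forall>j<r. \<forall>\<alpha>. bar (lookup (\<delta> j) \<alpha>) = bar s * lookup (e j) \<alpha>)"

definition noetherian_operators ::
    "nat \<Rightarrow> nat \<Rightarrow> 'k::comm_ring_1 mpoly set \<Rightarrow> (nat \<Rightarrow> 'k mpoly) set \<Rightarrow> nat \<Rightarrow>
      (nat \<Rightarrow> nat \<Rightarrow> 'k weyl) \<Rightarrow> bool" where
  "noetherian_operators n r p U m \<delta> \<longleftrightarrow>
    (\<forall>i<m. \<delta> i \<in> vecs (weyl n n) r) \<and>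
    U = {w \<in> vecs (pring n) r. \<forall>i<m. weyl_op r (\<delta> i) w \<in> p}"

end

theory Submission
  imports Defs
begin

text \<open>
  Write \<open>R\<close> for the polynomial ring, \<open>F\<close> for the residue field of \<open>\<pp>\<close> and \<open>B\<close> for the power
  series ring \<open>F[[y\<^sub>1, \<dots>, y\<^sub>c]]\<close>. The embedding \<open>\<gamma> : R \<rightarrow> B\<close> is Taylor expansion along the first
  \<open>c\<close> variables at the generic point of the variety of \<open>\<pp>\<close>: the coefficient of \<open>y\<^sup>\<alpha>\<close> in \<open>\<gamma>(f)\<close> is
  the class of \<open>\<partial>\<^sup>\<alpha>f / \<alpha>!\<close> (\<open>gamma_map_eq_taylor\<close>). The theorem holds because \<open>\<gamma>\<close> identifies \<open>B\<close>
  with the completion of \<open>R\<^sub>\<pp>\<close>. In elementary terms: modulo any step of a filtration of \<open>B\<close>, every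
  power series is a quotient \<open>\<gamma>(a) / \<gamma>(s)\<close> with \<open>s \<notin> \<pp>\<close> (\<open>tay_approximation\<close>), and \<open>\<gamma>(a)\<close> lies deep
  in the filtration only if \<open>s a\<close> lies, for some \<open>s \<notin> \<pp>\<close>, in a high power of \<open>\<pp>\<close> (\<open>tay_kernel\<close>).

  Both facts come from a triangular system of generators \<open>g\<^sub>1, \<dots>, g\<^sub>c\<close> of \<open>\<pp> R\<^sub>\<pp>\<close>
  (\<open>triangular_generators\<close>). The polynomial \<open>g\<^sub>i\<close> lies in \<open>\<pp>\<close>, involves only \<open>x\<^sub>1, \<dots>, x\<^sub>i\<close> and the
  variables of the basis modulo \<open>\<pp>\<close>, and has the least possible degree in \<open>x\<^sub>i\<close> among those whose
  leading coefficient is not in \<open>\<pp>\<close>; it plays the part of the minimal polynomial of \<open>x\<^sub>i\<close> over the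
  preceding variables. In characteristic zero minimality implies \<open>\<partial>g\<^sub>i/\<partial>x\<^sub>i \<notin> \<pp>\<close>. For the weights
  \<open>2c, 2c - 1, \<dots>, c + 1\<close> of \<open>y\<^sub>1, \<dots>, y\<^sub>c\<close>, this makes a nonzero multiple of \<open>y\<^sub>i\<close> the lightest
  term of \<open>\<gamma>(g\<^sub>i)\<close>: the earlier variables are heavier than \<open>y\<^sub>i\<close>, the later ones do not occur to first
  order, and every monomial of degree two is heavier than every variable. Hence \<open>\<gamma>(g\<^sup>\<alpha>)\<close> has lightest
  term a nonzero multiple of \<open>y\<^sup>\<alpha>\<close>, and both facts follow by induction on the weight.

  From (b) to (a) one pulls back along \<open>\<gamma>\<close>. The pullback of \<open>V\<close> is saturated with respect to the
  complement of \<open>\<pp>\<close> because \<open>\<gamma>(s)\<close> is a unit for \<open>s \<notin> \<pp>\<close>, and it determines \<open>V\<close> by approximation.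
  Its multiplicity is the length of chains of saturated submodules (\<open>multiplicity_saturated\<close>). Such
  chains are not longer than the colength \<open>m\<close>, because elements that witness their strict inclusions
  are independent modulo \<open>V\<close>; a chain of length \<open>m\<close> is the pullback of one dual to a flag of subspaces closed
  under differentiation (\<open>multiplicity_pullback\<close>). Conversely a primary submodule is saturated, by
  the Noetherian property of \<open>R\<close> (\<open>primary_saturated\<close>). If its multiplicity is finite, a power of
  \<open>\<pp>\<close> annihilates the quotient by Nakayama's lemma, and by \<open>tay_kernel\<close> it is a pullback
  (\<open>primary_is_pullback\<close>).

  The correspondence of (b) and (c) is Macaulay duality for the pairing \<open>\<langle>y\<^sup>\<alpha>, z\<^sup>\<beta>\<rangle> = \<alpha>!\<close> if
  \<open>\<alpha> = \<beta>\<close>, and \<open>0\<close> otherwise. Multiplication by \<open>y\<^sub>i\<close> is adjoint to \<open>\<partial>/\<partial>z\<^sub>i\<close>, and Nakayama's lemma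
  gives \<open>\<nn>\<^sup>m B\<^sup>r \<subseteq> V\<close>, so that the linear functionals on \<open>B\<^sup>r / V\<close> are represented by vectors of
  polynomials (\<open>perp_bij\<close>). For (c) and (d), the right action of \<open>g \<in> R\<close> on the Weyl-Noether module
  is the action of the power series \<open>\<gamma>(g)\<close> (\<open>right_act_eq_ps_act\<close>), and its commutator with the left
  action for \<open>g = x\<^sub>i\<close> is \<open>\<partial>/\<partial>z\<^sub>i\<close>. Finally, if \<open>\<delta>\<close> lifts \<open>e\<close>, then up to a nonzero factor
  \<open>\<delta>(u)\<close> reduces modulo \<open>\<pp>\<close> to \<open>\<langle>\<gamma>(u), e\<rangle>\<close> (\<open>bar_weyl_op\<close>), so the lifts of a basis of \<open>V\<^sup>\<bottom>\<close> detect
  membership in the pullback of \<open>V\<^sup>\<bottom>\<^sup>\<bottom> = V\<close>.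
\<close>

section \<open>Subrings, submodules and ideals on subsets of a type\<close>

definition subring_set :: "'a::comm_ring_1 set \<Rightarrow> bool" where
  "subring_set A \<longleftrightarrow> 1 \<in> A \<and> (\<forall>a\<in>A. \<forall>b\<in>A. a + b \<in> A \<and> a * b \<in> A) \<and> (\<forall>a\<in>A. - a \<in> A)"

lemma subring_setD:
  assumes "subring_set A"
  shows "1 \<in> A" "0 \<in> A" "a \<in> A \<Longrightarrow> b \<in> A \<Longrightarrow> a + b \<in> A" "a \<in> A \<Longrightarrow> b \<in> A \<Longrightarrow> a * b \<in> A"
    "a \<in> A \<Longrightarrow> - a \<in> A" "a \<in> A \<Longrightarrow> b \<in> A \<Longrightarrow> a - b \<in> A"
proof -
  show 1: "1 \<in> A" "a \<in> A \<Longrightarrow> b \<in> A \<Longrightarrow> a + b \<in> A" "a \<in> A \<Longrightarrow> b \<in> A \<Longrightarrow> a * b \<in> A" 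
    "a \<in> A \<Longrightarrow> - a \<in> A" for a b
    using assms by (auto simp: subring_set_def)
  show "0 \<in> A" using 1(2)[OF 1(1) 1(4)[OF 1(1)]] by simp
  show "a \<in> A \<Longrightarrow> b \<in> A \<Longrightarrow> a - b \<in> A"
    using 1(2)[of a "- b"] 1(4)[of b] by simp
qed

lemma subring_set_sum:
  "subring_set A \<Longrightarrow> (\<And>x. x \<in> S \<Longrightarrow> f x \<in> A) \<Longrightarrow> sum f S \<in> A"
  by (induction S rule: infinite_finite_induct) (auto intro: subring_setD)

lemma subring_set_prod:
  "subring_set A \<Longrightarrow> (\<And>x. x \<in> S \<Longrightarrow> f x \<in> A) \<Longrightarrow> prod f S \<in> A"
  by (induction S rule: infinite_finite_induct) (auto intro: subring_setD)

lemma subring_set_power: "subring_set A \<Longrightarrow> a \<in> A \<Longrightarrow> a ^ k \<in> A"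
  by (induction k) (auto intro: subring_setD)

lemma ring_on_simps [simp]:
  "carrier (ring_on A) = A" "monoid.mult (ring_on A) = (*)" "one (ring_on A) = 1"
  "zero (ring_on A) = 0" "add (ring_on A) = (+)"
  by (simp_all add: ring_on_def)

lemma cring_ring_on:
  assumes "subring_set A"
  shows "cring (ring_on A)"
proof (rule cringI)
  show "abelian_group (ring_on A)"
  proof (rule abelian_groupI)
    show "\<exists>y\<in>carrier (ring_on A). y \<oplus>\<^bsub>ring_on A\<^esub> x = \<zero>\<^bsub>ring_on A\<^esub>" if "x \<in> carrier (ring_on A)" for x
      using that subring_setD[OF assms] by (intro bexI[of _ "- x"]) (auto simp: ring_on_def)
  qed (auto simp: ring_on_def algebra_simps subring_setD[OF assms])
  show "comm_monoid (ring_on A)"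
    by (intro comm_monoidI) (auto simp: ring_on_def algebra_simps subring_setD[OF assms])
qed (auto simp: ring_on_def algebra_simps)

lemma subgroup_add_iff:
  fixes G :: "('a::ab_group_add, 'b) ring_scheme"
  assumes "zero G = 0" "add G = (+)" "\<And>x. x \<in> carrier G \<Longrightarrow> - x \<in> carrier G"
  shows "subgroup H (add_monoid G) \<longleftrightarrow>
    H \<subseteq> carrier G \<and> 0 \<in> H \<and> (\<forall>x\<in>H. \<forall>y\<in>H. x + y \<in> H) \<and> (\<forall>x\<in>H. - x \<in> H)"
proof -
  have inv: "inv\<^bsub>add_monoid G\<^esub> x = - x" if "x \<in> carrier G" for x
    unfolding m_inv_def
  proof (rule the_equality)
    fix y assume "y \<in> carrier (add_monoid G) \<and> x \<otimes>\<^bsub>add_monoid G\<^esub> y = \<one>\<^bsub>add_monoid G\<^esub> \<and> y \<otimes>\<^bsub>add_monoid G\<^esub> x = \<one>\<^bsub>add_monoid G\<^esub>"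
    then show "y = - x" using assms by (simp add: eq_neg_iff_add_eq_0 add.commute)
  qed (use assms that in auto)
  show ?thesis
    using inv assms unfolding subgroup_def by (auto simp: subset_iff)
qed

lemma submodules_iff:
  assumes A: "subring_set A"
  shows "U \<in> submodules A r \<longleftrightarrow> U \<subseteq> vecs A r \<and> 0 \<in> U \<and> (\<forall>u\<in>U. \<forall>v\<in>U. u + v \<in> U)
    \<and> (\<forall>a\<in>A. \<forall>u\<in>U. (\<lambda>j. a * u j) \<in> U)"
proof -
  have "(- x :: nat \<Rightarrow> 'a) = (\<lambda>j. (- 1) * x j)" for x
    by (simp add: fun_eq_iff)
  then have neg: "- x \<in> U" if "\<forall>a\<in>A. \<forall>u\<in>U. (\<lambda>j. a * u j) \<in> U" "x \<in> U" for x
    using that subring_setD(1,5)[OF A] by metis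
  have "subgroup U (add_monoid (free_module A r)) \<longleftrightarrow>
    U \<subseteq> vecs A r \<and> 0 \<in> U \<and> (\<forall>x\<in>U. \<forall>y\<in>U. x + y \<in> U) \<and> (\<forall>x\<in>U. - x \<in> U)"
    by (subst subgroup_add_iff) (auto simp: free_module_def vecs_def subring_setD[OF A])
  then show ?thesis
    using neg by (auto simp: submodules_def submodule_def submodule_axioms_def ring_on_def free_module_def)
qed

lemma ideal_ring_on_iff:
  assumes A: "subring_set A"
  shows "ideal I (ring_on A) \<longleftrightarrow> I \<subseteq> A \<and> 0 \<in> I \<and> (\<forall>x\<in>I. \<forall>y\<in>I. x + y \<in> I) \<and> (\<forall>a\<in>A. \<forall>x\<in>I. a * x \<in> I)"
proof -
  interpret cring "ring_on A" by (rule cring_ring_on[OF A])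
  have "- x = (- 1) * x" for x :: 'a by simp
  then have neg: "- x \<in> I" if "\<forall>a\<in>A. \<forall>x\<in>I. a * x \<in> I" "x \<in> I" for x
    using that subring_setD(1,5)[OF A] by metis
  have sub: "subgroup I (add_monoid (ring_on A)) \<longleftrightarrow>
    I \<subseteq> A \<and> 0 \<in> I \<and> (\<forall>x\<in>I. \<forall>y\<in>I. x + y \<in> I) \<and> (\<forall>x\<in>I. - x \<in> I)"
    by (subst subgroup_add_iff) (auto simp: ring_on_def subring_setD[OF A])
  have "ideal I (ring_on A) \<longleftrightarrow> subgroup I (add_monoid (ring_on A)) \<and> (\<forall>a\<in>A. \<forall>x\<in>I. a * x \<in> I)"
  proof -
    have "ideal_axioms I (ring_on A) \<longleftrightarrow> (\<forall>a\<in>A. \<forall>x\<in>I. a * x \<in> I)"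
    proof -
      have "ideal_axioms I (ring_on A) \<longleftrightarrow> (\<forall>x a. x \<in> I \<longrightarrow> a \<in> A \<longrightarrow> a * x \<in> I \<and> x * a \<in> I)"
        unfolding ideal_axioms_def ring_on_simps by (auto 0 0)
      then show ?thesis by (metis mult.commute)
    qed
    then show ?thesis using ring_axioms by (simp add: ideal_def additive_subgroup_def)
  qed
  then show ?thesis
    unfolding sub using neg by blast
qed

lemma primeideal_ring_on_iff:
  assumes A: "subring_set A"
  shows "primeideal I (ring_on A) \<longleftrightarrow> I \<subseteq> A \<and> 0 \<in> I \<and> (\<forall>x\<in>I. \<forall>y\<in>I. x + y \<in> I)
    \<and> (\<forall>a\<in>A. \<forall>x\<in>I. a * x \<in> I) \<and> 1 \<notin> I \<and> (\<forall>a\<in>A. \<forall>b\<in>A. a * b \<in> I \<longrightarrow> a \<in> I \<or> b \<in> I)"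
proof -
  have "1 \<in> I \<longleftrightarrow> A = I" if "I \<subseteq> A" "\<forall>a\<in>A. \<forall>x\<in>I. a * x \<in> I"
    using that subring_setD(1)[OF A] by (metis mult.right_neutral subsetI subset_antisym)
  moreover have "primeideal I (ring_on A) \<longleftrightarrow> ideal I (ring_on A) \<and> A \<noteq> I \<and>
      (\<forall>a b. a \<in> A \<longrightarrow> b \<in> A \<longrightarrow> a * b \<in> I \<longrightarrow> a \<in> I \<or> b \<in> I)"
    using cring_ring_on[OF A] unfolding primeideal_def primeideal_axioms_def ring_on_simps by blast
  ultimately show ?thesis
    unfolding ideal_ring_on_iff[OF A] by metis
qed

lemma vecs_nth: "v \<in> vecs A r \<Longrightarrow> 0 \<in> A \<Longrightarrow> v j \<in> A"
  by (cases "j < r") (auto simp: vecs_def)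

section \<open>Polynomials in a subset of the variables\<close>

lemma subring_polys: "subring_set (polys I :: 'a::comm_ring_1 mpoly set)"
  unfolding subring_set_def
proof (intro conjI ballI)
  show "1 \<in> polys I" by (auto simp: polys_def)
  fix f g :: "'a mpoly" assume fg: "f \<in> polys I" "g \<in> polys I"
  show "f + g \<in> polys I" using fg keys_add[of f g] by (auto simp: polys_def)
  show "f * g \<in> polys I"
    unfolding polys_def
  proof (intro CollectI ballI)
    fix \<alpha> assume "\<alpha> \<in> keys (f * g)"
    then obtain \<beta> \<gamma> where "\<alpha> = \<beta> + \<gamma>" "\<beta> \<in> keys f" "\<gamma> \<in> keys g"
      using keys_mult[of f g] by blast
    then show "keys \<alpha> \<subseteq> I" using fg keys_add[of \<beta> \<gamma>] by (fastforce simp: polys_def)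
  qed
next
  fix f :: "'a mpoly" assume "f \<in> polys I"
  then show "- f \<in> polys I" by (auto simp: polys_def)
qed

lemmas polys_closed [simp, intro] =
  subring_setD(1,2)[OF subring_polys] subring_setD(3-6)[OF subring_polys]
  subring_set_sum[OF subring_polys] subring_set_prod[OF subring_polys] subring_set_power[OF subring_polys]

lemma polys_mono: "I \<subseteq> J \<Longrightarrow> polys I \<subseteq> polys J"
  by (auto simp: polys_def)

lemma polys_lookupD: "f \<in> polys I \<Longrightarrow> lookup f \<alpha> \<noteq> 0 \<Longrightarrow> keys \<alpha> \<subseteq> I"
  by (auto simp: polys_def in_keys_iff)

lemma single_polys [intro]: "keys \<alpha> \<subseteq> I \<Longrightarrow> single \<alpha> a \<in> polys I"
  by (auto simp: polys_def split: if_splits)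

lemma single_0_polys [simp]: "single 0 a \<in> polys I"
  by (auto simp: polys_def split: if_splits)

lemma pd_polys [intro]: assumes "f \<in> polys I" shows "pd i f \<in> polys I"
  unfolding polys_def
proof (intro CollectI ballI)
  fix \<alpha> assume "\<alpha> \<in> keys (pd i f)"
  then have "lookup f (\<alpha> + single i 1) \<noteq> 0" by (auto simp: in_keys_iff lookup_pd)
  then have "keys (\<alpha> + single i 1) \<subseteq> I" by (rule polys_lookupD[OF assms])
  moreover have "keys \<alpha> \<subseteq> keys (\<alpha> + single i 1)" by (auto simp: in_keys_iff lookup_add)
  ultimately show "keys \<alpha> \<subseteq> I" by blast
qed

lemma mpd_polys [intro]: "f \<in> polys I \<Longrightarrow> mpd \<alpha> f \<in> polys I"
  by (induction \<alpha> rule: mindex_induct) (auto simp only: mpd_0 mpd_plus_single intro: pd_polys)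

lemma pd_polys_eq_0:
  assumes "f \<in> polys I" "i \<notin> I" shows "pd i f = 0"
proof (intro poly_mapping_eqI)
  fix \<alpha> :: mindex
  have "i \<in> keys (\<alpha> + single i 1)" by (simp add: in_keys_iff lookup_add)
  then have "lookup f (\<alpha> + single i 1) = 0" using assms polys_lookupD by blast
  then show "lookup (pd i f) \<alpha> = lookup 0 \<alpha>" by (simp add: lookup_pd)
qed

section \<open>The residue field\<close>

text \<open>What the proof uses of the residue field: a ring homomorphism with kernel \<open>\<pp>\<close> such that every
  element of the field is a quotient of two values.\<close>

locale residue_map =
  fixes n c :: nat and p :: "'k::field_char_0 mpoly set" and bar :: "'k mpoly \<Rightarrow> 'f::field"
  assumes c_le: "c \<le> n"
    and p_sub: "p \<subseteq> pring n"
    and bar_1 [simp]: "bar 1 = 1"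
    and bar_add: "\<And>f g. f \<in> pring n \<Longrightarrow> g \<in> pring n \<Longrightarrow> bar (f + g) = bar f + bar g"
    and bar_mult: "\<And>f g. f \<in> pring n \<Longrightarrow> g \<in> pring n \<Longrightarrow> bar (f * g) = bar f * bar g"
    and bar_eq_0: "\<And>f. f \<in> pring n \<Longrightarrow> bar f = 0 \<longleftrightarrow> f \<in> p"
    and bar_frac: "\<And>x. \<exists>a\<in>pring n. \<exists>s\<in>pring n - p. bar s * x = bar a"
    and basis: "basis_modulo n p {c..<n}"

lemma subring_local_ring:
  assumes "primeideal p (ring_on (pring n))"
  shows "subring_set (local_ring n p)"
proof -
  have p: "0 \<in> p" "1 \<notin> p" "\<And>a b. a \<in> pring n \<Longrightarrow> b \<in> pring n \<Longrightarrow> a * b \<in> p \<Longrightarrow> a \<in> p \<or> b \<in> p"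
    using assms unfolding primeideal_ring_on_iff[OF subring_polys] by auto
  have s: "s * t \<in> pring n - p" if "s \<in> pring n - p" "t \<in> pring n - p" for s t
    using that p(3) by auto
  have nz: "s \<noteq> 0" if "s \<in> pring n - p" for s using that p(1) by auto
  have memA: "Fract a s \<in> local_ring n p" if "a \<in> pring n" "s \<in> pring n - p" for a s
    using that by (auto simp: local_ring_def)
  show ?thesis
    unfolding subring_set_def
  proof (intro conjI ballI)
    show "1 \<in> local_ring n p" using memA[of 1 1] p(2) by (simp add: One_fract_def)
    fix x y assume "x \<in> local_ring n p" "y \<in> local_ring n p"
    then obtain a s b t where x: "x = Fract a s" "a \<in> pring n" "s \<in> pring n - p" and
      y: "y = Fract b t" "b \<in> pring n" "t \<in> pring n - p"
      unfolding local_ring_def by blast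
    show "x + y \<in> local_ring n p" using x y s nz by (auto intro!: memA)
    show "x * y \<in> local_ring n p" using x y s by (auto intro!: memA)
  next
    fix x assume "x \<in> local_ring n p"
    then show "- x \<in> local_ring n p" using memA by (auto simp: local_ring_def)
  qed
qed

text \<open>The residue map is the composition of \<open>R \<rightarrow> R\<^sub>\<pp>\<close>, the quotient by \<open>\<pp> R\<^sub>\<pp>\<close> and an isomorphism, and
  \<open>\<pp> R\<^sub>\<pp> \<inter> R = \<pp>\<close> because \<open>\<pp>\<close> is prime.\<close>

lemma residue_map_residue:
  fixes p :: "'k::field_char_0 mpoly set" and \<phi> :: "'k mpoly fract set \<Rightarrow> 'f::field"
  assumes "primeideal p (ring_on (pring n))"
    and "c \<le> n" "basis_modulo n p {c..<n}" "is_residue_field n p \<phi>"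
  shows "residue_map n c p (residue n p \<phi>)"
proof -
  let ?A = "local_ring n p" and ?I = "local_ideal n p"
  have p: "p \<subseteq> pring n" "0 \<in> p" "\<And>x y. x \<in> p \<Longrightarrow> y \<in> p \<Longrightarrow> x + y \<in> p"
    "\<And>a x. a \<in> pring n \<Longrightarrow> x \<in> p \<Longrightarrow> a * x \<in> p" "1 \<notin> p"
    "\<And>a b. a \<in> pring n \<Longrightarrow> b \<in> pring n \<Longrightarrow> a * b \<in> p \<Longrightarrow> a \<in> p \<or> b \<in> p"
    using assms(1) unfolding primeideal_ring_on_iff[OF subring_polys] by auto
  have s: "s * t \<in> pring n - p" if "s \<in> pring n - p" "t \<in> pring n - p" for s t
    using that p(6) by auto
  have nz: "s \<noteq> 0" if "s \<in> pring n - p" for s using that p(2) by auto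
  have one: "1 \<in> pring n - p" using p(5) by auto
  have memA: "Fract a s \<in> ?A" if "a \<in> pring n" "s \<in> pring n - p" for a s
    using that by (auto simp: local_ring_def)
  have memI: "Fract a s \<in> ?I" if "a \<in> p" "s \<in> pring n - p" for a s
    using that by (auto simp: local_ideal_def)
  have A: "subring_set ?A" by (rule subring_local_ring[OF assms(1)])
  have I: "ideal ?I (ring_on ?A)"
    unfolding ideal_ring_on_iff[OF A]
  proof (intro conjI ballI)
    show "?I \<subseteq> ?A" using p(1) by (auto simp: local_ideal_def intro!: memA)
    show "0 \<in> ?I" using memI[of 0 1] one p(2) by (simp add: Zero_fract_def)
  next
    fix x y assume "x \<in> ?I" "y \<in> ?I"
    then obtain a s b t where x: "x = Fract a s" "a \<in> p" "s \<in> pring n - p" and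
      y: "y = Fract b t" "b \<in> p" "t \<in> pring n - p"
      unfolding local_ideal_def by blast
    have "a * t + b * s \<in> p" using x y p(3) p(4)[of t a] p(4)[of s b] by (auto simp: mult.commute)
    then show "x + y \<in> ?I" using x y s nz by (auto intro!: memI)
  next
    fix x y assume "x \<in> ?A" "y \<in> ?I"
    then obtain a s b t where x: "x = Fract a s" "a \<in> pring n" "s \<in> pring n - p" and
      y: "y = Fract b t" "b \<in> p" "t \<in> pring n - p"
      unfolding local_ideal_def local_ring_def by blast
    then show "x * y \<in> ?I" using s p(4) by (auto intro!: memI)
  qed
  define h where "h x = \<phi> (?I +>\<^bsub>ring_on ?A\<^esub> x)" for x
  have \<phi>: "\<phi> \<in> ring_hom (ring_on ?A Quot ?I) (ring_on UNIV)"
    and bij: "bij_betw \<phi> (carrier (ring_on ?A Quot ?I)) UNIV"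
    using assms(4) by (auto simp: is_residue_field_def ring_iso_def)
  have "\<phi> \<circ> (+>\<^bsub>ring_on ?A\<^esub>) ?I \<in> ring_hom (ring_on ?A) (ring_on UNIV)"
    using ideal.rcos_ring_hom[OF I] \<phi> by (rule ring_hom_trans)
  then have h: "h 1 = 1" "\<And>x y. x \<in> ?A \<Longrightarrow> y \<in> ?A \<Longrightarrow> h (x + y) = h x + h y"
    "\<And>x y. x \<in> ?A \<Longrightarrow> y \<in> ?A \<Longrightarrow> h (x * y) = h x * h y"
    unfolding ring_hom_def by (auto simp: h_def)
  have coset: "?I +>\<^bsub>ring_on ?A\<^esub> x = {i + x | i. i \<in> ?I}" for x
    by (auto simp: a_r_coset_def r_coset_def)
  have carrier: "carrier (ring_on ?A Quot ?I) = {?I +>\<^bsub>ring_on ?A\<^esub> x | x. x \<in> ?A}"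
    by (auto simp: FactRing_def A_RCOSETS_def RCOSETS_def a_r_coset_def)
  have I0: "0 \<in> ?I" using I ideal_ring_on_iff[OF A] by blast
  have h0: "h x = 0 \<longleftrightarrow> x \<in> ?I" if x: "x \<in> ?A" for x
  proof -
    have "h 0 = h 0 + h 0" using h(2)[of 0 0] subring_setD(2)[OF A] by (simp only: add_0_right)
    then have "h 0 = 0" by (metis add.right_neutral add_left_cancel)
    then have "h x = 0 \<longleftrightarrow> h x = h 0" by simp
    also have "\<dots> \<longleftrightarrow> ?I +>\<^bsub>ring_on ?A\<^esub> x = ?I +>\<^bsub>ring_on ?A\<^esub> 0"
      unfolding h_def
      by (rule inj_on_eq_iff[OF bij_betw_imp_inj_on[OF bij]])
        (use x subring_setD(2)[OF A] carrier in blast)+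
    also have "\<dots> \<longleftrightarrow> x \<in> ?I"
    proof
      assume "?I +>\<^bsub>ring_on ?A\<^esub> x = ?I +>\<^bsub>ring_on ?A\<^esub> 0"
      then have "{i + x | i. i \<in> ?I} = ?I" unfolding coset by simp
      then show "x \<in> ?I" using I0 by force
    next
      assume xI: "x \<in> ?I"
      have "- x = (- 1) * x" by simp
      then have mx: "- x \<in> ?I" using xI I subring_setD(1,5)[OF A] ideal_ring_on_iff[OF A] by metis
      have add: "a + b \<in> ?I" if "a \<in> ?I" "b \<in> ?I" for a b
        using that I ideal_ring_on_iff[OF A] by metis
      show "?I +>\<^bsub>ring_on ?A\<^esub> x = ?I +>\<^bsub>ring_on ?A\<^esub> 0"
        unfolding coset
      proof (intro subset_antisym subsetI)
        fix z assume "z \<in> {i + 0 | i. i \<in> ?I}"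
        then have "z \<in> ?I" by simp
          then have "z + - x \<in> ?I" using mx by (rule add)
        then show "z \<in> {i + x | i. i \<in> ?I}" by (intro CollectI exI[of _ "z + - x"]) auto
      qed (use add xI in auto)
    qed
    finally show ?thesis .
  qed
  have res: "residue n p \<phi> f = h (Fract f 1)" for f by (simp add: residue_def h_def)
  have mem1: "Fract f 1 \<in> ?A" if "f \<in> pring n" for f using memA[OF that one] .
  show ?thesis
  proof (unfold_locales)
    show "residue n p \<phi> 1 = 1" using h(1) by (simp add: res One_fract_def)
    fix f g :: "'k mpoly" assume f: "f \<in> pring n" 
    show "residue n p \<phi> f = 0 \<longleftrightarrow> f \<in> p"
      unfolding res h0[OF mem1[OF f]]
    proof
      assume "Fract f 1 \<in> ?I"
      then obtain a t where t: "Fract f 1 = Fract a t" "a \<in> p" "t \<in> pring n - p"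
        by (auto simp: local_ideal_def)
      then have "f * t = a" using nz[OF t(3)] by (simp add: eq_fract)
      then show "f \<in> p" using t p(6)[of f t] f by auto
    qed (rule memI[OF _ one])
    assume g: "g \<in> pring n"
    show "residue n p \<phi> (f + g) = residue n p \<phi> f + residue n p \<phi> g"
      using h(2)[OF mem1[OF f] mem1[OF g]] by (simp add: res)
    show "residue n p \<phi> (f * g) = residue n p \<phi> f * residue n p \<phi> g"
      using h(3)[OF mem1[OF f] mem1[OF g]] by (simp add: res)
  next
    fix x :: 'f
    obtain y where y: "y \<in> ?A" "x = h y"
    proof -
      obtain X where X: "X \<in> carrier (ring_on ?A Quot ?I)" "x = \<phi> X"
        using bij_betw_imp_surj_on[OF bij] by blast
      obtain y where "y \<in> ?A" "X = ?I +>\<^bsub>ring_on ?A\<^esub> y"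
        using X(1) unfolding carrier by blast
      then show ?thesis using X(2) by (intro that[of y]) (simp_all add: h_def)
    qed
    then obtain a t where t: "y = Fract a t" "a \<in> pring n" "t \<in> pring n - p"
      by (auto simp: local_ring_def)
    have "Fract t 1 * y = Fract a 1"
      using t(1) nz[OF t(3)] by (simp add: eq_fract mult.commute)
    then have "h (Fract t 1) * h y = h (Fract a 1)"
      using h(3)[OF mem1[of t] y(1)] t(3) by simp
    then show "\<exists>a\<in>pring n. \<exists>s\<in>pring n - p. residue n p \<phi> s * x = residue n p \<phi> a"
      using t y unfolding res by blast
  qed (use assms p in auto)
qed

section \<open>Coefficients of power series\<close>

lemma mfps_nth_simps [simp]:
  "mfps_nth 0 \<alpha> = 0" "mfps_nth (f + g) \<alpha> = mfps_nth f \<alpha> + mfps_nth g \<alpha>"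
  "mfps_nth (f - g) \<alpha> = mfps_nth f \<alpha> - mfps_nth g \<alpha>" "mfps_nth (- f) \<alpha> = - mfps_nth f \<alpha>"
  "mfps_nth (mfps_const a) \<alpha> = (if \<alpha> = 0 then a else 0)"
  "mfps_nth 1 \<alpha> = (if \<alpha> = 0 then 1 else 0)"
  "mfps_nth (mfps_var i) \<alpha> = (if \<alpha> = single i 1 then 1 else 0)"
  by (simp_all add: mfps_defs mfps_const_def mfps_var_def)

lemma mfps_nth_mult: "mfps_nth (f * g) \<alpha> = (\<Sum>(\<beta>, \<gamma>)\<in>splits \<alpha>. mfps_nth f \<beta> * mfps_nth g \<gamma>)"
  by (simp add: mfps_defs)

lemma mfps_nth_sum [simp]: "mfps_nth (sum f S) \<alpha> = (\<Sum>x\<in>S. mfps_nth (f x) \<alpha>)"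
  by (induction S rule: infinite_finite_induct) auto

lemma splits_0 [simp]: "splits 0 = {(0, 0)}"
proof -
  have "\<beta> = 0 \<and> \<gamma> = 0" if "\<beta> + \<gamma> = 0" for \<beta> \<gamma> :: mindex
  proof -
    have "lookup \<beta> i = 0 \<and> lookup \<gamma> i = 0" for i
      using arg_cong[OF that, of "\<lambda>x. lookup x i"] by (simp add: lookup_add)
    then show ?thesis by (auto intro: poly_mapping_eqI)
  qed
  note * = this
  show ?thesis
  proof (intro subset_antisym subsetI)
    fix x assume "x \<in> splits 0"
    then obtain \<beta> \<gamma> :: mindex where x: "x = (\<beta>, \<gamma>)" "\<beta> + \<gamma> = 0" by (auto simp: splits_def)
    show "x \<in> {(0, 0)}" using *[OF x(2)] x(1) by simp
  qed (simp add: splits_def)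
qed

lemma keys_add_mindex: "keys (\<alpha> + \<beta> :: mindex) = keys \<alpha> \<union> keys \<beta>"
  by (auto simp: in_keys_iff lookup_add)

lemma mfps_nth_mult_0 [simp]: "mfps_nth (f * g) 0 = mfps_nth f 0 * mfps_nth g 0"
  by (simp add: mfps_nth_mult)

lemma mfps_nth_const_mult [simp]: "mfps_nth (mfps_const a * f) \<alpha> = a * mfps_nth f \<alpha>"
proof -
  have "mfps_nth (mfps_const a * f) \<alpha> = (\<Sum>x\<in>splits \<alpha>. if x = (0, \<alpha>) then a * mfps_nth f \<alpha> else 0)"
    unfolding mfps_nth_mult by (intro sum.cong) (auto simp: splits_def split: if_splits)
  also have "\<dots> = a * mfps_nth f \<alpha>"
    by (subst sum.delta) (simp_all, simp add: splits_def)
  finally show ?thesis .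
qed

lemma mfps_const_hom:
  "mfps_const (a + b) = mfps_const a + mfps_const b" "mfps_const (a * b) = mfps_const a * mfps_const b"
  "mfps_const (a - b) = mfps_const a - mfps_const b" "mfps_const (- a) = - mfps_const a"
  "mfps_const 0 = 0" "mfps_const 1 = 1"
  by (auto intro!: mfps_eqI)

definition mfps_monom :: "mindex \<Rightarrow> 'a::comm_ring_1 mfps" where
  "mfps_monom \<alpha> = Abs_mfps (\<lambda>\<beta>. if \<beta> = \<alpha> then 1 else 0)"

lemma mfps_nth_monom [simp]: "mfps_nth (mfps_monom \<alpha>) \<beta> = (if \<beta> = \<alpha> then 1 else 0)"
  by (simp add: mfps_monom_def)

lemma mfps_nth_monom_mult: "mfps_nth (mfps_monom \<alpha> * f) (\<alpha> + \<beta>) = mfps_nth f \<beta>"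
proof -
  have "mfps_nth (mfps_monom \<alpha> * f) (\<alpha> + \<beta>) = (\<Sum>x\<in>splits (\<alpha> + \<beta>). if x = (\<alpha>, \<beta>) then mfps_nth f \<beta> else 0)"
    unfolding mfps_nth_mult by (intro sum.cong) (auto simp: splits_def split: if_splits)
  also have "\<dots> = mfps_nth f \<beta>"
    by (subst sum.delta) (simp_all, simp add: splits_def)
  finally show ?thesis .
qed

lemma mfps_nth_monom_mult_0: 
  assumes "\<And>\<gamma>. \<beta> \<noteq> \<alpha> + \<gamma>" shows "mfps_nth (mfps_monom \<alpha> * f) \<beta> = 0"
  unfolding mfps_nth_mult using assms by (intro sum.neutral) (auto simp: splits_def)

lemma mfps_monom_mult: "mfps_monom \<alpha> * mfps_monom \<beta> = mfps_monom (\<alpha> + \<beta>)"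
proof (rule mfps_eqI)
  fix \<gamma>
  show "mfps_nth (mfps_monom \<alpha> * mfps_monom \<beta>) \<gamma> = mfps_nth (mfps_monom (\<alpha> + \<beta>)) \<gamma>"
  proof (cases "\<exists>\<delta>. \<gamma> = \<alpha> + \<delta>")
    case True
    then show ?thesis by (auto simp: mfps_nth_monom_mult)
  next
    case False
    then show ?thesis using mfps_nth_monom_mult_0[of \<gamma> \<alpha>] by auto
  qed
qed

lemma mfps_monom_simps: "mfps_monom 0 = 1" "mfps_monom (single i 1) = mfps_var i"
  by (auto intro: mfps_eqI)

lemma subring_psers: "subring_set (psers c)"
  unfolding subring_set_def
proof (intro conjI ballI)
  fix f g :: "'a mfps" assume fg: "f \<in> psers c" "g \<in> psers c"
  show "f + g \<in> psers c"
    unfolding psers_def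
  proof (intro CollectI allI impI)
    fix \<alpha> assume "mfps_nth (f + g) \<alpha> \<noteq> 0"
    then have "mfps_nth f \<alpha> \<noteq> 0 \<or> mfps_nth g \<alpha> \<noteq> 0" by auto
    then show "keys \<alpha> \<subseteq> {..<c}" using fg by (auto simp: psers_def)
  qed
  show "f * g \<in> psers c"
    unfolding psers_def
  proof (intro CollectI allI impI)
    fix \<alpha> assume "mfps_nth (f * g) \<alpha> \<noteq> 0"
    then obtain x where x: "x \<in> splits \<alpha>" "mfps_nth f (fst x) * mfps_nth g (snd x) \<noteq> 0"
      unfolding mfps_nth_mult case_prod_unfold by (meson sum.neutral)
    then have "mfps_nth f (fst x) \<noteq> 0" "mfps_nth g (snd x) \<noteq> 0" by auto
    then have "keys (fst x) \<subseteq> {..<c}" "keys (snd x) \<subseteq> {..<c}" using fg by (auto simp: psers_def)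
    moreover have "\<alpha> = fst x + snd x" using x(1) by (auto simp: splits_def)
    ultimately show "keys \<alpha> \<subseteq> {..<c}" by (simp add: keys_add_mindex)
  qed
qed (auto simp: psers_def)

lemmas psers_closed [simp, intro] =
  subring_setD[OF subring_psers]
  subring_set_sum[OF subring_psers] subring_set_prod[OF subring_psers] subring_set_power[OF subring_psers]

lemma psers_gens [simp, intro]:
  "mfps_const a \<in> psers c" "keys \<alpha> \<subseteq> {..<c} \<Longrightarrow> mfps_monom \<alpha> \<in> psers c"
  by (auto simp: psers_def split: if_splits)

lemma mfps_var_psers [simp, intro]: "i < c \<Longrightarrow> mfps_var i \<in> psers c"
  by (auto simp: psers_def split: if_splits)

section \<open>Taylor expansion\<close>

declare One_nat_def [simp del]

definition mfact :: "mindex \<Rightarrow> nat" where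
  "mfact \<alpha> = (\<Prod>i\<in>keys \<alpha>. fact (lookup \<alpha> i))"

lemma mfact_superset:
  assumes "finite S" "keys \<alpha> \<subseteq> S" shows "mfact \<alpha> = (\<Prod>i\<in>S. fact (lookup \<alpha> i))"
  unfolding mfact_def using assms by (intro prod.mono_neutral_left) (auto simp: in_keys_iff)

lemma mfact_0 [simp]: "mfact 0 = 1"
  by (simp add: mfact_def)

lemma mfact_pos: "mfact \<alpha> > 0"
  by (simp add: mfact_def prod_pos)

lemma mfact_plus_single: "mfact (\<alpha> + single i 1) = Suc (lookup \<alpha> i) * mfact \<alpha>"
proof -
  let ?S = "insert i (keys \<alpha>)"
  have "mfact (\<alpha> + single i 1) = (\<Prod>j\<in>?S. fact (lookup (\<alpha> + single i 1) j))"
    by (rule mfact_superset) (auto simp: keys_add_mindex)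
  also have "\<dots> = fact (Suc (lookup \<alpha> i)) * (\<Prod>j\<in>?S - {i}. fact (lookup (\<alpha> + single i 1) j))"
    by (subst prod.remove[of _ i]) (auto simp: lookup_add Suc_eq_plus1[symmetric])
  also have "(\<Prod>j\<in>?S - {i}. fact (lookup (\<alpha> + single i 1) j)) = (\<Prod>j\<in>?S - {i}. fact (lookup \<alpha> j))"
    by (intro prod.cong) (auto simp: lookup_add lookup_single when_def)
  also have "fact (Suc (lookup \<alpha> i)) * \<dots> = Suc (lookup \<alpha> i) * (\<Prod>j\<in>?S. fact (lookup \<alpha> j))"
    by (subst (2) prod.remove[of _ i]) (auto simp: algebra_simps)
  also have "(\<Prod>j\<in>?S. fact (lookup \<alpha> j)) = mfact \<alpha>"
    by (rule mfact_superset[symmetric]) auto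
  finally show ?thesis .
qed

lemma mbinom_mfact:
  assumes "\<beta> + \<gamma> = \<alpha>" shows "mbinom \<alpha> \<beta> * mfact \<beta> * mfact \<gamma> = mfact \<alpha>"
proof -
  have "mfact \<beta> = (\<Prod>i\<in>keys \<alpha>. fact (lookup \<beta> i))" "mfact \<gamma> = (\<Prod>i\<in>keys \<alpha>. fact (lookup \<gamma> i))"
    by (rule mfact_superset; use assms in \<open>auto simp: keys_add_mindex\<close>)+
  then have "mbinom \<alpha> \<beta> * mfact \<beta> * mfact \<gamma>
      = (\<Prod>i\<in>keys \<alpha>. (lookup \<alpha> i choose lookup \<beta> i) * fact (lookup \<beta> i) * fact (lookup \<gamma> i))"
    by (simp add: mbinom_def prod.distrib)
  also have "\<dots> = mfact \<alpha>"
    unfolding mfact_def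
  proof (rule prod.cong)
    fix i
    have "lookup \<alpha> i = lookup \<beta> i + lookup \<gamma> i" using assms by (auto simp: lookup_add)
    then show "(lookup \<alpha> i choose lookup \<beta> i) * fact (lookup \<beta> i) * fact (lookup \<gamma> i) = fact (lookup \<alpha> i)"
      using binomial_fact_lemma[of "lookup \<beta> i" "lookup \<alpha> i"] by (simp add: mult_ac)
  qed simp
  finally show ?thesis .
qed

lemma lookup_mpd:
  "of_nat (mfact \<gamma>) * lookup (mpd \<alpha> f) \<gamma> = of_nat (mfact (\<alpha> + \<gamma>)) * lookup f (\<alpha> + \<gamma>)"
proof (induction \<alpha> arbitrary: \<gamma> rule: mindex_induct)
  case (plus \<alpha> j)
  have "of_nat (mfact \<gamma>) * lookup (mpd (\<alpha> + single j 1) f) \<gamma>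
      = of_nat (mfact (\<gamma> + single j 1)) * lookup (mpd \<alpha> f) (\<gamma> + single j 1)"
    unfolding mpd_plus_single lookup_pd mfact_plus_single by (simp add: algebra_simps)
  also have "\<dots> = of_nat (mfact (\<alpha> + (\<gamma> + single j 1))) * lookup f (\<alpha> + (\<gamma> + single j 1))"
    by (rule plus)
  finally show ?case by (simp add: add_ac)
qed simp

lemma mpd_single: "mpd (single i 1) f = pd i f"
  using mpd_plus_single[of 0 i f] by simp

lemma pd_const: "pd i (single 0 a) = 0"
  by (simp add: pd_single)

lemma mpd_const: "\<alpha> \<noteq> 0 \<Longrightarrow> mpd \<alpha> (single 0 a) = 0"
proof (induction \<alpha> rule: mindex_induct)
  case (plus \<alpha> i)
  have "mpd (\<alpha> + single i 1) (single 0 a) = mpd \<alpha> (pd i (single 0 a))"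
    unfolding mpd_mpd mpd_single ..
  then show ?case by (simp only: pd_const mpd_zero)
qed simp

lemma single_1_neq_0 [simp]: "single i (1::nat) \<noteq> 0" "0 \<noteq> single i (1::nat)"
  by (metis lookup_single_eq lookup_zero zero_neq_one)+

lemma mindex_cases:
  assumes "\<alpha> \<noteq> 0" obtains \<beta> j where "\<alpha> = \<beta> + single j (1::nat)"
proof -
  obtain j where j: "lookup \<alpha> j \<noteq> 0" using assms by (metis poly_mapping_eqI lookup_zero)
  have "\<alpha> = (\<alpha> - single j 1) + single j 1"
    using j by (intro poly_mapping_eqI) (auto simp: lookup_add lookup_minus lookup_single when_def)
  then show ?thesis by (rule that)
qed

lemma mpd_diff: "mpd \<alpha> (f - g) = mpd \<alpha> f - mpd \<alpha> g"
proof -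
  have "mpd \<alpha> (f - g) + mpd \<alpha> g = mpd \<alpha> f" by (simp flip: mpd_add)
  then show ?thesis by (simp add: eq_diff_eq)
qed

lemma polys_of_nat [simp]: "of_nat k \<in> polys I"
  by (induction k) auto

lemma single_eq_prod: "single \<alpha> (a::'a::comm_ring_1) = single 0 a * (\<Prod>i\<in>keys \<alpha>. single (single i 1) 1 ^ lookup \<alpha> i)"
proof -
  have pow: "single (single i 1) (1::'a) ^ k = single (single i k) 1" for i k
    by (induction k) (auto simp: mult_single plus_1_eq_Suc simp flip: single_add)
  have "(\<Prod>i\<in>S. single (single i (lookup \<alpha> i)) (1::'a)) = single (\<Sum>i\<in>S. single i (lookup \<alpha> i)) 1" for S
    by (induction S rule: infinite_finite_induct) (auto simp: mult_single)
  then show ?thesis by (simp add: pow poly_mapping_sum_single mult_single)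
qed

lemma mpd_var: 
  "mpd \<alpha> (single (single i 1) (1::'a::comm_ring_1)) =
    (if \<alpha> = 0 then single (single i 1) 1 else if \<alpha> = single i 1 then 1 else 0)"
proof (cases "\<alpha> = 0")
  case False
  then obtain \<beta> j where \<alpha>: "\<alpha> = \<beta> + single j 1" using mindex_cases by metis
  have "mpd \<alpha> (single (single i 1) (1::'a)) = mpd \<beta> (pd j (single (single i 1) 1))"
    unfolding \<alpha> mpd_mpd mpd_single ..
  also have "pd j (single (single i 1) (1::'a)) = (if i = j then single 0 1 else 0)"
    by (simp add: pd_single lookup_single)
  finally have "mpd \<alpha> (single (single i 1) (1::'a)) = (if i = j \<and> \<beta> = 0 then 1 else 0)"
    using mpd_const[of \<beta> "1::'a"] by (simp split: if_splits)
  moreover have "\<alpha> = single i 1 \<longleftrightarrow> i = j \<and> \<beta> = 0"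
  proof
    assume *: "\<alpha> = single i 1"
    have "lookup \<beta> k + (1 when j = k) = (1 when i = k)" for k
      using arg_cong[OF *[unfolded \<alpha>], of "\<lambda>x. lookup x k"] by (simp add: lookup_add lookup_single)
    note k = this
    have "i = j" using k[of j] by (auto simp: when_def split: if_splits)
    then show "i = j \<and> \<beta> = 0" using \<alpha> * by simp
  qed (simp add: \<alpha>)
  ultimately show ?thesis using False by simp
qed simp

text \<open>This is \<open>\<gamma>\<close>. Defining it by its coefficients, instead of by the values at the variables, makes
  linearity and the Leibniz rule of \<open>\<partial>\<^sup>\<alpha>\<close> available at once.\<close>

definition taylor :: "('k::comm_ring_1 mpoly \<Rightarrow> 'f::field) \<Rightarrow> nat \<Rightarrow> 'k mpoly \<Rightarrow> 'f mfps" where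
  "taylor bar c f =
    Abs_mfps (\<lambda>\<alpha>. if keys \<alpha> \<subseteq> {..<c} then bar (mpd \<alpha> f) / of_nat (mfact \<alpha>) else 0)"

lemma mfps_nth_taylor [simp]:
  "mfps_nth (taylor bar c f) \<alpha> = (if keys \<alpha> \<subseteq> {..<c} then bar (mpd \<alpha> f) / of_nat (mfact \<alpha>) else 0)"
  by (simp add: taylor_def)

lemma taylor_psers [simp, intro]: "taylor bar c f \<in> psers c"
  by (auto simp: psers_def)

context residue_map
begin

lemma zero_in_p [simp]: "0 \<in> p"
proof -
  have "bar 0 = bar 0 + bar 0" using bar_add[of 0 0] by (simp only: polys_closed add_0_right)
  then have "bar 0 = 0" by (metis add.right_neutral add_left_cancel)
  then show ?thesis using bar_eq_0[of 0] by simp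
qed

lemma bar_0 [simp]: "bar 0 = 0"
  using bar_eq_0[of 0] by simp

lemma bar_p [simp]: "f \<in> p \<Longrightarrow> bar f = 0"
  using bar_eq_0 p_sub by blast

lemma bar_uminus: "f \<in> pring n \<Longrightarrow> bar (- f) = - bar f"
  using bar_add[of f "- f"] by (simp add: eq_neg_iff_add_eq_0 add.commute)

lemma bar_diff: "f \<in> pring n \<Longrightarrow> g \<in> pring n \<Longrightarrow> bar (f - g) = bar f - bar g"
  using bar_add[of f "- g"] bar_uminus[of g] by simp

lemma bar_sum: "(\<And>x. x \<in> S \<Longrightarrow> f x \<in> pring n) \<Longrightarrow> bar (sum f S) = (\<Sum>x\<in>S. bar (f x))"
  by (induction S rule: infinite_finite_induct) (auto simp: bar_add)

lemma bar_of_nat_mult: "f \<in> pring n \<Longrightarrow> bar (of_nat k * f) = of_nat k * bar f"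
  by (induction k) (auto simp: algebra_simps bar_add polys_of_nat)

lemma bar_of_nat [simp]: "bar (of_nat k) = of_nat k"
  using bar_of_nat_mult[of 1 k] by simp

text \<open>The residue field contains the ground field, so it has characteristic zero.\<close>

lemma of_nat_residue_neq_0: "k > 0 \<Longrightarrow> (of_nat k :: 'f) \<noteq> 0"
proof
  assume k: "k > 0" and 0: "(of_nat k :: 'f) = 0"
  have "of_nat k * single 0 (1 / of_nat k) = (1 :: 'k mpoly)"
    using k by (simp add: mult_single flip: single_of_nat)
  then have "1 = of_nat k * bar (single 0 (1 / of_nat k))"
    using bar_of_nat_mult[of "single 0 (1 / of_nat k)" k] by simp
  then show False using 0 by simp
qed

lemma of_nat_mfact_neq_0 [simp]: "(of_nat (mfact \<alpha>) :: 'f) \<noteq> 0"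
  by (rule of_nat_residue_neq_0[OF mfact_pos])

lemma p_absorb: "a \<in> pring n \<Longrightarrow> x \<in> p \<Longrightarrow> a * x \<in> p" "a \<in> pring n \<Longrightarrow> x \<in> p \<Longrightarrow> x * a \<in> p"
  using bar_eq_0[of "a * x"] bar_mult[of a x] p_sub by (auto simp: mult.commute)

lemma p_add: "x \<in> p \<Longrightarrow> y \<in> p \<Longrightarrow> x + y \<in> p"
  using bar_eq_0[of "x + y"] bar_add[of x y] p_sub by auto

lemma p_diff: "x \<in> p \<Longrightarrow> y \<in> p \<Longrightarrow> x - y \<in> p"
  using bar_eq_0[of "x - y"] bar_diff[of x y] p_sub by auto

lemma p_prime: "a \<in> pring n \<Longrightarrow> b \<in> pring n \<Longrightarrow> a * b \<in> p \<Longrightarrow> a \<in> p \<or> b \<in> p"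
  using bar_eq_0[of "a * b"] bar_eq_0[of a] bar_eq_0[of b] bar_mult[of a b] by auto

lemma one_notin_p [simp]: "1 \<notin> p"
  using bar_eq_0[of 1] by auto

abbreviation tay :: "'k mpoly \<Rightarrow> 'f mfps" where "tay \<equiv> taylor bar c"

lemma tay_add: "f \<in> pring n \<Longrightarrow> g \<in> pring n \<Longrightarrow> tay (f + g) = tay f + tay g"
  by (intro mfps_eqI) (auto simp: mpd_add bar_add mpd_polys add_divide_distrib)

lemma tay_0 [simp]: "tay 0 = 0"
  by (intro mfps_eqI) simp

lemma tay_sum: "(\<And>x. x \<in> S \<Longrightarrow> f x \<in> pring n) \<Longrightarrow> tay (sum f S) = (\<Sum>x\<in>S. tay (f x))"
  by (induction S rule: infinite_finite_induct) (auto simp: tay_add)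

text \<open>The Leibniz rule, divided by the factorial of the multi-index, is the product of power series.\<close>

lemma tay_mult: 
  assumes fg: "f \<in> pring n" "g \<in> pring n" shows "tay (f * g) = tay f * tay g"
proof (rule mfps_eqI)
  fix \<alpha> :: mindex
  show "mfps_nth (tay (f * g)) \<alpha> = mfps_nth (tay f * tay g) \<alpha>"
  proof (cases "keys \<alpha> \<subseteq> {..<c}")
    case True
    have "mfps_nth (tay (f * g)) \<alpha> = (\<Sum>(\<beta>, \<gamma>)\<in>splits \<alpha>.
        of_nat (mbinom \<alpha> \<beta>) * bar (mpd \<beta> f) * bar (mpd \<gamma> g) / of_nat (mfact \<alpha>))"
      using True fg
      by (simp add: mpd_mult case_prod_unfold sum_divide_distrib mult.assoc bar_sum bar_mult bar_of_nat mpd_polys)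
    also have "\<dots> = mfps_nth (tay f * tay g) \<alpha>"
      unfolding mfps_nth_mult
    proof (intro sum.cong refl, clarify)
      fix \<beta> \<gamma> assume "(\<beta>, \<gamma>) \<in> splits \<alpha>"
      then have s: "\<beta> + \<gamma> = \<alpha>" by (simp add: splits_def)
      then have "keys \<beta> \<subseteq> {..<c}" "keys \<gamma> \<subseteq> {..<c}" using True by (auto simp: keys_add_mindex)
      moreover have "(of_nat (mfact \<alpha>) :: 'f) = of_nat (mbinom \<alpha> \<beta>) * of_nat (mfact \<beta>) * of_nat (mfact \<gamma>)"
        unfolding mbinom_mfact[OF s, symmetric] by simp
      moreover have "(of_nat (mbinom \<alpha> \<beta>) :: 'f) \<noteq> 0"
        using of_nat_mfact_neq_0[of \<alpha>] calculation(3) by auto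
      ultimately show "of_nat (mbinom \<alpha> \<beta>) * bar (mpd \<beta> f) * bar (mpd \<gamma> g) / of_nat (mfact \<alpha>) =
          mfps_nth (tay f) \<beta> * mfps_nth (tay g) \<gamma>" by simp
    qed
    finally show ?thesis .
  next
    case False
    have "tay f * tay g \<in> psers c" by simp
    then have "mfps_nth (tay f * tay g) \<alpha> = 0" using False unfolding psers_def by blast
    then show ?thesis using False by simp
  qed
qed

lemma tay_const: "tay (single 0 a) = mfps_const (bar (single 0 a))"
  by (intro mfps_eqI) (auto simp: mpd_const)

lemma tay_1 [simp]: "tay 1 = 1"
  using tay_const[of 1] by (simp add: mfps_const_hom)

lemma tay_var: "tay (single (single i 1) 1) = (if i < c then mfps_var i else 0) + mfps_const (bar (single (single i 1) 1))"
  by (intro mfps_eqI) (auto simp: mpd_var mfact_def)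

lemma tay_power: "f \<in> pring n \<Longrightarrow> tay (f ^ k) = tay f ^ k"
  by (induction k) (auto simp: tay_mult)

lemma tay_prod: "(\<And>x. x \<in> S \<Longrightarrow> f x \<in> pring n) \<Longrightarrow> tay (prod f S) = (\<Prod>x\<in>S. tay (f x))"
  by (induction S rule: infinite_finite_induct) (auto simp: tay_mult)

lemma tay_diff: "f \<in> pring n \<Longrightarrow> g \<in> pring n \<Longrightarrow> tay (f - g) = tay f - tay g"
  by (intro mfps_eqI) (auto simp: mpd_diff bar_diff mpd_polys diff_divide_distrib)

lemma tay_nth_0 [simp]: "mfps_nth (tay f) 0 = bar f"
  by simp

text \<open>Taylor expansion is a ring homomorphism, so it is the substitution that its values at constants and
  variables prescribe.\<close>

lemma gamma_map_eq_taylor: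
  assumes f: "f \<in> pring n" shows "gamma_map bar c f = tay f"
proof -
  have "tay f = tay (\<Sum>\<alpha>\<in>keys f. single 0 (lookup f \<alpha>) * (\<Prod>i\<in>keys \<alpha>. single (single i 1) 1 ^ lookup \<alpha> i))"
    by (simp only: single_eq_prod[symmetric] poly_mapping_sum_single)
  also have "\<dots> = (\<Sum>\<alpha>\<in>keys f. tay (single 0 (lookup f \<alpha>) * (\<Prod>i\<in>keys \<alpha>. single (single i 1) 1 ^ lookup \<alpha> i)))"
    using f by (intro tay_sum polys_closed) (auto simp: polys_def)
  also have "\<dots> = gamma_map bar c f"
    unfolding gamma_map_def
  proof (intro sum.cong refl)
    fix \<alpha> assume "\<alpha> \<in> keys f"
    then have k: "single (single i 1) (1::'k) \<in> pring n" if "i \<in> keys \<alpha>" for i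
      using f that by (auto simp: polys_def)
    then have "tay (single 0 (lookup f \<alpha>) * (\<Prod>i\<in>keys \<alpha>. single (single i 1) 1 ^ lookup \<alpha> i)) =
      tay (single 0 (lookup f \<alpha>)) * (\<Prod>i\<in>keys \<alpha>. tay (single (single i 1) 1) ^ lookup \<alpha> i)"
      by (subst tay_mult, simp, (intro polys_closed; simp), subst tay_prod)
        (auto intro!: prod.cong simp: tay_power)
    then show "tay (single 0 (lookup f \<alpha>) * (\<Prod>i\<in>keys \<alpha>. single (single i 1) 1 ^ lookup \<alpha> i)) =
      mfps_const (bar (single 0 (lookup f \<alpha>))) * (\<Prod>i\<in>keys \<alpha>. ((if i < c then mfps_var i else 0) +
        mfps_const (bar (single (single i 1) 1))) ^ lookup \<alpha> i)"
      unfolding tay_var tay_const .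
  qed
  finally show ?thesis ..
qed

end

section \<open>A triangular system of local generators\<close>

abbreviation X :: "nat \<Rightarrow> 'a::comm_ring_1 mpoly" where
  "X i \<equiv> single (single i 1) 1"

lemma X_power: "X i ^ k = single (single i k) 1"
  by (induction k) (auto simp: mult_single plus_1_eq_Suc simp flip: single_add)

lemma coefficients_in_variable:
  fixes f :: "'a::comm_ring_1 mpoly"
  assumes f: "f \<in> polys (insert i I)" and i: "i \<notin> I"
  obtains d a where "\<forall>k. a k \<in> polys I" "f = (\<Sum>k\<le>d. a k * X i ^ k)"
proof -
  define strip where "strip \<alpha> = \<alpha> - single i (lookup \<alpha> i)" for \<alpha> :: mindex
  define a where "a k = (\<Sum>\<alpha> | \<alpha> \<in> keys f \<and> lookup \<alpha> i = k. single (strip \<alpha>) (lookup f \<alpha>))" for k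
  define d where "d = (\<Sum>\<alpha>\<in>keys f. lookup \<alpha> i)"
  have strip_keys: "keys (strip \<alpha>) = keys \<alpha> - {i}" for \<alpha>
    by (auto simp: strip_def in_keys_iff lookup_minus lookup_single when_def split: if_splits)
  have strip_plus: "strip \<alpha> + single i (lookup \<alpha> i) = \<alpha>" for \<alpha>
    by (intro poly_mapping_eqI) (auto simp: strip_def lookup_add lookup_minus lookup_single when_def)
  have le: "lookup \<alpha> i \<le> d" if "\<alpha> \<in> keys f" for \<alpha>
    unfolding d_def using that by (intro member_le_sum) auto
  have "(\<Sum>k\<le>d. a k * X i ^ k) = (\<Sum>k\<le>d. \<Sum>\<alpha> | \<alpha> \<in> keys f \<and> lookup \<alpha> i = k. single \<alpha> (lookup f \<alpha>))"
    by (auto simp: a_def X_power sum_distrib_right mult_single strip_plus intro!: sum.cong)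
  also have "\<dots> = (\<Sum>\<alpha>\<in>keys f. single \<alpha> (lookup f \<alpha>))"
    using le by (intro sum.group) auto
  finally have "f = (\<Sum>k\<le>d. a k * X i ^ k)" by (simp add: poly_mapping_sum_single)
  moreover have "a k \<in> polys I" for k
    unfolding a_def using f by (intro polys_closed) (fastforce simp: polys_def strip_keys split: if_splits)
  ultimately show ?thesis using that by blast
qed

lemma pd_X_power: "pd i (X i ^ k) = of_nat k * X i ^ (k - 1)"
proof (cases k)
  case (Suc j)
  have "single i k - single i 1 = single i j"
    using Suc by (intro poly_mapping_eqI) (simp add: lookup_minus lookup_single when_def)
  then show ?thesis
    unfolding X_power pd_single using Suc by (simp add: mult_single flip: single_of_nat)
qed (simp add: pd_const[of i 1, simplified])

context residue_map
begin

definition vars_upto :: "nat \<Rightarrow> nat set" where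
  "vars_upto i = {..<i} \<union> {c..<n}"

definition gspan :: "(nat \<Rightarrow> 'k mpoly) \<Rightarrow> nat \<Rightarrow> 'k mpoly set" where
  "gspan g i = {\<Sum>j<i. h j * g j | h. \<forall>j. h j \<in> pring n}"

lemma gspan_add: assumes "x \<in> gspan g i" "y \<in> gspan g i" shows "x + y \<in> gspan g i"
proof -
  obtain h h' where "\<forall>j. h j \<in> pring n" "x = (\<Sum>j<i. h j * g j)" "\<forall>j. h' j \<in> pring n" "y = (\<Sum>j<i. h' j * g j)"
    using assms by (auto simp: gspan_def)
  then show ?thesis unfolding gspan_def
    by (intro CollectI exI[of _ "\<lambda>j. h j + h' j"]) (auto simp: algebra_simps sum.distrib)
qed

lemma gspan_mult: assumes "a \<in> pring n" "x \<in> gspan g i" shows "a * x \<in> gspan g i"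
proof -
  obtain h where "\<forall>j. h j \<in> pring n" "x = (\<Sum>j<i. h j * g j)" using assms by (auto simp: gspan_def)
  then show ?thesis unfolding gspan_def using assms(1)
    by (intro CollectI exI[of _ "\<lambda>j. a * h j"]) (auto simp: sum_distrib_left mult.assoc)
qed

lemma gspan_gen: assumes "k < i" shows "g k \<in> gspan g i"
proof -
  have "g k = (\<Sum>j<i. (if j = k then 1 else 0) * g j)"
    using assms by (simp add: if_distrib[of "\<lambda>x. x * _"] cong: if_cong)
  then show ?thesis unfolding gspan_def 
    by (intro CollectI exI[of _ "\<lambda>j. if j = k then 1 else 0"]) auto
qed

lemma gspan_Suc:
  assumes "x \<in> gspan g i" "\<And>j. j < i \<Longrightarrow> g' j = g j" shows "x \<in> gspan g' (Suc i)"
proof -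
  obtain h where "\<forall>j. h j \<in> pring n" "x = (\<Sum>j<i. h j * g j)" using assms(1) by (auto simp: gspan_def)
  then show ?thesis unfolding gspan_def using assms(2)
    by (intro CollectI exI[of _ "\<lambda>j. if j < i then h j else 0"]) auto
qed

text \<open>Maximality of the basis: modulo \<open>\<pp>\<close>, each \<open>x\<^sub>i\<close> is algebraic over the variables of the basis.\<close>

lemma algebraic_relation:
  assumes "i < c"
  obtains f where "f \<in> p" "f \<noteq> 0" "f \<in> polys (insert i {c..<n})"
proof -
  have "i \<notin> {c..<n}" "insert i {c..<n} \<subseteq> {..<n}" using assms c_le by auto
  then have "{c..<n} \<subset> insert i {c..<n}" "insert i {c..<n} \<subseteq> {..<n}" by blast+
  then have "polys (insert i {c..<n}) \<inter> p \<noteq> {0}"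
    using basis by (auto simp: basis_modulo_def indep_modulo_def)
  moreover have "0 \<in> polys (insert i {c..<n}) \<inter> p" by simp
  ultimately show ?thesis using that by blast
qed

lemma p_inter_basis: "f \<in> p \<Longrightarrow> f \<in> polys {c..<n} \<Longrightarrow> f = 0"
  using basis by (auto simp: basis_modulo_def indep_modulo_def)

text \<open>Let \<open>G\<close> have the least possible degree \<open>d\<close> in \<open>x\<^sub>i\<close> among the elements of \<open>\<pp>\<close> whose leading
  coefficient is not in \<open>\<pp>\<close>. An element of \<open>\<pp>\<close> is reduced one power of \<open>x\<^sub>i\<close> at a time: if its
  leading coefficient is in \<open>\<pp>\<close>, that coefficient is handled by the preceding generators, and
  otherwise the degree is at least \<open>d\<close> and a multiple of \<open>G\<close> can be subtracted.\<close>

lemma triangular_step: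
  assumes i: "i < c"
    and g: "\<And>f. f \<in> p \<Longrightarrow> f \<in> polys (vars_upto i) \<Longrightarrow> \<exists>s\<in>pring n - p. s * f \<in> gspan g i"
  obtains G where "G \<in> p" "G \<in> polys (vars_upto (Suc i))" "pd i G \<notin> p"
    "\<And>f. f \<in> p \<Longrightarrow> f \<in> polys (vars_upto (Suc i)) \<Longrightarrow> \<exists>s\<in>pring n - p. s * f \<in> gspan (g(i := G)) (Suc i)"
proof -
  let ?A = "polys (vars_upto i) :: 'k mpoly set"
  let ?P = "\<lambda>d b. (\<forall>k\<le>d. b k \<in> ?A) \<and> b d \<notin> p \<and> (\<Sum>k\<le>d. b k * X i ^ k) \<in> p"
  have ins: "vars_upto (Suc i) = insert i (vars_upto i)" and i_notin: "i \<notin> vars_upto i"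
    using i by (auto simp: vars_upto_def)
  have "vars_upto i \<subseteq> {..<n}" "i < n" using i c_le by (auto simp: vars_upto_def)
  have A: "?A \<subseteq> pring n" by (rule polys_mono) fact
  have Xi: "X i \<in> (pring n :: 'k mpoly set)" by (rule single_polys) (use \<open>i < n\<close> in simp)
  have "\<exists>d b. ?P d b"
  proof -
    obtain f where f: "f \<in> p" "f \<noteq> 0" "f \<in> polys (insert i {c..<n})"
      using algebraic_relation[OF i] by blast
    have "i \<notin> {c..<n}" using i by simp
    with f(3) obtain d a where a: "\<forall>k. a k \<in> polys {c..<n}" "f = (\<Sum>k\<le>d. a k * X i ^ k)"
      by (rule coefficients_in_variable)
    define e where "e = Max {k. k \<le> d \<and> a k \<noteq> 0}"
    have "{k. k \<le> d \<and> a k \<noteq> 0} \<noteq> {}" using f(2) a(2) by (auto intro: sum.neutral)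
    then have "e \<in> {k. k \<le> d \<and> a k \<noteq> 0}" unfolding e_def by (intro Max_in) auto
    then have e: "e \<le> d" "a e \<noteq> 0" by auto
    have max: "a k = 0" if "k \<le> d" "k > e" for k
    proof (rule ccontr)
      assume "a k \<noteq> 0"
      then have "k \<le> e" unfolding e_def using that by (intro Max_ge) auto
      then show False using that by simp
    qed
    have "f = (\<Sum>k\<le>e. a k * X i ^ k)"
      unfolding a(2) using max e(1) by (intro sum.mono_neutral_right) auto
    moreover have "polys {c..<n} \<subseteq> ?A" by (rule polys_mono) (auto simp: vars_upto_def)
    ultimately have "?P e a" using f a(1) p_inter_basis[of "a e"] e by auto
    then show ?thesis by blast
  qed
  define d where "d = (LEAST d. \<exists>b. ?P d b)"
  have "\<exists>b. ?P d b" unfolding d_def by (rule LeastI_ex) fact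
  then obtain b where b: "\<And>k. k \<le> d \<Longrightarrow> b k \<in> ?A" "b d \<notin> p" "(\<Sum>k\<le>d. b k * X i ^ k) \<in> p" by blast
  have minimal: "d \<le> e" if "?P e b'" for e b'
    unfolding d_def using that by (intro Least_le) blast
  define G where "G = (\<Sum>k\<le>d. b k * X i ^ k)"
  have G: "G \<in> p" using b(3) by (simp add: G_def)
  have A': "?A \<subseteq> polys (vars_upto (Suc i))" unfolding ins by (rule polys_mono) auto
  have "X i \<in> (polys (vars_upto (Suc i)) :: 'k mpoly set)" unfolding ins by (intro single_polys) auto
  then have GA: "G \<in> polys (vars_upto (Suc i))" unfolding G_def using b(1) A' by (intro polys_closed) auto
  have Gn: "G \<in> pring n" using G p_sub by blast
  obtain d' where d': "d = Suc d'"
  proof (cases d)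
    case 0
    then show ?thesis using b by simp
  qed
  \<comment> \<open>characteristic zero: the derivative has the same leading coefficient up to the factor \<open>d\<close>\<close>
  have pdG: "pd i G \<notin> p"
  proof
    assume *: "pd i G \<in> p"
    have "pd i (b k) = 0" if "k \<le> d" for k using pd_polys_eq_0[OF b(1)[OF that] i_notin] .
    then have "pd i G = (\<Sum>k\<le>d. b k * (of_nat k * X i ^ (k - 1)))"
      unfolding G_def pd_sum pd_mult pd_X_power by (intro sum.cong) auto
    also have "\<dots> = (\<Sum>k\<le>d'. (of_nat (Suc k) * b (Suc k)) * X i ^ k)"
      unfolding d' sum.atMost_Suc_shift by (simp add: mult_ac)
    finally have "(\<Sum>k\<le>d'. (of_nat (Suc k) * b (Suc k)) * X i ^ k) \<in> p" using * by simp
    moreover have "of_nat (Suc d') * b (Suc d') \<notin> p"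
    proof -
      have bn: "b d \<in> pring n" using b(1)[of d] A by auto
      then have "bar (of_nat d * b d) \<noteq> 0" using bar_eq_0[OF bn] b(2) of_nat_residue_neq_0[of d] d'
        by (simp add: bar_of_nat_mult del: of_nat_Suc)
      then show ?thesis using d' by auto
    qed
    moreover have "of_nat (Suc k) * b (Suc k) \<in> ?A" if "k \<le> d'" for k
      using b(1)[of "Suc k"] that d' by (intro subring_setD(4)[OF subring_polys] polys_of_nat) simp
    ultimately have "d \<le> d'" by (intro minimal[of d' "\<lambda>k. of_nat (Suc k) * b (Suc k)"]) blast
    then show False using d' by simp
  qed
  define g' where "g' = g(i := G)"
  have g': "g' i = G" "\<And>j. j < i \<Longrightarrow> g' j = g j" by (auto simp: g'_def)
  have red: "\<exists>s\<in>pring n - p. s * (\<Sum>k<e. a k * X i ^ k) \<in> gspan g' (Suc i)"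
    if "\<And>k. k < e \<Longrightarrow> a k \<in> ?A" "(\<Sum>k<e. a k * X i ^ k) \<in> p" for e a
    using that
  proof (induction e arbitrary: a)
    case 0
    have "(0::'k mpoly) * g' i \<in> gspan g' (Suc i)" using gspan_gen[of i "Suc i" g'] by (intro gspan_mult) auto
    then show ?case by (intro bexI[of _ 1]) auto
  next
    case (Suc e)
    let ?f = "\<Sum>k<Suc e. a k * X i ^ k"
    have qn: "a e \<in> pring n" using Suc.prems(1) A by auto
    show ?case
    proof (cases "a e \<in> p")
      case True
      then obtain s where s: "s \<in> pring n - p" "s * a e \<in> gspan g i" using g Suc.prems(1) by blast
      have "(\<Sum>k<e. a k * X i ^ k) = ?f - a e * X i ^ e" by simp
      also have "\<dots> \<in> p" by (intro p_diff p_absorb Suc.prems True polys_closed Xi)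
      finally obtain s' where s': "s' \<in> pring n - p" "s' * (\<Sum>k<e. a k * X i ^ k) \<in> gspan g' (Suc i)"
        using Suc.IH[of a] Suc.prems by auto
      have sa: "s * a e \<in> gspan g' (Suc i)" using s(2) by (rule gspan_Suc) (rule g')
      then have "(s' * X i ^ e) * (s * a e) \<in> gspan g' (Suc i)"
        using s' Xi by (intro gspan_mult[OF _ sa]) auto
      moreover have "s * (s' * (\<Sum>k<e. a k * X i ^ k)) \<in> gspan g' (Suc i)"
        using s s' by (intro gspan_mult[OF _ s'(2)]) auto
      ultimately have "s * (s' * (\<Sum>k<e. a k * X i ^ k)) + (s' * X i ^ e) * (s * a e) \<in> gspan g' (Suc i)"
        by (rule gspan_add[rotated])
      also have "s * (s' * (\<Sum>k<e. a k * X i ^ k)) + (s' * X i ^ e) * (s * a e) = (s * s') * ?f"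
        by (simp add: algebra_simps)
      finally show ?thesis using s s' p_prime by (intro bexI[of _ "s * s'"]) auto
    next
      case False
      have "d \<le> e"
        using Suc.prems False by (intro minimal[of e a]) (auto simp: lessThan_Suc_atMost)
      define l where "l = b d"
      have l: "l \<in> ?A" "l \<in> pring n" "l \<notin> p" using b A by (auto simp: l_def)
      \<comment> \<open>the coefficients of \<open>l f - a\<^sub>e x\<^sub>i\<^sup>e\<^sup>-\<^sup>d G\<close>, in which the leading terms cancel\<close>
      define a' where "a' k = l * a k - (if e - d \<le> k then a e * b (k - (e - d)) else 0)" for k
      have a': "a' k \<in> ?A" if "k < Suc e" for k
        using that b(1) Suc.prems(1) l(1) \<open>d \<le> e\<close> by (auto simp: a'_def intro!: polys_closed)
      have shift: "X i ^ (e - d) * G = (\<Sum>k<Suc e. (if e - d \<le> k then b (k - (e - d)) else 0) * X i ^ k)"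
      proof -
        have "X i ^ (e - d) * G = (\<Sum>k\<le>d. b k * X i ^ (k + (e - d)))"
          by (simp add: G_def sum_distrib_left power_add mult_ac)
        also have "\<dots> = (\<Sum>k\<in>{e-d..e}. b (k - (e - d)) * X i ^ k)"
          using \<open>d \<le> e\<close> by (intro sum.reindex_bij_witness[of _ "\<lambda>k. k - (e - d)" "\<lambda>k. k + (e - d)"]) auto
        also have "\<dots> = (\<Sum>k<Suc e. (if e - d \<le> k then b (k - (e - d)) else 0) * X i ^ k)"
          by (intro sum.mono_neutral_cong_left) auto
        finally show ?thesis .
      qed
      have eq: "l * ?f - a e * (X i ^ (e - d) * G) = (\<Sum>k<Suc e. a' k * X i ^ k)"
        unfolding shift a'_def sum_distrib_left sum_subtractf[symmetric] by (intro sum.cong) (auto simp: algebra_simps)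
      have "a' e = 0" using \<open>d \<le> e\<close> by (simp add: a'_def l_def mult.commute)
      then have eq': "l * ?f - a e * (X i ^ (e - d) * G) = (\<Sum>k<e. a' k * X i ^ k)" using eq by simp
      have "l * ?f - a e * (X i ^ (e - d) * G) \<in> p"
        by (intro p_diff p_absorb(1) Suc.prems l G polys_closed Xi qn)
      then obtain s where s: "s \<in> pring n - p" "s * (\<Sum>k<e. a' k * X i ^ k) \<in> gspan g' (Suc i)"
        using Suc.IH[of a'] a' unfolding eq' by auto
      have "(s * a e * X i ^ (e - d)) * g' i \<in> gspan g' (Suc i)"
        using s qn Xi by (intro gspan_mult gspan_gen polys_closed) auto
      then have "s * (\<Sum>k<e. a' k * X i ^ k) + (s * a e * X i ^ (e - d)) * G \<in> gspan g' (Suc i)"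
        using s(2) unfolding g' by (intro gspan_add)
      also have "s * (\<Sum>k<e. a' k * X i ^ k) + (s * a e * X i ^ (e - d)) * G = (s * l) * ?f"
        unfolding eq'[symmetric] by (simp add: algebra_simps)
      finally show ?thesis using s l p_prime by (intro bexI[of _ "s * l"]) auto
    qed
  qed
  have "\<exists>s\<in>pring n - p. s * f \<in> gspan g' (Suc i)" if f: "f \<in> p" "f \<in> polys (vars_upto (Suc i))" for f
  proof -
    obtain e a where a: "\<forall>k. a k \<in> ?A" "f = (\<Sum>k\<le>e. a k * X i ^ k)"
      using f(2)[unfolded ins] i_notin by (rule coefficients_in_variable)
    then show ?thesis using red[of "Suc e" a] f(1) by (simp add: lessThan_Suc_atMost)
  qed
  then show ?thesis using that G GA pdG unfolding g'_def by blast
qed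

text \<open>The induction starts because \<open>\<pp>\<close> contains no nonzero polynomial in the variables of the basis.\<close>

theorem triangular_generators:
  obtains g where "\<And>i. i < c \<Longrightarrow> g i \<in> p" "\<And>i. i < c \<Longrightarrow> g i \<in> polys (vars_upto (Suc i))" 
    "\<And>i. i < c \<Longrightarrow> pd i (g i) \<notin> p"
    "\<And>f. f \<in> p \<Longrightarrow> \<exists>s\<in>pring n - p. \<exists>h. (\<forall>i. h i \<in> pring n) \<and> s * f = (\<Sum>i<c. h i * g i)"
proof -
  have "\<exists>g. (\<forall>j<i. g j \<in> p \<and> g j \<in> polys (vars_upto (Suc j)) \<and> pd j (g j) \<notin> p) \<and>
    (\<forall>f\<in>p. f \<in> polys (vars_upto i) \<longrightarrow> (\<exists>s\<in>pring n - p. s * f \<in> gspan g i))" if "i \<le> c" for i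
    using that
  proof (induction i)
    case 0
    have "1 * f \<in> gspan g 0" if "f \<in> p" "f \<in> polys (vars_upto 0)" for f g
      using p_inter_basis[of f] that by (auto simp: vars_upto_def gspan_def intro: exI[of _ "\<lambda>_. 0"])
    then show ?case by (intro exI[of _ "\<lambda>_. 0"]) (auto intro!: bexI[of _ 1])
  next
    case (Suc i)
    then obtain g where g: "\<forall>j<i. g j \<in> p \<and> g j \<in> polys (vars_upto (Suc j)) \<and> pd j (g j) \<notin> p"
      "\<And>f. f \<in> p \<Longrightarrow> f \<in> polys (vars_upto i) \<Longrightarrow> \<exists>s\<in>pring n - p. s * f \<in> gspan g i" by auto
    have "i < c" using Suc.prems by simp
    then obtain G where "G \<in> p" "G \<in> polys (vars_upto (Suc i))" "pd i G \<notin> p"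
      "\<And>f. f \<in> p \<Longrightarrow> f \<in> polys (vars_upto (Suc i)) \<Longrightarrow> \<exists>s\<in>pring n - p. s * f \<in> gspan (g(i := G)) (Suc i)"
      using triangular_step[OF _ g(2)] by metis
    then show ?case using g(1) by (intro exI[of _ "g(i := G)"] conjI) (simp add: less_Suc_eq, blast)
  qed
  from this[of c] obtain g where g: "\<And>i. i < c \<Longrightarrow> g i \<in> p" "\<And>i. i < c \<Longrightarrow> g i \<in> polys (vars_upto (Suc i))" 
    "\<And>i. i < c \<Longrightarrow> pd i (g i) \<notin> p"
    "\<And>f. f \<in> p \<Longrightarrow> f \<in> polys (vars_upto c) \<Longrightarrow> \<exists>s\<in>pring n - p. s * f \<in> gspan g c" by auto
  have "vars_upto c = {..<n}" using c_le by (auto simp: vars_upto_def)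
  then have "\<exists>s\<in>pring n - p. \<exists>h. (\<forall>i. h i \<in> pring n) \<and> s * f = (\<Sum>i<c. h i * g i)" if "f \<in> p" for f
    using g(4)[of f] p_sub that unfolding gspan_def by auto
  then show ?thesis using that g(1-3) by blast
qed

end

section \<open>The weight filtration\<close>

text \<open>The weights \<open>2c, 2c - 1, \<dots>, c + 1\<close> decrease along the variables, and they lie so close together that
  a product of two variables is heavier than each single variable.\<close>

definition wt :: "nat \<Rightarrow> mindex \<Rightarrow> nat" where
  "wt c \<alpha> = (\<Sum>i<c. (2 * c - i) * lookup \<alpha> i)"

lemma wt_0 [simp]: "wt c 0 = 0"
  by (simp add: wt_def)

lemma wt_add: "wt c (\<alpha> + \<beta>) = wt c \<alpha> + wt c \<beta>"
  by (simp add: wt_def lookup_add distrib_left sum.distrib)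

lemma wt_single: "i < c \<Longrightarrow> wt c (single i 1) = 2 * c - i"
  by (simp add: wt_def lookup_single when_def if_distrib[of "\<lambda>x. _ * x"] cong: if_cong)

lemma wt_eq_0:
  assumes "keys \<alpha> \<subseteq> {..<c}" "wt c \<alpha> = 0" shows "\<alpha> = 0"
proof (intro poly_mapping_eqI)
  fix i
  show "lookup \<alpha> i = lookup 0 i"
    using assms by (cases "i < c") (auto simp: wt_def in_keys_iff subset_iff)
qed

lemma wt_le_degree: "wt c \<alpha> \<le> 2 * c * (\<Sum>i<c. lookup \<alpha> i)"
  unfolding wt_def sum_distrib_left by (intro sum_mono mult_right_mono) auto

lemma finite_wt_eq: "finite {\<alpha>. keys \<alpha> \<subseteq> {..<c} \<and> wt c \<alpha> = t}"
proof (rule finite_subset[OF _ finite_mindex_le[of "\<Sum>i<c. single i t"]], clarify)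
  fix \<alpha> :: mindex and i assume \<alpha>: "keys \<alpha> \<subseteq> {..<c}"
  show "lookup \<alpha> i \<le> lookup (\<Sum>i<c. single i (wt c \<alpha>)) i"
  proof (cases "i < c")
    case True
    have "lookup \<alpha> i \<le> (2 * c - i) * lookup \<alpha> i"
      using mult_le_mono1[of 1 "2 * c - i" "lookup \<alpha> i"] True by linarith
    also have "\<dots> \<le> wt c \<alpha>" unfolding wt_def using True by (intro member_le_sum) auto
    finally show ?thesis using True by (simp add: lookup_sum lookup_single when_def)
  next
    case False
    then have "lookup \<alpha> i = 0" using \<alpha> by (auto simp: in_keys_iff)
    then show ?thesis by simp
  qed
qed

definition wfilt :: "nat \<Rightarrow> nat \<Rightarrow> 'a::comm_ring_1 mfps set" where
  "wfilt c t = {f \<in> psers c. \<forall>\<alpha>. mfps_nth f \<alpha> \<noteq> 0 \<longrightarrow> t \<le> wt c \<alpha>}"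

lemma wfilt_psers: "f \<in> wfilt c t \<Longrightarrow> f \<in> psers c"
  by (simp add: wfilt_def)

lemma wfilt_nth_0: "f \<in> wfilt c t \<Longrightarrow> wt c \<alpha> < t \<Longrightarrow> mfps_nth f \<alpha> = 0"
  by (auto simp: wfilt_def)

lemma wfilt_zero [simp]: "0 \<in> wfilt c t"
  by (simp add: wfilt_def)

lemma wfilt_0: "wfilt c 0 = psers c"
  by (simp add: wfilt_def)

lemma wfilt_mono: "s \<le> t \<Longrightarrow> f \<in> wfilt c t \<Longrightarrow> f \<in> wfilt c s"
  by (auto simp: wfilt_def intro: order_trans)

lemma wfilt_add: "f \<in> wfilt c t \<Longrightarrow> g \<in> wfilt c t \<Longrightarrow> f + g \<in> wfilt c t"
  by (auto simp: wfilt_def) (metis add.left_neutral)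

lemma wfilt_uminus: "f \<in> wfilt c t \<Longrightarrow> - f \<in> wfilt c t"
  by (auto simp: wfilt_def)

lemma wfilt_diff: "f \<in> wfilt c t \<Longrightarrow> g \<in> wfilt c t \<Longrightarrow> f - g \<in> wfilt c t"
  using wfilt_add[of f c t "- g"] wfilt_uminus[of g c t] by simp

lemma wfilt_sum: "(\<And>x. x \<in> S \<Longrightarrow> f x \<in> wfilt c t) \<Longrightarrow> sum f S \<in> wfilt c t"
  by (induction S rule: infinite_finite_induct) (auto intro: wfilt_add)

lemma wfilt_mult:
  assumes f: "f \<in> wfilt c s" and g: "g \<in> wfilt c t" shows "f * g \<in> wfilt c (s + t)"
  unfolding wfilt_def
proof (intro CollectI conjI allI impI)
  show "f * g \<in> psers c" using f g by (simp add: wfilt_psers)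
  fix \<alpha> assume "mfps_nth (f * g) \<alpha> \<noteq> 0"
  then obtain x where x: "x \<in> splits \<alpha>" "mfps_nth f (fst x) * mfps_nth g (snd x) \<noteq> 0"
    unfolding mfps_nth_mult case_prod_unfold by (meson sum.neutral)
  then have "mfps_nth f (fst x) \<noteq> 0" "mfps_nth g (snd x) \<noteq> 0" by auto
  then have "s \<le> wt c (fst x)" "t \<le> wt c (snd x)" using f g by (auto simp: wfilt_def)
  moreover have "\<alpha> = fst x + snd x" using x(1) by (auto simp: splits_def)
  ultimately show "s + t \<le> wt c \<alpha>" by (simp add: wt_add)
qed

lemma wfilt_mult_psers: "f \<in> psers c \<Longrightarrow> g \<in> wfilt c t \<Longrightarrow> f * g \<in> wfilt c t"
  using wfilt_mult[of f c 0 g t] by (simp add: wfilt_0)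

text \<open>A term of the product that has the least weight of \<open>g\<close> can only come from the constant term of \<open>f\<close>.\<close>

lemma nth_mult_wfilt:
  assumes f: "f \<in> psers c" and g: "g \<in> wfilt c t" and \<beta>: "keys \<beta> \<subseteq> {..<c}" "wt c \<beta> = t"
  shows "mfps_nth (f * g) \<beta> = mfps_nth f 0 * mfps_nth g \<beta>"
proof -
  have "mfps_nth (f * g) \<beta> = (\<Sum>x\<in>splits \<beta>. if x = (0, \<beta>) then mfps_nth f 0 * mfps_nth g \<beta> else 0)"
    unfolding mfps_nth_mult
  proof (intro sum.cong refl, clarify)
    fix \<alpha> \<gamma> assume "(\<alpha>, \<gamma>) \<in> splits \<beta>"
    then have s: "\<beta> = \<alpha> + \<gamma>" by (simp add: splits_def)
    show "mfps_nth f \<alpha> * mfps_nth g \<gamma> = (if (\<alpha>, \<gamma>) = (0, \<beta>) then mfps_nth f 0 * mfps_nth g \<beta> else 0)"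
    proof (cases "wt c \<gamma> < t")
      case True
      then show ?thesis using wfilt_nth_0[OF g True] \<beta> by auto
    next
      case False
      then have "wt c \<alpha> = 0" using \<beta>(2) by (simp add: s wt_add)
      moreover have "keys \<alpha> \<subseteq> {..<c}" using \<beta>(1) by (simp add: s keys_add_mindex)
      ultimately have "\<alpha> = 0" by (rule wt_eq_0[rotated])
      then show ?thesis using s by simp
    qed
  qed
  also have "\<dots> = mfps_nth f 0 * mfps_nth g \<beta>"
    by (subst sum.delta) (simp_all, simp add: splits_def)
  finally show ?thesis .
qed

text \<open>The only term of weight at most that of \<open>\<alpha>\<close> is \<open>k y\<^sup>\<alpha>\<close>; here \<open>k\<close> may be zero.\<close>

definition has_leading_term :: "nat \<Rightarrow> 'a::comm_ring_1 mfps \<Rightarrow> mindex \<Rightarrow> 'a \<Rightarrow> bool" where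
  "has_leading_term c f \<alpha> k \<longleftrightarrow> keys \<alpha> \<subseteq> {..<c} \<and> f \<in> psers c \<and>
    f - mfps_const k * mfps_monom \<alpha> \<in> wfilt c (Suc (wt c \<alpha>))"

lemma const_monom_wfilt: "keys \<alpha> \<subseteq> {..<c} \<Longrightarrow> mfps_const k * mfps_monom \<alpha> \<in> wfilt c (wt c \<alpha>)"
  unfolding wfilt_def by auto

lemma has_leading_term_mult:
  assumes "has_leading_term c f \<alpha> k" "has_leading_term c g \<beta> l"
  shows "has_leading_term c (f * g) (\<alpha> + \<beta>) (k * l)"
proof -
  let ?m = "mfps_const k * mfps_monom \<alpha>" and ?n = "mfps_const l * mfps_monom \<beta>"
  have f: "keys \<alpha> \<subseteq> {..<c}" "f \<in> psers c" "f - ?m \<in> wfilt c (Suc (wt c \<alpha>))"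
    and g: "keys \<beta> \<subseteq> {..<c}" "g \<in> psers c" "g - ?n \<in> wfilt c (Suc (wt c \<beta>))"
    using assms by (auto simp: has_leading_term_def)
  have "g - ?n + ?n \<in> wfilt c (wt c \<beta>)"
    by (rule wfilt_add[OF wfilt_mono[OF _ g(3)] const_monom_wfilt[OF g(1)]]) simp
  then have "g \<in> wfilt c (wt c \<beta>)" by simp
  then have "(f - ?m) * g \<in> wfilt c (Suc (wt c (\<alpha> + \<beta>)))"
    using wfilt_mult[OF f(3)] by (simp add: wt_add)
  moreover have "?m * (g - ?n) \<in> wfilt c (Suc (wt c (\<alpha> + \<beta>)))"
    using wfilt_mult[OF const_monom_wfilt[OF f(1)] g(3)] by (simp add: wt_add)
  ultimately have "(f - ?m) * g + ?m * (g - ?n) \<in> wfilt c (Suc (wt c (\<alpha> + \<beta>)))" by (rule wfilt_add)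
  also have "(f - ?m) * g + ?m * (g - ?n) = f * g - mfps_const (k * l) * mfps_monom (\<alpha> + \<beta>)"
    by (simp add: algebra_simps mfps_const_hom flip: mfps_monom_mult)
  finally show ?thesis using f g by (simp add: has_leading_term_def keys_add_mindex)
qed

lemma has_leading_term_wfilt:
  assumes "has_leading_term c f \<alpha> k" shows "f \<in> wfilt c (wt c \<alpha>)"
proof -
  let ?m = "mfps_const k * mfps_monom \<alpha>"
  have f: "keys \<alpha> \<subseteq> {..<c}" "f - ?m \<in> wfilt c (Suc (wt c \<alpha>))"
    using assms by (auto simp: has_leading_term_def)
  have "f - ?m + ?m \<in> wfilt c (wt c \<alpha>)"
    by (rule wfilt_add[OF wfilt_mono[OF _ f(2)] const_monom_wfilt[OF f(1)]]) simp
  then show ?thesis by simp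
qed

lemma has_leading_term_nth:
  assumes "has_leading_term c f \<alpha> k" "wt c \<beta> = wt c \<alpha>"
  shows "mfps_nth f \<beta> = (if \<beta> = \<alpha> then k else 0)"
proof -
  have "mfps_nth (f - mfps_const k * mfps_monom \<alpha>) \<beta> = 0"
    using assms by (intro wfilt_nth_0[of _ c "Suc (wt c \<alpha>)"]) (auto simp: has_leading_term_def)
  then show ?thesis by (auto split: if_splits)
qed

section \<open>Approximation of power series by Taylor expansions of fractions\<close>

locale local_generators = residue_map n c p bar
  for n c :: nat and p :: "'k::field_char_0 mpoly set" and bar :: "'k mpoly \<Rightarrow> 'f::field" +
  fixes g :: "nat \<Rightarrow> 'k mpoly"
  assumes g_p: "\<And>i. i < c \<Longrightarrow> g i \<in> p"
    and g_vars: "\<And>i. i < c \<Longrightarrow> g i \<in> polys (vars_upto (Suc i))"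
    and pd_g: "\<And>i. i < c \<Longrightarrow> pd i (g i) \<notin> p"
    and g_generate: "\<And>f. f \<in> p \<Longrightarrow> \<exists>s\<in>pring n - p. \<exists>h. (\<forall>i. h i \<in> pring n) \<and> s * f = (\<Sum>i<c. h i * g i)"
begin

definition gmonom :: "mindex \<Rightarrow> 'k mpoly" where
  "gmonom \<alpha> = (\<Prod>i<c. g i ^ lookup \<alpha> i)"

lemma g_pring: "i < c \<Longrightarrow> g i \<in> pring n"
  using g_p p_sub by blast

lemma gmonom_pring [simp]: "gmonom \<alpha> \<in> pring n"
  unfolding gmonom_def using g_pring by (intro polys_closed) auto

lemma gmonom_0 [simp]: "gmonom 0 = 1"
  by (simp add: gmonom_def)

lemma gmonom_plus_single: "i < c \<Longrightarrow> gmonom (\<alpha> + single i 1) = gmonom \<alpha> * g i"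
proof -
  assume i: "i < c"
  have "(\<Prod>j<c. g j ^ lookup (single i (1::nat)) j) = (\<Prod>j<c. if j = i then g i else 1)"
    by (intro prod.cong) (auto simp: lookup_single)
  also have "\<dots> = g i" using i by simp
  finally show ?thesis by (simp add: gmonom_def lookup_add power_add prod.distrib)
qed

text \<open>There is no constant term since \<open>g\<^sub>i \<in> \<pp>\<close>, and no linear term in a later variable since \<open>g\<^sub>i\<close>
  does not involve it. All other terms are heavier than \<open>y\<^sub>i\<close>.\<close>

lemma tay_g_leading:
  assumes i: "i < c" shows "has_leading_term c (tay (g i)) (single i 1) (bar (pd i (g i)))"
  unfolding has_leading_term_def wfilt_def
proof (intro conjI CollectI allI impI)
  fix \<alpha> :: mindex 
  let ?d = "tay (g i) - mfps_const (bar (pd i (g i))) * mfps_monom (single i 1)"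
  assume nz: "mfps_nth ?d \<alpha> \<noteq> 0"
  have k: "keys \<alpha> \<subseteq> {..<c}"
  proof (rule ccontr)
    assume "\<not> keys \<alpha> \<subseteq> {..<c}"
    then have "mfps_nth ?d \<alpha> = 0" using i by auto
    then show False using nz by simp
  qed
  have "\<alpha> \<noteq> 0" using nz g_p[OF i] by (auto split: if_splits)
  then obtain \<beta> j where \<beta>: "\<alpha> = \<beta> + single j 1" using mindex_cases by metis
  then have j: "j < c" and k\<beta>: "keys \<beta> \<subseteq> {..<c}" using k by (auto simp: keys_add_mindex)
  show "Suc (wt c (single i 1)) \<le> wt c \<alpha>"
  proof (cases "\<beta> = 0")
    case True
    have ne: "j \<noteq> i"
    proof
      assume "j = i"
      then have \<alpha>: "\<alpha> = single i 1" using True \<beta> by simp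
      have "mfact (single i 1) = 1" using mfact_plus_single[of 0 i] by simp
      moreover have "keys (single i (1::nat)) \<subseteq> {..<c}" using i by simp
      ultimately have "mfps_nth ?d \<alpha> = 0"
        by (simp add: \<alpha> mpd_single)
      then show False using nz by simp
    qed
    have "\<not> i < j"
    proof
      assume "i < j"
      then have "pd j (g i) = 0" using j by (intro pd_polys_eq_0[OF g_vars[OF i]]) (auto simp: vars_upto_def)
      then have "mfps_nth ?d \<alpha> = 0" using ne True \<beta> j mpd_single[of j "g i"]
        by (auto simp: lookup_single_eq dest: arg_cong[of _ _ "\<lambda>x. lookup x i"] simp: lookup_single when_def)
      then show False using nz by simp
    qed
    then show ?thesis using ne True \<beta> i j by (simp add: wt_single)
  next
    case False
    then obtain \<gamma> k where \<gamma>: "\<beta> = \<gamma> + single k 1" using mindex_cases by metis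
    then have "k < c" using k\<beta> by (auto simp: keys_add_mindex)
    then show ?thesis unfolding \<beta> \<gamma> wt_add using i j by (simp add: wt_single)
  qed
qed (use i in auto)

lemma gmonom_leading:
  assumes "keys \<alpha> \<subseteq> {..<c}"
  shows "\<exists>k. k \<noteq> 0 \<and> has_leading_term c (tay (gmonom \<alpha>)) \<alpha> k"
  using assms
proof (induction \<alpha> rule: mindex_induct)
  case 0
  then show ?case
    by (intro exI[of _ 1]) (auto simp: has_leading_term_def mfps_const_hom mfps_monom_simps)
next
  case (plus \<alpha> i)
  have i: "i < c" using plus.prems by (simp add: keys_add_mindex)
  obtain k where "k \<noteq> 0" "has_leading_term c (tay (gmonom \<alpha>)) \<alpha> k"
    using plus by (auto simp: keys_add_mindex)
  moreover have "bar (pd i (g i)) \<noteq> 0"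
    using pd_g[OF i] bar_eq_0[of "pd i (g i)"] g_pring[OF i] by (auto intro: pd_polys)
  ultimately show ?case
    using has_leading_term_mult[OF _ tay_g_leading[OF i]] g_pring[OF i]
    by (intro exI[of _ "k * bar (pd i (g i))"]) (auto simp: gmonom_plus_single i tay_mult)
qed

lemma common_denominator:
  assumes "finite T"
  obtains s a where "s \<in> pring n - p" "\<And>t. a t \<in> pring n" "\<And>t. t \<in> T \<Longrightarrow> bar s * x t = bar (a t)"
proof -
  have "\<exists>s\<in>pring n - p. \<exists>a. (\<forall>t. a t \<in> pring n) \<and> (\<forall>t\<in>T. bar s * x t = bar (a t))"
    using assms
  proof (induction T)
    case empty
    show ?case by (intro bexI[of _ 1] exI[of _ "\<lambda>_. 0"]) auto
  next
    case (insert u T)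
    then obtain s a where s: "s \<in> pring n - p" "\<forall>t. a t \<in> pring n" "\<forall>t\<in>T. bar s * x t = bar (a t)" by blast
    obtain b s' where b: "b \<in> pring n" "s' \<in> pring n - p" "bar s' * x u = bar b" using bar_frac by blast
    show ?case
    proof (intro bexI exI conjI allI ballI)
      show "s * s' \<in> pring n - p" using s b p_prime by auto
      show "(if t = u then s * b else s' * a t) \<in> pring n" for t using s b by auto
      show "bar (s * s') * x t = bar (if t = u then s * b else s' * a t)" if "t \<in> insert u T" for t
        using that s b by (auto simp: bar_mult mult_ac)
    qed
  qed
  then show ?thesis using that by blast
qed

text \<open>The terms of least weight of the error are removed by a combination of the \<open>\<gamma>(g\<^sup>\<alpha>)\<close> whose
  coefficients are lifted from the residue field with a common denominator.\<close>

theorem tay_approximation: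
  assumes b: "b \<in> psers c"
  obtains s a where "s \<in> pring n - p" "a \<in> pring n" "tay s * b - tay a \<in> wfilt c t"
proof -
  have "\<exists>s\<in>pring n - p. \<exists>a\<in>pring n. tay s * b - tay a \<in> wfilt c t"
  proof (induction t)
    case 0
    show ?case using b by (intro bexI[of _ 1] bexI[of _ 0]) (auto simp: wfilt_0)
  next
    case (Suc t)
    then obtain s a where s: "s \<in> pring n - p" "a \<in> pring n" "tay s * b - tay a \<in> wfilt c t" by blast
    define T where "T = {\<alpha>. keys \<alpha> \<subseteq> {..<c} \<and> wt c \<alpha> = t}"
    have T: "finite T" unfolding T_def by (rule finite_wt_eq)
    define d where "d = tay s * b - tay a"
    have "\<exists>k. \<forall>\<alpha>\<in>T. k \<alpha> \<noteq> 0 \<and> has_leading_term c (tay (gmonom \<alpha>)) \<alpha> (k \<alpha>)"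
      using gmonom_leading by (intro bchoice) (auto simp: T_def)
    then obtain k where k: "\<And>\<alpha>. \<alpha> \<in> T \<Longrightarrow> k \<alpha> \<noteq> 0" 
      "\<And>\<alpha>. \<alpha> \<in> T \<Longrightarrow> has_leading_term c (tay (gmonom \<alpha>)) \<alpha> (k \<alpha>)" by blast
    obtain s' h where s': "s' \<in> pring n - p" "\<And>\<alpha>. h \<alpha> \<in> pring n" 
      "\<And>\<alpha>. \<alpha> \<in> T \<Longrightarrow> bar s' * (mfps_nth d \<alpha> / k \<alpha>) = bar (h \<alpha>)"
      using common_denominator[OF T, of "\<lambda>\<alpha>. mfps_nth d \<alpha> / k \<alpha>"] by metis
    define e where "e = tay s' * d - (\<Sum>\<alpha>\<in>T. tay (h \<alpha>) * tay (gmonom \<alpha>))"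
    have dW: "d \<in> wfilt c t" using s(3) by (simp add: d_def)
    have gW: "tay (gmonom \<alpha>) \<in> wfilt c t" if "\<alpha> \<in> T" for \<alpha>
      using has_leading_term_wfilt[OF k(2)[OF that]] that by (simp add: T_def)
    have eW: "e \<in> wfilt c t"
      unfolding e_def by (intro wfilt_diff wfilt_sum wfilt_mult_psers dW gW) auto
    have "e \<in> wfilt c (Suc t)"
      unfolding wfilt_def
    proof (intro CollectI conjI allI impI)
      show "e \<in> psers c" using eW by (rule wfilt_psers)
      fix \<beta> assume nz: "mfps_nth e \<beta> \<noteq> 0"
      then have le: "t \<le> wt c \<beta>" and kb: "keys \<beta> \<subseteq> {..<c}" using eW by (auto simp: wfilt_def psers_def)
      show "Suc t \<le> wt c \<beta>"
      proof (rule ccontr)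
        assume "\<not> Suc t \<le> wt c \<beta>"
        then have wb: "wt c \<beta> = t" using le by simp
        then have bT: "\<beta> \<in> T" using kb by (simp add: T_def)
        have "mfps_nth (tay (h \<alpha>) * tay (gmonom \<alpha>)) \<beta> = (if \<alpha> = \<beta> then bar (h \<beta>) * k \<beta> else 0)"
          if "\<alpha> \<in> T" for \<alpha>
          using nth_mult_wfilt[OF taylor_psers gW[OF that] kb wb, of bar "h \<alpha>"] has_leading_term_nth[OF k(2)[OF that], of \<beta>] that wb
          by (auto simp: T_def)
        then have "(\<Sum>\<alpha>\<in>T. mfps_nth (tay (h \<alpha>) * tay (gmonom \<alpha>)) \<beta>) = bar (h \<beta>) * k \<beta>"
          using T bT by (simp add: sum.delta)
        then have "mfps_nth e \<beta> = bar s' * mfps_nth d \<beta> - bar (h \<beta>) * k \<beta>"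
          using nth_mult_wfilt[OF taylor_psers dW kb wb, of bar s'] by (simp add: e_def)
        also have "\<dots> = 0" using s'(3)[OF bT, symmetric] k(1)[OF bT] by simp
        finally show False using nz by simp
      qed
    qed
    also have "e = tay (s' * s) * b - tay (s' * a + (\<Sum>\<alpha>\<in>T. h \<alpha> * gmonom \<alpha>))"
      using s s'(1,2) by (simp add: e_def d_def tay_mult tay_add tay_sum algebra_simps)
    finally show ?case
      using s s'(1,2) p_prime by (intro bexI[of _ "s' * s"] bexI[of _ "s' * a + (\<Sum>\<alpha>\<in>T. h \<alpha> * gmonom \<alpha>)"]) auto
  qed
  then show ?thesis using that by blast
qed

text \<open>The ideal generated by the products of generators of weight at least \<open>t\<close>.\<close>

inductive_set gideal :: "nat \<Rightarrow> 'k mpoly set" for t where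
  zero: "0 \<in> gideal t"
| plus: "x \<in> gideal t \<Longrightarrow> h \<in> pring n \<Longrightarrow> keys \<alpha> \<subseteq> {..<c} \<Longrightarrow> t \<le> wt c \<alpha> \<Longrightarrow> x + h * gmonom \<alpha> \<in> gideal t"

lemma gideal_add: "y \<in> gideal t \<Longrightarrow> x \<in> gideal t \<Longrightarrow> x + y \<in> gideal t"
  by (induction rule: gideal.induct) (auto simp: add.assoc[symmetric] intro: gideal.plus)

lemma gideal_mult: "x \<in> gideal t \<Longrightarrow> a \<in> pring n \<Longrightarrow> a * x \<in> gideal t"
  by (induction rule: gideal.induct) (auto simp: distrib_left mult.assoc[symmetric] intro: gideal.intros)

lemma gideal_sum: "(\<And>x. x \<in> S \<Longrightarrow> f x \<in> gideal t) \<Longrightarrow> sum f S \<in> gideal t"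
  by (induction S rule: infinite_finite_induct) (auto intro: gideal_add gideal.zero)

lemma gideal_gen: "h \<in> pring n \<Longrightarrow> keys \<alpha> \<subseteq> {..<c} \<Longrightarrow> t \<le> wt c \<alpha> \<Longrightarrow> h * gmonom \<alpha> \<in> gideal t"
  using gideal.plus[OF gideal.zero] by simp

lemma gideal_pring: "x \<in> gideal t \<Longrightarrow> x \<in> pring n"
  by (induction rule: gideal.induct) auto

lemma tay_gideal: "x \<in> gideal t \<Longrightarrow> tay x \<in> wfilt c t"
proof (induction rule: gideal.induct)
  case (plus x h \<alpha>)
  then obtain k where "has_leading_term c (tay (gmonom \<alpha>)) \<alpha> k" using gmonom_leading by blast
  then have "tay h * tay (gmonom \<alpha>) \<in> wfilt c t"
    using plus by (intro wfilt_mult_psers wfilt_mono[OF _ has_leading_term_wfilt]) auto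
  then show ?case using plus gideal_pring[OF plus.hyps(1)] by (simp add: tay_add tay_mult wfilt_add)
qed simp

lemma gideal_decompose:
  assumes "x \<in> gideal t"
  shows "\<exists>h y. (\<forall>\<alpha>. h \<alpha> \<in> pring n) \<and> y \<in> gideal (Suc t) \<and>
    x = (\<Sum>\<alpha> | keys \<alpha> \<subseteq> {..<c} \<and> wt c \<alpha> = t. h \<alpha> * gmonom \<alpha>) + y"
  using assms
proof (induction rule: gideal.induct)
  case zero
  then show ?case by (intro exI[of _ "\<lambda>_. 0"] exI[of _ 0]) (auto intro: gideal.zero)
next
  case (plus x h' \<beta>)
  let ?T = "{\<alpha>. keys \<alpha> \<subseteq> {..<c} \<and> wt c \<alpha> = t}"
  obtain h y where h: "\<forall>\<alpha>. h \<alpha> \<in> pring n" "y \<in> gideal (Suc t)" "x = (\<Sum>\<alpha>\<in>?T. h \<alpha> * gmonom \<alpha>) + y"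
    using plus by blast
  show ?case
  proof (cases "wt c \<beta> = t")
    case True
    then have "\<beta> \<in> ?T" using plus by simp
    then have "(\<Sum>\<alpha>\<in>?T. (h \<alpha> + (if \<alpha> = \<beta> then h' else 0)) * gmonom \<alpha>) = (\<Sum>\<alpha>\<in>?T. h \<alpha> * gmonom \<alpha>) + h' * gmonom \<beta>"
      using finite_wt_eq[of c t] 
      by (simp add: distrib_right sum.distrib if_distrib[of "\<lambda>x. x * _"] cong: if_cong)
    then show ?thesis using h plus.hyps
      by (intro exI[of _ "\<lambda>\<alpha>. h \<alpha> + (if \<alpha> = \<beta> then h' else 0)"] exI[of _ y]) (auto simp: algebra_simps)
  next
    case False
    then have "y + h' * gmonom \<beta> \<in> gideal (Suc t)" using plus h by (intro gideal.plus) auto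
    then show ?thesis using h 
      by (intro exI[of _ h] exI[of _ "y + h' * gmonom \<beta>"]) (auto simp: algebra_simps)
  qed
qed

text \<open>If \<open>s a\<close> is a combination of the \<open>g\<^sup>\<alpha>\<close> of weight at least \<open>t\<close>, the classes of the coefficients of
  weight \<open>t\<close> are, up to nonzero factors, the coefficients of \<open>\<gamma>(s a)\<close> of that weight. They vanish, so these
  coefficients lie in \<open>\<pp>\<close> and can be expressed by the generators again, which raises the weight.\<close>

theorem tay_kernel:
  assumes "a \<in> pring n" "tay a \<in> wfilt c t"
  shows "\<exists>s\<in>pring n - p. s * a \<in> gideal t"
  using assms
proof (induction t)
  case 0
  then show ?case using gideal_gen[of a 0 0] by (intro bexI[of _ 1]) auto
next
  case (Suc t)
  let ?T = "{\<alpha>. keys \<alpha> \<subseteq> {..<c} \<and> wt c \<alpha> = t}"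
  have "tay a \<in> wfilt c t" using Suc.prems(2) by (rule wfilt_mono[rotated]) simp
  then obtain s where s: "s \<in> pring n - p" "s * a \<in> gideal t" using Suc by blast
  obtain h y where h: "\<And>\<alpha>. h \<alpha> \<in> pring n" and y: "y \<in> gideal (Suc t)" 
    and eq: "s * a = (\<Sum>\<alpha>\<in>?T. h \<alpha> * gmonom \<alpha>) + y" using gideal_decompose[OF s(2)] by blast
  have sa: "tay (s * a) \<in> wfilt c (Suc t)" using s Suc.prems by (simp add: tay_mult wfilt_mult_psers)
  have h0: "h \<beta> \<in> p" if bT: "\<beta> \<in> ?T" for \<beta>
  proof -
    have b: "keys \<beta> \<subseteq> {..<c}" "wt c \<beta> = t" using bT by auto
    have tsa: "tay (s * a) = (\<Sum>\<alpha>\<in>?T. tay (h \<alpha>) * tay (gmonom \<alpha>)) + tay y"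
      unfolding eq using h gideal_pring[OF y] by (simp add: tay_add tay_sum tay_mult)
    have "mfps_nth (tay (s * a)) \<beta> = (\<Sum>\<alpha>\<in>?T. mfps_nth (tay (h \<alpha>) * tay (gmonom \<alpha>)) \<beta>) + mfps_nth (tay y) \<beta>"
      by (simp only: tsa mfps_nth_simps mfps_nth_sum)
    moreover have "mfps_nth (tay (s * a)) \<beta> = 0" "mfps_nth (tay y) \<beta> = 0"
      using b by (auto intro!: wfilt_nth_0[OF sa] wfilt_nth_0[OF tay_gideal[OF y]] simp del: mfps_nth_taylor)
    ultimately have 0: "(\<Sum>\<alpha>\<in>?T. mfps_nth (tay (h \<alpha>) * tay (gmonom \<alpha>)) \<beta>) = 0"
      by (simp only: add_0_right)
    obtain k where k: "k \<noteq> 0" "has_leading_term c (tay (gmonom \<beta>)) \<beta> k" using gmonom_leading[OF b(1)] by blast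
    have "mfps_nth (tay (h \<alpha>) * tay (gmonom \<alpha>)) \<beta> = (if \<alpha> = \<beta> then bar (h \<beta>) * k else 0)" if "\<alpha> \<in> ?T" for \<alpha>
    proof -
      have a: "keys \<alpha> \<subseteq> {..<c}" "wt c \<alpha> = t" using that by auto
      obtain l where l: "has_leading_term c (tay (gmonom \<alpha>)) \<alpha> l" using gmonom_leading[OF a(1)] by blast
      have "mfps_nth (tay (h \<alpha>) * tay (gmonom \<alpha>)) \<beta> = bar (h \<alpha>) * mfps_nth (tay (gmonom \<alpha>)) \<beta>"
        using nth_mult_wfilt[OF taylor_psers has_leading_term_wfilt[OF l] b(1), of bar "h \<alpha>"] a b
        by (simp del: mfps_nth_taylor add: tay_nth_0)
      also have "\<dots> = (if \<alpha> = \<beta> then bar (h \<beta>) * k else 0)"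
        using has_leading_term_nth[OF k(2), of \<beta>] has_leading_term_nth[OF l, of \<beta>] a b
        by (cases "\<alpha> = \<beta>") (simp_all del: mfps_nth_taylor)
      finally show ?thesis .
    qed
    then have "(\<Sum>\<alpha>\<in>?T. mfps_nth (tay (h \<alpha>) * tay (gmonom \<alpha>)) \<beta>)
        = (\<Sum>\<alpha>\<in>?T. if \<alpha> = \<beta> then bar (h \<beta>) * k else 0)"
      by (intro sum.cong refl)
    also have "\<dots> = bar (h \<beta>) * k"
      by (subst sum.delta[OF finite_wt_eq]) (use bT in simp)
    finally show ?thesis using 0 k bar_eq_0[OF h[of \<beta>]] by simp
  qed
  have "\<exists>s\<in>pring n - p. s * (h \<beta> * gmonom \<beta>) \<in> gideal (Suc t)" if bT: "\<beta> \<in> ?T" for \<beta>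
  proof -
    obtain s h' where s: "s \<in> pring n - p" "\<And>i. h' i \<in> pring n" "s * h \<beta> = (\<Sum>i<c. h' i * g i)"
      using g_generate[OF h0[OF bT]] by blast
    have "s * (h \<beta> * gmonom \<beta>) = (\<Sum>i<c. h' i * gmonom (\<beta> + single i 1))"
      unfolding mult.assoc[symmetric] s(3) sum_distrib_right by (intro sum.cong) (auto simp: gmonom_plus_single mult_ac)
    also have "\<dots> \<in> gideal (Suc t)"
      using bT s(2) by (intro gideal_sum gideal_gen) (auto simp: keys_add_mindex wt_add wt_single)
    finally show ?thesis using s(1) by blast
  qed
  moreover have "\<exists>s\<in>pring n - p. s * (\<Sum>\<beta>\<in>S. h \<beta> * gmonom \<beta>) \<in> gideal (Suc t)"
    if "finite S" "\<forall>\<beta>\<in>S. \<exists>s\<in>pring n - p. s * (h \<beta> * gmonom \<beta>) \<in> gideal (Suc t)" for S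
    using that
  proof (induction S)
    case empty
    show ?case by (intro bexI[of _ 1]) (auto intro: gideal.zero)
  next
    case (insert \<beta> S)
    obtain s where s: "s \<in> pring n - p" "s * (\<Sum>\<beta>\<in>S. h \<beta> * gmonom \<beta>) \<in> gideal (Suc t)" using insert by auto
    obtain s' where s': "s' \<in> pring n - p" "s' * (h \<beta> * gmonom \<beta>) \<in> gideal (Suc t)" using insert by auto
    have "s * (s' * (h \<beta> * gmonom \<beta>)) + s' * (s * (\<Sum>\<beta>\<in>S. h \<beta> * gmonom \<beta>)) \<in> gideal (Suc t)"
      using s s' by (intro gideal_add gideal_mult[OF s(2)] gideal_mult[OF s'(2)]) auto
    then have "(s * s') * (\<Sum>\<beta>\<in>insert \<beta> S. h \<beta> * gmonom \<beta>) \<in> gideal (Suc t)"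
      using insert(1,2) by (simp add: algebra_simps)
    then show ?case using s s' p_prime by (intro bexI[of _ "s * s'"]) auto
  qed
  ultimately obtain s' where s': "s' \<in> pring n - p" "s' * (\<Sum>\<beta>\<in>?T. h \<beta> * gmonom \<beta>) \<in> gideal (Suc t)"
    using finite_wt_eq[of c t] by blast
  have "s' * (\<Sum>\<beta>\<in>?T. h \<beta> * gmonom \<beta>) + s' * y \<in> gideal (Suc t)"
    using s' by (intro gideal_add gideal_mult[OF s'(2)] gideal_mult[OF y]) auto
  then have "(s' * s) * a \<in> gideal (Suc t)" by (simp only: mult.assoc eq distrib_left)
  then show ?case using s s' p_prime by (intro bexI[of _ "s' * s"]) auto
qed

end

section \<open>Power series as a local ring\<close>

lemma wfilt_Suc_0_iff: "f \<in> wfilt c 1 \<longleftrightarrow> f \<in> psers c \<and> mfps_nth f 0 = 0"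
proof
  assume f: "f \<in> psers c \<and> mfps_nth f 0 = 0"
  have "1 \<le> wt c \<alpha>" if nz: "mfps_nth f \<alpha> \<noteq> 0" for \<alpha>
  proof (rule ccontr)
    assume "\<not> 1 \<le> wt c \<alpha>"
    then have "wt c \<alpha> = 0" by simp
    moreover have "keys \<alpha> \<subseteq> {..<c}" using f nz by (auto simp: psers_def)
    ultimately have "\<alpha> = 0" by (rule wt_eq_0[rotated])
    then show False using f nz by simp
  qed
  then show "f \<in> wfilt c 1" using f by (simp add: wfilt_def)
qed (auto simp: wfilt_psers wfilt_nth_0[of f c 1])

lemma wfilt_Inter: "(\<And>t. f \<in> wfilt c t) \<Longrightarrow> f = 0"
proof (rule mfps_eqI)
  fix \<alpha> assume "\<And>t. f \<in> wfilt c t"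
  then show "mfps_nth f \<alpha> = mfps_nth 0 \<alpha>"
    using wfilt_nth_0[of f c "Suc (wt c \<alpha>)" \<alpha>] by simp
qed

lemma wfilt_power: "z \<in> wfilt c 1 \<Longrightarrow> z ^ k \<in> wfilt c k"
proof (induction k)
  case (Suc k)
  then show ?case using wfilt_mult[of z c 1 "z ^ k" k] by (simp add: plus_1_eq_Suc)
qed (simp add: wfilt_0)

text \<open>The geometric series converges in the filtration.\<close>

lemma psers_unit:
  fixes f :: "'a::field mfps"
  assumes f: "f \<in> psers c" "mfps_nth f 0 \<noteq> 0"
  obtains h where "h \<in> psers c" "f * h = 1"
proof -
  define k where "k = mfps_const (1 / mfps_nth f 0)"
  define z where "z = 1 - k * f"
  have z: "z \<in> wfilt c 1" using f unfolding wfilt_Suc_0_iff by (simp add: z_def k_def)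
  define zinv where "zinv = Abs_mfps (\<lambda>\<alpha>. \<Sum>j\<le>wt c \<alpha>. mfps_nth (z ^ j) \<alpha>)"
  have zinv_sum: "zinv - (\<Sum>j<N. z ^ j) \<in> wfilt c N" for N
    unfolding wfilt_def
  proof (intro CollectI conjI allI impI)
    have zp: "z ^ j \<in> psers c" for j using z by (auto intro: wfilt_psers)
    have "zinv \<in> psers c"
      unfolding psers_def
    proof (intro CollectI allI impI)
      fix \<alpha> assume "mfps_nth zinv \<alpha> \<noteq> 0"
      then obtain j where "mfps_nth (z ^ j) \<alpha> \<noteq> 0" 
        unfolding zinv_def mfps_nth_Abs by (meson sum.neutral)
      then show "keys \<alpha> \<subseteq> {..<c}" using zp[of j] by (auto simp: psers_def)
    qed
    then show "zinv - (\<Sum>j<N. z ^ j) \<in> psers c" using zp by simp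
    fix \<alpha> assume nz: "mfps_nth (zinv - (\<Sum>j<N. z ^ j)) \<alpha> \<noteq> 0"
    show "N \<le> wt c \<alpha>"
    proof (rule ccontr)
      assume "\<not> N \<le> wt c \<alpha>"
      then have "(\<Sum>j<N. mfps_nth (z ^ j) \<alpha>) = (\<Sum>j\<le>wt c \<alpha>. mfps_nth (z ^ j) \<alpha>)"
        by (intro sum.mono_neutral_right) (auto intro: wfilt_nth_0[OF wfilt_power[OF z]])
      then show False using nz by (simp add: zinv_def)
    qed
  qed
  have zinvp: "zinv \<in> psers c" using zinv_sum[of 0] by (simp add: wfilt_0)
  have "(1 - z) * zinv - 1 \<in> wfilt c N" for N
  proof -
    have "1 - z \<in> psers c" using wfilt_psers[OF z] by simp
    then have "(1 - z) * (zinv - (\<Sum>j<N. z ^ j)) - z ^ N \<in> wfilt c N"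
      using z by (intro wfilt_diff wfilt_mult_psers zinv_sum wfilt_power)
    also have "(1 - z) * (zinv - (\<Sum>j<N. z ^ j)) - z ^ N = (1 - z) * zinv - 1"
      using one_diff_power_eq[of z N, symmetric] by (simp add: right_diff_distrib)
    finally show ?thesis .
  qed
  then have "(1 - z) * zinv - 1 = 0" by (rule wfilt_Inter)
  then have "f * (k * zinv) = 1" by (simp add: z_def mult_ac)
  then show ?thesis using zinvp by (intro that[of "k * zinv"]) (auto simp: k_def)
qed

lemma max_ideal_ideal: "ideal (max_ideal c) (ring_on (psers c))"
proof -
  interpret cring "ring_on (psers c)" by (rule cring_ring_on[OF subring_psers])
  show ?thesis unfolding max_ideal_def by (rule genideal_ideal) auto
qed

lemma mfps_var_max_ideal: "i < c \<Longrightarrow> mfps_var i \<in> max_ideal c"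
proof -
  assume i: "i < c"
  interpret cring "ring_on (psers c)" by (rule cring_ring_on[OF subring_psers])
  have "mfps_var ` {..<c} \<subseteq> max_ideal c" unfolding max_ideal_def by (rule genideal_self) auto
  then show ?thesis using i by blast
qed

lemma max_ideal_nth_0: 
  assumes "f \<in> max_ideal c" shows "f \<in> psers c" "mfps_nth f 0 = 0"
proof -
  interpret cring "ring_on (psers c :: 'a mfps set)" by (rule cring_ring_on[OF subring_psers])
  have "ideal (wfilt c 1 :: 'a mfps set) (ring_on (psers c))"
    unfolding ideal_ring_on_iff[OF subring_psers]
    by (auto intro: wfilt_psers wfilt_add wfilt_mult_psers)
  moreover have "mfps_var ` {..<c} \<subseteq> (wfilt c 1 :: 'a mfps set)" by (auto simp: wfilt_Suc_0_iff)
  ultimately have "max_ideal c \<subseteq> (wfilt c 1 :: 'a mfps set)"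
    unfolding max_ideal_def by (rule genideal_minimal)
  then show "f \<in> psers c" "mfps_nth f 0 = 0" using assms unfolding wfilt_Suc_0_iff[symmetric] 
    by (auto simp: wfilt_Suc_0_iff)
qed

lemma max_ideal_pow_simps:
  "max_ideal_pow c 0 = psers c"
  "max_ideal_pow c (Suc k) = ideal_prod (ring_on (psers c)) (max_ideal_pow c k) (max_ideal c)"
  by (simp_all add: max_ideal_pow_def nat_pow_def ideals_set_def)

lemma nth_var_mult:
  "mfps_nth (mfps_var i * f) \<alpha> = (if lookup \<alpha> i = 0 then 0 else mfps_nth f (\<alpha> - single i 1))"
proof (cases "lookup \<alpha> i = 0")
  case True
  then have "\<alpha> \<noteq> single i 1 + \<gamma>" for \<gamma> by (auto simp: lookup_add)
  then show ?thesis using True mfps_nth_monom_mult_0[of \<alpha> "single i 1" f] by (simp add: mfps_monom_simps)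
next
  case False
  then have "\<alpha> = single i 1 + (\<alpha> - single i 1)"
    by (intro poly_mapping_eqI) (auto simp: lookup_add lookup_minus lookup_single when_def)
  then show ?thesis using False mfps_nth_monom_mult[of "single i 1" f "\<alpha> - single i 1"] by (simp add: mfps_monom_simps)
qed

text \<open>A power series without terms of small weight is a combination of the variables: each of its
  terms is divided by the first variable that it contains.\<close>

lemma wfilt_var_decomposition:
  assumes f: "f \<in> wfilt c (Suc (t + 2 * c))"
  obtains h where "\<And>i. i < c \<Longrightarrow> h i \<in> wfilt c t" "f = (\<Sum>i<c. mfps_var i * h i)"
proof -
  define h where "h i = Abs_mfps (\<lambda>\<beta>. if \<forall>j<i. lookup \<beta> j = 0 then mfps_nth f (\<beta> + single i 1) else 0)" for i
  have "h i \<in> wfilt c t" if i: "i < c" for i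
    unfolding wfilt_def
  proof (intro CollectI conjI allI impI)
    have "keys \<beta> \<subseteq> {..<c}" if "mfps_nth f (\<beta> + single i 1) \<noteq> 0" for \<beta>
    proof -
      have "keys (\<beta> + single i 1) \<subseteq> {..<c}" using wfilt_psers[OF f] that by (simp add: psers_def)
      then show ?thesis by (simp add: keys_add_mindex)
    qed
    then show "h i \<in> psers c" unfolding psers_def h_def by auto
    fix \<beta> assume "mfps_nth (h i) \<beta> \<noteq> 0"
    then have "mfps_nth f (\<beta> + single i 1) \<noteq> 0" by (auto simp: h_def split: if_splits)
    then have "Suc (t + 2 * c) \<le> wt c (\<beta> + single i 1)" using f by (auto simp: wfilt_def)
    then show "t \<le> wt c \<beta>" using i by (simp add: wt_add wt_single)
  qed
  moreover have "f = (\<Sum>i<c. mfps_var i * h i)"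
  proof (rule mfps_eqI)
    fix \<alpha>
    have coeff: "mfps_nth (mfps_var i * h i) \<alpha> = (if lookup \<alpha> i \<noteq> 0 \<and> (\<forall>j<i. lookup \<alpha> j = 0) then mfps_nth f \<alpha> else 0)" for i
    proof (cases "lookup \<alpha> i = 0")
      case False
      then have "\<alpha> - single i 1 + single i 1 = \<alpha>"
        by (intro poly_mapping_eqI) (auto simp: lookup_add lookup_minus lookup_single when_def)
      moreover have "(\<forall>j<i. lookup (\<alpha> - single i 1) j = 0) \<longleftrightarrow> (\<forall>j<i. lookup \<alpha> j = 0)"
        by (simp add: lookup_minus lookup_single when_def)
      ultimately show ?thesis using False by (auto simp: nth_var_mult h_def)
    qed (simp add: nth_var_mult)
    show "mfps_nth f \<alpha> = mfps_nth (\<Sum>i<c. mfps_var i * h i) \<alpha>"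
    proof (cases "mfps_nth f \<alpha> = 0")
      case True
      show ?thesis unfolding mfps_nth_sum coeff True by simp
    next
      case False
      then have "\<alpha> \<noteq> 0" "keys \<alpha> \<subseteq> {..<c}"
        using wfilt_nth_0[OF f, of 0] wfilt_psers[OF f] by (auto simp: psers_def)
      then obtain k where k: "lookup \<alpha> k \<noteq> 0" by (metis poly_mapping_eqI lookup_zero)
      define i where "i = (LEAST i. lookup \<alpha> i \<noteq> 0)"
      have i: "lookup \<alpha> i \<noteq> 0" unfolding i_def using k by (rule LeastI)
      have below: "lookup \<alpha> j = 0" if "j < i" for j using that not_less_Least unfolding i_def by blast
      have "i \<in> keys \<alpha>" using i by (simp add: in_keys_iff)
      then have "i < c" using \<open>keys \<alpha> \<subseteq> {..<c}\<close> by blast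
      moreover have "lookup \<alpha> j \<noteq> 0 \<and> (\<forall>k<j. lookup \<alpha> k = 0) \<longleftrightarrow> j = i" for j
        using i below by (metis linorder_neqE_nat)
      ultimately show ?thesis by (simp add: coeff)
    qed
  qed
  ultimately show ?thesis by (rule that)
qed

text \<open>Each extraction of a variable lowers the weight by at most \<open>2c\<close>; one more unit of weight excludes
  the constant term.\<close>

lemma wfilt_subset_max_ideal_pow:
  fixes f :: "'a::comm_ring_1 mfps"
  shows "f \<in> wfilt c (Suc (2 * c) * k) \<Longrightarrow> f \<in> max_ideal_pow c k"
proof (induction k arbitrary: f)
  case (Suc k)
  have "Suc (2 * c) * Suc k = Suc (Suc (2 * c) * k + 2 * c)" by simp
  then obtain h where h: "\<And>i. i < c \<Longrightarrow> h i \<in> wfilt c (Suc (2 * c) * k)" "f = (\<Sum>i<c. mfps_var i * h i)"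
    using wfilt_var_decomposition[of f c "Suc (2 * c) * k"] Suc.prems by metis
  have "d \<le> c \<Longrightarrow> (\<Sum>i<d. mfps_var i * h i) \<in> max_ideal_pow c (Suc k)" for d
  proof (induction d)
    case 0
    have "(0::'a mfps) \<in> max_ideal_pow c k" by (rule Suc.IH) simp
    moreover have "(0::'a mfps) \<in> max_ideal c" using max_ideal_ideal ideal_ring_on_iff[OF subring_psers] by blast
    ultimately have "(0::'a mfps) \<otimes>\<^bsub>ring_on (psers c)\<^esub> 0 \<in> max_ideal_pow c (Suc k)"
      unfolding max_ideal_pow_simps by (rule ideal_prod.prod)
    then show ?case by simp
  next
    case (Suc d)
    have "h d \<otimes>\<^bsub>ring_on (psers c)\<^esub> mfps_var d \<in> max_ideal_pow c (Suc k)"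
      unfolding max_ideal_pow_simps using Suc.prems h(1) \<open>\<And>f. f \<in> wfilt c (Suc (2 * c) * k) \<Longrightarrow> f \<in> max_ideal_pow c k\<close>
      by (intro ideal_prod.prod mfps_var_max_ideal) auto
    moreover have "(\<Sum>i<d. mfps_var i * h i) \<in> max_ideal_pow c (Suc k)" using Suc by simp
    ultimately have "(\<Sum>i<d. mfps_var i * h i) \<oplus>\<^bsub>ring_on (psers c)\<^esub> (h d \<otimes>\<^bsub>ring_on (psers c)\<^esub> mfps_var d) \<in> max_ideal_pow c (Suc k)"
      unfolding max_ideal_pow_simps by (intro ideal_prod.sum)
    then show ?case by (simp add: mult.commute)
  qed
  from this[OF order_refl] show ?case using h(2) by simp
qed (simp add: max_ideal_pow_simps wfilt_0)

section \<open>Submodules of finite colength\<close>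

lemma underdetermined_system:
  fixes y :: "'i \<Rightarrow> nat \<Rightarrow> 'a::field"
  assumes "finite I" "card I > m"
  shows "\<exists>x. (\<exists>i\<in>I. x i \<noteq> 0) \<and> (\<forall>j<m. (\<Sum>i\<in>I. x i * y i j) = 0)"
  using assms
proof (induction m arbitrary: I y)
  case 0
  then obtain i where "i \<in> I" by fastforce
  then show ?case by (intro exI[of _ "\<lambda>_. 1"]) auto
next
  case (Suc m)
  show ?case
  proof (cases "\<forall>i\<in>I. y i m = 0")
    case True
    obtain x where "\<exists>i\<in>I. x i \<noteq> 0" "\<forall>j<m. (\<Sum>i\<in>I. x i * y i j) = 0"
      using Suc.IH[of I y] Suc.prems by auto
    then show ?thesis using True by (intro exI[of _ x]) (auto simp: less_Suc_eq)
  next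
    case False
    then obtain k where k: "k \<in> I" "y k m \<noteq> 0" by blast
    define y' where "y' i j = y i j - y i m / y k m * y k j" for i j
    have "card (I - {k}) > m" using Suc.prems k by simp
    then obtain x where x: "\<exists>i\<in>I - {k}. x i \<noteq> 0" "\<And>j. j < m \<Longrightarrow> (\<Sum>i\<in>I - {k}. x i * y' i j) = 0"
      using Suc.IH[of "I - {k}" y'] Suc.prems by auto
    define x' where "x' = x(k := - (\<Sum>i\<in>I - {k}. x i * (y i m / y k m)))"
    have sum: "(\<Sum>i\<in>I. x' i * y i j) = (\<Sum>i\<in>I - {k}. x i * y' i j)" for j
    proof -
      have "(\<Sum>i\<in>I. x' i * y i j) = x' k * y k j + (\<Sum>i\<in>I - {k}. x' i * y i j)"
        using Suc.prems(1) k(1) by (rule sum.remove)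
      also have "(\<Sum>i\<in>I - {k}. x' i * y i j) = (\<Sum>i\<in>I - {k}. x i * y i j)"
        by (intro sum.cong) (auto simp: x'_def)
      finally show ?thesis
        by (simp add: x'_def y'_def sum_distrib_right sum_distrib_left sum_subtractf algebra_simps)
    qed
    have "y' i m = 0" for i using k(2) by (simp add: y'_def)
    then have "\<forall>j<Suc m. (\<Sum>i\<in>I. x' i * y i j) = 0" unfolding sum using x(2) by (auto simp: less_Suc_eq)
    moreover have "\<exists>i\<in>I. x' i \<noteq> 0" using x(1) by (auto simp: x'_def)
    ultimately show ?thesis by blast
  qed
qed

abbreviation (input) smul :: "'a::comm_ring_1 \<Rightarrow> (nat \<Rightarrow> 'a) \<Rightarrow> nat \<Rightarrow> 'a" (infixr \<open>*v\<close> 75) where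
  "a *v v \<equiv> (\<lambda>j. a * v j)"

lemma vecs_closed:
  assumes "subring_set A"
  shows "0 \<in> vecs A r" "v \<in> vecs A r \<Longrightarrow> w \<in> vecs A r \<Longrightarrow> v + w \<in> vecs A r"
    "v \<in> vecs A r \<Longrightarrow> w \<in> vecs A r \<Longrightarrow> v - w \<in> vecs A r"
    "a \<in> A \<Longrightarrow> v \<in> vecs A r \<Longrightarrow> a *v v \<in> vecs A r"
  using subring_setD[OF assms] by (auto simp: vecs_def)

lemmas vecs_psers [simp, intro] = vecs_closed[OF subring_psers]
lemmas vecs_polys [simp, intro] = vecs_closed[OF subring_polys]

lemma vecs_sum: "subring_set A \<Longrightarrow> (\<And>x. x \<in> S \<Longrightarrow> f x \<in> vecs A r) \<Longrightarrow> sum f S \<in> vecs A r"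
  by (induction S rule: infinite_finite_induct) (auto simp: vecs_closed)

lemma submodulesD:
  assumes "subring_set A" "U \<in> submodules A r"
  shows "U \<subseteq> vecs A r" "0 \<in> U" "u \<in> U \<Longrightarrow> v \<in> U \<Longrightarrow> u + v \<in> U" "a \<in> A \<Longrightarrow> u \<in> U \<Longrightarrow> a *v u \<in> U"
    "u \<in> U \<Longrightarrow> v \<in> U \<Longrightarrow> u - v \<in> U"
proof -
  note * = assms(2)[unfolded submodules_iff[OF assms(1)]]
  show U: "U \<subseteq> vecs A r" "0 \<in> U" "u \<in> U \<Longrightarrow> v \<in> U \<Longrightarrow> u + v \<in> U" "a \<in> A \<Longrightarrow> u \<in> U \<Longrightarrow> a *v u \<in> U" for u v a
    using * by auto
  assume "u \<in> U" "v \<in> U"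
  then have "u + (- 1) *v v \<in> U" by (intro U(3) U(4) subring_setD(1,5)[OF assms(1)])
  also have "u + (- 1) *v v = u - v" by (auto simp: fun_eq_iff)
  finally show "u - v \<in> U" .
qed

lemma submodules_sum:
  assumes "subring_set A" "U \<in> submodules A r"
  shows "(\<And>x. x \<in> S \<Longrightarrow> f x \<in> U) \<Longrightarrow> sum f S \<in> U"
  by (induction S rule: infinite_finite_induct) (auto intro: submodulesD[OF assms])

text \<open>A quotient of dimension \<open>m\<close> over the coefficient field is cut out by \<open>m\<close> linear functionals.\<close>

lemma quotient_basis_functionals:
  assumes V: "V \<in> submodules (psers c) r" and b: "quotient_basis c r V m b"
  obtains L where
    "\<forall>v\<in>vecs (psers c) r. \<forall>w\<in>vecs (psers c) r. \<forall>i. L (v + w) i = L v i + L w i"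
    "\<forall>v\<in>vecs (psers c) r. \<forall>x i. L (mfps_const x *v v) i = x * L v i"
    "\<forall>v\<in>vecs (psers c) r. v \<in> V \<longleftrightarrow> (\<forall>i<m. L v i = 0)"
    "\<forall>i<m. \<forall>k<m. L (b k) i = (if i = k then 1 else 0)"
proof -
  let ?B = "vecs (psers c) r"
  let ?P = "\<lambda>v a. (\<forall>i\<ge>m. a i = 0) \<and> (\<lambda>j. v j - (\<Sum>i<m. mfps_const (a i) * b i j)) \<in> V"
  note V' = submodulesD[OF subring_psers V]
  define L where "L v = (THE a. ?P v a)" for v
  have ex1: "\<exists>!a. ?P v a" if "v \<in> ?B" for v
    using b that unfolding quotient_basis_def by blast
  have L: "?P v (L v)" if "v \<in> ?B" for v
    unfolding L_def using ex1[OF that] by (rule theI')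
  have unique: "L v = a" if "v \<in> ?B" "?P v a" for v a
    using ex1[OF that(1)] L[OF that(1)] that(2) by blast
  have bB: "b k \<in> ?B" if "k < m" for k using b that by (simp add: quotient_basis_def)
  have add: "L (v + w) = (\<lambda>i. L v i + L w i)" if v: "v \<in> ?B" and w: "w \<in> ?B" for v w
  proof (rule unique)
    have "(\<lambda>j. (v + w) j - (\<Sum>i<m. mfps_const (L v i + L w i) * b i j)) =
      (\<lambda>j. v j - (\<Sum>i<m. mfps_const (L v i) * b i j)) + (\<lambda>j. w j - (\<Sum>i<m. mfps_const (L w i) * b i j))"
      by (auto simp: fun_eq_iff mfps_const_hom algebra_simps sum.distrib)
    then show "?P (v + w) (\<lambda>i. L v i + L w i)" using L[OF v] L[OF w] V'(3) by simp
  qed (use v w in auto)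
  have scale: "L (mfps_const x *v v) = (\<lambda>i. x * L v i)" if v: "v \<in> ?B" for v x
  proof (rule unique)
    have "(\<lambda>j. (mfps_const x *v v) j - (\<Sum>i<m. mfps_const (x * L v i) * b i j)) =
      mfps_const x *v (\<lambda>j. v j - (\<Sum>i<m. mfps_const (L v i) * b i j))"
      by (auto simp: fun_eq_iff mfps_const_hom algebra_simps sum_distrib_left)
    then show "?P (mfps_const x *v v) (\<lambda>i. x * L v i)" using L[OF v] V'(4)[of "mfps_const x"] by simp
  qed (use v in auto)
  have mem: "v \<in> V \<longleftrightarrow> (\<forall>i<m. L v i = 0)" if v: "v \<in> ?B" for v
  proof
    assume "v \<in> V"
    then have "L v = (\<lambda>_. 0)" by (intro unique v) (simp add: mfps_const_hom)
    then show "\<forall>i<m. L v i = 0" by simp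
  next
    assume "\<forall>i<m. L v i = 0"
    then show "v \<in> V" using L[OF v] by (simp add: mfps_const_hom)
  qed
  have basis: "L (b k) = (\<lambda>i. if i = k then 1 else 0)" if k: "k < m" for k
  proof (rule unique[OF bB[OF k]])
    have "(\<Sum>i<m. mfps_const (if i = k then 1 else 0) * b i j) = b k j" for j
    proof -
      have "(\<Sum>i<m. mfps_const (if i = k then 1 else 0) * b i j) = (\<Sum>i<m. if i = k then b k j else 0)"
        by (intro sum.cong) (auto simp: mfps_const_hom)
      then show ?thesis using k by simp
    qed
    then show "?P (b k) (\<lambda>i. if i = k then 1 else 0)" using k V'(2) by (simp add: zero_fun_def)
  qed
  show ?thesis by (rule that[of L]) (simp_all add: add scale mem basis)
qed

lemma functional_sum:
  fixes L :: "(nat \<Rightarrow> 'f::field mfps) \<Rightarrow> nat \<Rightarrow> 'f"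
  assumes add: "\<forall>v\<in>vecs (psers c) r. \<forall>w\<in>vecs (psers c) r. \<forall>i. L (v + w) i = L v i + L w i"
    and scale: "\<forall>v\<in>vecs (psers c) r. \<forall>x i. L (mfps_const x *v v) i = x * L v i"
    and S: "finite S" "\<And>i. i \<in> S \<Longrightarrow> b i \<in> vecs (psers c) r"
  shows "(\<Sum>i\<in>S. mfps_const (x i) *v b i) \<in> vecs (psers c) r"
    "L (\<Sum>i\<in>S. mfps_const (x i) *v b i) k = (\<Sum>i\<in>S. x i * L (b i) k)"
proof -
  have "(\<Sum>i\<in>S. mfps_const (x i) *v b i) \<in> vecs (psers c) r \<and>
    L (\<Sum>i\<in>S. mfps_const (x i) *v b i) k = (\<Sum>i\<in>S. x i * L (b i) k)"
    using S
  proof (induction S)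
    case empty
    have "L 0 k = L 0 k + L 0 k" using add[rule_format, of 0 0 k] by (simp only: vecs_psers(1) add_0_left)
    then have "L 0 k = 0" by (metis add.right_neutral add_left_cancel)
    then show ?case by (simp only: sum.empty vecs_psers(1) simp_thms)
  next
    case (insert i S)
    let ?s = "\<Sum>i\<in>S. mfps_const (x i) *v b i"
    have i: "b i \<in> vecs (psers c) r" and IH: "?s \<in> vecs (psers c) r" "L ?s k = (\<Sum>i\<in>S. x i * L (b i) k)"
      using insert by blast+
    have xi: "mfps_const (x i) *v b i \<in> vecs (psers c) r" by (rule vecs_psers(4)[OF psers_gens(1) i])
    show ?case
      by (simp only: sum.insert[OF insert(1,2)] add[rule_format, OF xi IH(1)] scale[rule_format, OF i]
        IH(2) vecs_psers(2)[OF xi IH(1)] simp_thms)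
  qed
  then show "(\<Sum>i\<in>S. mfps_const (x i) *v b i) \<in> vecs (psers c) r"
    "L (\<Sum>i\<in>S. mfps_const (x i) *v b i) k = (\<Sum>i\<in>S. x i * L (b i) k)" by blast+
qed

text \<open>All products of \<open>k\<close> elements of \<open>N\<close> map \<open>v\<close> into \<open>V\<close>. The recursion allows the same argument for the
  maximal ideal of \<open>B\<close> and for \<open>\<pp>\<close>, without powers of ideals.\<close>

fun killed :: "'a::comm_ring_1 set \<Rightarrow> (nat \<Rightarrow> 'a) set \<Rightarrow> nat \<Rightarrow> (nat \<Rightarrow> 'a) \<Rightarrow> bool" where
  "killed N V 0 v \<longleftrightarrow> v \<in> V"
| "killed N V (Suc k) v \<longleftrightarrow> (\<forall>a\<in>N. killed N V k (a *v v))"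

lemma killed_max_ideal_pow:
  assumes V: "V \<in> submodules (psers c) r"
  shows "f \<in> max_ideal_pow c k \<Longrightarrow> killed (wfilt c 1) V k v \<Longrightarrow> f *v v \<in> V"
proof (induction k arbitrary: f v)
  case 0
  then show ?case using submodulesD(4)[OF subring_psers V] by (simp add: max_ideal_pow_simps)
next
  case (Suc k)
  from Suc.prems(1)[unfolded max_ideal_pow_simps] show ?case
  proof (induction rule: ideal_prod.induct)
    case (prod i j)
    have "j \<in> wfilt c 1" using prod(2) max_ideal_nth_0[of j c] by (simp add: wfilt_Suc_0_iff)
    then have "i *v (j *v v) \<in> V" using Suc prod by simp
    then show ?case by (simp add: mult.assoc)
  next
    case (sum s1 s2)
    then have "s1 *v v + s2 *v v \<in> V" using submodulesD(3)[OF subring_psers V] by blast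
    then show ?case by (simp add: distrib_right plus_fun_def)
  qed
qed

lemma not_killed_chain:
  "\<not> killed N V k v \<Longrightarrow> \<exists>u. u 0 = 1 \<and> (\<forall>i<k. \<exists>a\<in>N. u (Suc i) = a * u i) \<and> u k *v v \<notin> V"
proof (induction k arbitrary: v)
  case 0
  then show ?case by (intro exI[of _ "\<lambda>_. 1"]) simp
next
  case (Suc k)
  then obtain a where a: "a \<in> N" "\<not> killed N V k (a *v v)" by auto
  obtain u where u: "u 0 = 1" "\<forall>i<k. \<exists>a\<in>N. u (Suc i) = a * u i" "u k *v (a *v v) \<notin> V"
    using Suc.IH[OF a(2)] by blast
  define u' where "u' i = (case i of 0 \<Rightarrow> 1 | Suc j \<Rightarrow> u j * a)" for i
  have "\<exists>b\<in>N. u' (Suc i) = b * u' i" if i: "i < Suc k" for i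
  proof (cases i)
    case 0
    then show ?thesis using a u(1) by (intro bexI[of _ a]) (auto simp: u'_def)
  next
    case (Suc j)
    then obtain b where "b \<in> N" "u (Suc j) = b * u j" using u(2) i by auto
    then show ?thesis using Suc by (intro bexI[of _ b]) (auto simp: u'_def mult_ac)
  qed
  moreover have "u' (Suc k) *v v \<notin> V" using u(3) by (simp add: u'_def mult.assoc)
  ultimately show ?case by (intro exI[of _ u']) (auto simp: u'_def)
qed

text \<open>Nakayama in quantitative form: along a chain \<open>v, a\<^sub>1 v, a\<^sub>2 a\<^sub>1 v, \<dots>\<close> with \<open>a\<^sub>i\<close> in the maximal
  ideal, a linear relation modulo \<open>V\<close> is a unit times its first member, so \<open>m + 1\<close> members cannot
  all lie outside \<open>V\<close> when the colength is \<open>m\<close>.\<close>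

lemma quotient_basis_killed:
  fixes V :: "(nat \<Rightarrow> 'f::field mfps) set"
  assumes V: "V \<in> submodules (psers c) r" and b: "quotient_basis c r V m b" and v: "v \<in> vecs (psers c) r"
  shows "killed (wfilt c 1) V m v"
proof (rule ccontr)
  assume "\<not> killed (wfilt c 1) V m v"
  then obtain u where u: "u 0 = 1" "\<And>i. i < m \<Longrightarrow> \<exists>a\<in>psers c. mfps_nth a 0 = 0 \<and> u (Suc i) = a * u i" "u m *v v \<notin> V"
    using not_killed_chain[of "wfilt c 1" V m v] by (metis wfilt_Suc_0_iff)
  note V' = submodulesD[OF subring_psers V]
  obtain L where LL:
    "\<forall>v\<in>vecs (psers c) r. \<forall>w\<in>vecs (psers c) r. \<forall>i. L (v + w) i = L v i + L w i"
    "\<forall>v\<in>vecs (psers c) r. \<forall>x i. L (mfps_const x *v v) i = x * L v i"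
    "\<forall>v\<in>vecs (psers c) r. v \<in> V \<longleftrightarrow> (\<forall>i<m. L v i = 0)"
    "\<forall>i<m. \<forall>k<m. L (b k) i = (if i = k then 1 else 0)"
    using quotient_basis_functionals[OF V b] by blast
  note L = LL[rule_format]
  have up: "i \<le> m \<Longrightarrow> u i \<in> psers c" for i
  proof (induction i)
    case (Suc i)
    then obtain a where "a \<in> psers c" "u (Suc i) = a * u i" using u(2)[of i] by auto
    then show ?case using Suc by simp
  qed (simp add: u(1))
  have mult: "\<exists>a\<in>psers c. (i < k \<longrightarrow> mfps_nth a 0 = 0) \<and> u k = a * u i" if "i \<le> k" "k \<le> m" for i k
    using that
  proof (induction k rule: dec_induct)
    case base
    show ?case by (intro bexI[of _ 1]) auto
  next
    case (step k)
    then obtain a a' where "a \<in> psers c" "u k = a * u i" "a' \<in> psers c" "mfps_nth a' 0 = 0" "u (Suc k) = a' * u k"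
      using u(2)[of k] by auto
    then show ?case by (intro bexI[of _ "a' * a"]) (auto simp: mult.assoc)
  qed
  obtain x where x: "\<exists>i\<in>{..m}. x i \<noteq> 0" "\<And>j. j < m \<Longrightarrow> (\<Sum>i\<le>m. x i * L (u i *v v) j) = 0"
    using underdetermined_system[of "{..m}" m "\<lambda>i j. L (u i *v v) j"] by auto
  have uv: "u i *v v \<in> vecs (psers c) r" if "i \<in> {..m}" for i using up[of i] v that by auto
  note sum = functional_sum[where S = "{..m}" and b = "\<lambda>i. u i *v v" and x = x, OF LL(1,2) finite_atMost uv]
  have rel: "(\<Sum>i\<le>m. mfps_const (x i) *v (u i *v v)) \<in> V" using L(3)[OF sum(1)] sum(2) x(2) by simp
  define k where "k = (LEAST i. i \<le> m \<and> x i \<noteq> 0)"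
  have "k \<le> m \<and> x k \<noteq> 0" unfolding k_def by (rule LeastI_ex) (use x(1) in auto)
  then have k: "k \<le> m" "x k \<noteq> 0" by auto
  have below: "x i = 0" if "i < k" for i using not_less_Least[of i "\<lambda>i. i \<le> m \<and> x i \<noteq> 0"] that k unfolding k_def by auto
  have "\<exists>a. \<forall>i\<in>{k..m}. a i \<in> psers c \<and> (k < i \<longrightarrow> mfps_nth (a i) 0 = 0) \<and> u i = a i * u k"
    using mult[of k] by (intro bchoice ballI) (auto simp: Bex_def)
  then obtain a where "\<forall>i\<in>{k..m}. a i \<in> psers c \<and> (k < i \<longrightarrow> mfps_nth (a i) 0 = 0) \<and> u i = a i * u k" ..
  note A = bspec[OF this]
  have a: "k \<le> i \<Longrightarrow> i \<le> m \<Longrightarrow> a i \<in> psers c" "k < i \<Longrightarrow> i \<le> m \<Longrightarrow> mfps_nth (a i) 0 = 0"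
     "k \<le> i \<Longrightarrow> i \<le> m \<Longrightarrow> u i = a i * u k" for i
    using A[of i] atLeastAtMost_iff[of i k m] less_imp_le[of k i] by blast+
  define e where "e = mfps_const (x k) + (\<Sum>i\<in>{Suc k..m}. mfps_const (x i) * a i)"
  have e: "e \<in> psers c" "mfps_nth e 0 \<noteq> 0" using a k by (auto simp: e_def intro!: psers_closed)
  have "(\<Sum>i\<le>m. mfps_const (x i) *v (u i *v v)) = e *v (u k *v v)"
  proof
    fix j
    have "(\<Sum>i\<le>m. mfps_const (x i) *v (u i *v v)) j = (\<Sum>i\<le>m. mfps_const (x i) * (u i * v j))" 
      by (induction m) (simp_all add: plus_fun_def)
    also have "\<dots> = (\<Sum>i\<in>{k..m}. mfps_const (x i) * (u i * v j))"
      using below by (intro sum.mono_neutral_right) (auto simp: mfps_const_hom not_le)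
    also have "\<dots> = mfps_const (x k) * (u k * v j) + (\<Sum>i\<in>{Suc k..m}. mfps_const (x i) * (u i * v j))"
      using k(1) by (simp add: sum.atLeast_Suc_atMost)
    also have "(\<Sum>i\<in>{Suc k..m}. mfps_const (x i) * (u i * v j)) = (\<Sum>i\<in>{Suc k..m}. mfps_const (x i) * a i) * (u k * v j)"
      unfolding sum_distrib_right
    proof (rule sum.cong[OF refl])
      fix i assume "i \<in> {Suc k..m}"
      then have "u i = a i * u k" using a(3)[of i] by simp
      then show "mfps_const (x i) * (u i * v j) = mfps_const (x i) * a i * (u k * v j)"
        by (simp only: mult.assoc)
    qed
    finally show "(\<Sum>i\<le>m. mfps_const (x i) *v (u i *v v)) j = (e *v (u k *v v)) j"
      by (simp add: e_def distrib_right)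
  qed
  then have ev: "e *v (u k *v v) \<in> V" using rel by simp
  obtain h where h: "h \<in> psers c" "e * h = 1" using psers_unit[OF e] by blast
  have "a m *v (h *v (e *v (u k *v v))) \<in> V"
    using a(1)[of m] k(1) h(1) ev V'(4) by blast
  also have "a m *v (h *v (e *v (u k *v v))) = u m *v v"
  proof
    fix j
    have "a m * (h * (e * (u k * v j))) = (e * h) * (a m * u k) * v j" by (simp add: mult_ac)
    then show "(a m *v (h *v (e *v (u k *v v)))) j = (u m *v v) j" using h(2) a(3)[of m] k(1) by simp
  qed
  finally show False using u(3) by contradiction
qed

definition wvecs :: "nat \<Rightarrow> nat \<Rightarrow> nat \<Rightarrow> (nat \<Rightarrow> 'a::comm_ring_1 mfps) set" where
  "wvecs c r t = vecs (wfilt c t) r"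

lemma wvecs_subset_hull:
  assumes V: "V \<in> submodules (psers c) r"
    and "\<And>a v. a \<in> max_ideal_pow c m \<Longrightarrow> v \<in> vecs (psers c) r \<Longrightarrow> a *v v \<in> V"
  shows "wvecs c r (Suc (2 * c) * m) \<subseteq> V"
proof
  fix v :: "nat \<Rightarrow> 'a mfps" assume v: "v \<in> wvecs c r (Suc (2 * c) * m)"
  define d where "d k = (\<lambda>j. if j = k then 1 else 0 :: 'a mfps)" for k :: nat
  have "v k *v d k \<in> V" if "k < r" for k
    using that v by (intro assms wfilt_subset_max_ideal_pow) (auto simp: wvecs_def vecs_def d_def)
  then have "(\<Sum>k<r. v k *v d k) \<in> V" by (intro submodules_sum[OF subring_psers V]) auto
  also have "(\<Sum>k<r. v k *v d k) = v"
  proof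
    fix j
    have "(\<Sum>k<r. v k *v d k) j = (\<Sum>k<r. if k = j then v j else 0)"
      by (induction r) (auto simp: plus_fun_def d_def)
    then show "(\<Sum>k<r. v k *v d k) j = v j" using v by (auto simp: wvecs_def vecs_def)
  qed
  finally show "v \<in> V" .
qed

lemma quotient_basis_max_ideal_pow:
  fixes V :: "(nat \<Rightarrow> 'f::field mfps) set"
  assumes "V \<in> submodules (psers c) r" "quotient_basis c r V m b" "v \<in> vecs (psers c) r" "a \<in> max_ideal_pow c m"
  shows "a *v v \<in> V"
  using killed_max_ideal_pow[OF assms(1,4)] quotient_basis_killed[OF assms(1-3)] by blast

lemma quotient_basis_wvecs:
  fixes V :: "(nat \<Rightarrow> 'f::field mfps) set"
  assumes "V \<in> submodules (psers c) r" "quotient_basis c r V m b"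
  shows "wvecs c r (Suc (2 * c) * m) \<subseteq> V"
  using quotient_basis_max_ideal_pow[OF assms] by (intro wvecs_subset_hull assms(1)) auto

section \<open>The pairing between power series and polynomials\<close>

lemma range_combination:
  "w = (\<Sum>i<m. vscale (x i) (e i)) \<Longrightarrow> w \<in> range (\<lambda>x. \<Sum>i<m. vscale (x i) (e i))"
  by (rule range_eqI[where x = x])

lemma is_basis_iff:
  "is_basis m e W \<longleftrightarrow> (\<forall>x. (\<Sum>i<m. vscale (x i) (e i)) = 0 \<longrightarrow> (\<forall>i<m. x i = 0)) \<and>
    W = range (\<lambda>x. \<Sum>i<m. vscale (x i) (e i))"
proof
  assume "is_basis m e W"
  then have inj: "inj_on e {..<m}" and ind: "vec.independent (e ` {..<m})" and W: "W = vec.span (e ` {..<m})"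
    by (auto simp: is_basis_def)
  have to_image: "(\<Sum>i<m. vscale (x i) (e i)) = (\<Sum>v\<in>e ` {..<m}. vscale (x (the_inv_into {..<m} e v)) v)" for x
    using inj by (simp add: sum.reindex the_inv_into_f_f)
  show "(\<forall>x. (\<Sum>i<m. vscale (x i) (e i)) = 0 \<longrightarrow> (\<forall>i<m. x i = 0)) \<and>
    W = range (\<lambda>x. \<Sum>i<m. vscale (x i) (e i))"
  proof (intro conjI allI impI)
    fix x i assume x: "(\<Sum>i<m. vscale (x i) (e i)) = 0" and i: "i < m"
    have "x (the_inv_into {..<m} e (e i)) = 0"
      using vec.independentD[OF ind _ subset_refl x[unfolded to_image]] i by simp
    then show "x i = 0" using inj i by (simp add: the_inv_into_f_f)
  next
    have "vec.span (e ` {..<m}) = range (\<lambda>u. \<Sum>v\<in>e ` {..<m}. vscale (u v) v)"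
      by (rule vec.span_finite) simp
    also have "\<dots> = range (\<lambda>x. \<Sum>i<m. vscale (x i) (e i))"
    proof (intro subset_antisym subsetI)
      fix w assume "w \<in> range (\<lambda>u. \<Sum>v\<in>e ` {..<m}. vscale (u v) v)"
      then obtain u where "w = (\<Sum>v\<in>e ` {..<m}. vscale (u v) v)" by blast
      then have "w = (\<Sum>i<m. vscale (u (e i)) (e i))" using inj by (simp add: sum.reindex)
      then show "w \<in> range (\<lambda>x. \<Sum>i<m. vscale (x i) (e i))" by (rule range_combination)
    qed (auto simp: to_image)
    finally show "W = range (\<lambda>x. \<Sum>i<m. vscale (x i) (e i))" using W by simp
  qed
next
  assume *: "(\<forall>x. (\<Sum>i<m. vscale (x i) (e i)) = 0 \<longrightarrow> (\<forall>i<m. x i = 0)) \<and>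
    W = range (\<lambda>x. \<Sum>i<m. vscale (x i) (e i))"
  then have W: "W = range (\<lambda>x. \<Sum>i<m. vscale (x i) (e i))" by blast
  from * have ind: "\<And>x i. (\<Sum>i<m. vscale (x i) (e i)) = 0 \<Longrightarrow> i < m \<Longrightarrow> x i = 0" by blast
  have inj: "inj_on e {..<m}"
  proof (rule inj_onI, rule ccontr)
    fix i j assume ij: "i \<in> {..<m}" "j \<in> {..<m}" "e i = e j" "i \<noteq> j"
    define x where "x k = (if k = i then 1 else 0) - (if k = j then 1 else 0 :: 'a)" for k
    have "(\<Sum>k<m. vscale (x k) (e k)) = (\<Sum>k<m. if k = i then e i else 0) - (\<Sum>k<m. if k = j then e j else 0)"
      unfolding x_def sum_subtractf[symmetric] by (intro sum.cong) (auto simp: vec.scale_left_diff_distrib)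
    also have "\<dots> = 0" using ij by simp
    finally have "x i = 0" using ind ij by blast
    then show False using ij by (simp add: x_def)
  qed
  have "vec.independent (e ` {..<m})"
  proof (rule vec.independent_if_scalars_zero)
    fix u v assume u: "(\<Sum>v\<in>e ` {..<m}. vscale (u v) v) = 0" and v: "v \<in> e ` {..<m}"
    have "(\<Sum>i<m. vscale (u (e i)) (e i)) = 0" using u inj by (simp add: sum.reindex)
    then show "u v = 0" using ind[of "\<lambda>i. u (e i)"] v by auto
  qed simp
  moreover have "vec.span (e ` {..<m}) = W"
  proof (intro subset_antisym)
    define F where "F x = (\<Sum>i<m. vscale (x i) (e i))" for x
    have WF: "W = range F" unfolding W F_def ..
    have "vec.subspace W"
      unfolding vec.subspace_def
    proof (intro conjI ballI allI)
      have "0 = F (\<lambda>_. 0)" by (simp add: F_def)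
      then show "0 \<in> W" unfolding WF by blast
    next
      fix v w assume "v \<in> W" "w \<in> W"
      then obtain x y where "v = F x" "w = F y" unfolding WF by blast
      then have "v + w = F (\<lambda>i. x i + y i)" by (simp add: F_def vec.scale_left_distrib sum.distrib)
      then show "v + w \<in> W" unfolding WF by blast
    next
      fix a v assume "v \<in> W"
      then obtain x where "v = F x" unfolding WF by blast
      then have "vscale a v = F (\<lambda>i. a * x i)" by (simp add: F_def vec.scale_sum_right)
      then show "vscale a v \<in> W" unfolding WF by blast
    qed
    moreover have "e ` {..<m} \<subseteq> W"
    proof clarify
      fix k assume "k < m"
      then have "e k = F (\<lambda>i. if i = k then 1 else 0)"
        by (simp add: F_def if_distrib[of "\<lambda>x. vscale x _"] cong: if_cong)
      then show "e k \<in> W" unfolding WF by blast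
    qed
    ultimately show "vec.span (e ` {..<m}) \<subseteq> W" by (rule vec.span_minimal[rotated])
    show "W \<subseteq> vec.span (e ` {..<m})"
      unfolding W by (rule image_subsetI, rule vec.span_sum, rule vec.span_scale, rule vec.span_base) simp
  qed
  ultimately show "is_basis m e W" using inj by (simp add: is_basis_def)
qed

lemma is_basis_unique_dim:
  assumes e: "is_basis m e W" and e': "is_basis k e' W" shows "m \<le> k"
proof -
  have "e ` {..<m} \<subseteq> vec.span (e' ` {..<k})"
    using e e' vec.span_superset[of "e ` {..<m}"] by (simp add: is_basis_def)
  moreover have "vec.independent (e ` {..<m})" using e by (simp add: is_basis_def)
  ultimately have "card (e ` {..<m}) \<le> card (e' ` {..<k})"
    using vec.independent_span_bound[of "e' ` {..<k}" "e ` {..<m}"] by simp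
  also have "\<dots> \<le> k" using card_image_le[of "{..<k}" e'] by simp
  finally show ?thesis using e by (simp add: is_basis_def card_image)
qed

text \<open>The pairing \<open>\<langle>y\<^sup>\<alpha>, z\<^sup>\<beta>\<rangle> = \<alpha>!\<close> if \<open>\<alpha> = \<beta>\<close>, and \<open>0\<close> otherwise. It is the value at \<open>z = 0\<close> of the
  action of the power series as a differential operator.\<close>

definition pair1 :: "'a::comm_ring_1 mfps \<Rightarrow> 'a mpoly \<Rightarrow> 'a" where
  "pair1 v w = (\<Sum>\<beta>\<in>keys w. of_nat (mfact \<beta>) * mfps_nth v \<beta> * lookup w \<beta>)"

lemma pair1_superset:
  assumes "finite S" "keys w \<subseteq> S"
  shows "pair1 v w = (\<Sum>\<beta>\<in>S. of_nat (mfact \<beta>) * mfps_nth v \<beta> * lookup w \<beta>)"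
  unfolding pair1_def using assms by (intro sum.mono_neutral_left) (auto simp: in_keys_iff)

lemma pair1_add_left: "pair1 (u + v) w = pair1 u w + pair1 v w"
  by (simp add: pair1_def algebra_simps sum.distrib)

lemma pair1_diff_left: "pair1 (u - v) w = pair1 u w - pair1 v w"
  by (simp add: pair1_def algebra_simps sum_subtractf)

lemma pair1_const_left: "pair1 (mfps_const x * v) w = x * pair1 v w"
  by (simp add: pair1_def sum_distrib_left) (simp add: mult_ac)

lemma pair1_zero [simp]: "pair1 0 w = 0" "pair1 v 0 = 0"
  by (simp_all add: pair1_def)

lemma pair1_add_right: "pair1 u (v + w) = pair1 u v + pair1 u w"
proof -
  have "keys (v + w) \<subseteq> keys v \<union> keys w" by (rule keys_add)
  then show ?thesis
    by (subst (1 2 3) pair1_superset[of "keys v \<union> keys w"]) (auto simp: lookup_add algebra_simps sum.distrib)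
qed

lemma pair1_scale_right: "pair1 v (Poly_Mapping.map ((*) x) w) = x * pair1 v w"
proof -
  have "keys (Poly_Mapping.map ((*) x) w) \<subseteq> keys w" by (auto simp: in_keys_iff lookup_map_times)
  then show ?thesis
    by (subst (1 2) pair1_superset[of "keys w"]) (auto simp: lookup_map_times sum_distrib_left mult_ac)
qed

lemma pair1_monom_mult:
  assumes S: "finite S" "{\<alpha>. \<alpha> + \<gamma> \<in> keys w} \<subseteq> S"
  shows "pair1 (mfps_monom \<gamma> * v) w = (\<Sum>\<alpha>\<in>S. of_nat (mfact (\<alpha> + \<gamma>)) * mfps_nth v \<alpha> * lookup w (\<alpha> + \<gamma>))"
proof -
  let ?A = "{\<alpha>. \<alpha> + \<gamma> \<in> keys w}"
  let ?t = "\<lambda>\<beta>. of_nat (mfact \<beta>) * mfps_nth (mfps_monom \<gamma> * v) \<beta> * lookup w \<beta>"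
  have "pair1 (mfps_monom \<gamma> * v) w = (\<Sum>\<beta>\<in>(\<lambda>\<alpha>. \<alpha> + \<gamma>) ` ?A. ?t \<beta>)"
    unfolding pair1_def
  proof (rule sum.mono_neutral_right)
    show "\<forall>\<beta>\<in>keys w - (\<lambda>\<alpha>. \<alpha> + \<gamma>) ` ?A. ?t \<beta> = 0"
    proof
      fix \<beta> assume \<beta>: "\<beta> \<in> keys w - (\<lambda>\<alpha>. \<alpha> + \<gamma>) ` ?A"
      have "mfps_nth (mfps_monom \<gamma> * v) \<beta> = 0"
        using \<beta> by (intro mfps_nth_monom_mult_0) (auto simp: add.commute image_iff)
      then show "?t \<beta> = 0" by simp
    qed
  qed auto
  also have "\<dots> = (\<Sum>\<alpha>\<in>?A. of_nat (mfact (\<alpha> + \<gamma>)) * mfps_nth v \<alpha> * lookup w (\<alpha> + \<gamma>))"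
    by (subst sum.reindex) (auto intro!: inj_onI sum.cong simp: mfps_nth_monom_mult[of \<gamma> v, unfolded add.commute[of \<gamma>]])
  also have "\<dots> = (\<Sum>\<alpha>\<in>S. of_nat (mfact (\<alpha> + \<gamma>)) * mfps_nth v \<alpha> * lookup w (\<alpha> + \<gamma>))"
    using S by (intro sum.mono_neutral_left) (auto simp: in_keys_iff)
  finally show ?thesis .
qed

lemma finite_shifted_keys: "finite {\<alpha>. \<alpha> + \<gamma> \<in> keys (w :: 'a::zero mpoly)}"
  using finite_vimageI[OF finite_keys, of "\<lambda>\<alpha>. \<alpha> + \<gamma>" w] by (simp add: vimage_def inj_def)

text \<open>Multiplication by \<open>y\<^sub>i\<close> is adjoint to \<open>\<partial>/\<partial>z\<^sub>i\<close>.\<close>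

lemma pair1_pd: "pair1 v (pd i w) = pair1 (mfps_var i * v) w"
proof -
  let ?S = "{\<alpha>. \<alpha> + single i 1 \<in> keys w}"
  have "keys (pd i w) \<subseteq> ?S" by (auto simp: in_keys_iff lookup_pd)
  then have "pair1 v (pd i w) = (\<Sum>\<alpha>\<in>?S. of_nat (mfact \<alpha>) * mfps_nth v \<alpha> * lookup (pd i w) \<alpha>)"
    by (rule pair1_superset[OF finite_shifted_keys])
  also have "\<dots> = (\<Sum>\<alpha>\<in>?S. of_nat (mfact (\<alpha> + single i 1)) * mfps_nth v \<alpha> * lookup w (\<alpha> + single i 1))"
    by (intro sum.cong refl) (simp add: lookup_pd mfact_plus_single algebra_simps)
  also have "\<dots> = pair1 (mfps_var i * v) w"
    unfolding mfps_monom_simps(2)[symmetric] by (rule pair1_monom_mult[symmetric, OF finite_shifted_keys]) auto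
  finally show ?thesis .
qed

definition pair :: "nat \<Rightarrow> (nat \<Rightarrow> 'a::comm_ring_1 mfps) \<Rightarrow> (nat \<Rightarrow> 'a mpoly) \<Rightarrow> 'a" where
  "pair r v w = (\<Sum>j<r. pair1 (v j) (w j))"

lemma pair_left:
  "pair r (u + v) w = pair r u w + pair r v w" "pair r (u - v) w = pair r u w - pair r v w"
  "pair r (mfps_const x *v v) w = x * pair r v w" "pair r 0 w = 0"
  by (simp_all add: pair_def pair1_add_left pair1_diff_left pair1_const_left sum.distrib sum_subtractf sum_distrib_left)

lemma pair_right:
  "pair r u (v + w) = pair r u v + pair r u w" "pair r u (vscale x w) = x * pair r u w" "pair r u 0 = 0"
  by (simp_all add: pair_def pair1_add_right pair1_scale_right sum.distrib sum_distrib_left vscale_def)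

lemma pair_sum_left: "pair r (\<Sum>i\<in>S. mfps_const (x i) *v b i) w = (\<Sum>i\<in>S. x i * pair r (b i) w)"
  by (induction S rule: infinite_finite_induct) (simp_all only: sum.infinite sum.empty sum.insert pair_left not_False_eq_True)

lemma pair_sum_right: "pair r v (\<Sum>i\<in>S. vscale (x i) (e i)) = (\<Sum>i\<in>S. x i * pair r v (e i))"
  by (induction S rule: infinite_finite_induct) (simp_all only: sum.infinite sum.empty sum.insert pair_right not_False_eq_True)

lemma pair_diff_right:
  fixes u :: "nat \<Rightarrow> 'a::field mfps"
  shows "pair r u (v - w) = pair r u v - pair r u w"
  using pair_right(1)[of r u "v - w" w] by (simp add: eq_diff_eq)

lemma sum_pointwise: "sum f S j = (\<Sum>x\<in>S. f x j)"
  by (induction S rule: infinite_finite_induct) auto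

lemma vscale_vecs: "w \<in> vecs (pring c) r \<Longrightarrow> vscale x w \<in> vecs (pring c) r"
  by (auto simp: vecs_def vscale_def polys_def in_keys_iff lookup_map_times intro!: poly_mapping_eqI)

definition annihilator :: "nat \<Rightarrow> nat \<Rightarrow> (nat \<Rightarrow> 'a::comm_ring_1 mpoly) set \<Rightarrow> (nat \<Rightarrow> 'a mfps) set" where
  "annihilator c r W = {v \<in> vecs (psers c) r. \<forall>w\<in>W. pair r v w = 0}"

definition unit_vec :: "nat \<Rightarrow> mindex \<Rightarrow> nat \<Rightarrow> 'a::comm_ring_1 mfps" where
  "unit_vec k \<alpha> = (\<lambda>j. if j = k then mfps_monom \<alpha> else 0)"

lemma unit_vec_vecs: "k < r \<Longrightarrow> keys \<alpha> \<subseteq> {..<c} \<Longrightarrow> unit_vec k \<alpha> \<in> vecs (psers c) r"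
  by (auto simp: unit_vec_def vecs_def)

lemma pair1_monom: "pair1 (mfps_monom \<alpha>) w = of_nat (mfact \<alpha>) * lookup w \<alpha>"
proof -
  have "pair1 (mfps_monom \<alpha>) w = (\<Sum>\<beta>\<in>insert \<alpha> (keys w). of_nat (mfact \<beta>) * mfps_nth (mfps_monom \<alpha>) \<beta> * lookup w \<beta>)"
    by (rule pair1_superset) auto
  also have "\<dots> = (\<Sum>\<beta>\<in>insert \<alpha> (keys w). if \<beta> = \<alpha> then of_nat (mfact \<alpha>) * lookup w \<alpha> else 0)"
    by (intro sum.cong) auto
  also have "\<dots> = of_nat (mfact \<alpha>) * lookup w \<alpha>" by (subst sum.delta) auto
  finally show ?thesis .
qed

lemma pair_unit_vec: assumes "k < r" shows "pair r (unit_vec k \<alpha>) w = of_nat (mfact \<alpha>) * lookup (w k) \<alpha>"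
proof -
  have "pair r (unit_vec k \<alpha>) w = (\<Sum>j<r. if j = k then of_nat (mfact \<alpha>) * lookup (w k) \<alpha> else 0)"
    unfolding pair_def unit_vec_def by (intro sum.cong) (auto simp: pair1_monom)
  then show ?thesis using assms by simp
qed

lemma finite_wt_less: "finite {\<alpha>. keys \<alpha> \<subseteq> {..<c} \<and> wt c \<alpha> < t}"
proof -
  have "{\<alpha>. keys \<alpha> \<subseteq> {..<c} \<and> wt c \<alpha> < t} = (\<Union>s<t. {\<alpha>. keys \<alpha> \<subseteq> {..<c} \<and> wt c \<alpha> = s})" by auto
  then show ?thesis using finite_wt_eq by simp
qed

lemma wfilt_truncation:
  assumes a: "a \<in> psers c"
  shows "a - (\<Sum>\<alpha> | keys \<alpha> \<subseteq> {..<c} \<and> wt c \<alpha> < t. mfps_const (mfps_nth a \<alpha>) * mfps_monom \<alpha>) \<in> wfilt c t"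
    (is "a - ?s \<in> _")
  unfolding wfilt_def
proof (intro CollectI conjI allI impI)
  let ?A = "{\<alpha>. keys \<alpha> \<subseteq> {..<c} \<and> wt c \<alpha> < t}"
  have "?s \<in> psers c" by (intro psers_closed psers_gens) auto
  then show "a - ?s \<in> psers c" using a by simp
  fix \<beta> assume nz: "mfps_nth (a - ?s) \<beta> \<noteq> 0"
  have "mfps_nth ?s \<beta> = (\<Sum>\<alpha>\<in>?A. if \<alpha> = \<beta> then mfps_nth a \<beta> else 0)"
    unfolding mfps_nth_sum by (intro sum.cong) auto
  also have "\<dots> = (if \<beta> \<in> ?A then mfps_nth a \<beta> else 0)" by (rule sum.delta[OF finite_wt_less])
  finally have "\<beta> \<notin> ?A" "mfps_nth a \<beta> \<noteq> 0" using nz by (auto split: if_splits)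
  then show "t \<le> wt c \<beta>" using a by (auto simp: psers_def)
qed

lemma finite_weight:
  assumes w: "w \<in> vecs (pring c) r"
  obtains t where "\<And>j \<beta>. \<beta> \<in> keys (w j) \<Longrightarrow> wt c \<beta> < t"
proof
  fix j \<beta> assume \<beta>: "\<beta> \<in> keys (w j)"
  then have j: "j < r" using w by (cases "j < r") (auto simp: vecs_def)
  have "wt c \<beta> \<le> (\<Sum>\<beta>\<in>keys (w j). wt c \<beta>)" using \<beta> by (intro member_le_sum) auto
  also have "\<dots> \<le> (\<Sum>j<r. \<Sum>\<beta>\<in>keys (w j). wt c \<beta>)"
    using j by (intro member_le_sum[of j "{..<r}" "\<lambda>j. \<Sum>\<beta>\<in>keys (w j). wt c \<beta>"]) auto
  finally show "wt c \<beta> < Suc (\<Sum>j<r. \<Sum>\<beta>\<in>keys (w j). wt c \<beta>)" by simp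
qed

lemma pair1_wfilt_eq_0:
  assumes "u \<in> wfilt c t" "\<And>\<beta>. \<beta> \<in> keys w \<Longrightarrow> wt c \<beta> < t" shows "pair1 u w = 0"
  unfolding pair1_def using assms by (intro sum.neutral) (auto simp: wfilt_nth_0)

context residue_map
begin

text \<open>All coefficients of \<open>v \<cdot> w\<close> are pairings of multiples of \<open>v\<close> with \<open>w\<close>. Hence for a submodule the
  condition that defines \<open>perp\<close> can be tested by the pairing.\<close>

lemma lookup_ps_act:
  fixes v :: "'f mfps"
  shows "of_nat (mfact \<gamma>) * lookup (ps_act v w) \<gamma> = pair1 (mfps_monom \<gamma> * v) w"
proof -
  let ?S = "{\<alpha>. mpd \<alpha> w \<noteq> 0}"
  have "\<alpha> \<in> ?S" if "\<alpha> + \<gamma> \<in> keys w" for \<alpha>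
  proof -
    have "of_nat (mfact \<gamma>) * lookup (mpd \<alpha> w) \<gamma> \<noteq> 0"
      using that unfolding lookup_mpd by (simp add: in_keys_iff)
    then show ?thesis by auto
  qed
  then have "pair1 (mfps_monom \<gamma> * v) w = (\<Sum>\<alpha>\<in>?S. of_nat (mfact (\<alpha> + \<gamma>)) * mfps_nth v \<alpha> * lookup w (\<alpha> + \<gamma>))"
    by (intro pair1_monom_mult mpd_nonzero_finite) auto
  also have "\<dots> = (\<Sum>\<alpha>\<in>?S. mfps_nth v \<alpha> * (of_nat (mfact \<gamma>) * lookup (mpd \<alpha> w) \<gamma>))"
    unfolding lookup_mpd by (simp add: mult_ac)
  also have "\<dots> = of_nat (mfact \<gamma>) * lookup (ps_act v w) \<gamma>"
    by (simp add: ps_act_def lookup_sum lookup_map_times sum_distrib_left mult_ac)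
  finally show ?thesis ..
qed

lemma perp_eq:
  fixes V :: "(nat \<Rightarrow> 'f mfps) set"
  assumes V: "V \<in> submodules (psers c) r"
  shows "perp c r V = {w \<in> vecs (pring c) r. \<forall>v\<in>V. pair r v w = 0}"
proof -
  have key: "of_nat (mfact \<gamma>) * lookup (\<Sum>j<r. ps_act (v j) (w j)) \<gamma> = pair r (mfps_monom \<gamma> *v v) w"
    for v :: "nat \<Rightarrow> 'f mfps" and w \<gamma>
    by (simp add: lookup_sum sum_distrib_left lookup_ps_act pair_def)
  have "(\<forall>v\<in>V. (\<Sum>j<r. ps_act (v j) (w j)) = 0) \<longleftrightarrow> (\<forall>v\<in>V. pair r v w = 0)" if w: "w \<in> vecs (pring c) r" for w
  proof
    assume *: "\<forall>v\<in>V. (\<Sum>j<r. ps_act (v j) (w j)) = 0"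
    show "\<forall>v\<in>V. pair r v w = 0"
    proof
      fix v assume "v \<in> V"
      then show "pair r v w = 0" using key[of 0 v w] * by (simp add: mfps_monom_simps)
    qed
  next
    assume *: "\<forall>v\<in>V. pair r v w = 0"
    show "\<forall>v\<in>V. (\<Sum>j<r. ps_act (v j) (w j)) = 0"
    proof
      fix v assume v: "v \<in> V"
      show "(\<Sum>j<r. ps_act (v j) (w j)) = 0"
      proof (intro poly_mapping_eqI)
        fix \<gamma>
        have "pair r (mfps_monom \<gamma> *v v) w = 0"
        proof (cases "keys \<gamma> \<subseteq> {..<c}")
          case True
          then have "mfps_monom \<gamma> *v v \<in> V" using submodulesD(4)[OF subring_psers V] v by blast
          then show ?thesis using * by blast
        next
          case False
          have "pair1 (mfps_monom \<gamma> * v j) (w j) = 0" for j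
          proof -
            have "w j \<in> pring c" using w by (rule vecs_nth) simp
            then have "\<alpha> + \<gamma> \<notin> keys (w j)" for \<alpha>
              using False polys_def keys_add_mindex[of \<alpha> \<gamma>] by blast
            then show ?thesis using pair1_monom_mult[of "{}" \<gamma> "w j" "v j"] by simp
          qed
          then show ?thesis by (simp add: pair_def)
        qed
        then show "lookup (\<Sum>j<r. ps_act (v j) (w j)) \<gamma> = lookup 0 \<gamma>"
          using key[of \<gamma> v w] by simp
      qed
    qed
  qed
  then show ?thesis unfolding perp_def by blast
qed

lemma pair_nondegenerate:
  fixes w :: "nat \<Rightarrow> 'f mpoly"
  assumes w: "w \<in> vecs (pring c) r" and "\<And>v. v \<in> vecs (psers c) r \<Longrightarrow> pair r v w = 0"
  shows "w = 0"
proof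
  fix k
  show "w k = 0 k"
  proof (cases "k < r")
    case True
    have "lookup (w k) \<alpha> = 0" for \<alpha>
    proof (cases "keys \<alpha> \<subseteq> {..<c}")
      case t: True
      then show ?thesis
        using assms(2)[OF unit_vec_vecs[OF True t]] pair_unit_vec[OF True, of \<alpha> w] by simp
    next
      case False
      then show ?thesis using polys_lookupD[of "w k" "{..<c}" \<alpha>] vecs_nth[OF w, of k] by auto
    qed
    then show ?thesis by (auto intro: poly_mapping_eqI)
  qed (use w in \<open>auto simp: vecs_def\<close>)
qed

text \<open>Gram-Schmidt: the component of \<open>e\<^sub>m\<close> outside the span of the preceding vectors is detected by some
  \<open>v\<close>, which is corrected to vanish on these vectors.\<close>

lemma dual_family:
  fixes e :: "nat \<Rightarrow> nat \<Rightarrow> 'f mpoly"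
  assumes "\<And>i. i < m \<Longrightarrow> e i \<in> vecs (pring c) r"
    and "\<And>x i. (\<Sum>i<m. vscale (x i) (e i)) = 0 \<Longrightarrow> i < m \<Longrightarrow> x i = 0"
  shows "\<exists>b. \<forall>i<m. b i \<in> vecs (psers c) r \<and> (\<forall>k<m. pair r (b i) (e k) = (if i = k then 1 else 0))"
  using assms
proof (induction m)
  case (Suc m)
  have "x i = 0" if "(\<Sum>i<m. vscale (x i) (e i)) = 0" "i < m" for x i
  proof -
    have "(\<Sum>i<Suc m. vscale ((x(m := 0)) i) (e i)) = 0" using that by simp
    from Suc.prems(2)[OF this, of i] show ?thesis using that by simp
  qed
  then obtain b where b: "\<And>i. i < m \<Longrightarrow> b i \<in> vecs (psers c) r"
    "\<And>i k. i < m \<Longrightarrow> k < m \<Longrightarrow> pair r (b i) (e k) = (if i = k then 1 else 0)"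
  proof -
    have "\<exists>b. \<forall>i<m. b i \<in> vecs (psers c) r \<and> (\<forall>k<m. pair r (b i) (e k) = (if i = k then 1 else 0))"
      by (rule Suc.IH) (use Suc.prems(1) in simp, fact)
    then show thesis using that by blast
  qed
  define w where "w = e m - (\<Sum>i<m. vscale (pair r (b i) (e m)) (e i))"
  have "w \<in> vecs (pring c) r"
    unfolding w_def using Suc.prems(1) by (intro vecs_polys vecs_sum[OF subring_polys] vscale_vecs) auto
  moreover have "w \<noteq> 0"
  proof
    assume "w = 0"
    then have "(\<Sum>i<Suc m. vscale (if i = m then - 1 else pair r (b i) (e m)) (e i)) = 0"
      by (simp add: w_def)
    from Suc.prems(2)[OF this, of m] show False by simp
  qed
  ultimately obtain v where v: "v \<in> vecs (psers c) r" "pair r v w \<noteq> 0"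
    using pair_nondegenerate by blast
  define v' where "v' = v - (\<Sum>i<m. mfps_const (pair r v (e i)) *v b i)"
  have v': "v' \<in> vecs (psers c) r"
    unfolding v'_def using b(1) v(1) by (intro vecs_psers vecs_sum[OF subring_psers]) auto
  have v'e: "pair r v' (e k) = 0" if "k < m" for k
  proof -
    have "(\<Sum>i<m. pair r v (e i) * pair r (b i) (e k)) = (\<Sum>i<m. if i = k then pair r v (e k) else 0)"
      using b(2) that by (intro sum.cong) auto
    then show ?thesis using that unfolding v'_def pair_left pair_sum_left by simp
  qed
  have "pair r v' (e m) = pair r v w"
    unfolding v'_def w_def pair_left pair_sum_left pair_diff_right pair_sum_right by (simp add: mult.commute)
  then have nz: "pair r v' (e m) \<noteq> 0" using v by simp
  define bm where "bm = mfps_const (1 / pair r v' (e m)) *v v'"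
  define b' where "b' i = (if i = m then bm else b i - mfps_const (pair r (b i) (e m)) *v bm)" for i
  have bm: "bm \<in> vecs (psers c) r" unfolding bm_def using v' by (intro vecs_psers) auto
  have bme: "pair r bm (e k) = (if k = m then 1 else 0)" if "k < Suc m" for k
    using that v'e[of k] nz unfolding bm_def pair_left by auto
  have "b' i \<in> vecs (psers c) r" if "i < Suc m" for i
    using that bm b(1)[of i] unfolding b'_def by (auto intro!: vecs_psers(3,4))
  moreover have "pair r (b' i) (e k) = (if i = k then 1 else 0)" if "i < Suc m" "k < Suc m" for i k
    using that bme[of k] b(2)[of i k] unfolding b'_def by (auto simp: pair_left less_Suc_eq)
  ultimately show ?case by blast
qed simp

text \<open>A dual family splits off every vector into a part in \<open>V\<close> and coordinates, so a polynomial vector that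
  is orthogonal to \<open>V\<close> is determined by its pairings with the family.\<close>

lemma annihilator_of_dual_family:
  fixes e :: "nat \<Rightarrow> nat \<Rightarrow> 'f mpoly"
  assumes e: "\<And>i. i < m \<Longrightarrow> e i \<in> vecs (pring c) r" and b: "\<And>i. i < m \<Longrightarrow> b i \<in> vecs (psers c) r"
    and dual: "\<And>i k. i < m \<Longrightarrow> k < m \<Longrightarrow> pair r (b i) (e k) = (if i = k then 1 else 0)"
    and V: "V = {v \<in> vecs (psers c) r. \<forall>i<m. pair r v (e i) = 0}"
  shows "is_basis m e {w \<in> vecs (pring c) r. \<forall>v\<in>V. pair r v w = 0}"
  unfolding is_basis_iff
proof (intro conjI allI impI)
  fix x i assume x: "(\<Sum>i<m. vscale (x i) (e i)) = 0" and i: "i < m"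
  have "(\<Sum>k<m. x k * pair r (b i) (e k)) = 0"
    using arg_cong[OF x, of "pair r (b i)"] unfolding pair_sum_right pair_right(3) .
  moreover have "(\<Sum>k<m. x k * pair r (b i) (e k)) = (\<Sum>k<m. if k = i then x i else 0)"
    using dual i by (intro sum.cong) auto
  ultimately show "x i = 0" using i by simp
next
  show "{w \<in> vecs (pring c) r. \<forall>v\<in>V. pair r v w = 0} = range (\<lambda>x. \<Sum>i<m. vscale (x i) (e i))"
  proof (intro subset_antisym subsetI)
    fix w assume "w \<in> range (\<lambda>x. \<Sum>i<m. vscale (x i) (e i))"
    then obtain x where w: "w = (\<Sum>i<m. vscale (x i) (e i))" by blast
    have "w \<in> vecs (pring c) r" unfolding w using e by (intro vecs_sum[OF subring_polys] vscale_vecs) auto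
    moreover have "pair r v w = 0" if "v \<in> V" for v
      using that unfolding w pair_sum_right V by simp
    ultimately show "w \<in> {w \<in> vecs (pring c) r. \<forall>v\<in>V. pair r v w = 0}" by blast
  next
    fix w assume w: "w \<in> {w \<in> vecs (pring c) r. \<forall>v\<in>V. pair r v w = 0}"
    define w' where "w' = w - (\<Sum>i<m. vscale (pair r (b i) w) (e i))"
    have "w' = 0"
    proof (rule pair_nondegenerate)
      show "w' \<in> vecs (pring c) r"
        unfolding w'_def using e w by (intro vecs_polys(3) vecs_sum[OF subring_polys] vscale_vecs) auto
      fix v :: "nat \<Rightarrow> 'f mfps" assume v: "v \<in> vecs (psers c) r"
      define v' where "v' = v - (\<Sum>i<m. mfps_const (pair r v (e i)) *v b i)"
      have "v' \<in> vecs (psers c) r"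
        unfolding v'_def using v b by (intro vecs_psers(3,4) vecs_sum[OF subring_psers]) auto
      moreover have "pair r v' (e k) = 0" if k: "k < m" for k
      proof -
        have "(\<Sum>i<m. pair r v (e i) * pair r (b i) (e k)) = (\<Sum>i<m. if i = k then pair r v (e k) else 0)"
          using dual k by (intro sum.cong) auto
        then show ?thesis using k unfolding v'_def pair_left pair_sum_left by simp
      qed
      ultimately have "v' \<in> V" unfolding V by blast
      then have "pair r v' w = 0" using w by blast
      then show "pair r v w' = 0"
        unfolding v'_def w'_def pair_left pair_sum_left pair_diff_right pair_sum_right by (simp add: mult.commute)
    qed
    then have "w = (\<Sum>i<m. vscale (pair r (b i) w) (e i))" by (simp add: w'_def)
    then show "w \<in> range (\<lambda>x. \<Sum>i<m. vscale (x i) (e i))" by (rule range_combination)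
  qed
qed

text \<open>The coordinate functionals of the quotient vanish on series of large weight, so they are
  represented by vectors of polynomials.\<close>

theorem perp_quot_point:
  fixes V :: "(nat \<Rightarrow> 'f mfps) set"
  assumes V: "V \<in> quot_points c r m"
  shows "perp c r V \<in> diff_closed_subspaces c r m" "annihilator c r (perp c r V) = V"
proof -
  have Vs: "V \<in> submodules (psers c) r" using V by (simp add: quot_points_def)
  obtain b where b: "quotient_basis c r V m b" using V by (auto simp: quot_points_def)
  let ?B = "vecs (psers c) r :: (nat \<Rightarrow> 'f mfps) set"
  define T where "T = Suc (2 * c) * m"
  have WV: "wvecs c r T \<subseteq> V" unfolding T_def by (rule quotient_basis_wvecs[OF Vs b])
  obtain L where LL:
    "\<forall>v\<in>?B. \<forall>w\<in>?B. \<forall>i. L (v + w) i = L v i + L w i"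
    "\<forall>v\<in>?B. \<forall>x i. L (mfps_const x *v v) i = x * L v i"
    "\<forall>v\<in>?B. v \<in> V \<longleftrightarrow> (\<forall>i<m. L v i = 0)"
    "\<forall>i<m. \<forall>k<m. L (b k) i = (if i = k then 1 else 0)"
    using quotient_basis_functionals[OF Vs b] by blast
  note L = LL[rule_format]
  have bB: "b k \<in> ?B" if "k < m" for k using b that by (simp add: quotient_basis_def)
  define A where "A = {\<alpha>. keys \<alpha> \<subseteq> {..<c} \<and> wt c \<alpha> < T}"
  have A: "finite A" unfolding A_def by (rule finite_wt_less)
  define e where "e i = (\<lambda>j. if j < r then \<Sum>\<alpha>\<in>A. single \<alpha> (L (unit_vec j \<alpha>) i / of_nat (mfact \<alpha>)) else 0)" for i
  have e: "e i \<in> vecs (pring c) r" for i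
    unfolding e_def vecs_def by (auto simp: A_def intro!: polys_closed single_polys)
  have lookup_e: "lookup (e i j) \<alpha> = (if \<alpha> \<in> A then L (unit_vec j \<alpha>) i / of_nat (mfact \<alpha>) else 0)" if "j < r" for i j \<alpha>
    using that A by (auto simp: e_def lookup_sum lookup_single when_def)
  have pair_e: "pair r v (e i) = L v i" if v: "v \<in> ?B" and i: "i < m" for v i
  proof -
    let ?I = "{..<r} \<times> A"
    define s where "s = (\<Sum>x\<in>?I. mfps_const (mfps_nth (v (fst x)) (snd x)) *v unit_vec (fst x) (snd x))"
    have trm: "unit_vec j \<alpha> \<in> ?B" if "j < r" "\<alpha> \<in> A" for j \<alpha>
      using that unit_vec_vecs[of j r \<alpha> c] by (simp add: A_def)
    note sum = functional_sum[where S = ?I and b = "\<lambda>x. unit_vec (fst x) (snd x)" and x = "\<lambda>x. mfps_nth (v (fst x)) (snd x)",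
        OF LL(1,2), folded s_def]
    have sB: "s \<in> ?B" by (rule sum(1)) (use A trm in auto)
    have "v - s \<in> wvecs c r T"
      unfolding wvecs_def vecs_def
    proof (intro CollectI conjI allI impI)
      fix j assume j: "j < r"
      have sj: "s j = (\<Sum>\<alpha>\<in>A. mfps_const (mfps_nth (v j) \<alpha>) * mfps_monom \<alpha>)"
      proof -
        have "s j = (\<Sum>k<r. \<Sum>\<alpha>\<in>A. mfps_const (mfps_nth (v k) \<alpha>) * unit_vec k \<alpha> j)"
          unfolding s_def sum_pointwise by (simp add: sum.cartesian_product case_prod_unfold)
        also have "\<dots> = (\<Sum>k<r. if k = j then \<Sum>\<alpha>\<in>A. mfps_const (mfps_nth (v j) \<alpha>) * mfps_monom \<alpha> else 0)"
          by (intro sum.cong) (auto simp: unit_vec_def)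
        finally show ?thesis using j by simp
      qed
      show "(v - s) j \<in> wfilt c T"
        using wfilt_truncation[OF vecs_nth[OF v, of j], of T] by (simp add: sj A_def)
    qed (use v sB in \<open>auto simp: vecs_def\<close>)
    then have "v - s \<in> V" using WV by blast
    then have "L (v - s) i = 0" using L(3)[of "v - s"] i v sB by auto
    moreover have "L v i = L (v - s) i + L s i" using L(1)[of "v - s" s i] v sB by simp
    moreover have "L s i = (\<Sum>x\<in>?I. mfps_nth (v (fst x)) (snd x) * L (unit_vec (fst x) (snd x)) i)"
      by (rule sum(2)) (use A trm in auto)
    moreover have "pair r v (e i) = (\<Sum>x\<in>?I. mfps_nth (v (fst x)) (snd x) * L (unit_vec (fst x) (snd x)) i)"
    proof -
      have "pair1 (v j) (e i j) = (\<Sum>\<alpha>\<in>A. mfps_nth (v j) \<alpha> * L (unit_vec j \<alpha>) i)" if "j < r" for j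
      proof -
        have "pair1 (v j) (e i j) = (\<Sum>\<alpha>\<in>A. of_nat (mfact \<alpha>) * mfps_nth (v j) \<alpha> * lookup (e i j) \<alpha>)"
          using A lookup_e[OF that] by (intro pair1_superset) (auto simp: in_keys_iff split: if_splits)
        also have "\<dots> = (\<Sum>\<alpha>\<in>A. mfps_nth (v j) \<alpha> * L (unit_vec j \<alpha>) i)"
          using lookup_e[OF that] by (intro sum.cong) auto
        finally show ?thesis .
      qed
      then show ?thesis unfolding pair_def by (simp add: sum.cartesian_product case_prod_unfold)
    qed
    ultimately show ?thesis by simp
  qed
  have VL: "V = {v \<in> ?B. \<forall>i<m. pair r v (e i) = 0}"
    using L(3) pair_e submodulesD(1)[OF subring_psers Vs] by auto
  have dual: "pair r (b i) (e k) = (if i = k then 1 else 0)" if "i < m" "k < m" for i k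
    using pair_e[OF bB that(2)] L(4)[of k i] that by auto
  have basis: "is_basis m e (perp c r V)"
    unfolding perp_eq[OF Vs] by (rule annihilator_of_dual_family[OF e bB dual VL])
  have eW: "e i \<in> perp c r V" if "i < m" for i
    unfolding perp_eq[OF Vs] using VL e that by blast
  show "annihilator c r (perp c r V) = V"
  proof (intro subset_antisym subsetI)
    fix v assume "v \<in> annihilator c r (perp c r V)"
    then have "v \<in> ?B" "\<forall>i<m. pair r v (e i) = 0" using eW by (simp_all add: annihilator_def)
    then show "v \<in> V" by (subst VL) simp
  next
    fix v assume "v \<in> V"
    then show "v \<in> annihilator c r (perp c r V)"
      using submodulesD(1)[OF subring_psers Vs] unfolding annihilator_def perp_eq[OF Vs] by blast
  qed
  show "perp c r V \<in> diff_closed_subspaces c r m"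
    unfolding diff_closed_subspaces_def subspaces_of_dim_def
  proof (intro CollectI conjI ballI allI impI)
    show "vec.subspace (perp c r V)" using basis vec.subspace_span[of "e ` {..<m}"] by (simp add: is_basis_def)
    show "perp c r V \<subseteq> vecs (pring c) r" unfolding perp_eq[OF Vs] by blast
    show "\<exists>e. is_basis m e (perp c r V)" using basis by blast
    fix w i assume w: "w \<in> perp c r V" and i: "i < c"
    have "pair r v (\<lambda>j. pd i (w j)) = pair r (mfps_var i *v v) w" for v by (simp add: pair_def pair1_pd)
    moreover have "mfps_var i *v v \<in> V" if "v \<in> V" for v
      using submodulesD(4)[OF subring_psers Vs _ that] i by auto
    moreover have "(\<lambda>j. pd i (w j)) \<in> vecs (pring c) r"
      using w unfolding perp_eq[OF Vs] by (auto simp: vecs_def)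
    ultimately show "(\<lambda>j. pd i (w j)) \<in> perp c r V" using w unfolding perp_eq[OF Vs] by auto
  qed
qed

text \<open>The annihilator is a submodule by adjointness; a dual family of a basis of \<open>W\<close> is a basis of
  the quotient.\<close>

theorem annihilator_diff_closed:
  fixes W :: "(nat \<Rightarrow> 'f mpoly) set"
  assumes W: "W \<in> diff_closed_subspaces c r m"
  shows "annihilator c r W \<in> quot_points c r m" "perp c r (annihilator c r W) = W"
proof -
  obtain e where e: "is_basis m e W" and WE: "W \<subseteq> vecs (pring c) r"
    and closed: "\<And>w i. w \<in> W \<Longrightarrow> i < c \<Longrightarrow> (\<lambda>j. pd i (w j)) \<in> W" and sub: "vec.subspace W"
    using W by (auto simp: diff_closed_subspaces_def subspaces_of_dim_def)
  note eW = e[unfolded is_basis_iff]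
  have eE: "e i \<in> vecs (pring c) r" if "i < m" for i
    using e that vec.span_base[of "e i" "e ` {..<m}"] WE by (auto simp: is_basis_def)
  obtain b where b: "\<And>i. i < m \<Longrightarrow> b i \<in> vecs (psers c) r"
    "\<And>i k. i < m \<Longrightarrow> k < m \<Longrightarrow> pair r (b i) (e k) = (if i = k then 1 else 0)"
    using dual_family[of m e r] eE eW by blast
  let ?V = "annihilator c r W"
  have VL: "?V = {v \<in> vecs (psers c) r. \<forall>i<m. pair r v (e i) = 0}"
  proof (intro subset_antisym subsetI)
    fix v assume v: "v \<in> ?V"
    have "e i \<in> W" if "i < m" for i using e that vec.span_base[of "e i" "e ` {..<m}"] by (auto simp: is_basis_def)
    then show "v \<in> {v \<in> vecs (psers c) r. \<forall>i<m. pair r v (e i) = 0}" using v by (auto simp: annihilator_def)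
  next
    fix v assume v: "v \<in> {v \<in> vecs (psers c) r. \<forall>i<m. pair r v (e i) = 0}"
    then show "v \<in> ?V" using eW by (auto simp: annihilator_def pair_sum_right)
  qed
  \<comment> \<open>closure under all monomials, by adjointness\<close>
  have pair_mult: "pair r (a *v v) w = 0" if v: "v \<in> ?V" and a: "a \<in> psers c" and w: "w \<in> W" for a v w
  proof -
    have monom: "keys \<gamma> \<subseteq> {..<c} \<Longrightarrow> pair r (mfps_monom \<gamma> *v v) w = 0" if "w \<in> W" for \<gamma> w
      using that
    proof (induction \<gamma> arbitrary: w rule: mindex_induct)
      case 0
      then show ?case using v by (simp add: mfps_monom_simps annihilator_def)
    next
      case (plus \<gamma> i)
      have "pair r (mfps_monom (\<gamma> + single i 1) *v v) w = pair r (mfps_monom \<gamma> *v v) (\<lambda>j. pd i (w j))"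
        by (simp add: pair_def pair1_pd mult_ac mfps_monom_simps(2)[symmetric] flip: mfps_monom_mult)
      then show ?case using plus closed[of w i] by (simp add: keys_add_mindex)
    qed
    obtain t where t: "\<And>j \<beta>. \<beta> \<in> keys (w j) \<Longrightarrow> wt c \<beta> < t" using finite_weight[of w c r] w WE by blast
    let ?A = "{\<alpha>. keys \<alpha> \<subseteq> {..<c} \<and> wt c \<alpha> < t}"
    define s where "s = (\<Sum>\<alpha>\<in>?A. mfps_const (mfps_nth a \<alpha>) * mfps_monom \<alpha>)"
    have vB: "v j \<in> psers c" for j using v by (auto simp: annihilator_def intro: vecs_nth)
    have "(a - s) * v j \<in> wfilt c t" for j
      using wfilt_mult[OF wfilt_truncation[OF a, of t], of "v j" 0] vB by (simp add: s_def wfilt_0)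
    then have "pair r ((a - s) *v v) w = 0"
      unfolding pair_def using t by (intro sum.neutral ballI pair1_wfilt_eq_0) auto
    moreover have "pair r (s *v v) w = 0"
    proof -
      have "s *v v = (\<Sum>\<alpha>\<in>?A. mfps_const (mfps_nth a \<alpha>) *v (mfps_monom \<alpha> *v v))"
        by (simp add: fun_eq_iff sum_pointwise s_def sum_distrib_right mult.assoc)
      then show ?thesis using monom[OF w] by (simp only: pair_sum_left) simp
    qed
    moreover have "a *v v = (a - s) *v v + s *v v" by (simp add: fun_eq_iff algebra_simps)
    ultimately show ?thesis by (simp only: pair_left add_0)
  qed
  have Vs: "?V \<in> submodules (psers c) r"
    unfolding submodules_iff[OF subring_psers]
  proof (intro conjI ballI)
    show "?V \<subseteq> vecs (psers c) r" by (auto simp: annihilator_def)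
    show "0 \<in> ?V" by (simp add: annihilator_def pair_left)
    show "u + v \<in> ?V" if "u \<in> ?V" "v \<in> ?V" for u v
      using that by (auto simp: annihilator_def pair_left)
    show "a *v v \<in> ?V" if "a \<in> psers c" "v \<in> ?V" for a v
      using that pair_mult by (auto simp: annihilator_def)
  qed
  have "quotient_basis c r ?V m b"
    unfolding quotient_basis_def
  proof (intro conjI allI impI ballI)
    fix v :: "nat \<Rightarrow> 'f mfps" assume v: "v \<in> vecs (psers c) r"
    let ?d = "\<lambda>a j. v j - (\<Sum>i<m. mfps_const (a i) * b i j)"
    have "?d a \<in> ?V \<longleftrightarrow> (\<forall>k<m. a k = pair r v (e k))" for a
    proof -
      have d: "?d a = v - (\<Sum>i<m. mfps_const (a i) *v b i)" by (simp add: fun_eq_iff sum_pointwise)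
      have "?d a \<in> vecs (psers c) r"
        unfolding d using v b(1) by (intro vecs_psers(3,4) vecs_sum[OF subring_psers]) auto
      moreover have "pair r (?d a) (e k) = pair r v (e k) - a k" if k: "k < m" for k
      proof -
        have "(\<Sum>i<m. a i * pair r (b i) (e k)) = (\<Sum>i<m. if i = k then a k else 0)"
          using b(2) k by (intro sum.cong) auto
        then show ?thesis using k unfolding d pair_left pair_sum_left by simp
      qed
      ultimately show ?thesis unfolding VL by auto
    qed
    then show "\<exists>!a. (\<forall>i\<ge>m. a i = 0) \<and> ?d a \<in> ?V"
      by (intro ex1I[of _ "\<lambda>k. if k < m then pair r v (e k) else 0"]) (auto simp: fun_eq_iff)
  qed (use b in auto)
  then show "annihilator c r W \<in> quot_points c r m" using Vs by (auto simp: quot_points_def)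
  have "is_basis m e (perp c r ?V)"
    unfolding perp_eq[OF Vs] by (rule annihilator_of_dual_family[OF eE b VL])
  then show "perp c r ?V = W" using e by (simp add: is_basis_def)
qed

theorem perp_bij: 
  "bij_betw (perp c r) (quot_points c r m :: (nat \<Rightarrow> 'f mfps) set set) (diff_closed_subspaces c r m)"
  by (rule bij_betw_byWitness[where f' = "annihilator c r"]) (auto simp: perp_quot_point annihilator_diff_closed)

end

section \<open>The Weyl-Noether module\<close>

lemma Omega_eq [simp]: "Omega w = w"
proof
  fix j
  have "Poly_Mapping.map ((*) x) (single \<alpha> 1) = single \<alpha> x" for \<alpha> and x :: 'a
    by (intro poly_mapping_eqI) (simp add: lookup_map_times lookup_single when_def)
  then show "Omega w j = w j" by (simp add: Omega_def poly_mapping_sum_single)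
qed

lemma wnoether_eq: "wnoether c = pring c"
  by (simp add: wnoether_def polys_def)

lemma left_act_eq: "(\<lambda>j. left_act bar g (e j)) = vscale (bar g) e"
  by (simp add: left_act_def vscale_def)

lemma map_times_zero [simp]: "Poly_Mapping.map ((*) (a::'a::comm_ring_1)) 0 = 0"
  by (intro poly_mapping_eqI) (simp add: lookup_map_times)

context residue_map
begin

lemma lookup_one_tensor: "lookup (one_tensor bar P) \<beta> = bar (lookup P \<beta>)"
  by (simp add: one_tensor_def Poly_Mapping.map.rep_eq when_def)

lemma lookup_weyl_monomial:
  "lookup (weyl_mult (single \<alpha> 1) (single 0 (g :: 'k mpoly))) \<beta> =
    (\<Sum>(\<gamma>, \<delta>)\<in>splits \<alpha>. if \<delta> = \<beta> then of_nat (mbinom \<alpha> \<gamma>) * mpd \<gamma> g else 0)"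
proof -
  have "weyl_mult (single \<alpha> 1) (single 0 g) = (\<Sum>(\<gamma>, \<delta>)\<in>splits \<alpha>. single \<delta> (of_nat (mbinom \<alpha> \<gamma>) * mpd \<gamma> g))"
    by (cases "g = 0") (simp_all add: weyl_mult_def case_prod_unfold)
  then show ?thesis by (simp add: lookup_sum case_prod_unfold lookup_single when_def)
qed

text \<open>Moving \<open>g\<close> to the left past \<open>\<partial>\<^sup>\<alpha>\<close> differentiates it, and the coefficients so produced are those
  of its Taylor expansion: the right action of \<open>g\<close> is the action of the power series \<open>\<gamma>(g)\<close>.\<close>

lemma right_act_eq_ps_act:
  assumes g: "g \<in> pring n" and e: "e \<in> pring c"
  shows "right_act bar e g = ps_act (tay g) e"
proof (intro poly_mapping_eqI)
  fix \<beta> :: mindex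
  have coeff: "of_nat (mfact \<beta>) * bar (lookup (weyl_mult (single \<alpha> 1) (single 0 g)) \<beta>)
    = of_nat (mfact \<alpha>) * mfps_nth (mfps_monom \<beta> * tay g) \<alpha>" if "\<alpha> \<in> keys e" for \<alpha>
  proof (cases "\<exists>\<gamma>. \<alpha> = \<gamma> + \<beta>")
    case True
    then obtain \<gamma> where \<gamma>: "\<alpha> = \<gamma> + \<beta>" by blast
    have "keys (\<gamma> + \<beta>) \<subseteq> {..<c}" using e that unfolding \<gamma> polys_def by blast
    then have k: "keys \<gamma> \<subseteq> {..<c}" by (simp add: keys_add_mindex)
    have "(\<Sum>(\<gamma>', \<delta>)\<in>splits \<alpha>. if \<delta> = \<beta> then of_nat (mbinom \<alpha> \<gamma>') * mpd \<gamma>' g else 0)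
      = (\<Sum>x\<in>splits \<alpha>. if x = (\<gamma>, \<beta>) then of_nat (mbinom \<alpha> \<gamma>) * mpd \<gamma> g else 0)"
      by (intro sum.cong refl) (auto simp: splits_def \<gamma> split: if_splits)
    also have "\<dots> = of_nat (mbinom \<alpha> \<gamma>) * mpd \<gamma> g"
      by (subst sum.delta[OF finite_splits]) (simp add: splits_def \<gamma>)
    finally have "bar (lookup (weyl_mult (single \<alpha> 1) (single 0 g)) \<beta>) = of_nat (mbinom \<alpha> \<gamma>) * bar (mpd \<gamma> g)"
      using g by (simp add: lookup_weyl_monomial bar_of_nat_mult mpd_polys)
    moreover have "mfps_nth (mfps_monom \<beta> * tay g) \<alpha> = bar (mpd \<gamma> g) / of_nat (mfact \<gamma>)"
      using mfps_nth_monom_mult[of \<beta> "tay g" \<gamma>] k by (simp add: \<gamma> add.commute)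
    moreover have "(of_nat (mfact \<alpha>) :: 'f) = of_nat (mbinom \<alpha> \<gamma>) * of_nat (mfact \<gamma>) * of_nat (mfact \<beta>)"
      using mbinom_mfact[of \<gamma> \<beta> \<alpha>] \<gamma> by (metis of_nat_mult)
    ultimately show ?thesis by simp
  next
    case False
    then have "(\<Sum>(\<gamma>, \<delta>)\<in>splits \<alpha>. if \<delta> = \<beta> then of_nat (mbinom \<alpha> \<gamma>) * mpd \<gamma> g else 0) = 0"
      by (intro sum.neutral) (auto simp: splits_def)
    moreover have "mfps_nth (mfps_monom \<beta> * tay g) \<alpha> = 0"
      using False by (intro mfps_nth_monom_mult_0) (auto simp: add.commute)
    ultimately show ?thesis by (simp add: lookup_weyl_monomial)
  qed
  have "lookup (right_act bar e g) \<beta> = (\<Sum>\<alpha>\<in>keys e. lookup e \<alpha> * bar (lookup (weyl_mult (single \<alpha> 1) (single 0 g)) \<beta>))"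
    by (simp add: right_act_def lookup_sum lookup_map_times lookup_one_tensor)
  then have "of_nat (mfact \<beta>) * lookup (right_act bar e g) \<beta>
    = (\<Sum>\<alpha>\<in>keys e. lookup e \<alpha> * (of_nat (mfact \<beta>) * bar (lookup (weyl_mult (single \<alpha> 1) (single 0 g)) \<beta>)))"
    by (simp add: sum_distrib_left mult_ac)
  also have "\<dots> = pair1 (mfps_monom \<beta> * tay g) e"
    unfolding pair1_def by (intro sum.cong refl) (simp only: coeff mult_ac)
  also have "\<dots> = of_nat (mfact \<beta>) * lookup (ps_act (tay g) e) \<beta>" by (rule lookup_ps_act[symmetric])
  finally show "lookup (right_act bar e g) \<beta> = lookup (ps_act (tay g) e) \<beta>" by simp
qed

lemma ps_act_diff_closed:
  fixes W :: "(nat \<Rightarrow> 'f mpoly) set"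
  assumes W: "W \<in> diff_closed_subspaces c r m" and w: "w \<in> W" and v: "v \<in> psers c"
  shows "(\<lambda>j. ps_act v (w j)) \<in> W"
proof -
  have sub: "vec.subspace W" and WE: "W \<subseteq> vecs (pring c) r"
    and closed: "\<And>w i. w \<in> W \<Longrightarrow> i < c \<Longrightarrow> (\<lambda>j. pd i (w j)) \<in> W"
    using W by (auto simp: diff_closed_subspaces_def subspaces_of_dim_def)
  have mpdW: "keys \<gamma> \<subseteq> {..<c} \<Longrightarrow> (\<lambda>j. mpd \<gamma> (w j)) \<in> W" for \<gamma>
  proof (induction \<gamma> rule: mindex_induct)
    case 0
    then show ?case using w by simp
  next
    case (plus \<gamma> i)
    then have "(\<lambda>j. pd i (mpd \<gamma> (w j))) \<in> W" using closed[of "\<lambda>j. mpd \<gamma> (w j)" i] by (simp add: keys_add_mindex)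
    then show ?case by (simp only: mpd_plus_single)
  qed
  define S where "S = (\<Union>j<r. {\<gamma>. mpd \<gamma> (w j) \<noteq> 0})"
  have S: "finite S" unfolding S_def using mpd_nonzero_finite by blast
  have "(\<lambda>j. ps_act v (w j)) = (\<Sum>\<gamma>\<in>S. vscale (mfps_nth v \<gamma>) (\<lambda>j. mpd \<gamma> (w j)))"
  proof
    fix j
    have "{\<gamma>. mpd \<gamma> (w j) \<noteq> 0} \<subseteq> S"
    proof (cases "j < r")
      case False
      then have "w j = 0" using WE w by (auto simp: vecs_def)
      then show ?thesis by simp
    qed (auto simp: S_def)
    then have "ps_act v (w j) = (\<Sum>\<gamma>\<in>S. Poly_Mapping.map ((*) (mfps_nth v \<gamma>)) (mpd \<gamma> (w j)))"
      unfolding ps_act_def using S by (intro sum.mono_neutral_left) auto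
    then show "ps_act v (w j) = (\<Sum>\<gamma>\<in>S. vscale (mfps_nth v \<gamma>) (\<lambda>j. mpd \<gamma> (w j))) j"
      by (simp add: sum_pointwise vscale_def)
  qed
  also have "\<dots> \<in> W"
  proof (rule vec.subspace_sum[OF sub])
    fix \<gamma>
    show "vscale (mfps_nth v \<gamma>) (\<lambda>j. mpd \<gamma> (w j)) \<in> W"
    proof (cases "keys \<gamma> \<subseteq> {..<c}")
      case True
      then show ?thesis using mpdW vec.subspace_scale[OF sub] by blast
    next
      case False
      then have "mfps_nth v \<gamma> = 0" using v by (auto simp: psers_def)
      then show ?thesis using vec.subspace_0[OF sub] by (simp only: vec.scale_zero_left)
    qed
  qed
  finally show ?thesis .
qed

text \<open>The commutator of the right and left actions of \<open>x\<^sub>i\<close> is \<open>\<partial>/\<partial>z\<^sub>i\<close>.\<close>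

lemma right_act_var:
  assumes i: "i < c" and e: "e \<in> pring c"
  shows "right_act bar e (X i) = pd i e + Poly_Mapping.map ((*) (bar (X i))) e"
proof -
  have "X i \<in> (pring n :: 'k mpoly set)" using i c_le by (intro single_polys) simp
  then have "right_act bar e (X i) = ps_act (mfps_var i + mfps_const (bar (X i))) e"
    using i by (simp add: right_act_eq_ps_act[OF _ e] tay_var)
  also have "\<dots> = pd i e + Poly_Mapping.map ((*) (bar (X i))) e"
  proof (intro poly_mapping_eqI)
    fix \<gamma> :: mindex
    have "of_nat (mfact \<gamma>) * lookup (ps_act (mfps_var i + mfps_const (bar (X i))) e) \<gamma>
      = pair1 (mfps_var i * mfps_monom \<gamma>) e + pair1 (mfps_const (bar (X i)) * mfps_monom \<gamma>) e"
      unfolding lookup_ps_act pair1_add_left[symmetric] by (simp add: algebra_simps)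
    also have "\<dots> = of_nat (mfact \<gamma>) * lookup (pd i e + Poly_Mapping.map ((*) (bar (X i))) e) \<gamma>"
      unfolding pair1_pd[symmetric] pair1_const_left pair1_monom by (simp add: lookup_add lookup_map_times algebra_simps)
    finally show "lookup (ps_act (mfps_var i + mfps_const (bar (X i))) e) \<gamma> 
      = lookup (pd i e + Poly_Mapping.map ((*) (bar (X i))) e) \<gamma>" by simp
  qed
  finally show ?thesis .
qed

theorem diff_closed_eq_bimodule:
  "diff_closed_subspaces c r m = bimodule_subspaces bar n c r m"
proof (intro subset_antisym subsetI)
  fix W :: "(nat \<Rightarrow> 'f mpoly) set" assume W: "W \<in> diff_closed_subspaces c r m"
  have sub: "vec.subspace W" and WE: "W \<subseteq> vecs (pring c) r"
    using W by (auto simp: diff_closed_subspaces_def subspaces_of_dim_def)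
  have "(\<lambda>j. left_act bar g (e j)) \<in> W \<and> (\<lambda>j. right_act bar (e j) g) \<in> W" if "e \<in> W" "g \<in> pring n" for e g
  proof
    show "(\<lambda>j. left_act bar g (e j)) \<in> W" unfolding left_act_eq using sub that by (auto intro: vec.subspace_scale)
    have "e j \<in> pring c" for j using WE that by (auto intro: vecs_nth)
    then have "(\<lambda>j. right_act bar (e j) g) = (\<lambda>j. ps_act (tay g) (e j))" using that by (simp add: right_act_eq_ps_act)
    then show "(\<lambda>j. right_act bar (e j) g) \<in> W" using ps_act_diff_closed[OF W that(1), of "tay g"] by simp
  qed
  then show "W \<in> bimodule_subspaces bar n c r m"
    using W by (auto simp: bimodule_subspaces_def diff_closed_subspaces_def wnoether_eq)
next
  fix W :: "(nat \<Rightarrow> 'f mpoly) set" assume W: "W \<in> bimodule_subspaces bar n c r m"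
  then have sub: "vec.subspace W" and WE: "W \<subseteq> vecs (pring c) r"
    and act: "\<And>e g. e \<in> W \<Longrightarrow> g \<in> pring n \<Longrightarrow> (\<lambda>j. left_act bar g (e j)) \<in> W \<and> (\<lambda>j. right_act bar (e j) g) \<in> W"
    by (auto simp: bimodule_subspaces_def subspaces_of_dim_def wnoether_eq)
  have "(\<lambda>j. pd i (w j)) \<in> W" if w: "w \<in> W" and i: "i < c" for w i
  proof -
    have Xi: "X i \<in> (pring n :: 'k mpoly set)" using i c_le by (intro single_polys) simp
    have wj: "w j \<in> pring c" for j using WE w by (auto intro: vecs_nth)
    have "(\<lambda>j. right_act bar (w j) (X i)) - (\<lambda>j. left_act bar (X i) (w j)) \<in> W"
      using act[OF w Xi] by (intro vec.subspace_diff[OF sub]) auto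
    also have "(\<lambda>j. right_act bar (w j) (X i)) - (\<lambda>j. left_act bar (X i) (w j)) = (\<lambda>j. pd i (w j))"
      by (simp add: fun_eq_iff right_act_var[OF i wj] left_act_def)
    finally show ?thesis .
  qed
  then show "W \<in> diff_closed_subspaces c r m"
    using W by (auto simp: bimodule_subspaces_def diff_closed_subspaces_def wnoether_eq)
qed

section \<open>Noetherian operators\<close>

text \<open>Modulo \<open>\<pp>\<close> the value of a differential operator depends only on the classes of its coefficients and
  of the derivatives of \<open>u\<close>, which are the Taylor coefficients up to factorials.\<close>

lemma bar_weyl_op:
  assumes e: "e \<in> vecs (pring c) r" and u: "u \<in> vecs (pring n) r"
    and \<delta>: "\<delta> \<in> vecs (weyl n c) r" and s: "s \<in> pring n - p"
    and lift: "\<And>j \<alpha>. j < r \<Longrightarrow> bar (lookup (\<delta> j) \<alpha>) = bar s * lookup (e j) \<alpha>"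
  shows "weyl_op r \<delta> u \<in> pring n" "bar (weyl_op r \<delta> u) = bar s * pair r (\<lambda>j. tay (u j)) e"
proof -
  have un: "u j \<in> pring n" for j using u by (rule vecs_nth) simp
  have \<delta>n: "lookup (\<delta> j) \<alpha> \<in> pring n" if "j < r" for j \<alpha>
  proof (cases "\<alpha> \<in> keys (\<delta> j)")
    case True
    then show ?thesis using \<delta> that by (auto simp: vecs_def weyl_def)
  qed (simp add: in_keys_iff)
  have apply_n: "weyl_apply (\<delta> j) (u j) \<in> pring n" if "j < r" for j
    unfolding weyl_apply_def using \<delta>n[OF that] un mpd_polys by (intro polys_closed) auto
  then show "weyl_op r \<delta> u \<in> pring n" unfolding weyl_op_def by (intro polys_closed) auto
  have "bar (weyl_apply (\<delta> j) (u j)) = bar s * pair1 (tay (u j)) (e j)" if j: "j < r" for j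
  proof -
    have ej: "e j \<in> pring c" using e by (rule vecs_nth) simp
    have sub: "keys (e j) \<subseteq> keys (\<delta> j)"
    proof
      fix \<alpha> assume "\<alpha> \<in> keys (e j)"
      moreover have "bar s \<noteq> 0" using s bar_eq_0 by auto
      ultimately have "bar (lookup (\<delta> j) \<alpha>) \<noteq> 0" using lift[OF j, of \<alpha>] by (simp add: in_keys_iff)
      then show "\<alpha> \<in> keys (\<delta> j)" by (auto simp: in_keys_iff)
    qed
    have "bar (weyl_apply (\<delta> j) (u j)) = (\<Sum>\<alpha>\<in>keys (\<delta> j). bar s * lookup (e j) \<alpha> * bar (mpd \<alpha> (u j)))"
      unfolding weyl_apply_def using \<delta>n[OF j] un by (simp add: bar_sum bar_mult mpd_polys lift[OF j])
    also have "\<dots> = (\<Sum>\<alpha>\<in>keys (e j). bar s * lookup (e j) \<alpha> * bar (mpd \<alpha> (u j)))"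
      using sub by (intro sum.mono_neutral_right) (auto simp: in_keys_iff)
    also have "\<dots> = bar s * pair1 (tay (u j)) (e j)"
      unfolding pair1_def sum_distrib_left using ej by (intro sum.cong) (auto simp: polys_def)
    finally show ?thesis .
  qed
  then show "bar (weyl_op r \<delta> u) = bar s * pair r (\<lambda>j. tay (u j)) e"
    unfolding weyl_op_def pair_def using apply_n by (subst bar_sum) (auto simp: sum_distrib_left)
qed

end

context local_generators
begin

lemma lift_exists:
  assumes e: "e \<in> vecs (pring c) r"
  shows "\<exists>\<delta>. is_lift bar n c r p e \<delta>"
proof -
  let ?T = "SIGMA j:{..<r}. keys (e j)"
  have "finite ?T" by auto
  then obtain s a where s: "s \<in> pring n - p" "\<And>t. a t \<in> pring n"
    "\<And>t. t \<in> ?T \<Longrightarrow> bar s * lookup (e (fst t)) (snd t) = bar (a t)"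
    using common_denominator[of ?T "\<lambda>t. lookup (e (fst t)) (snd t)"] by metis
  define \<delta> where "\<delta> j = (if j < r then \<Sum>\<alpha>\<in>keys (e j). single \<alpha> (a (j, \<alpha>)) else 0)" for j
  have lookup: "lookup (\<delta> j) \<alpha> = (if \<alpha> \<in> keys (e j) then a (j, \<alpha>) else 0)" if "j < r" for j \<alpha>
    using that by (auto simp: \<delta>_def lookup_sum lookup_single when_def sum.delta)
  have "\<delta> j \<in> weyl n c" if "j < r" for j
    unfolding weyl_def
  proof (intro CollectI ballI conjI)
    fix \<alpha> assume "\<alpha> \<in> keys (\<delta> j)"
    then have "\<alpha> \<in> keys (e j)" using lookup[OF that, of \<alpha>] by (auto simp: in_keys_iff split: if_splits)
    moreover have "e j \<in> pring c" using e by (rule vecs_nth) simp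
    ultimately show "keys \<alpha> \<subseteq> {..<c}" by (auto simp: polys_def)
    show "lookup (\<delta> j) \<alpha> \<in> pring n" using s(2) by (simp add: lookup[OF that])
  qed
  then have "\<delta> \<in> vecs (weyl n c) r" by (auto simp: vecs_def \<delta>_def)
  moreover have "bar (lookup (\<delta> j) \<alpha>) = bar s * lookup (e j) \<alpha>" if "j < r" for j \<alpha>
    using s(3)[of "(j, \<alpha>)"] that by (auto simp: lookup in_keys_iff)
  ultimately show ?thesis using s(1) unfolding is_lift_def by blast
qed

end

section \<open>Maximal elements among ideals of a polynomial ring\<close>

lemma nat_mono_subsequence: "\<exists>s::nat \<Rightarrow> nat. strict_mono s \<and> mono (\<lambda>i. (a :: nat \<Rightarrow> nat) (s i))"
proof -
  obtain s :: "nat \<Rightarrow> nat" where s: "strict_mono s" "monoseq (\<lambda>i. a (s i))" using seq_monosub by blast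
  show ?thesis
  proof (cases "incseq (\<lambda>i. a (s i))")
    case False
    then have dec: "decseq (\<lambda>i. a (s i))" using s(2) by (simp add: monoseq_iff)
    obtain N where N: "\<And>i. a (s N) \<le> a (s i)" using ex_has_least_nat[of "\<lambda>_. True" _ "\<lambda>i. a (s i)"] by auto
    have "a (s (i + N)) = a (s N)" for i
      using decseqD[OF dec, of N "i + N"] N[of "i + N"] by simp
    then have "mono (\<lambda>i. a (s (i + N)))" by (simp add: mono_def)
    moreover have "strict_mono (\<lambda>i. s (i + N))" using s(1) by (simp add: strict_mono_def)
    ultimately show ?thesis by blast
  qed (use s in \<open>auto simp: incseq_def mono_def\<close>)
qed

text \<open>Passing to a subsequence for each variable makes all exponents nondecreasing.\<close>

lemma dickson:
  fixes f :: "nat \<Rightarrow> mindex"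
  assumes "\<And>i. keys (f i) \<subseteq> {..<n}"
  obtains i j \<gamma> where "i < j" "f j = f i + \<gamma>"
proof -
  have "\<exists>s::nat \<Rightarrow> nat. strict_mono s \<and> (\<forall>k<d. mono (\<lambda>i. lookup (f (s i)) k))" for d
  proof (induction d)
    case 0
    show ?case by (rule exI[where x = "\<lambda>i. i"]) (simp add: strict_mono_def)
  next
    case (Suc d)
    then obtain s :: "nat \<Rightarrow> nat" where s: "strict_mono s" "\<forall>k<d. mono (\<lambda>i. lookup (f (s i)) k)" by blast
    obtain t :: "nat \<Rightarrow> nat" where t: "strict_mono t" "mono (\<lambda>i. lookup (f (s (t i))) d)"
      using nat_mono_subsequence[of "\<lambda>i. lookup (f (s i)) d"] by blast
    have "mono (\<lambda>i. lookup (f (s (t i))) k)" if "k < Suc d" for k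
    proof (cases "k = d")
      case False
      then have "mono (\<lambda>i. lookup (f (s i)) k)" using s(2) that by simp
      moreover have "mono t" using t(1) by (rule strict_mono_mono)
      ultimately show ?thesis by (simp add: mono_def)
    qed (use t in simp)
    moreover have "strict_mono (\<lambda>i. s (t i))" using s(1) t(1) by (simp add: strict_mono_def)
    ultimately show ?case by (intro exI[of _ "\<lambda>i. s (t i)"]) simp
  qed
  then obtain s :: "nat \<Rightarrow> nat" where s: "strict_mono s" "\<forall>k<n. mono (\<lambda>i. lookup (f (s i)) k)" by blast
  have "lookup (f (s 0)) k \<le> lookup (f (s 1)) k" for k
  proof (cases "k < n")
    case True
    then show ?thesis using s(2) by (simp add: mono_def)
  next
    case False
    then have "k \<notin> keys (f (s 0))" using assms by blast
    then show ?thesis by (simp add: in_keys_iff)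
  qed
  then have "f (s 1) = f (s 0) + (f (s 1) - f (s 0))"
    by (intro poly_mapping_eqI) (simp add: lookup_add lookup_minus)
  moreover have "s 0 < s 1" using s(1) by (simp add: strict_mono_def)
  ultimately show ?thesis by (rule that[rotated])
qed

text \<open>The order of multi-indices is the lexicographic one; it is compatible with addition, and
  \<open>0\<close> is its least element.\<close>

lemma mindex_zero_le: "0 \<le> (\<gamma> :: mindex)"
proof (cases "\<gamma> = 0")
  case False
  then obtain k where "lookup \<gamma> k \<noteq> 0" by (metis poly_mapping_eqI lookup_zero)
  define l where "l = (LEAST k. lookup \<gamma> k \<noteq> 0)"
  have "lookup \<gamma> l \<noteq> 0" unfolding l_def by (rule LeastI) fact
  moreover have "lookup \<gamma> k = 0" if "k < l" for k using that not_less_Least unfolding l_def by blast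
  ultimately have "0 < \<gamma>" unfolding less_poly_mapping.rep_eq less_fun_def by auto
  then show ?thesis by simp
qed simp

lemma wf_mindex: "wf {(\<alpha>, \<beta> :: mindex). \<alpha> < \<beta> \<and> keys \<alpha> \<subseteq> {..<n} \<and> keys \<beta> \<subseteq> {..<n}}"
  unfolding wf_iff_no_infinite_down_chain
proof
  assume "\<exists>f. \<forall>i. (f (Suc i), f i) \<in> {(\<alpha>, \<beta> :: mindex). \<alpha> < \<beta> \<and> keys \<alpha> \<subseteq> {..<n} \<and> keys \<beta> \<subseteq> {..<n}}"
  then obtain f :: "nat \<Rightarrow> mindex" where f: "\<And>i. f (Suc i) < f i" "\<And>i. keys (f i) \<subseteq> {..<n}" by auto
  obtain i j \<gamma> where ij: "i < j" "f j = f i + \<gamma>" using dickson[of f n] f(2) by blast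
  have "f (i + Suc d) < f i" for d
    by (induction d) (use f(1) order.strict_trans in auto)
  then have "f j < f i" using ij(1) by (metis less_iff_Suc_add add_Suc_right)
  moreover have "f i + 0 \<le> f i + \<gamma>" using mindex_zero_le by (rule add_left_mono)
  ultimately show False using ij(2) by simp
qed

lemma keys_monomial_mult: 
  fixes f :: "'a::field mpoly"
  assumes "\<beta> \<in> keys (single \<gamma> a * f)" shows "\<exists>\<alpha>\<in>keys f. \<beta> = \<gamma> + \<alpha>"
proof -
  obtain \<gamma>' \<alpha> where "\<gamma>' \<in> keys (single \<gamma> a)" "\<alpha> \<in> keys f" "\<beta> = \<gamma>' + \<alpha>"
    using assms keys_mult[of "single \<gamma> a" f] by blast
  then show ?thesis by (auto split: if_splits)
qed

lemma lookup_monomial_mult: "lookup (single \<gamma> a * (f :: 'a::comm_ring_1 mpoly)) (\<gamma> + \<alpha>) = a * lookup f \<alpha>"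
proof -
  have "single \<gamma> a * f = (\<Sum>\<beta>\<in>keys f. single (\<gamma> + \<beta>) (a * lookup f \<beta>))"
    by (subst (1) poly_mapping_sum_single[symmetric, of f]) (simp add: sum_distrib_left mult_single)
  then have "lookup (single \<gamma> a * f) (\<gamma> + \<alpha>) = (\<Sum>\<beta>\<in>keys f. if \<beta> = \<alpha> then a * lookup f \<alpha> else 0)"
    by (simp add: lookup_sum lookup_single when_def)
  then show ?thesis by (simp add: sum.delta in_keys_iff)
qed

definition ideal_set :: "nat \<Rightarrow> 'a::comm_ring_1 mpoly set \<Rightarrow> bool" where
  "ideal_set n I \<longleftrightarrow> I \<subseteq> pring n \<and> 0 \<in> I \<and> (\<forall>x\<in>I. \<forall>y\<in>I. x + y \<in> I) \<and> (\<forall>a\<in>pring n. \<forall>x\<in>I. a * x \<in> I)"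

text \<open>In an ascending chain, choose \<open>f\<^sub>k\<close> in the \<open>k\<close>-th step with the least possible leading
  monomial. By Dickson's lemma one leading monomial divides a later one, and cancelling it
  contradicts the choice.\<close>

lemma no_ascending_ideals:
  fixes I :: "nat \<Rightarrow> 'k::field mpoly set"
  assumes ideal: "\<And>k. ideal_set n (I k)" and strict: "\<And>k. I k \<subset> I (Suc k)"
  shows False
proof -
  let ?r = "{(\<alpha>, \<beta> :: mindex). \<alpha> < \<beta> \<and> keys \<alpha> \<subseteq> {..<n} \<and> keys \<beta> \<subseteq> {..<n}}"
  note I = ideal[unfolded ideal_set_def]
  have lead_n: "keys (Max (keys f)) \<subseteq> {..<n}" if "f \<in> pring n" "f \<noteq> 0" for f :: "'k mpoly"
  proof -
    have "Max (keys f) \<in> keys f" using that(2) by (intro Max_in) auto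
    then show ?thesis using that(1) by (auto simp: polys_def)
  qed
  have "\<exists>f. f \<in> I (Suc k) - I k \<and> (\<forall>h\<in>I (Suc k) - I k. \<not> Max (keys h) < Max (keys f))" for k
  proof -
    obtain f0 where f0: "f0 \<in> I (Suc k) - I k" using strict[of k] by blast
    have nz: "f \<noteq> 0" "f \<in> pring n" if "f \<in> I (Suc k) - I k" for f
      using that I[of k] I[of "Suc k"] by auto
    obtain \<alpha> where \<alpha>: "\<alpha> \<in> (\<lambda>f. Max (keys f)) ` (I (Suc k) - I k)"
      and min: "\<And>\<beta>. (\<beta>, \<alpha>) \<in> ?r \<Longrightarrow> \<beta> \<notin> (\<lambda>f. Max (keys f)) ` (I (Suc k) - I k)"
      using wfE_min[OF wf_mindex, of "Max (keys f0)" "(\<lambda>f. Max (keys f)) ` (I (Suc k) - I k)" n] f0 by blast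
    obtain f where f: "f \<in> I (Suc k) - I k" "\<alpha> = Max (keys f)" using \<alpha> by blast
    have "\<not> Max (keys h) < Max (keys f)" if h: "h \<in> I (Suc k) - I k" for h
      using min[of "Max (keys h)"] h lead_n[OF nz(2)[OF h] nz(1)[OF h]] lead_n[OF nz(2)[OF f(1)] nz(1)[OF f(1)]] f(2) by blast
    then show ?thesis using f(1) by blast
  qed
  then obtain f where f: "\<And>k. f k \<in> I (Suc k) - I k"
    and min: "\<And>k h. h \<in> I (Suc k) - I k \<Longrightarrow> \<not> Max (keys h) < Max (keys (f k))" by metis
  have nz: "f k \<noteq> 0" "f k \<in> pring n" for k using f[of k] I[of k] I[of "Suc k"] by auto
  obtain i j \<gamma> where ij: "i < j" "Max (keys (f j)) = Max (keys (f i)) + \<gamma>"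
    using dickson[of "\<lambda>k. Max (keys (f k))" n] lead_n nz by blast
  let ?a = "Max (keys (f i))"
  have ai: "?a \<in> keys (f i)" and aj: "Max (keys (f j)) \<in> keys (f j)" using nz by (auto intro!: Max_in)
  \<comment> \<open>\<open>h\<close> is \<open>f\<^sub>j\<close> with its leading term cancelled by a multiple of \<open>f\<^sub>i\<close>; like \<open>f\<^sub>j\<close>, it enters at the \<open>j\<close>-th step\<close>
  define x where "x = lookup (f j) (\<gamma> + ?a) / lookup (f i) ?a"
  define h where "h = f j + - single \<gamma> x * f i"
  have \<gamma>n: "single \<gamma> x \<in> pring n"
    using lead_n[OF nz(2)[of j] nz(1)[of j]] unfolding ij(2) keys_add_mindex by (intro single_polys) simp
  have mono: "I k \<subseteq> I l" if "k \<le> l" for k l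
    by (rule lift_Suc_mono_le[of I, OF psubset_imp_subset[OF strict] that])
  have fi: "single \<gamma> x * f i \<in> I j" "- single \<gamma> x * f i \<in> I j"
  proof -
    have "f i \<in> I j" using f[of i] mono[of "Suc i" j] ij(1) by auto
    moreover have "\<forall>a\<in>pring n. \<forall>x\<in>I j. a * x \<in> I j" using I[of j] by blast
    moreover have "- single \<gamma> x \<in> pring n" using \<gamma>n by (rule subring_setD(5)[OF subring_polys])
    ultimately show "single \<gamma> x * f i \<in> I j" "- single \<gamma> x * f i \<in> I j" using \<gamma>n by blast+
  qed
  have "h \<in> I (Suc j)" unfolding h_def using I[of "Suc j"] f[of j] fi(2) strict[of j] by blast
  moreover have "h \<notin> I j"
  proof
    assume "h \<in> I j"
    then have "h + single \<gamma> x * f i \<in> I j" using I[of j] fi(1) by blast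
    then show False using f[of j] by (simp add: h_def)
  qed
  ultimately have hI: "h \<in> I (Suc j) - I j" by blast
  then have h0: "h \<noteq> 0" using I[of j] by auto
  have "Max (keys h) \<in> keys h" using h0 by (intro Max_in) auto
  moreover have "\<beta> < Max (keys (f j))" if \<beta>: "\<beta> \<in> keys h" for \<beta>
  proof -
    have "\<beta> \<le> Max (keys (f j))"
    proof (cases "\<beta> \<in> keys (f j)")
      case False
      then have "lookup (single \<gamma> x * f i) \<beta> \<noteq> 0" using \<beta> by (simp add: h_def in_keys_iff lookup_add lookup_minus)
      then obtain \<alpha> where "\<alpha> \<in> keys (f i)" "\<beta> = \<gamma> + \<alpha>"
        using keys_monomial_mult[of \<beta> \<gamma> x "f i"] by (auto simp: in_keys_iff)
      then show ?thesis unfolding ij(2) by (simp add: add.commute[of \<gamma>] add_right_mono)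
    qed (simp add: Max_ge)
    moreover have "\<beta> \<noteq> Max (keys (f j))"
    proof
      assume "\<beta> = Max (keys (f j))"
      then have "lookup h (\<gamma> + ?a) \<noteq> 0" using \<beta> ij(2) by (simp add: in_keys_iff add.commute)
      moreover have "lookup h (\<gamma> + ?a) = 0"
        using ai by (simp add: h_def lookup_add lookup_minus lookup_monomial_mult x_def in_keys_iff)
      ultimately show False by simp
    qed
    ultimately show ?thesis by simp
  qed
  ultimately show False using min[OF hI] by blast
qed

theorem maximal_ideal_in_family:
  fixes F :: "'k::field mpoly set set"
  assumes "F \<noteq> {}" "\<And>I. I \<in> F \<Longrightarrow> ideal_set n I"
  obtains I where "I \<in> F" "\<And>J. J \<in> F \<Longrightarrow> I \<subseteq> J \<Longrightarrow> J = I"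
proof -
  have "wf {(J, I). I \<subset> J \<and> I \<in> F \<and> J \<in> F}"
    unfolding wf_iff_no_infinite_down_chain
  proof
    assume "\<exists>f. \<forall>i. (f (Suc i), f i) \<in> {(J, I). I \<subset> J \<and> I \<in> F \<and> J \<in> F}"
    then obtain f where "\<forall>i. (f (Suc i), f i) \<in> {(J, I). I \<subset> J \<and> I \<in> F \<and> J \<in> F}" ..
    then have f: "\<And>i. f i \<subset> f (Suc i)" "\<And>i. f i \<in> F" by simp_all
    show False using no_ascending_ideals[of n f] f assms(2) by blast
  qed
  moreover obtain I0 where "I0 \<in> F" using assms(1) by blast
  ultimately obtain I where "I \<in> F" "\<And>J. (J, I) \<in> {(J, I). I \<subset> J \<and> I \<in> F \<and> J \<in> F} \<Longrightarrow> J \<notin> F"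
    by (rule wfE_min) blast
  then show ?thesis using that by blast
qed

section \<open>Primary submodules are saturated\<close>

context residue_map
begin

text \<open>The submodules that are contracted from \<open>R\<^sub>\<pp>\<^sup>r\<close>.\<close>

definition saturated :: "nat \<Rightarrow> (nat \<Rightarrow> 'k mpoly) set \<Rightarrow> bool" where
  "saturated r U \<longleftrightarrow> U \<in> submodules (pring n) r \<and>
    (\<forall>s\<in>pring n - p. \<forall>w\<in>vecs (pring n) r. s *v w \<in> U \<longrightarrow> w \<in> U)"

lemma saturatedD:
  assumes "saturated r U"
  shows "U \<in> submodules (pring n) r" "s \<in> pring n - p \<Longrightarrow> w \<in> vecs (pring n) r \<Longrightarrow> s *v w \<in> U \<Longrightarrow> w \<in> U"
  using assms by (auto simp: saturated_def)

lemma primeideal_p: "primeideal p (ring_on (pring n))"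
  unfolding primeideal_ring_on_iff[OF subring_polys] using p_sub p_add p_absorb p_prime by auto

text \<open>If \<open>s \<notin> p\<close> kills the class of \<open>w\<close>, a maximal annihilator of a multiple of \<open>w\<close> is an
  associated prime that contains \<open>s\<close>.\<close>

lemma primary_saturated:
  assumes U: "primary n r p U"
  shows "saturated r U"
  unfolding saturated_def
proof (intro conjI ballI impI, rule_tac[2] ccontr)
  show Us: "U \<in> submodules (pring n) r" using U by (simp add: primary_def)
  note U' = submodulesD[OF subring_polys Us]
  fix s w assume s: "s \<in> pring n - p" and w: "w \<in> vecs (pring n) r" and sw: "s *v w \<in> U" and "w \<notin> U"
  let ?ann = "\<lambda>w. {a \<in> pring n. a *v w \<in> U}"
  let ?W = "{w' \<in> vecs (pring n) r. w' \<notin> U \<and> s *v w' \<in> U}"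
  have ann: "ideal_set n (?ann w')" if "w' \<in> vecs (pring n) r" for w'
    unfolding ideal_set_def
  proof (intro conjI ballI)
    show "0 \<in> ?ann w'" using U'(2) by (simp add: zero_fun_def)
    show "x + y \<in> ?ann w'" if "x \<in> ?ann w'" "y \<in> ?ann w'" for x y
      using that U'(3)[of "x *v w'" "y *v w'"] by (simp add: distrib_right plus_fun_def)
    show "a * x \<in> ?ann w'" if "a \<in> pring n" "x \<in> ?ann w'" for a x
      using that U'(4)[of a "x *v w'"] by (simp add: mult.assoc)
  qed auto
  have "w \<in> ?W" using w sw \<open>w \<notin> U\<close> by simp
  then obtain q where q: "q \<in> ?ann ` ?W" "\<And>J. J \<in> ?ann ` ?W \<Longrightarrow> q \<subseteq> J \<Longrightarrow> J = q"
    using maximal_ideal_in_family[of "?ann ` ?W" n] ann by blast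
  then obtain w' where w': "w' \<in> ?W" "q = ?ann w'" by blast
  have "primeideal q (ring_on (pring n))"
    unfolding primeideal_ring_on_iff[OF subring_polys]
  proof (intro conjI ballI impI)
    have "ideal_set n q" using ann w' by auto
    then show "q \<subseteq> pring n" "0 \<in> q" "\<And>x y. x \<in> q \<Longrightarrow> y \<in> q \<Longrightarrow> x + y \<in> q"
      "\<And>a x. a \<in> pring n \<Longrightarrow> x \<in> q \<Longrightarrow> a * x \<in> q" by (auto simp: ideal_set_def)
    show "1 \<notin> q" using w' by simp
    fix x y assume x: "x \<in> pring n" and y: "y \<in> pring n" and xy: "x * y \<in> q"
    show "x \<in> q \<or> y \<in> q"
    proof (rule disjCI)
      assume "y \<notin> q"
      let ?v = "y *v w'"
      have v: "?v \<in> ?W"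
      proof -
        have "s *v ?v = y *v (s *v w')" by (simp add: mult_ac)
        then have "s *v ?v \<in> U" using U'(4)[of y "s *v w'"] w'(1) y by simp
        then show ?thesis using w' y \<open>y \<notin> q\<close> vecs_polys(4)[of y "{..<n}" w' r] by simp
      qed
      have "q \<subseteq> ?ann ?v"
      proof
        fix a assume "a \<in> q"
        then have "a \<in> pring n" "y *v (a *v w') \<in> U" using w' U'(4)[of y "a *v w'"] y by auto
        then show "a \<in> ?ann ?v" by (simp add: mult.left_commute)
      qed
      then have "?ann ?v = q" using q(2) v by blast
      moreover have "x \<in> ?ann ?v" using x xy w' by (simp add: mult.assoc)
      ultimately show "x \<in> q" by simp
    qed
  qed
  then have "q \<in> assoc_primes (pring n) r U" using w' unfolding assoc_primes_def by blast
  then have "q = p" using U by (simp add: primary_def)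
  moreover have "s \<in> q" using s w' by simp
  ultimately show False using s by simp
qed

end

section \<open>Multiplicity in terms of saturated submodules\<close>

context residue_map
begin

abbreviation R_vecs :: "nat \<Rightarrow> (nat \<Rightarrow> 'k mpoly) set" where
  "R_vecs r \<equiv> vecs (pring n) r"

definition contraction :: "nat \<Rightarrow> (nat \<Rightarrow> 'k mpoly fract) set \<Rightarrow> (nat \<Rightarrow> 'k mpoly) set" where
  "contraction r L = {u \<in> R_vecs r. (\<lambda>j. Fract (u j) 1) \<in> L}"

lemma subring_local: "subring_set (local_ring n p)"
  by (rule subring_local_ring[OF primeideal_p])

lemma denom: "s \<in> pring n - p \<Longrightarrow> s \<noteq> 0" "1 \<in> pring n - p"
  "s \<in> pring n - p \<Longrightarrow> t \<in> pring n - p \<Longrightarrow> s * t \<in> pring n - p"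
  using p_prime by auto

lemma denom_prod: "(\<And>x. x \<in> S \<Longrightarrow> f x \<in> pring n - p) \<Longrightarrow> prod f S \<in> pring n - p"
proof (induction S rule: infinite_finite_induct)
  case (insert x F)
  then show ?case unfolding prod.insert[OF insert.hyps] by (intro denom(3)) blast+
qed (simp_all add: denom(2) del: Diff_iff)

lemma Fract_local: "a \<in> pring n \<Longrightarrow> s \<in> pring n - p \<Longrightarrow> Fract a s \<in> local_ring n p"
  by (auto simp: local_ring_def)

lemma local_vecs_representation:
  assumes "x \<in> vecs (local_ring n p) r"
  obtains u s where "u \<in> R_vecs r" "s \<in> pring n - p" "x = (\<lambda>j. Fract (u j) s)"
proof -
  have "\<forall>j<r. \<exists>a s. a \<in> pring n \<and> s \<in> pring n - p \<and> x j = Fract a s"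
  proof (intro allI impI)
    fix j assume "j < r"
    then have "x j \<in> local_ring n p" using assms by (simp add: vecs_def)
    then show "\<exists>a s. a \<in> pring n \<and> s \<in> pring n - p \<and> x j = Fract a s"
      unfolding local_ring_def by blast
  qed
  then obtain a s where as: "\<And>j. j < r \<Longrightarrow> a j \<in> pring n" "\<And>j. j < r \<Longrightarrow> s j \<in> pring n - p"
    "\<And>j. j < r \<Longrightarrow> x j = Fract (a j) (s j)" by metis
  define t where "t = prod s {..<r}"
  define u where "u j = (if j < r then a j * prod s ({..<r} - {j}) else 0)" for j
  have t: "t \<in> pring n - p" unfolding t_def using as(2) by (intro denom_prod) auto
  have "u \<in> R_vecs r"
    unfolding vecs_def u_def using as by (auto intro!: polys_closed)
  moreover have "x j = Fract (u j) t" for j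
  proof (cases "j < r")
    case True
    have "t = s j * prod s ({..<r} - {j})" unfolding t_def using True by (intro prod.remove) auto
    then show ?thesis using True as denom(1)[OF t] denom(1)[OF as(2)[OF True]]
      by (simp add: eq_fract u_def mult_ac)
  next
    case False
    then have "x j = 0" using assms by (auto simp: vecs_def)
    then show ?thesis using False denom(1)[OF t] by (simp add: u_def Zero_fract_def eq_fract)
  qed
  ultimately show ?thesis using t that by blast
qed

lemma Fract_vec_mem_iff:
  assumes L: "L \<in> submodules (local_ring n p) r" and s: "s \<in> pring n - p"
  shows "(\<lambda>j. Fract (u j) s) \<in> L \<longleftrightarrow> (\<lambda>j. Fract (u j) 1) \<in> L"
proof -
  note L' = submodulesD[OF subring_local L]
  have "Fract s 1 *v (\<lambda>j. Fract (u j) s) = (\<lambda>j. Fract (u j) 1)"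
    using denom(1)[OF s] by (simp add: fun_eq_iff eq_fract)
  moreover have "Fract 1 s *v (\<lambda>j. Fract (u j) 1) = (\<lambda>j. Fract (u j) s)" by simp
  moreover have "Fract s 1 \<in> local_ring n p" "Fract 1 s \<in> local_ring n p"
    using s denom(2) by (auto intro!: Fract_local)
  ultimately show ?thesis using L'(4) by metis
qed

lemma contraction_saturated:
  assumes L: "L \<in> submodules (local_ring n p) r"
  shows "saturated r (contraction r L)"
proof -
  note L' = submodulesD[OF subring_local L]
  have "contraction r L \<in> submodules (pring n) r"
    unfolding submodules_iff[OF subring_polys]
  proof (intro conjI ballI)
    have "(\<lambda>j::nat. Fract (0 :: 'k mpoly) 1) = 0" by (simp add: fun_eq_iff Zero_fract_def)
    then show "0 \<in> contraction r L" using L'(2) by (simp add: contraction_def)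
    fix u v assume u: "u \<in> contraction r L" and v: "v \<in> contraction r L"
    have "(\<lambda>j. Fract ((u + v) j) 1) = (\<lambda>j. Fract (u j) 1) + (\<lambda>j. Fract (v j) 1)" by (simp add: fun_eq_iff)
    then show "u + v \<in> contraction r L" using u v L'(3) by (simp add: contraction_def)
  next
    fix a :: "'k mpoly" and u assume a: "a \<in> pring n" and u: "u \<in> contraction r L"
    have "Fract a 1 *v (\<lambda>j. Fract (u j) 1) \<in> L"
      using u by (intro L'(4) Fract_local a denom(2)) (simp add: contraction_def)
    then have "(\<lambda>j. Fract (a * u j) 1) \<in> L" by simp
    then show "a *v u \<in> contraction r L" using u a by (simp add: contraction_def)
  qed (auto simp: contraction_def)
  moreover have "w \<in> contraction r L"
    if s: "s \<in> pring n - p" and w: "w \<in> R_vecs r" and sw: "s *v w \<in> contraction r L" for s w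
  proof -
    have "(\<lambda>j. Fract (s * w j) s) \<in> L" using sw Fract_vec_mem_iff[OF L s] by (simp add: contraction_def)
    also have "(\<lambda>j. Fract (s * w j) s) = (\<lambda>j. Fract (w j) 1)"
      using denom(1)[OF s] by (simp add: fun_eq_iff eq_fract)
    finally show ?thesis using w by (simp add: contraction_def)
  qed
  ultimately show ?thesis by (auto simp: saturated_def)
qed

lemma local_submoduleI: "u \<in> U \<Longrightarrow> s \<in> pring n - p \<Longrightarrow> (\<lambda>j. Fract (u j) s) \<in> local_submodule n p U"
  unfolding local_submodule_def by blast

lemma local_submodule_submodule:
  assumes U: "saturated r U"
  shows "local_submodule n p U \<in> submodules (local_ring n p) r"
  unfolding submodules_iff[OF subring_local]
proof (intro conjI ballI)
  note U' = submodulesD[OF subring_polys saturatedD(1)[OF U]]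
  show "local_submodule n p U \<subseteq> vecs (local_ring n p) r"
  proof
    fix x assume "x \<in> local_submodule n p U"
    then obtain u s where x: "x = (\<lambda>j. Fract (u j) s)" "u \<in> U" "s \<in> pring n - p"
      by (auto simp: local_submodule_def)
    then have "u \<in> R_vecs r" using U'(1) by blast
    then show "x \<in> vecs (local_ring n p) r"
      using x denom(1) by (auto simp: vecs_def Zero_fract_def eq_fract intro!: Fract_local)
  qed
  have "(\<lambda>j. Fract ((0 :: nat \<Rightarrow> 'k mpoly) j) 1) \<in> local_submodule n p U" by (rule local_submoduleI[OF U'(2) denom(2)])
  then show "0 \<in> local_submodule n p U" by (simp add: zero_fun_def Zero_fract_def)
  fix x y assume "x \<in> local_submodule n p U" "y \<in> local_submodule n p U"
  then obtain u s v t where x: "x = (\<lambda>j. Fract (u j) s)" "u \<in> U" "s \<in> pring n - p"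
    and y: "y = (\<lambda>j. Fract (v j) t)" "v \<in> U" "t \<in> pring n - p"
    by (auto simp: local_submodule_def)
  have "t *v u + s *v v \<in> U" using x y U' by blast
  then have "(\<lambda>j. Fract ((t *v u + s *v v) j) (s * t)) \<in> local_submodule n p U"
    using x y by (intro local_submoduleI denom)
  also have "(\<lambda>j. Fract ((t *v u + s *v v) j) (s * t)) = x + y"
    using denom(1)[OF x(3)] denom(1)[OF y(3)] by (simp add: x(1) y(1) fun_eq_iff mult.commute)
  finally show "x + y \<in> local_submodule n p U" .
next
  note U' = submodulesD[OF subring_polys saturatedD(1)[OF U]]
  fix a x assume "a \<in> local_ring n p" "x \<in> local_submodule n p U"
  then obtain b t u s where a: "a = Fract b t" "b \<in> pring n" "t \<in> pring n - p"
    and x: "x = (\<lambda>j. Fract (u j) s)" "u \<in> U" "s \<in> pring n - p"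
    by (auto simp: local_submodule_def local_ring_def)
  have "(\<lambda>j. Fract ((b *v u) j) (t * s)) \<in> local_submodule n p U"
    by (rule local_submoduleI[OF U'(4)[OF a(2) x(2)] denom(3)[OF a(3) x(3)]])
  then show "a *v x \<in> local_submodule n p U" by (simp add: a(1) x(1))
qed

lemma local_submodule_mem_iff:
  assumes U: "saturated r U" and u: "u \<in> R_vecs r"
  shows "(\<lambda>j. Fract (u j) 1) \<in> local_submodule n p U \<longleftrightarrow> u \<in> U"
proof
  assume "(\<lambda>j. Fract (u j) 1) \<in> local_submodule n p U"
  then obtain v s where v: "v \<in> U" "s \<in> pring n - p" "\<And>j. Fract (u j) 1 = Fract (v j) s"
    by (auto simp: local_submodule_def fun_eq_iff)
  have "u j * s = v j" for j using v(3)[of j] denom(1)[OF v(2)] by (simp add: eq_fract)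
  then have "s *v u = v" by (auto simp: fun_eq_iff mult.commute)
  then show "u \<in> U" using saturatedD(2)[OF U v(2) u] v(1) by simp
next
  assume "u \<in> U"
  then show "(\<lambda>j. Fract (u j) 1) \<in> local_submodule n p U"
    using denom(2) unfolding local_submodule_def by blast
qed

text \<open>Submodules of \<open>R\<^sub>\<pp>\<^sup>r\<close> are the localizations of the saturated submodules of \<open>R\<^sup>r\<close>.\<close>

lemma multiplicity_saturated:
  assumes U: "saturated r U"
  shows "multiplicity n r p U =
    Sup {enat l | l. \<exists>L. (\<forall>i\<le>l. saturated r (L i) \<and> U \<subseteq> L i) \<and> (\<forall>i<l. L i \<subset> L (Suc i))}"
proof -
  have "(\<exists>L. (\<forall>i\<le>l. L i \<in> submodules (local_ring n p) r \<and> local_submodule n p U \<subseteq> L i) \<and> (\<forall>i<l. L i \<subset> L (Suc i)))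
    \<longleftrightarrow> (\<exists>L. (\<forall>i\<le>l. saturated r (L i) \<and> U \<subseteq> L i) \<and> (\<forall>i<l. L i \<subset> L (Suc i)))" for l
  proof
    assume "\<exists>L. (\<forall>i\<le>l. L i \<in> submodules (local_ring n p) r \<and> local_submodule n p U \<subseteq> L i) \<and> (\<forall>i<l. L i \<subset> L (Suc i))"
    then obtain L where L: "\<And>i. i \<le> l \<Longrightarrow> L i \<in> submodules (local_ring n p) r"
      "\<And>i. i \<le> l \<Longrightarrow> local_submodule n p U \<subseteq> L i" "\<And>i. i < l \<Longrightarrow> L i \<subset> L (Suc i)" by blast
    have "U \<subseteq> contraction r (L i)" if "i \<le> l" for i
    proof
      fix u assume u: "u \<in> U"
      then have "u \<in> R_vecs r" using submodulesD(1)[OF subring_polys saturatedD(1)[OF U]] by blast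
      then show "u \<in> contraction r (L i)"
        using local_submodule_mem_iff[OF U] u L(2)[OF that] by (auto simp: contraction_def)
    qed
    moreover have "contraction r (L i) \<subset> contraction r (L (Suc i))" if i: "i < l" for i
    proof -
      have sub: "contraction r (L i) \<subseteq> contraction r (L (Suc i))" using L(3)[OF i] by (auto simp: contraction_def)
      obtain x where x: "x \<in> L (Suc i)" "x \<notin> L i" using L(3)[OF i] by blast
      have Li: "L i \<in> submodules (local_ring n p) r" "L (Suc i) \<in> submodules (local_ring n p) r" using L(1) i by auto
      have "x \<in> vecs (local_ring n p) r" using x(1) submodulesD(1)[OF subring_local Li(2)] by blast
      then obtain u s where u: "u \<in> R_vecs r" "s \<in> pring n - p" "x = (\<lambda>j. Fract (u j) s)"
        by (rule local_vecs_representation)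
      then have "u \<in> contraction r (L (Suc i))" "u \<notin> contraction r (L i)"
        using x Fract_vec_mem_iff[OF Li(1) u(2)] Fract_vec_mem_iff[OF Li(2) u(2)] by (auto simp: contraction_def)
      then show ?thesis using sub by blast
    qed
    ultimately show "\<exists>L. (\<forall>i\<le>l. saturated r (L i) \<and> U \<subseteq> L i) \<and> (\<forall>i<l. L i \<subset> L (Suc i))"
      using L(1) contraction_saturated by (intro exI[of _ "\<lambda>i. contraction r (L i)"]) auto
  next
    assume "\<exists>L. (\<forall>i\<le>l. saturated r (L i) \<and> U \<subseteq> L i) \<and> (\<forall>i<l. L i \<subset> L (Suc i))"
    then obtain L where L: "\<And>i. i \<le> l \<Longrightarrow> saturated r (L i)"
      "\<And>i. i \<le> l \<Longrightarrow> U \<subseteq> L i" "\<And>i. i < l \<Longrightarrow> L i \<subset> L (Suc i)" by blast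
    have mono: "local_submodule n p M \<subseteq> local_submodule n p M'" if "M \<subseteq> M'" for M M'
      using that unfolding local_submodule_def by blast
    have "local_submodule n p (L i) \<subset> local_submodule n p (L (Suc i))" if i: "i < l" for i
    proof -
      obtain u where u: "u \<in> L (Suc i)" "u \<notin> L i" using L(3)[OF i] by blast
      have S: "saturated r (L i)" "saturated r (L (Suc i))" using L(1) i by auto
      have "u \<in> R_vecs r" using u(1) submodulesD(1)[OF subring_polys saturatedD(1)[OF S(2)]] by blast
      then have "(\<lambda>j. Fract (u j) 1) \<in> local_submodule n p (L (Suc i))" "(\<lambda>j. Fract (u j) 1) \<notin> local_submodule n p (L i)"
        using u local_submodule_mem_iff[OF S(1)] local_submodule_mem_iff[OF S(2)] by auto
      moreover have "local_submodule n p (L i) \<subseteq> local_submodule n p (L (Suc i))" using L(3)[OF i] by (intro mono) blast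
      ultimately show ?thesis by blast
    qed
    then show "\<exists>L. (\<forall>i\<le>l. L i \<in> submodules (local_ring n p) r \<and> local_submodule n p U \<subseteq> L i) \<and> (\<forall>i<l. L i \<subset> L (Suc i))"
      using L(1,2) local_submodule_submodule mono by (intro exI[of _ "\<lambda>i. local_submodule n p (L i)"]) auto
  qed
  then show ?thesis by (simp only: multiplicity_def quotient_length_def)
qed

lemma multiplicity_chain_le:
  assumes "saturated r U" "multiplicity n r p U = enat m"
    and "\<And>i. i \<le> l \<Longrightarrow> saturated r (L i)" "\<And>i. i \<le> l \<Longrightarrow> U \<subseteq> L i" "\<And>i. i < l \<Longrightarrow> L i \<subset> L (Suc i)"
  shows "l \<le> m"
proof -
  have "enat l \<le> enat m"
    unfolding assms(2)[symmetric] multiplicity_saturated[OF assms(1)] using assms(3-5) by (intro Sup_upper) blast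
  then show ?thesis by simp
qed

lemma multiplicity_eqI:
  assumes U: "saturated r U"
    and chain: "\<And>i. i \<le> m \<Longrightarrow> saturated r (L i)" "\<And>i. i \<le> m \<Longrightarrow> U \<subseteq> L i" "\<And>i. i < m \<Longrightarrow> L i \<subset> L (Suc i)"
    and bound: "\<And>l L. (\<And>i. i \<le> l \<Longrightarrow> saturated r (L i)) \<Longrightarrow> (\<And>i. i \<le> l \<Longrightarrow> U \<subseteq> L i) \<Longrightarrow>
      (\<And>i. i < l \<Longrightarrow> L i \<subset> L (Suc i)) \<Longrightarrow> l \<le> m"
  shows "multiplicity n r p U = enat m"
  unfolding multiplicity_saturated[OF U]
proof (rule antisym)
  show "Sup {enat l |l. \<exists>L. (\<forall>i\<le>l. saturated r (L i) \<and> U \<subseteq> L i) \<and> (\<forall>i<l. L i \<subset> L (Suc i))} \<le> enat m"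
  proof (rule Sup_least)
    fix x assume "x \<in> {enat l |l. \<exists>L. (\<forall>i\<le>l. saturated r (L i) \<and> U \<subseteq> L i) \<and> (\<forall>i<l. L i \<subset> L (Suc i))}"
    then obtain l L where "x = enat l" "\<forall>i\<le>l. saturated r (L i) \<and> U \<subseteq> L i" "\<forall>i<l. L i \<subset> L (Suc i)" by blast
    then show "x \<le> enat m" using bound[of l L] by simp
  qed
  show "enat m \<le> Sup {enat l |l. \<exists>L. (\<forall>i\<le>l. saturated r (L i) \<and> U \<subseteq> L i) \<and> (\<forall>i<l. L i \<subset> L (Suc i))}"
    using chain by (intro Sup_upper) blast
qed

section \<open>Saturated submodules of finite multiplicity\<close>

lemma killed_power: "killed N V k w \<Longrightarrow> a \<in> N \<Longrightarrow> (a ^ k) *v w \<in> V"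
proof (induction k arbitrary: w)
  case (Suc k)
  then have "(a ^ k) *v (a *v w) \<in> V" by simp
  then show ?case by (simp add: mult_ac)
qed simp

lemma killed_imp_socle:
  "killed p U k w \<Longrightarrow> w \<in> R_vecs r \<Longrightarrow> w \<notin> U \<Longrightarrow> \<exists>w'\<in>R_vecs r. w' \<notin> U \<and> (\<forall>a\<in>p. a *v w' \<in> U)"
proof (induction k arbitrary: w)
  case (Suc k)
  show ?case
  proof (cases "\<forall>a\<in>p. a *v w \<in> U")
    case False
    then obtain a where a: "a \<in> p" "a *v w \<notin> U" by blast
    then have "a \<in> pring n" using p_sub by blast
    then show ?thesis using Suc a by (intro Suc.IH[of "a *v w"]) auto
  qed (use Suc in blast)
qed simp

text \<open>Multiplying an element outside \<open>U\<close> by elements of \<open>\<pp>\<close> as long as the result stays outside gives an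
  element with annihilator \<open>\<pp>\<close>. Any associated prime contains a power of \<open>\<pp>\<close>, and it is contained in
  \<open>\<pp>\<close> by saturation.\<close>

lemma saturated_killed_primary:
  assumes U: "saturated r U" and killed: "\<And>w. w \<in> R_vecs r \<Longrightarrow> killed p U m w" and ne: "U \<noteq> R_vecs r"
  shows "primary n r p U"
proof -
  note Us = saturatedD(1)[OF U]
  note U' = submodulesD[OF subring_polys Us]
  obtain w where w: "w \<in> R_vecs r" "w \<notin> U" using ne U'(1) by blast
  obtain w' where w': "w' \<in> R_vecs r" "w' \<notin> U" "\<forall>a\<in>p. a *v w' \<in> U"
    using killed_imp_socle[OF killed[OF w(1)] w] by blast
  have "p = {a \<in> pring n. a *v w' \<in> U}"
  proof (intro subset_antisym subsetI)
    fix a assume "a \<in> {a \<in> pring n. a *v w' \<in> U}"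
    then show "a \<in> p" using saturatedD(2)[OF U _ w'(1), of a] w'(2) by auto
  qed (use w'(3) p_sub in auto)
  then have "p \<in> assoc_primes (pring n) r U" using w'(1) primeideal_p unfolding assoc_primes_def by blast
  moreover have "q = p" if "q \<in> assoc_primes (pring n) r U" for q
  proof -
    have prime: "primeideal q (ring_on (pring n))" using that unfolding assoc_primes_def by blast
    have "\<exists>w\<in>R_vecs r. q = {a \<in> pring n. a *v w \<in> U}"
      using that unfolding assoc_primes_def by (elim CollectE conjE)
    then obtain w where w: "w \<in> R_vecs r" "q = {a \<in> pring n. a *v w \<in> U}" ..
    note q = prime[unfolded primeideal_ring_on_iff[OF subring_polys]]
    have "1 \<in> q \<longleftrightarrow> w \<in> U" unfolding w(2) by simp
    then have "w \<notin> U" using q by blast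
    have "q \<subseteq> p"
    proof
      fix a assume "a \<in> q"
      then have "a \<in> pring n" "a *v w \<in> U" by (simp_all add: w(2))
      then show "a \<in> p" using saturatedD(2)[OF U _ w(1), of a] \<open>w \<notin> U\<close> by blast
    qed
    moreover have "p \<subseteq> q"
    proof
      have prime_q: "x \<in> q \<or> y \<in> q" if "x \<in> pring n" "y \<in> pring n" "x * y \<in> q" for x y
        using q that by blast
      fix a assume a: "a \<in> p"
      then have an: "a \<in> pring n" using p_sub by blast
      have "a ^ m \<in> q" using killed_power[OF killed[OF w(1)] a] an by (simp add: w(2))
      moreover have "a ^ k \<in> q \<Longrightarrow> a \<in> q" for k
      proof (induction k)
        case (Suc k)
        then have "a \<in> q \<or> a ^ k \<in> q" using prime_q[of a "a ^ k"] an by simp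
        then show ?case using Suc.IH by blast
      next
        case 0
        then show ?case using q by simp
      qed
      ultimately show "a \<in> q" by blast
    qed
    ultimately show ?thesis by blast
  qed
  ultimately show ?thesis using Us unfolding primary_def by blast
qed

text \<open>If the products \<open>w, a\<^sub>1 w, a\<^sub>2 a\<^sub>1 w, \<dots>\<close> with \<open>a\<^sub>i \<in> \<pp>\<close> stay outside \<open>U\<close>, then the saturations
  of \<open>U + R w, U + R a\<^sub>1 w, \<dots>\<close> descend strictly, by Nakayama.\<close>

lemma finite_multiplicity_killed:
  assumes U: "saturated r U" and mult: "multiplicity n r p U = enat m" and w: "w \<in> R_vecs r"
  shows "killed p U m w"
proof (rule ccontr)
  assume "\<not> killed p U m w"
  then obtain u where u: "u 0 = 1" "\<And>i. i < m \<Longrightarrow> \<exists>a\<in>p. u (Suc i) = a * u i" "u m *v w \<notin> U"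
    using not_killed_chain[of p U m w] by blast
  note Us = saturatedD(1)[OF U]
  note U' = submodulesD[OF subring_polys Us]
  have un: "i \<le> m \<Longrightarrow> u i \<in> pring n" for i
  proof (induction i)
    case (Suc i)
    then obtain a where "a \<in> p" "u (Suc i) = a * u i" using u(2)[of i] by auto
    then show ?case using Suc p_sub by auto
  qed (simp add: u(1))
  define x where "x i = u i *v w" for i
  have xv: "x i \<in> R_vecs r" if "i \<le> m" for i using un[OF that] w unfolding x_def by auto
  have xU: "x i \<notin> U" if "i \<le> m" for i
    using that
  proof (induction i rule: inc_induct)
    case base
    then show ?case using u(3) by (simp add: x_def)
  next
    case (step i)
    obtain a where "a \<in> p" "u (Suc i) = a * u i" using u(2)[of i] step by auto
    then have "x (Suc i) = a *v x i" "a \<in> pring n" using p_sub by (auto simp: x_def mult.assoc)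
    then show ?case using step U'(4) by auto
  qed
  \<comment> \<open>\<open>C i\<close> is the saturation of \<open>U + R x\<^sub>i\<close>\<close>
  define C where "C i = {v \<in> R_vecs r. \<exists>s\<in>pring n - p. \<exists>a\<in>pring n. s *v v - a *v x i \<in> U}" for i
  have CI: "v \<in> C i" if "v \<in> R_vecs r" "s \<in> pring n - p" "a \<in> pring n" "s *v v - a *v x i \<in> U" for v s a i
    using that unfolding C_def by blast
  have C_sub: "C i \<in> submodules (pring n) r" for i
    unfolding submodules_iff[OF subring_polys]
  proof (intro conjI ballI)
    show "C i \<subseteq> R_vecs r" by (auto simp: C_def)
    have "1 *v (0::nat \<Rightarrow> 'k mpoly) - 0 *v x i = 0" by (simp add: fun_eq_iff)
    then have "1 *v (0::nat \<Rightarrow> 'k mpoly) - 0 *v x i \<in> U" using U'(2) by (simp only:)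
    then show "0 \<in> C i" by (rule CI[OF vecs_polys(1) denom(2) polys_closed(2)])
  next
    fix v v' assume "v \<in> C i" "v' \<in> C i"
    then obtain s a s' a' where v: "v \<in> R_vecs r" "s \<in> pring n - p" "a \<in> pring n" "s *v v - a *v x i \<in> U"
      and v': "v' \<in> R_vecs r" "s' \<in> pring n - p" "a' \<in> pring n" "s' *v v' - a' *v x i \<in> U"
      unfolding C_def by blast
    have "s' *v (s *v v - a *v x i) + s *v (s' *v v' - a' *v x i) \<in> U"
      using v(2) v'(2) by (intro U'(3) U'(4)[OF _ v(4)] U'(4)[OF _ v'(4)]) auto
    also have "s' *v (s *v v - a *v x i) + s *v (s' *v v' - a' *v x i) = (s * s') *v (v + v') - (s' * a + s * a') *v x i"
      by (simp add: fun_eq_iff algebra_simps)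
    finally have F: "(s * s') *v (v + v') - (s' * a + s * a') *v x i \<in> U" .
    show "v + v' \<in> C i"
      by (rule CI[OF vecs_polys(2)[OF v(1) v'(1)] denom(3)[OF v(2) v'(2)] _ F]) (use v v' in auto)
  next
    fix b :: "'k mpoly" and v assume b: "b \<in> pring n" and "v \<in> C i"
    then obtain s a where v: "v \<in> R_vecs r" "s \<in> pring n - p" "a \<in> pring n" "s *v v - a *v x i \<in> U"
      unfolding C_def by blast
    have "b *v (s *v v - a *v x i) \<in> U" using v b by (intro U'(4))
    also have "b *v (s *v v - a *v x i) = s *v (b *v v) - (b * a) *v x i"
      by (simp add: fun_eq_iff algebra_simps)
    finally have F: "s *v (b *v v) - (b * a) *v x i \<in> U" .
    show "b *v v \<in> C i" by (rule CI[OF vecs_polys(4)[OF b v(1)] v(2) _ F]) (use v b in auto)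
  qed
  have C_sat: "saturated r (C i)" for i
    unfolding saturated_def
  proof (intro conjI ballI impI C_sub)
    fix t v assume t: "t \<in> pring n - p" and v: "v \<in> R_vecs r" and "t *v v \<in> C i"
    then obtain s a where s: "s \<in> pring n - p" "a \<in> pring n" "s *v (t *v v) - a *v x i \<in> U"
      unfolding C_def by blast
    have "s *v (t *v v) = (s * t) *v v" by (simp add: mult.assoc)
    then show "v \<in> C i" using s t v denom(3)[of s t] by (intro CI[of v "s * t" a]) auto
  qed
  have UC: "U \<subseteq> C i" for i
  proof
    fix v assume v: "v \<in> U"
    moreover have "1 *v v - 0 *v x i = v" by (simp add: fun_eq_iff)
    ultimately have "1 *v v - 0 *v x i \<in> U" by (simp only:)
    then show "v \<in> C i" using v U'(1) by (intro CI[OF _ denom(2) polys_closed(2)]) auto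
  qed
  have xC: "x i \<in> C i" if "i \<le> m" for i
  proof -
    have "1 *v x i - 1 *v x i = 0" by (simp add: fun_eq_iff)
    then have "1 *v x i - 1 *v x i \<in> U" using U'(2) by (simp only:)
    then show ?thesis by (rule CI[OF xv[OF that] denom(2) polys_closed(1)])
  qed
  have step: "C (Suc i) \<subset> C i" if i: "i < m" for i
  proof -
    obtain b where b: "b \<in> p" "u (Suc i) = b * u i" using u(2)[OF i] by blast
    have bn: "b \<in> pring n" using b p_sub by blast
    have xS: "x (Suc i) = b *v x i" by (simp add: x_def b(2) mult.assoc)
    have "C (Suc i) \<subseteq> C i"
    proof
      fix v assume "v \<in> C (Suc i)"
      then obtain s a where v: "v \<in> R_vecs r" "s \<in> pring n - p" "a \<in> pring n" "s *v v - a *v x (Suc i) \<in> U"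
        unfolding C_def by blast
      then have "s *v v - (a * b) *v x i \<in> U" by (simp add: xS mult.assoc)
      then show "v \<in> C i" using v bn by (intro CI[of v s "a * b"]) auto
    qed
    moreover have "x i \<notin> C (Suc i)"
    proof
      assume "x i \<in> C (Suc i)"
      then obtain s a where s: "s \<in> pring n - p" "a \<in> pring n" "s *v x i - a *v x (Suc i) \<in> U"
        unfolding C_def by blast
      have "s *v x i - a *v x (Suc i) = (s - a * b) *v x i"
        by (simp add: xS fun_eq_iff algebra_simps)
      then have "(s - a * b) *v x i \<in> U" using s(3) by simp
      moreover have "s - a * b \<in> pring n - p"
      proof -
        have "a * b \<in> p" using s(2) b(1) by (rule p_absorb)
        then have "s - a * b \<notin> p" using s(1) p_add[of "s - a * b" "a * b"] by auto
        then show ?thesis using s bn by auto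
      qed
      ultimately have "x i \<in> U" using saturatedD(2)[OF U _ xv] i by simp
      then show False using xU[of i] i by simp
    qed
    ultimately show ?thesis using xC[of i] i by auto
  qed
  define L where "L i = (if i = 0 then U else C (Suc m - i))" for i
  have "Suc m \<le> m"
  proof (rule multiplicity_chain_le[OF U mult, of "Suc m" L])
    fix i assume i: "i < Suc m"
    show "L i \<subset> L (Suc i)"
    proof (cases i)
      case 0
      then show ?thesis using UC[of m] xC[of m] xU[of m] by (auto simp: L_def)
    next
      case (Suc k)
      then have "Suc m - i = Suc (Suc m - Suc i)" "Suc m - Suc i < m" using i by auto
      then show ?thesis using step[of "Suc m - Suc i"] Suc by (simp add: L_def)
    qed
  qed (use U UC C_sat in \<open>auto simp: L_def\<close>)
  then show False by simp
qed

end

section \<open>Flags of subspaces closed under differentiation\<close>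

text \<open>Adjoin an element of \<open>W\<close> outside \<open>W'\<close> of least possible weight: its derivatives lie in \<open>W\<close> and have
  smaller weight, so they lie in \<open>W'\<close>.\<close>

lemma diff_closed_step:
  fixes W W' :: "(nat \<Rightarrow> 'f::field mpoly) set"
  assumes W: "W \<in> diff_closed_subspaces c r m" and W': "W' \<in> diff_closed_subspaces c r k"
    and sub: "W' \<subseteq> W" and k: "k < m"
  shows "\<exists>W''\<in>diff_closed_subspaces c r (Suc k). W' \<subseteq> W'' \<and> W'' \<subseteq> W"
proof -
  obtain e where e: "is_basis m e W" and WE: "W \<subseteq> vecs (pring c) r" and Ws: "vec.subspace W"
    and closed: "\<And>w i. w \<in> W \<Longrightarrow> i < c \<Longrightarrow> (\<lambda>j. pd i (w j)) \<in> W"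
    using W by (auto simp: diff_closed_subspaces_def subspaces_of_dim_def)
  obtain e' where e': "is_basis k e' W'" and Ws': "vec.subspace W'"
    and closed': "\<And>w i. w \<in> W' \<Longrightarrow> i < c \<Longrightarrow> (\<lambda>j. pd i (w j)) \<in> W'"
    using W' by (auto simp: diff_closed_subspaces_def subspaces_of_dim_def)
  have "W \<noteq> W'" using is_basis_unique_dim[of m e W k e'] e e' k by auto
  then obtain w0 where w0: "w0 \<in> W" "w0 \<notin> W'" using sub by blast
  define D where "D N = {w :: nat \<Rightarrow> 'f mpoly. \<forall>j. \<forall>\<alpha>\<in>keys (w j). wt c \<alpha> < N}" for N
  have fin: "\<exists>N. w \<in> D N" if w: "w \<in> W" for w
  proof -
    obtain N where "\<And>j \<alpha>. \<alpha> \<in> keys (w j) \<Longrightarrow> wt c \<alpha> < N" using finite_weight[of w c r] w WE by blast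
    then show ?thesis unfolding D_def by blast
  qed
  define N where "N = (LEAST N. \<exists>w\<in>W - W'. w \<in> D N)"
  have "\<exists>w\<in>W - W'. w \<in> D N" unfolding N_def by (rule LeastI_ex) (use fin w0 in blast)
  then obtain w where w: "w \<in> W" "w \<notin> W'" "w \<in> D N" by blast
  have less: "v \<in> W'" if "v \<in> W" "v \<in> D M" "M < N" for v M
    using that not_less_Least[of M "\<lambda>N. \<exists>w\<in>W - W'. w \<in> D N"] unfolding N_def by blast
  have pdw: "(\<lambda>j. pd i (w j)) \<in> W'" if i: "i < c" for i
  proof (cases N)
    case 0
    then have "w j = 0" for j using w(3) by (auto simp: D_def)
    then have "w = 0" by (simp add: fun_eq_iff)
    then show ?thesis using w(2) vec.subspace_0[OF Ws'] by simp
  next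
    case (Suc M)
    have "wt c \<alpha> < M" if "\<alpha> \<in> keys (pd i (w j))" for j \<alpha>
    proof -
      have "\<alpha> + single i 1 \<in> keys (w j)" using that by (auto simp: in_keys_iff lookup_pd)
      then have "wt c (\<alpha> + single i 1) < Suc M" using w(3) Suc unfolding D_def by blast
      then show ?thesis using i by (simp add: wt_add wt_single)
    qed
    then have "(\<lambda>j. pd i (w j)) \<in> D M" by (simp add: D_def)
    then show ?thesis using less[OF closed[OF w(1) i]] Suc by simp
  qed
  define f where "f = e'(k := w)"
  have img: "f ` {..<Suc k} = insert w (e' ` {..<k})" by (auto simp: f_def lessThan_Suc)
  have span': "vec.span (e' ` {..<k}) = W'" using e' by (simp add: is_basis_def)
  let ?S = "vec.span (insert w (e' ` {..<k}))"
  have wS: "w \<notin> vec.span (e' ` {..<k})" using w(2) span' by simp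
  then have "w \<notin> e' ` {..<k}" using vec.span_superset[of "e' ` {..<k}"] by (rule contra_subsetD[rotated])
  then have "inj_on f {..<Suc k}"
    using e' by (auto simp: f_def inj_on_def is_basis_def less_Suc_eq)
  moreover have "vec.independent (insert w (e' ` {..<k}))"
    using e' wS by (simp add: vec.independent_insert is_basis_def)
  ultimately have basis: "is_basis (Suc k) f ?S" unfolding is_basis_def img by blast
  have S_iff: "v \<in> ?S \<longleftrightarrow> (\<exists>a. v - vscale a w \<in> W')" for v
    using vec.span_insert[of w "e' ` {..<k}"] span' by auto
  have "W' \<subseteq> ?S" using span' vec.span_mono[of "e' ` {..<k}" "insert w (e' ` {..<k})"] by auto
  moreover have SW: "?S \<subseteq> W"
  proof
    fix v assume "v \<in> ?S"
    then obtain a where "v - vscale a w \<in> W'" using S_iff by blast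
    then have "(v - vscale a w) + vscale a w \<in> W"
      using sub w(1) vec.subspace_add[OF Ws] vec.subspace_scale[OF Ws] by blast
    then show "v \<in> W" by simp
  qed
  moreover have "(\<lambda>j. pd i (v j)) \<in> ?S" if v: "v \<in> ?S" and i: "i < c" for v i
  proof -
    obtain a where "v - vscale a w \<in> W'" using S_iff v by blast
    then have "(\<lambda>j. pd i ((v - vscale a w) j)) \<in> W'" using closed' i by blast
    moreover have "vscale a (\<lambda>j. pd i (w j)) \<in> W'" using pdw[OF i] vec.subspace_scale[OF Ws'] by blast
    ultimately have "(\<lambda>j. pd i ((v - vscale a w) j)) + vscale a (\<lambda>j. pd i (w j)) \<in> W'"
      by (rule vec.subspace_add[OF Ws'])
    also have "(\<lambda>j. pd i ((v - vscale a w) j)) + vscale a (\<lambda>j. pd i (w j)) = (\<lambda>j. pd i (v j))"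
      by (intro ext poly_mapping_eqI)
        (simp add: vscale_def lookup_add lookup_minus lookup_pd lookup_map_times algebra_simps)
    finally show ?thesis using \<open>W' \<subseteq> ?S\<close> by blast
  qed
  ultimately have "?S \<in> diff_closed_subspaces c r (Suc k)"
    using basis WE vec.subspace_span unfolding diff_closed_subspaces_def subspaces_of_dim_def by blast
  then show ?thesis using \<open>W' \<subseteq> ?S\<close> SW by blast
qed

lemma diff_closed_flag:
  fixes W :: "(nat \<Rightarrow> 'f::field mpoly) set"
  assumes W: "W \<in> diff_closed_subspaces c r m"
  obtains F where "\<And>k. k \<le> m \<Longrightarrow> F k \<in> diff_closed_subspaces c r k" "\<And>k. k \<le> m \<Longrightarrow> F k \<subseteq> W"
    "\<And>k. k < m \<Longrightarrow> F k \<subseteq> F (Suc k)"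
proof -
  have "\<exists>F. \<forall>k. (k \<le> m \<longrightarrow> F k \<in> diff_closed_subspaces c r k \<and> F k \<subseteq> W) \<and> (k < m \<longrightarrow> F k \<subseteq> F (Suc k))"
  proof (rule dependent_nat_choice)
    have "vec.subspace W" using W by (simp add: diff_closed_subspaces_def subspaces_of_dim_def)
    then have 0: "0 \<in> W" by (rule vec.subspace_0)
    have "is_basis 0 e {0 :: nat \<Rightarrow> 'f mpoly}" for e
      by (simp add: is_basis_def vec.independent_empty)
    moreover have "(\<lambda>j. pd i ((0 :: nat \<Rightarrow> 'f mpoly) j)) = 0" for i by (simp add: fun_eq_iff)
    ultimately have "{0} \<in> (diff_closed_subspaces c r 0 :: (nat \<Rightarrow> 'f mpoly) set set)"
      by (simp add: diff_closed_subspaces_def subspaces_of_dim_def vec.subspace_single_0)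
    then show "\<exists>F. 0 \<le> m \<longrightarrow> F \<in> diff_closed_subspaces c r 0 \<and> F \<subseteq> W" using 0 by blast
  next
    fix F k assume "k \<le> m \<longrightarrow> F \<in> diff_closed_subspaces c r k \<and> F \<subseteq> W"
    then show "\<exists>F'. (Suc k \<le> m \<longrightarrow> F' \<in> diff_closed_subspaces c r (Suc k) \<and> F' \<subseteq> W) \<and> (k < m \<longrightarrow> F \<subseteq> F')"
      using diff_closed_step[OF W, of F k] by (cases "k < m") auto
  qed
  then show ?thesis using that by blast
qed

section \<open>Existence of quotient bases\<close>

text \<open>Modulo series of weight at least \<open>t\<close> only finitely many coefficients matter, which bounds the size of
  families that are independent modulo \<open>V\<close>. A family of maximal size is a basis.\<close>

lemma finite_colength_basis:
  fixes V :: "(nat \<Rightarrow> 'f::field mfps) set"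
  assumes V: "V \<in> submodules (psers c) r" and W: "wvecs c r t \<subseteq> V"
  shows "\<exists>m. V \<in> quot_points c r m"
proof -
  note V' = submodulesD[OF subring_psers V]
  let ?B = "vecs (psers c) r :: (nat \<Rightarrow> 'f mfps) set"
  let ?A = "{\<alpha>. keys \<alpha> \<subseteq> {..<c} \<and> wt c \<alpha> < t}"
  let ?I = "{..<r} \<times> ?A"
  have finI: "finite ?I" using finite_wt_less by simp
  then obtain h where h: "bij_betw h {0..<card ?I} ?I" using ex_bij_betw_nat_finite by blast
  define Q where "Q b k \<longleftrightarrow> (\<forall>i<k. b i \<in> ?B) \<and>
    (\<forall>x. (\<Sum>i<k. mfps_const (x i) *v b i) \<in> V \<longrightarrow> (\<forall>i<k. x i = 0))" for b and k :: nat
  have QD: "i < k \<Longrightarrow> b i \<in> ?B" "(\<Sum>i<k. mfps_const (x i) *v b i) \<in> V \<Longrightarrow> \<forall>i<k. x i = 0"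
    if "Q b k" for b k x i
  proof -
    show "i < k \<Longrightarrow> b i \<in> ?B" using that[unfolded Q_def, THEN conjunct1] by blast
    show "(\<Sum>i<k. mfps_const (x i) *v b i) \<in> V \<Longrightarrow> \<forall>i<k. x i = 0"
      by (rule that[unfolded Q_def, THEN conjunct2, THEN spec, THEN mp])
  qed
  define P where "P k \<longleftrightarrow> (\<exists>b. Q b k)" for k
  have bound: "k \<le> card ?I" if Pk: "P k" for k
  proof (rule ccontr)
    assume "\<not> k \<le> card ?I"
    obtain b where "Q b k" using Pk unfolding P_def ..
    note b = QD[OF this]
    obtain x where x: "\<exists>i\<in>{..<k}. x i \<noteq> 0" 
      "\<forall>l<card ?I. (\<Sum>i\<in>{..<k}. x i * mfps_nth (b i (fst (h l))) (snd (h l))) = 0"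
      using underdetermined_system[of "{..<k}" "card ?I" "\<lambda>i l. mfps_nth (b i (fst (h l))) (snd (h l))"]
        \<open>\<not> k \<le> card ?I\<close> by auto
    let ?s = "\<Sum>i<k. mfps_const (x i) *v b i"
    have sB: "?s \<in> ?B" using b(1) by (intro vecs_sum[OF subring_psers] vecs_psers(4)) auto
    have "?s \<in> wvecs c r t"
      unfolding wvecs_def vecs_def
    proof (intro CollectI conjI allI impI)
      fix j assume j: "j < r"
      show "?s j \<in> wfilt c t"
        unfolding wfilt_def
      proof (intro CollectI conjI allI impI)
        show sj: "?s j \<in> psers c" using sB by (rule vecs_nth) simp
        fix \<alpha> assume nz: "mfps_nth (?s j) \<alpha> \<noteq> 0"
        show "t \<le> wt c \<alpha>"
        proof (rule ccontr)
          assume "\<not> t \<le> wt c \<alpha>"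
          then have "(j, \<alpha>) \<in> ?I" using nz sj j by (auto simp: psers_def)
          then have "(j, \<alpha>) \<in> h ` {0..<card ?I}" using bij_betw_imp_surj_on[OF h] by simp
          then obtain l where l: "l < card ?I" "h l = (j, \<alpha>)" by (auto simp: image_iff)
          have "mfps_nth (?s j) \<alpha> = (\<Sum>i\<in>{..<k}. x i * mfps_nth (b i j) \<alpha>)" by (simp add: sum_pointwise)
          also have "\<dots> = 0" using x(2)[rule_format, OF l(1)] by (simp add: l(2))
          finally show False using nz by simp
        qed
      qed
    qed (use sB in \<open>auto simp: vecs_def\<close>)
    then show False using b(2) x(1) W by blast
  qed
  have "P 0" by (auto simp: P_def Q_def)
  define m where "m = Greatest P"
  have "P m" unfolding m_def using \<open>P 0\<close> bound by (rule GreatestI_nat)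
  have notP: "\<not> P (Suc m)"
  proof
    assume "P (Suc m)"
    then have "Suc m \<le> m" unfolding m_def using bound by (rule Greatest_le_nat)
    then show False by simp
  qed
  obtain b where "Q b m" using \<open>P m\<close> unfolding P_def ..
  note b = QD[OF this]
  have "quotient_basis c r V m b"
    unfolding quotient_basis_def
  proof (intro conjI allI impI ballI)
    fix v :: "nat \<Rightarrow> 'f mfps" assume v: "v \<in> ?B"
    let ?d = "\<lambda>a j. v j - (\<Sum>i<m. mfps_const (a i) * b i j)"
    have d: "?d a = v - (\<Sum>i<m. mfps_const (a i) *v b i)" for a by (simp add: fun_eq_iff sum_pointwise)
    define b' where "b' = b(m := v)"
    have b'B: "\<forall>i<Suc m. b' i \<in> ?B" using b(1) v by (simp add: b'_def less_Suc_eq)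
    have b'sum: "(\<Sum>i<Suc m. mfps_const (x i) *v b' i) = (\<Sum>i<m. mfps_const (x i) *v b i) + mfps_const (x m) *v v" for x
      unfolding sum.lessThan_Suc by (simp add: b'_def)
    obtain x where x: "(\<Sum>i<Suc m. mfps_const (x i) *v b' i) \<in> V" "\<not> (\<forall>i<Suc m. x i = 0)"
    proof -
      have "\<not> Q b' (Suc m)" using notP unfolding P_def by blast
      have "\<not> (\<forall>x. (\<Sum>i<Suc m. mfps_const (x i) *v b' i) \<in> V \<longrightarrow> (\<forall>i<Suc m. x i = 0))"
      proof
        assume "\<forall>x. (\<Sum>i<Suc m. mfps_const (x i) *v b' i) \<in> V \<longrightarrow> (\<forall>i<Suc m. x i = 0)"
        with b'B have "Q b' (Suc m)" unfolding Q_def by (rule conjI)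
        then show False using \<open>\<not> Q b' (Suc m)\<close> by (rule notE[rotated])
      qed
      then obtain x where "\<not> ((\<Sum>i<Suc m. mfps_const (x i) *v b' i) \<in> V \<longrightarrow> (\<forall>i<Suc m. x i = 0))"
        unfolding not_all ..
      then show thesis unfolding not_imp by (elim conjE) (rule that)
    qed
    have xm: "x m \<noteq> 0"
    proof
      assume "x m = 0"
      then have "(\<Sum>i<m. mfps_const (x i) *v b i) \<in> V"
        using x(1) unfolding b'sum by (simp add: mfps_const_hom flip: zero_fun_def)
      then have "\<forall>i<m. x i = 0" by (rule b(2))
      then show False using x(2) \<open>x m = 0\<close> by (simp add: less_Suc_eq)
    qed
    define a where "a i = (if i < m then - x i / x m else 0)" for i
    have "mfps_const (1 / x m) *v (\<Sum>i<Suc m. mfps_const (x i) *v b' i) \<in> V"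
      by (rule V'(4)[OF psers_gens(1) x(1)])
    also have "mfps_const (1 / x m) *v (\<Sum>i<Suc m. mfps_const (x i) *v b' i) = ?d a"
    proof
      fix j
      have "mfps_const (1 / x m) * (\<Sum>i<m. mfps_const (x i) * b i j) = - (\<Sum>i<m. mfps_const (a i) * b i j)"
        unfolding sum_distrib_left sum_negf[symmetric]
      proof (rule sum.cong[OF refl])
        fix i assume "i \<in> {..<m}"
        then have "a i = - (1 / x m * x i)" by (simp add: a_def)
        then show "mfps_const (1 / x m) * (mfps_const (x i) * b i j) = - (mfps_const (a i) * b i j)"
          by (simp only: mfps_const_hom(2,4) mult.assoc minus_mult_left minus_minus)
      qed
      moreover have "mfps_const (1 / x m) * (mfps_const (x m) * v j) = v j"
        using xm by (simp add: mult.assoc[symmetric] mfps_const_hom(6) flip: mfps_const_hom(2))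
      ultimately show "(mfps_const (1 / x m) *v (\<Sum>i<Suc m. mfps_const (x i) *v b' i)) j = ?d a j"
        unfolding b'sum by (simp add: sum_pointwise distrib_left)
    qed
    finally have aV: "?d a \<in> V" .
    have a0: "\<forall>i\<ge>m. a i = 0" by (simp add: a_def)
    have unique: "a' = a" if a': "(\<forall>i\<ge>m. a' i = 0) \<and> ?d a' \<in> V" for a'
    proof
      fix i
      have "?d a - ?d a' \<in> V" by (rule V'(5)[OF aV conjunct2[OF a']])
      also have "?d a - ?d a' = (\<Sum>i<m. mfps_const (a' i - a i) *v b i)"
        by (simp add: fun_eq_iff sum_pointwise mfps_const_hom left_diff_distrib sum_subtractf)
      finally have "\<forall>i<m. a' i - a i = 0" by (rule b(2))
      then show "a' i = a i" using a' a0 by (cases "i < m") auto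
    qed
    show "\<exists>!a. (\<forall>i\<ge>m. a i = 0) \<and> ?d a \<in> V"
    proof (rule ex1I)
      show "(\<forall>i\<ge>m. a i = 0) \<and> ?d a \<in> V" using a0 aV by (rule conjI)
    qed (rule unique)
  qed (use b(1) in auto)
  then show ?thesis using V by (auto simp: quot_points_def)
qed

section \<open>Points of the Quot scheme and primary submodules\<close>

context residue_map
begin

abbreviation tayv :: "(nat \<Rightarrow> 'k mpoly) \<Rightarrow> nat \<Rightarrow> 'f mfps" where
  "tayv u \<equiv> (\<lambda>j. tay (u j))"

lemma tayv_vecs: "u \<in> R_vecs r \<Longrightarrow> tayv u \<in> vecs (psers c) r"
  by (auto simp: vecs_def)

lemma tayv_hom:
  "u \<in> R_vecs r \<Longrightarrow> v \<in> R_vecs r \<Longrightarrow> tayv (u + v) = tayv u + tayv v"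
  "u \<in> R_vecs r \<Longrightarrow> v \<in> R_vecs r \<Longrightarrow> tayv (u - v) = tayv u - tayv v"
  "a \<in> pring n \<Longrightarrow> u \<in> R_vecs r \<Longrightarrow> tayv (a *v u) = tay a *v tayv u"
  "tayv 0 = 0"
proof -
  have nth: "u j \<in> pring n" if "u \<in> R_vecs r" for u j using that by (rule vecs_nth) simp
  show "u \<in> R_vecs r \<Longrightarrow> v \<in> R_vecs r \<Longrightarrow> tayv (u + v) = tayv u + tayv v"
    "u \<in> R_vecs r \<Longrightarrow> v \<in> R_vecs r \<Longrightarrow> tayv (u - v) = tayv u - tayv v"
    "a \<in> pring n \<Longrightarrow> u \<in> R_vecs r \<Longrightarrow> tayv (a *v u) = tay a *v tayv u"
    using nth[of u] nth[of v] by (simp_all add: fun_eq_iff tay_add tay_diff tay_mult)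
  show "tayv 0 = 0" by (simp add: fun_eq_iff)
qed

definition pullback :: "nat \<Rightarrow> (nat \<Rightarrow> 'f mfps) set \<Rightarrow> (nat \<Rightarrow> 'k mpoly) set" where
  "pullback r V = {u \<in> R_vecs r. tayv u \<in> V}"

text \<open>The constant term of \<open>\<gamma>(s)\<close> is the class of \<open>s\<close>, so \<open>\<gamma>(s)\<close> is a unit.\<close>

lemma denom_cancel:
  assumes V: "V \<in> submodules (psers c) r" and s: "s \<in> pring n - p" and sv: "tay s *v v \<in> V"
  shows "v \<in> V"
proof -
  have "mfps_nth (tay s) 0 \<noteq> 0" using s bar_eq_0[of s] by auto
  then obtain h where h: "h \<in> psers c" "tay s * h = 1" using psers_unit[of "tay s" c] by blast
  have "h *v (tay s *v v) \<in> V" using submodulesD(4)[OF subring_psers V h(1) sv] .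
  also have "h *v (tay s *v v) = v" using h(2) by (simp add: mult.assoc[symmetric] mult.commute[of h])
  finally show ?thesis .
qed

lemma pullback_saturated:
  assumes V: "V \<in> submodules (psers c) r"
  shows "saturated r (pullback r V)"
  unfolding saturated_def
proof (intro conjI ballI impI)
  note V' = submodulesD[OF subring_psers V]
  show "pullback r V \<in> submodules (pring n) r"
    unfolding submodules_iff[OF subring_polys]
  proof (intro conjI ballI)
    show "0 \<in> pullback r V" using V'(2) tayv_hom(4) by (simp add: pullback_def)
    show "u + v \<in> pullback r V" if "u \<in> pullback r V" "v \<in> pullback r V" for u v
    proof -
      have "u \<in> R_vecs r" "v \<in> R_vecs r" "tayv u + tayv v \<in> V" using that V'(3) by (auto simp: pullback_def)
      then show ?thesis using tayv_hom(1)[of u r v] by (simp only: pullback_def mem_Collect_eq vecs_polys(2))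
    qed
    show "a *v u \<in> pullback r V" if "a \<in> pring n" "u \<in> pullback r V" for a u
    proof -
      have "u \<in> R_vecs r" "tay a *v tayv u \<in> V" using that V'(4)[of "tay a" "tayv u"] by (auto simp: pullback_def)
      then show ?thesis using tayv_hom(3)[OF that(1)] that(1) vecs_polys(4)[OF that(1)] by (simp add: pullback_def)
    qed
  qed (auto simp: pullback_def)
  fix s w assume s: "s \<in> pring n - p" and w: "w \<in> R_vecs r" and sw: "s *v w \<in> pullback r V"
  have "tay s *v tayv w \<in> V" using sw tayv_hom(3)[of s w r] s w by (simp add: pullback_def)
  then have "tayv w \<in> V" by (rule denom_cancel[OF V s])
  then show "w \<in> pullback r V" using w by (simp add: pullback_def)
qed

lemma killed_pullback:
  "killed (wfilt c 1) V k (tayv w) \<Longrightarrow> w \<in> R_vecs r \<Longrightarrow> killed p (pullback r V) k w"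
proof (induction k arbitrary: w)
  case (Suc k)
  show ?case
    unfolding killed.simps
  proof
    fix a assume a: "a \<in> p"
    then have an: "a \<in> pring n" using p_sub by blast
    have "tay a \<in> wfilt c 1" using a by (simp add: wfilt_Suc_0_iff)
    then have "killed (wfilt c 1) V k (tay a *v tayv w)" using Suc.prems(1) by simp
    then have "killed (wfilt c 1) V k (tayv (a *v w))" by (simp only: tayv_hom(3)[OF an Suc.prems(2)])
    then show "killed p (pullback r V) k (a *v w)" by (rule Suc.IH) (rule vecs_polys(4)[OF an Suc.prems(2)])
  qed
qed (simp add: pullback_def)

end

context local_generators
begin

lemma tay_approximation_family:
  assumes "finite I" "\<And>i. i \<in> I \<Longrightarrow> b i \<in> psers c"
  obtains s a where "s \<in> pring n - p" "\<And>i. a i \<in> pring n" "\<And>i. i \<in> I \<Longrightarrow> tay s * b i - tay (a i) \<in> wfilt c t"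
proof -
  have "\<exists>s\<in>pring n - p. \<exists>a. (\<forall>i. a i \<in> pring n) \<and> (\<forall>i\<in>I. tay s * b i - tay (a i) \<in> wfilt c t)"
    using assms
  proof (induction I)
    case empty
    show ?case by (intro bexI[of _ 1] exI[of _ "\<lambda>_. 0"]) auto
  next
    case (insert k I)
    then have "\<exists>s\<in>pring n - p. \<exists>a. (\<forall>i. a i \<in> pring n) \<and> (\<forall>i\<in>I. tay s * b i - tay (a i) \<in> wfilt c t)" by simp
    then obtain s a where s: "s \<in> pring n - p" "\<forall>i. a i \<in> pring n" "\<forall>i\<in>I. tay s * b i - tay (a i) \<in> wfilt c t" by blast
    obtain s' a' where s': "s' \<in> pring n - p" "a' \<in> pring n" "tay s' * b k - tay a' \<in> wfilt c t"
      using tay_approximation[of "b k" t] insert.prems by blast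
    show ?case
    proof (intro bexI exI conjI allI ballI)
      show "s * s' \<in> pring n - p" by (rule denom(3)[OF s(1) s'(1)])
      show "(if i = k then s * a' else s' * a i) \<in> pring n" for i using s s' by auto
      fix i assume i: "i \<in> insert k I"
      show "tay (s * s') * b i - tay (if i = k then s * a' else s' * a i) \<in> wfilt c t"
      proof (cases "i = k")
        case True
        have "tay s * (tay s' * b k - tay a') \<in> wfilt c t" using s'(3) by (intro wfilt_mult_psers) auto
        then show ?thesis using True s s' by (simp add: tay_mult algebra_simps)
      next
        case False
        then have "tay s' * (tay s * b i - tay (a i)) \<in> wfilt c t" using s(3) i by (intro wfilt_mult_psers) auto
        then show ?thesis using False s s' by (simp add: tay_mult algebra_simps)
      qed
    qed
  qed
  then show ?thesis using that by blast
qed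

lemma tayv_approximation:
  assumes v: "v \<in> vecs (psers c) r"
  obtains s u where "s \<in> pring n - p" "u \<in> R_vecs r" "tay s *v v - tayv u \<in> wvecs c r t"
proof -
  obtain s a where s: "s \<in> pring n - p" "\<And>i. a i \<in> pring n" "\<And>i. i \<in> {..<r} \<Longrightarrow> tay s * v i - tay (a i) \<in> wfilt c t"
    using tay_approximation_family[of "{..<r}" v t] vecs_nth[OF v] by blast
  define u where "u j = (if j < r then a j else 0)" for j
  have "u \<in> R_vecs r" using s(2) by (auto simp: u_def vecs_def)
  moreover have "tay s *v v - tayv u \<in> wvecs c r t" using s(3) v by (auto simp: wvecs_def vecs_def u_def)
  ultimately show ?thesis using s(1) that by blast
qed

text \<open>An element of the larger submodule outside the smaller one is, up to a unit and an error in the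
  smaller one, the expansion of some \<open>u \<in> R\<^sup>r\<close>.\<close>

lemma pullback_strict_mono:
  assumes V: "V \<in> submodules (psers c) r" "V' \<in> submodules (psers c) r" and W: "wvecs c r t \<subseteq> V" and sub: "V \<subset> V'"
  shows "pullback r V \<subset> pullback r V'"
proof -
  obtain v where v: "v \<in> V'" "v \<notin> V" using sub by blast
  have "v \<in> vecs (psers c) r" using v(1) submodulesD(1)[OF subring_psers V(2)] by blast
  then obtain s u where s: "s \<in> pring n - p" "u \<in> R_vecs r" "tay s *v v - tayv u \<in> wvecs c r t"
    by (rule tayv_approximation)
  have d: "tay s *v v - tayv u \<in> V" using s(3) W by blast
  have "tay s *v v - (tay s *v v - tayv u) \<in> V'"
  proof (rule submodulesD(5)[OF subring_psers V(2)])
    show "tay s *v v \<in> V'" by (rule submodulesD(4)[OF subring_psers V(2) taylor_psers v(1)])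
  qed (use d sub in blast)
  then have "tayv u \<in> V'" by (simp add: fun_eq_iff)
  moreover have "tayv u \<notin> V"
  proof
    assume "tayv u \<in> V"
    then have "(tay s *v v - tayv u) + tayv u \<in> V" using d by (intro submodulesD(3)[OF subring_psers V(1)])
    then have "tay s *v v \<in> V" by (simp add: fun_eq_iff)
    then show False using denom_cancel[OF V(1) s(1)] v(2) by blast
  qed
  ultimately have "u \<in> pullback r V'" "u \<notin> pullback r V" using s(2) by (auto simp: pullback_def)
  moreover have "pullback r V \<subseteq> pullback r V'" using sub by (auto simp: pullback_def)
  ultimately show ?thesis by blast
qed

lemma quot_point_of_eq:
  assumes "U \<subseteq> R_vecs r"
  shows "quot_point_of bar c r m U = submodule_hull (psers c) r
    (tayv ` U \<union> {\<lambda>j. a * v j | a v. a \<in> max_ideal_pow c m \<and> v \<in> vecs (psers c) r})"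
proof -
  have "(\<lambda>u j. gamma_map bar c (u j)) ` U = tayv ` U"
  proof (rule image_cong)
    fix u assume "u \<in> U"
    then have "u j \<in> pring n" for j using assms by (auto intro: vecs_nth)
    then show "(\<lambda>j. gamma_map bar c (u j)) = tayv u" by (simp add: gamma_map_eq_taylor)
  qed simp
  then show ?thesis by (simp add: quot_point_of_def)
qed

text \<open>A submodule that contains \<open>\<nn>\<^sup>m B\<^sup>r\<close> is generated by it and by approximations of its elements, which
  can be taken in the image of \<open>\<gamma>\<close>.\<close>

theorem quot_point_of_pullback:
  assumes V: "V \<in> quot_points c r m"
  shows "quot_point_of bar c r m (pullback r V) = V"
proof -
  have Vs: "V \<in> submodules (psers c) r" using V by (simp add: quot_points_def)
  obtain b where b: "quotient_basis c r V m b" using V by (auto simp: quot_points_def)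
  let ?S = "tayv ` pullback r V \<union> {\<lambda>j. a * v j | a v. a \<in> max_ideal_pow c m \<and> v \<in> vecs (psers c) r}"
  have "?S \<subseteq> V"
    using quotient_basis_max_ideal_pow[OF Vs b] by (auto simp: pullback_def)
  moreover have "V \<subseteq> H" if H: "H \<in> submodules (psers c) r" "?S \<subseteq> H" for H
  proof
    fix v assume v: "v \<in> V"
    then have "v \<in> vecs (psers c) r" using submodulesD(1)[OF subring_psers Vs] by blast
    then obtain s u where s: "s \<in> pring n - p" "u \<in> R_vecs r" "tay s *v v - tayv u \<in> wvecs c r (Suc (2 * c) * m)"
      by (rule tayv_approximation)
    have dV: "tay s *v v - tayv u \<in> V" using s(3) quotient_basis_wvecs[OF Vs b] by blast
    have "wvecs c r (Suc (2 * c) * m) \<subseteq> H"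
      by (rule wvecs_subset_hull[OF H(1)]) (use H(2) in blast)
    then have dH: "tay s *v v - tayv u \<in> H" using s(3) by blast
    have "tay s *v v - (tay s *v v - tayv u) \<in> V"
      by (rule submodulesD(5)[OF subring_psers Vs submodulesD(4)[OF subring_psers Vs taylor_psers v] dV])
    then have "tayv u \<in> V" by (simp add: fun_eq_iff)
    then have "tayv u \<in> H" using s(2) H(2) by (auto simp: pullback_def)
    then have "(tay s *v v - tayv u) + tayv u \<in> H" using dH by (intro submodulesD(3)[OF subring_psers H(1)])
    then have "tay s *v v \<in> H" by (simp add: fun_eq_iff)
    then show "v \<in> H" by (rule denom_cancel[OF H(1) s(1)])
  qed
  ultimately have "submodule_hull (psers c) r ?S = V"
    unfolding submodule_hull_def using Vs by (intro subset_antisym Inter_lower Inter_greatest) simp_all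
  then show ?thesis by (subst quot_point_of_eq) (auto simp: pullback_def)
qed

lemma annihilator_antimono: "W \<subseteq> W' \<Longrightarrow> annihilator c r W' \<subseteq> annihilator c r W"
  by (auto simp: annihilator_def)

text \<open>A chain of length \<open>m\<close> is the pullback of the annihilators of a flag in \<open>V\<^sup>\<bottom>\<close>. For the upper
  bound, a linear relation modulo \<open>V\<close> between the expansions of witnesses of the strict inclusions
  \<open>L\<^sub>i \<subset> L\<^sub>i\<^sub>+\<^sub>1\<close> has coefficients in \<open>F\<close>; approximating them by elements of \<open>R\<^sub>\<pp>\<close> gives a
  relation that puts the last witness into its \<open>L\<^sub>i\<close>.\<close>

theorem multiplicity_pullback:
  assumes V: "V \<in> quot_points c r m"
  shows "multiplicity n r p (pullback r V) = enat m"
proof -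
  have Vs: "V \<in> submodules (psers c) r" using V by (simp add: quot_points_def)
  note V' = submodulesD[OF subring_psers Vs]
  obtain b where b: "quotient_basis c r V m b" using V by (auto simp: quot_points_def)
  define t where "t = Suc (2 * c) * m"
  have WV: "wvecs c r t \<subseteq> V" unfolding t_def by (rule quotient_basis_wvecs[OF Vs b])
  obtain Y where YY:
    "\<forall>v\<in>vecs (psers c) r. \<forall>w\<in>vecs (psers c) r. \<forall>i. Y (v + w) i = Y v i + Y w i"
    "\<forall>v\<in>vecs (psers c) r. \<forall>x i. Y (mfps_const x *v v) i = x * Y v i"
    "\<forall>v\<in>vecs (psers c) r. v \<in> V \<longleftrightarrow> (\<forall>i<m. Y v i = 0)"
    "\<forall>i<m. \<forall>k<m. Y (b k) i = (if i = k then 1 else 0)"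
    using quotient_basis_functionals[OF Vs b] by blast
  note Y = YY[rule_format]
  obtain F where F: "\<And>k. k \<le> m \<Longrightarrow> F k \<in> diff_closed_subspaces c r k" "\<And>k. k \<le> m \<Longrightarrow> F k \<subseteq> perp c r V"
    "\<And>k. k < m \<Longrightarrow> F k \<subseteq> F (Suc k)"
    using diff_closed_flag[OF perp_quot_point(1)[OF V]] by blast
  define A where "A k = annihilator c r (F k)" for k
  have Aq: "A k \<in> quot_points c r k" if "k \<le> m" for k
    unfolding A_def by (rule annihilator_diff_closed(1)[OF F(1)[OF that]])
  then have As: "A k \<in> submodules (psers c) r" if "k \<le> m" for k using that by (simp add: quot_points_def)
  have VA: "V \<subseteq> A k" if "k \<le> m" for k
    using annihilator_antimono[OF F(2)[OF that], of r] unfolding perp_quot_point(2)[OF V] A_def .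
  have FS: "F k \<noteq> F (Suc k)" if km: "k < m" for k
  proof
    assume eq: "F k = F (Suc k)"
    obtain e where e: "is_basis k e (F k)"
      using F(1)[of k] km by (auto simp: diff_closed_subspaces_def subspaces_of_dim_def)
    obtain e' where e': "is_basis (Suc k) e' (F k)"
      using F(1)[of "Suc k"] km eq by (auto simp: diff_closed_subspaces_def subspaces_of_dim_def)
    show False using is_basis_unique_dim[OF e' e] by simp
  qed
  have A_strict: "A (Suc k) \<subset> A k" if k: "k < m" for k
  proof -
    have "A (Suc k) \<noteq> A k"
    proof
      assume "A (Suc k) = A k"
      then have "perp c r (A (Suc k)) = perp c r (A k)" by simp
      then have "F (Suc k) = F k"
        using annihilator_diff_closed(2)[OF F(1)[of "Suc k"]] annihilator_diff_closed(2)[OF F(1)[of k]] k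
        by (simp add: A_def)
      then show False using FS[OF k] by simp
    qed
    then show ?thesis using annihilator_antimono[OF F(3)[OF k]] by (auto simp: A_def)
  qed
  show ?thesis
  proof (rule multiplicity_eqI[OF pullback_saturated[OF Vs]])
    show "saturated r (pullback r (A (m - i)))" for i by (rule pullback_saturated[OF As]) simp
    show "pullback r V \<subseteq> pullback r (A (m - i))" for i using VA[of "m - i"] by (auto simp: pullback_def)
    show "pullback r (A (m - i)) \<subset> pullback r (A (m - Suc i))" if i: "i < m" for i
    proof -
      have "A (Suc (m - Suc i)) \<subset> A (m - Suc i)" using i by (intro A_strict) simp
      moreover have "Suc (m - Suc i) = m - i" using i by simp
      ultimately show ?thesis using As[of "m - i"] As[of "m - Suc i"] WV VA[of "m - i"]
        by (intro pullback_strict_mono[where t = t]) auto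
    qed
  next
    \<comment> \<open>elements that witness the strict inclusions of a chain are independent modulo \<open>V\<close>\<close>
    fix l L assume L: "\<And>i. i \<le> l \<Longrightarrow> saturated r (L i)" "\<And>i. i \<le> l \<Longrightarrow> pullback r V \<subseteq> L i" "\<And>i. i < l \<Longrightarrow> L i \<subset> L (Suc i)"
    show "l \<le> m"
    proof (rule ccontr)
      assume "\<not> l \<le> m"
      have "\<forall>i\<in>{..<l}. \<exists>u. u \<in> L (Suc i) \<and> u \<notin> L i" using L(3) by blast
      then obtain u where u: "\<And>i. i < l \<Longrightarrow> u i \<in> L (Suc i)" "\<And>i. i < l \<Longrightarrow> u i \<notin> L i" by (metis lessThan_iff)
      have Ls: "L i \<in> submodules (pring n) r" if "i \<le> l" for i using saturatedD(1)[OF L(1)[OF that]] .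
      have uR: "u i \<in> R_vecs r" if "i < l" for i
        using u(1)[OF that] submodulesD(1)[OF subring_polys Ls[of "Suc i"]] that by auto
      have uB: "tayv (u i) \<in> vecs (psers c) r" if "i < l" for i by (rule tayv_vecs[OF uR[OF that]])
      have Lmono: "i \<le> j \<Longrightarrow> j \<le> l \<Longrightarrow> L i \<subseteq> L j" for i j
      proof (induction j rule: dec_induct)
        case (step j)
        then show ?case using L(3)[of j] by auto
      qed simp
      obtain x where x: "\<exists>i\<in>{..<l}. x i \<noteq> 0" "\<forall>k<m. (\<Sum>i\<in>{..<l}. x i * Y (tayv (u i)) k) = 0"
        using underdetermined_system[of "{..<l}" m "\<lambda>i k. Y (tayv (u i)) k"] \<open>\<not> l \<le> m\<close> by auto
      \<comment> \<open>the last witness that occurs in the relation\<close>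
      define q where "q = Max {i. i < l \<and> x i \<noteq> 0}"
      have "q \<in> {i. i < l \<and> x i \<noteq> 0}" unfolding q_def using x(1) by (intro Max_in) auto
      then have q: "q < l" "x q \<noteq> 0" by auto
      have above: "x i = 0" if "q < i" "i < l" for i
      proof (rule ccontr)
        assume "x i \<noteq> 0"
        then have "i \<le> q" unfolding q_def using that by (intro Max_ge) auto
        then show False using that by simp
      qed
      have uB': "tayv (u i) \<in> vecs (psers c) r" if "i \<in> {..<l}" for i using uB that by simp
      note sum = functional_sum[where S = "{..<l}" and b = "\<lambda>i. tayv (u i)" and x = x, OF YY(1,2) finite_lessThan uB']
      have "(\<Sum>i<l. mfps_const (x i) *v tayv (u i)) \<in> V" using Y(3)[OF sum(1)] sum(2) x(2) by simp
      also have "(\<Sum>i<l. mfps_const (x i) *v tayv (u i)) = (\<Sum>i\<le>q. mfps_const (x i) *v tayv (u i))"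
        using q(1) above by (intro sum.mono_neutral_right) (auto simp: mfps_const_hom fun_eq_iff)
      finally have comb: "(\<Sum>i\<le>q. mfps_const (x i) *v tayv (u i)) \<in> V" .
      obtain s a where s: "s \<in> pring n - p" "\<And>i. a i \<in> pring n"
        "\<And>i. i \<in> {..q} \<Longrightarrow> tay s * mfps_const (x i) - tay (a i) \<in> wfilt c (Suc t)"
        using tay_approximation_family[of "{..q}" "\<lambda>i. mfps_const (x i)" "Suc t"] by blast
      define v where "v = (\<Sum>i\<le>q. a i *v u i)"
      have vR: "v \<in> R_vecs r" unfolding v_def using s(2) uR q(1) by (intro vecs_sum[OF subring_polys] vecs_polys(4)) auto
      have tv: "tayv v = (\<Sum>i\<le>q. tay (a i) *v tayv (u i))"
      proof
        fix j
        have uj: "u i j \<in> pring n" if "i \<le> q" for i using uR[of i] that q(1) by (auto intro: vecs_nth)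
        have "tay (v j) = tay (\<Sum>i\<le>q. a i * u i j)" by (simp add: v_def sum_pointwise)
        also have "\<dots> = (\<Sum>i\<le>q. tay (a i) * tay (u i j))"
          using uj s(2) by (subst tay_sum) (auto simp: tay_mult)
        finally show "tay (v j) = (\<Sum>i\<le>q. tay (a i) *v tayv (u i)) j" by (simp add: sum_pointwise)
      qed
      have "(\<Sum>i\<le>q. (tay s * mfps_const (x i) - tay (a i)) *v tayv (u i)) \<in> V"
      proof (rule submodules_sum[OF subring_psers Vs])
        fix i assume i: "i \<in> {..q}"
        have "(tay s * mfps_const (x i) - tay (a i)) * tay (u i j) \<in> wfilt c t" for j
          using wfilt_mult[OF wfilt_mono[OF _ s(3)[OF i], of t], of "tay (u i j)" 0] by (simp add: wfilt_0)
        moreover have "tay (u i j) = 0" if "r \<le> j" for j using uB[of i] i q(1) that by (auto simp: vecs_def)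
        ultimately have "(tay s * mfps_const (x i) - tay (a i)) *v tayv (u i) \<in> wvecs c r t"
          by (auto simp: wvecs_def vecs_def)
        then show "(tay s * mfps_const (x i) - tay (a i)) *v tayv (u i) \<in> V" using WV by blast
      qed
      moreover have "tay s *v (\<Sum>i\<le>q. mfps_const (x i) *v tayv (u i)) \<in> V" using comb by (intro V'(4)) auto
      ultimately have "tay s *v (\<Sum>i\<le>q. mfps_const (x i) *v tayv (u i)) -
        (\<Sum>i\<le>q. (tay s * mfps_const (x i) - tay (a i)) *v tayv (u i)) \<in> V" by (intro V'(5))
      also have "tay s *v (\<Sum>i\<le>q. mfps_const (x i) *v tayv (u i)) -
        (\<Sum>i\<le>q. (tay s * mfps_const (x i) - tay (a i)) *v tayv (u i)) = tayv v"
        unfolding tv by (simp add: fun_eq_iff sum_pointwise sum_distrib_left left_diff_distrib sum_subtractf mult.assoc)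
      finally have "v \<in> pullback r V" using vR by (simp add: pullback_def)
      then have vL: "v \<in> L q" using L(2)[of q] q(1) by auto
      note Lq = submodulesD[OF subring_polys Ls[of q]]
      have "(\<Sum>i<q. a i *v u i) \<in> L q"
      proof (rule submodules_sum[OF subring_polys Ls])
        show "q \<le> l" using q(1) by simp
        fix i assume "i \<in> {..<q}"
        then have "u i \<in> L q" using u(1)[of i] Lmono[of "Suc i" q] q(1) by auto
        then show "a i *v u i \<in> L q" using Lq(4)[OF _ s(2)] q(1) by simp
      qed
      then have "v - (\<Sum>i<q. a i *v u i) \<in> L q" using vL Lq(5) q(1) by simp
      also have "v - (\<Sum>i<q. a i *v u i) = a q *v u q"
        unfolding v_def by (simp add: lessThan_Suc_atMost[symmetric])
      finally have aq: "a q *v u q \<in> L q" .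
      have "mfps_nth (tay s * mfps_const (x q) - tay (a q)) 0 = 0"
        using s(3)[of q] by (intro wfilt_nth_0[of _ c "Suc t"]) auto
      then have "bar (a q) = bar s * x q" by simp
      moreover have "bar s \<noteq> 0" using s(1) bar_eq_0[of s] by auto
      ultimately have "a q \<in> pring n - p" using q(2) s(2)[of q] bar_eq_0[of "a q"] by auto
      then have "u q \<in> L q" using saturatedD(2)[OF L(1) _ uR aq] q(1) by simp
      then show False using u(2)[OF q(1)] by blast
    qed
  qed
qed

theorem pullback_primary:
  assumes V: "V \<in> quot_points c r m"
  shows "pullback r V \<in> primary_submodules n r p m"
proof -
  have Vs: "V \<in> submodules (psers c) r" using V by (simp add: quot_points_def)
  obtain b where b: "quotient_basis c r V m b" using V by (auto simp: quot_points_def)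
  have "killed p (pullback r V) m w" if "w \<in> R_vecs r" for w
    using quotient_basis_killed[OF Vs b tayv_vecs[OF that]] that by (rule killed_pullback)
  then have "primary n r p (pullback r V) \<or> pullback r V = R_vecs r"
    using saturated_killed_primary[OF pullback_saturated[OF Vs]] by blast
  then show ?thesis using multiplicity_pullback[OF V] by (simp add: primary_submodules_def)
qed

lemma primary_submodules_saturated:
  assumes "U \<in> primary_submodules n r p m"
  shows "saturated r U"
proof (cases "primary n r p U")
  case False
  then have "U = R_vecs r" using assms by (simp add: primary_submodules_def)
  moreover have "R_vecs r \<in> submodules (pring n) r" unfolding submodules_iff[OF subring_polys] by auto
  ultimately show ?thesis by (auto simp: saturated_def)
qed (rule primary_saturated)

lemma killed_gmonom:
  assumes "keys \<alpha> \<subseteq> {..<c}"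
  shows "\<forall>w\<in>R_vecs r. killed p U (\<Sum>i<c. lookup \<alpha> i) w \<longrightarrow> gmonom \<alpha> *v w \<in> U"
  using assms
proof (induction \<alpha> rule: mindex_induct)
  case (plus \<alpha> i)
  have i: "i < c" using plus.prems by (simp add: keys_add_mindex)
  have "(\<Sum>k<c. lookup (single i (1::nat)) k) = (\<Sum>k<c. if k = i then 1 else 0)"
    by (intro sum.cong) (auto simp: lookup_single)
  then have deg: "(\<Sum>k<c. lookup (\<alpha> + single i 1) k) = Suc (\<Sum>k<c. lookup \<alpha> k)"
    using i by (simp add: lookup_add sum.distrib)
  show ?case
  proof (intro ballI impI)
    fix w assume w: "w \<in> R_vecs r" and "killed p U (\<Sum>k<c. lookup (\<alpha> + single i 1) k) w"
    then have "killed p U (\<Sum>k<c. lookup \<alpha> k) (g i *v w)" using g_p[OF i] unfolding deg killed.simps by blast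
    moreover have "g i *v w \<in> R_vecs r" using w g_pring[OF i] by auto
    ultimately have "gmonom \<alpha> *v (g i *v w) \<in> U" using plus by (simp add: keys_add_mindex)
    then show "gmonom (\<alpha> + single i 1) *v w \<in> U" using i by (simp add: gmonom_plus_single mult.assoc)
  qed
qed simp

lemma killed_mono:
  assumes "\<And>w. w \<in> R_vecs r \<Longrightarrow> killed p U m w" "m \<le> k" "w \<in> R_vecs r"
  shows "killed p U k w"
  using assms(2,3)
proof (induction k arbitrary: w rule: dec_induct)
  case (step k)
  show ?case
    unfolding killed.simps
  proof
    fix a assume "a \<in> p"
    then have "a \<in> pring n" using p_sub by blast
    then show "killed p U k (a *v w)" using step by auto
  qed
qed (use assms(1) in auto)

text \<open>Since \<open>wt \<alpha> \<le> 2c |\<alpha>|\<close>, weight greater than \<open>2 c m\<close> means at least \<open>m\<close> factors in \<open>\<pp>\<close>.\<close>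

lemma gideal_killed:
  assumes U: "U \<in> submodules (pring n) r" and killed: "\<And>w. w \<in> R_vecs r \<Longrightarrow> killed p U m w"
    and x: "x \<in> gideal (Suc (2 * c * m))" and w: "w \<in> R_vecs r"
  shows "x *v w \<in> U"
  using x
proof (induction rule: gideal.induct)
  case zero
  then show ?case using submodulesD(2)[OF subring_polys U] by (simp add: zero_fun_def)
next
  case (plus x h \<alpha>)
  have "Suc (2 * c * m) \<le> 2 * c * (\<Sum>i<c. lookup \<alpha> i)" using plus.hyps(4) wt_le_degree[of c \<alpha>] by simp
  then have "m \<le> (\<Sum>i<c. lookup \<alpha> i)" by (metis Suc_le_lessD mult_less_cancel1 less_imp_le)
  then have "killed p U (\<Sum>i<c. lookup \<alpha> i) w" using killed_mono[of r U m, OF killed _ w] by blast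
  then have "gmonom \<alpha> *v w \<in> U" using killed_gmonom[OF plus.hyps(3), of r U] w by blast
  then have "x *v w + h *v (gmonom \<alpha> *v w) \<in> U"
    by (intro submodulesD(3)[OF subring_polys U] plus.IH submodulesD(4)[OF subring_polys U plus.hyps(2)])
  also have "x *v w + h *v (gmonom \<alpha> *v w) = (x + h * gmonom \<alpha>) *v w" by (simp add: fun_eq_iff algebra_simps)
  finally show ?case .
qed

lemma tayv_wvecs_killed:
  assumes U: "saturated r U" and killed: "\<And>w. w \<in> R_vecs r \<Longrightarrow> killed p U m w"
    and u: "u \<in> R_vecs r" and W: "tayv u \<in> wvecs c r (Suc (2 * c * m))"
  shows "u \<in> U"
proof -
  have un: "u j \<in> pring n" for j using u by (rule vecs_nth) simp
  have "\<forall>j\<in>{..<r}. \<exists>s. s \<in> pring n - p \<and> s * u j \<in> gideal (Suc (2 * c * m))"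
  proof
    fix j assume "j \<in> {..<r}"
    then have "tay (u j) \<in> wfilt c (Suc (2 * c * m))" using W by (simp add: wvecs_def vecs_def)
    then show "\<exists>s. s \<in> pring n - p \<and> s * u j \<in> gideal (Suc (2 * c * m))"
      using tay_kernel[OF un, of j] by blast
  qed
  then obtain s where s: "\<And>j. j < r \<Longrightarrow> s j \<in> pring n - p" "\<And>j. j < r \<Longrightarrow> s j * u j \<in> gideal (Suc (2 * c * m))"
    by (metis lessThan_iff)
  \<comment> \<open>a common denominator for the coordinates\<close>
  define d where "d = prod s {..<r}"
  have d: "d \<in> pring n - p" unfolding d_def using s(1) by (intro denom_prod) auto
  have du: "d * u j \<in> gideal (Suc (2 * c * m))" if "j < r" for j
  proof -
    have "prod s ({..<r} - {j}) \<in> pring n - p" using s(1) by (intro denom_prod) auto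
    then have "prod s ({..<r} - {j}) * (s j * u j) \<in> gideal (Suc (2 * c * m))" using gideal_mult[OF s(2)[OF that]] by simp
    also have "prod s ({..<r} - {j}) * (s j * u j) = d * u j"
      unfolding d_def using that prod.remove[of "{..<r}" j s] by (simp add: mult_ac)
    finally show ?thesis .
  qed
  define unit where "unit k = (\<lambda>j. if j = k then 1 else 0 :: 'k mpoly)" for k :: nat
  have unit: "unit k \<in> R_vecs r" if "k < r" for k using that by (auto simp: unit_def vecs_def)
  have "(\<Sum>k<r. (d * u k) *v unit k) \<in> U"
    using gideal_killed[OF saturatedD(1)[OF U] killed du unit]
    by (intro submodules_sum[OF subring_polys saturatedD(1)[OF U]]) auto
  also have "(\<Sum>k<r. (d * u k) *v unit k) = d *v u"
  proof
    fix j
    have "(\<Sum>k<r. (d * u k) *v unit k) j = (\<Sum>k<r. if k = j then d * u j else 0)"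
      unfolding sum_pointwise by (intro sum.cong) (auto simp: unit_def)
    also have "\<dots> = d * u j" using u by (auto simp: vecs_def)
    finally show "(\<Sum>k<r. (d * u k) *v unit k) j = d * u j" .
  qed
  finally show ?thesis using saturatedD(2)[OF U d u] by blast
qed

text \<open>\<open>V\<close> is the submodule generated by \<open>\<gamma>(U)\<close> up to series of large weight. It is described by
  denominators in \<open>R\<close> instead of by generators, so that the kernel of \<open>\<gamma>\<close> modulo large weight, which lies
  in \<open>U\<close>, decides membership at once. Its colength is finite, and hence equal to the multiplicity
  of \<open>U\<close>.\<close>

theorem primary_is_pullback:
  assumes U: "U \<in> primary_submodules n r p m"
  obtains V where "V \<in> quot_points c r m" "pullback r V = U"
proof -
  have sat: "saturated r U" using U by (rule primary_submodules_saturated)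
  note Us = saturatedD(1)[OF sat]
  note U' = submodulesD[OF subring_polys Us]
  have mult: "multiplicity n r p U = enat m" using U by (simp add: primary_submodules_def)
  note killed = finite_multiplicity_killed[OF sat mult]
  define t where "t = Suc (2 * c * m)"
  have ker: "u \<in> U" if "u \<in> R_vecs r" "tayv u \<in> wvecs c r t" for u
    using tayv_wvecs_killed[OF sat killed] that unfolding t_def by blast
  define V where "V = {v \<in> vecs (psers c) r. \<exists>s\<in>pring n - p. \<exists>u\<in>U. tay s *v v - tayv u \<in> wvecs c r t}"
  have VI: "v \<in> V" if "v \<in> vecs (psers c) r" "s \<in> pring n - p" "u \<in> U" "tay s *v v - tayv u \<in> wvecs c r t" for v s u
    using that unfolding V_def by blast
  have W_sub: "wvecs c r t \<subseteq> vecs (psers c) r" by (auto simp: wvecs_def vecs_def intro: wfilt_psers)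
  have W_add: "v + w \<in> wvecs c r t" if "v \<in> wvecs c r t" "w \<in> wvecs c r t" for v w :: "nat \<Rightarrow> 'f mfps"
    using that by (auto simp: wvecs_def vecs_def intro: wfilt_add)
  have W_mult: "a *v w \<in> wvecs c r t" if "a \<in> psers c" "w \<in> wvecs c r t" for a and w :: "nat \<Rightarrow> 'f mfps"
    using that by (auto simp: wvecs_def vecs_def intro: wfilt_mult_psers)
  have W_mult': "a *v w \<in> wvecs c r t" if "a \<in> wfilt c t" "w \<in> vecs (psers c) r" for a and w :: "nat \<Rightarrow> 'f mfps"
    using that wfilt_mult_psers[of _ c a t] by (auto simp: wvecs_def vecs_def mult.commute[of a])
  have UR: "u \<in> R_vecs r" if "u \<in> U" for u using that U'(1) by blast
  have WV: "wvecs c r t \<subseteq> V"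
  proof
    fix w :: "nat \<Rightarrow> 'f mfps" assume "w \<in> wvecs c r t"
    then show "w \<in> V" using W_sub tayv_hom(4) by (intro VI[OF _ denom(2) U'(2)]) auto
  qed
  have Vs: "V \<in> submodules (psers c) r"
    unfolding submodules_iff[OF subring_psers]
  proof (intro conjI ballI)
    show "V \<subseteq> vecs (psers c) r" by (auto simp: V_def)
    have "0 \<in> wvecs c r t" by (auto simp: wvecs_def vecs_def)
    then show "0 \<in> V" using WV by blast
  next
    fix v v' :: "nat \<Rightarrow> 'f mfps" assume "v \<in> V" "v' \<in> V"
    then obtain s u s' u' where v: "v \<in> vecs (psers c) r" "s \<in> pring n - p" "u \<in> U" "tay s *v v - tayv u \<in> wvecs c r t"
      and v': "v' \<in> vecs (psers c) r" "s' \<in> pring n - p" "u' \<in> U" "tay s' *v v' - tayv u' \<in> wvecs c r t"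
      unfolding V_def by blast
    have "s \<in> pring n" "s' \<in> pring n" using v v' by auto
    then have su: "s' *v u \<in> U" "s *v u' \<in> U" using v v' U'(4) by auto
    have "tay s' *v (tay s *v v - tayv u) + tay s *v (tay s' *v v' - tayv u') \<in> wvecs c r t"
      by (intro W_add W_mult[OF _ v(4)] W_mult[OF _ v'(4)]) auto
    also have "tay s' *v (tay s *v v - tayv u) + tay s *v (tay s' *v v' - tayv u')
      = tay (s * s') *v (v + v') - (tay s' *v tayv u + tay s *v tayv u')"
      using \<open>s \<in> pring n\<close> \<open>s' \<in> pring n\<close> by (simp add: fun_eq_iff tay_mult algebra_simps)
    also have "tay s' *v tayv u + tay s *v tayv u' = tayv (s' *v u + s *v u')"
      using tayv_hom(1)[OF UR[OF su(1)] UR[OF su(2)]] tayv_hom(3)[OF \<open>s' \<in> pring n\<close> UR[OF v(3)]]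
        tayv_hom(3)[OF \<open>s \<in> pring n\<close> UR[OF v'(3)]] by simp
    finally show "v + v' \<in> V"
      by (rule VI[OF vecs_psers(2)[OF v(1) v'(1)] denom(3)[OF v(2) v'(2)] U'(3)[OF su]])
  next
    fix b :: "'f mfps" and v :: "nat \<Rightarrow> 'f mfps" assume b: "b \<in> psers c" and "v \<in> V"
    then obtain s u where v: "v \<in> vecs (psers c) r" "s \<in> pring n - p" "u \<in> U" "tay s *v v - tayv u \<in> wvecs c r t"
      unfolding V_def by blast
    obtain s' a where a: "s' \<in> pring n - p" "a \<in> pring n" "tay s' * b - tay a \<in> wfilt c t"
      using tay_approximation[OF b] by blast
    have sn: "s \<in> pring n" "s' \<in> pring n" using v a by auto
    have "(tay s' * b) *v (tay s *v v - tayv u) + (tay s' * b - tay a) *v tayv u \<in> wvecs c r t"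
      using b by (intro W_add W_mult[OF _ v(4)] W_mult'[OF a(3)] tayv_vecs[OF UR[OF v(3)]]) auto
    also have "(tay s' * b) *v (tay s *v v - tayv u) + (tay s' * b - tay a) *v tayv u
      = tay (s' * s) *v (b *v v) - tay a *v tayv u"
      using sn by (simp add: fun_eq_iff tay_mult algebra_simps)
    also have "tay a *v tayv u = tayv (a *v u)" using tayv_hom(3)[OF a(2) UR[OF v(3)]] by simp
    finally show "b *v v \<in> V"
      by (rule VI[OF vecs_psers(4)[OF b v(1)] denom(3)[OF a(1) v(2)] U'(4)[OF a(2) v(3)]])
  qed
  have pull: "pullback r V = U"
  proof (intro subset_antisym subsetI)
    fix w assume "w \<in> pullback r V"
    then have w: "w \<in> R_vecs r" "tayv w \<in> V" by (auto simp: pullback_def)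
    then obtain s u where s: "s \<in> pring n - p" "u \<in> U" "tay s *v tayv w - tayv u \<in> wvecs c r t"
      unfolding V_def by blast
    have sn: "s \<in> pring n" using s(1) by auto
    have sw: "s *v w \<in> R_vecs r" using sn w(1) by (rule vecs_polys(4))
    have "tayv (s *v w - u) \<in> wvecs c r t"
      using s(3) tayv_hom(2)[OF sw UR[OF s(2)]] tayv_hom(3)[OF sn w(1)] by simp
    then have "s *v w - u \<in> U" by (rule ker[OF vecs_polys(3)[OF sw UR[OF s(2)]]])
    then have "(s *v w - u) + u \<in> U" using s(2) by (rule U'(3))
    then have "s *v w \<in> U" by (simp add: fun_eq_iff)
    then show "w \<in> U" by (rule saturatedD(2)[OF sat s(1) w(1)])
  next
    fix u assume u: "u \<in> U"
    have "(0 :: nat \<Rightarrow> 'f mfps) \<in> wvecs c r t" by (auto simp: wvecs_def vecs_def)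
    then have "tayv u \<in> V" using tayv_vecs[OF UR[OF u]] by (intro VI[OF _ denom(2) u]) auto
    then show "u \<in> pullback r V" using UR[OF u] by (simp add: pullback_def)
  qed
  obtain m' where m': "V \<in> quot_points c r m'" using finite_colength_basis[OF Vs WV] by blast
  have "m' = m" using multiplicity_pullback[OF m'] mult pull by simp
  then show ?thesis using that m' pull by blast
qed

theorem quot_point_of_bij:
  "bij_betw (quot_point_of bar c r m) (primary_submodules n r p m) (quot_points c r m)"
proof (rule bij_betw_byWitness[where f' = "pullback r"])
  show "\<forall>U\<in>primary_submodules n r p m. pullback r (quot_point_of bar c r m U) = U"
    using primary_is_pullback quot_point_of_pullback by metis
  show "\<forall>V\<in>quot_points c r m. quot_point_of bar c r m (pullback r V) = V"
    using quot_point_of_pullback by blast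
  show "quot_point_of bar c r m ` primary_submodules n r p m \<subseteq> quot_points c r m"
  proof clarify
    fix U assume "U \<in> primary_submodules n r p m"
    then obtain V where "V \<in> quot_points c r m" "pullback r V = U" by (rule primary_is_pullback)
    then show "quot_point_of bar c r m U \<in> quot_points c r m" using quot_point_of_pullback by metis
  qed
  show "pullback r ` quot_points c r m \<subseteq> primary_submodules n r p m"
    using pullback_primary by blast
qed

theorem lifted_basis_noetherian:
  assumes U: "U \<in> primary_submodules n r p m"
    and e: "is_basis m e (perp c r (quot_point_of bar c r m U))"
    and lift: "\<And>i. i < m \<Longrightarrow> is_lift bar n c r p (e i) (\<delta> i)"
  shows "noetherian_operators n r p U m \<delta>"
proof -
  obtain V where V: "V \<in> quot_points c r m" "pullback r V = U" using U by (rule primary_is_pullback)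
  have eV: "is_basis m e (perp c r V)" using e quot_point_of_pullback[OF V(1)] V(2) by simp
  have W: "perp c r V \<subseteq> vecs (pring c) r" unfolding perp_def by blast
  have eW: "e i \<in> perp c r V" if "i < m" for i
    using eV that vec.span_base[of "e i" "e ` {..<m}"] by (simp add: is_basis_def)
  have "weyl n c \<subseteq> (weyl n n :: 'k weyl set)"
    unfolding weyl_def using c_le by (auto dest!: subsetD intro: less_le_trans)
  then have \<delta>n: "\<delta> i \<in> vecs (weyl n n) r" if "i < m" for i
    using lift[OF that] unfolding is_lift_def vecs_def by blast
  have op: "weyl_op r (\<delta> i) w \<in> p \<longleftrightarrow> pair r (tayv w) (e i) = 0" if w: "w \<in> R_vecs r" and i: "i < m" for w i
  proof -
    obtain s where s: "\<delta> i \<in> vecs (weyl n c) r" "s \<in> pring n - p"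
      "\<And>j \<alpha>. j < r \<Longrightarrow> bar (lookup (\<delta> i j) \<alpha>) = bar s * lookup (e i j) \<alpha>"
      using lift[OF i] unfolding is_lift_def by blast
    have ei: "e i \<in> vecs (pring c) r" using eW[OF i] W by blast
    have "bar s \<noteq> 0" using s(2) bar_eq_0[of s] by auto
    then show ?thesis
      using bar_weyl_op[OF ei w s] bar_eq_0[of "weyl_op r (\<delta> i) w"] by simp
  qed
  have "U = {w \<in> R_vecs r. \<forall>i<m. weyl_op r (\<delta> i) w \<in> p}"
  proof (intro subset_antisym subsetI)
    fix w assume "w \<in> U"
    then have w: "w \<in> R_vecs r" "tayv w \<in> V" using V(2) by (auto simp: pullback_def)
    have "tayv w \<in> annihilator c r (perp c r V)" using w(2) perp_quot_point(2)[OF V(1)] by simp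
    then show "w \<in> {w \<in> R_vecs r. \<forall>i<m. weyl_op r (\<delta> i) w \<in> p}"
      using op[OF w(1)] eW w(1) by (simp add: annihilator_def)
  next
    fix w assume "w \<in> {w \<in> R_vecs r. \<forall>i<m. weyl_op r (\<delta> i) w \<in> p}"
    then have w: "w \<in> R_vecs r" "\<And>i. i < m \<Longrightarrow> pair r (tayv w) (e i) = 0" using op by auto
    have "pair r (tayv w) v = 0" if "v \<in> perp c r V" for v
    proof -
      have "perp c r V = range (\<lambda>x. \<Sum>i<m. vscale (x i) (e i))" using eV unfolding is_basis_iff by (rule conjunct2)
      then have "v \<in> range (\<lambda>x. \<Sum>i<m. vscale (x i) (e i))" using that by simp
      then obtain x where "v = (\<Sum>i<m. vscale (x i) (e i))" by (rule rangeE)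
      then show ?thesis using w(2) by (simp add: pair_sum_right)
    qed
    then have "tayv w \<in> annihilator c r (perp c r V)" using tayv_vecs[OF w(1)] by (simp add: annihilator_def)
    then show "w \<in> U" using perp_quot_point(2)[OF V(1)] V(2) w(1) by (auto simp: pullback_def)
  qed
  then show ?thesis using \<delta>n by (simp add: noetherian_operators_def)
qed

end

section \<open>The correspondence\<close>

theorem theorem3p2:
  fixes n c r m :: nat
    and p :: "'k::field_char_0 mpoly set"
    and \<phi> :: "'k mpoly fract set \<Rightarrow> 'f::field"
    and bar :: "'k mpoly \<Rightarrow> 'f"
  assumes "primeideal p (ring_on (pring n))"
    and "height (pring n) p = enat c"
    and "c \<le> n"
    and "basis_modulo n p {c..<n}"
    and "is_residue_field n p \<phi>"
  defines "bar \<equiv> residue n p \<phi>"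
  shows
    "bij_betw (quot_point_of bar c r m) (primary_submodules n r p m) (quot_points c r m) \<and>
     bij_betw (perp c r) (quot_points c r m :: (nat \<Rightarrow> 'f mfps) set set) (diff_closed_subspaces c r m) \<and>
     bij_betw (\<lambda>W. Omega ` W) (diff_closed_subspaces c r m) (bimodule_subspaces bar n c r m) \<and>
     (\<forall>U\<in>primary_submodules n r p m. \<forall>e.
        is_basis m e (Omega ` perp c r (quot_point_of bar c r m U)) \<longrightarrow>
          (\<forall>i<m. \<exists>\<delta>. is_lift bar n c r p (e i) \<delta>) \<and>
          (\<forall>\<delta>. (\<forall>i<m. is_lift bar n c r p (e i) (\<delta> i)) \<longrightarrow>
            (\<forall>i<m. \<delta> i \<in> vecs (weyl n c) r) \<and> noetherian_operators n r p U m \<delta>))"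
proof -
  interpret residue_map n c p bar
    unfolding bar_def by (rule residue_map_residue) fact+
  obtain g where "\<And>i. i < c \<Longrightarrow> g i \<in> p" "\<And>i. i < c \<Longrightarrow> g i \<in> polys (vars_upto (Suc i))" 
    "\<And>i. i < c \<Longrightarrow> pd i (g i) \<notin> p"
    "\<And>f. f \<in> p \<Longrightarrow> \<exists>s\<in>pring n - p. \<exists>h. (\<forall>i. h i \<in> pring n) \<and> s * f = (\<Sum>i<c. h i * g i)"
    using triangular_generators by blast
  then interpret local_generators n c p bar g
    by unfold_locales
  have Omega: "Omega ` W = W" for W :: "(nat \<Rightarrow> 'f mpoly) set" by simp
  have "bij_betw (\<lambda>W. Omega ` W) (diff_closed_subspaces c r m) (bimodule_subspaces bar n c r m)"
    unfolding Omega diff_closed_eq_bimodule by (simp add: bij_betw_def)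
  moreover have "(\<forall>i<m. \<exists>\<delta>. is_lift bar n c r p (e i) \<delta>) \<and>
          (\<forall>\<delta>. (\<forall>i<m. is_lift bar n c r p (e i) (\<delta> i)) \<longrightarrow>
            (\<forall>i<m. \<delta> i \<in> vecs (weyl n c) r) \<and> noetherian_operators n r p U m \<delta>)"
    if U: "U \<in> primary_submodules n r p m" and "is_basis m e (Omega ` perp c r (quot_point_of bar c r m U))" for U e
  proof (intro conjI allI impI)
    have e: "is_basis m e (perp c r (quot_point_of bar c r m U))" using that(2) unfolding Omega .
    show "\<exists>\<delta>. is_lift bar n c r p (e i) \<delta>" if "i < m" for i
    proof (rule lift_exists)
      have "e i \<in> perp c r (quot_point_of bar c r m U)"
        using e that vec.span_base[of "e i" "e ` {..<m}"] by (simp add: is_basis_def)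
      then show "e i \<in> vecs (pring c) r" unfolding perp_def by blast
    qed
    fix \<delta> assume lift: "\<forall>i<m. is_lift bar n c r p (e i) (\<delta> i)"
    show "\<delta> i \<in> vecs (weyl n c) r" if "i < m" for i using lift that by (simp add: is_lift_def)
    show "noetherian_operators n r p U m \<delta>" using lift by (intro lifted_basis_noetherian[OF U e]) simp
  qed
  ultimately show ?thesis using quot_point_of_bij perp_bij by blast
qed

end
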